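(* Let $G$ be a symmetry group of a discrete Lagrange--D'Alembert--Poincaré system $\mathcal{M}=(E,L_d,\mathcal{D}_d,\mathcal{D},\mathcal{P})$ over a fiber bundle $\phi:E\to M$, and let $\mathcal{A}_d^1$, $\mathcal{A}_d^2$ be two discrete connections on the principal $G$-bundle $\pi^{M,G}:M\to M/G$. Then the reduced systems $\mathcal{M}/(G,\mathcal{A}_d^1)$ and $\mathcal{M}/(G,\mathcal{A}_d^2)$ are isomorphic in the category of discrete Lagrange--D'Alembert--Poincaré systems.
   Context: All manifolds, maps and actions are smooth; $p_j$ denotes projection onto the $j$-th factor of a product; $D_1,D_2$ are partial differentials with respect to the first and second factor. DLDPS. For a fiber bundle $\phi:E\to M$ put $C'(E):=E\times M$ and $C''(E):=\{((\epsilon_0,m_1),(\epsilon_1,m_2))\in C'(E)\times C'(E):\phi(\epsilon_1)=m_1\}$, with $\tilde p_{34}:C''(E)\to C'(E)$, $\tilde p_{34}((\epsilon_0,m_1),(\epsilon_1,m_2))=(\epsilon_1,m_2)$. $p_1^*TE\subset T(C'(E))$ is the subbundle of vectors $(\delta\epsilon,0)$. A discrete Lagrange--D'Alembert--Poincaré system (DLDPS) over $E$ is $\mathcal{M}=(E,L_d,\mathcal{D}_d,\mathcal{D},\mathcal{P})$ where $L_d:C'(E)\to\mathbb{R}$ is smooth, $\mathcal{D}_d\subset C'(E)$ is a regular (embedded) submanifold, $\mathcal{D}\subset p_1^*TE$ is a vector subbundle, and $\mathcal{P}:\tilde p_{34}^*\mathcal{D}\to\ker(d\phi)\subset TE$ is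 a vector bundle homomorphism over $((\epsilon_0,m_1),(\epsilon_1,m_2))\mapsto\epsilon_0$; i.e. $\mathcal{P}((\epsilon_0,m_1),(\epsilon_1,m_2)):\mathcal{D}_{(\epsilon_1,m_2)}\to\ker d\phi(\epsilon_0)$ is linear and depends smoothly on the base point. Category. A morphism from $(E,L_d,\mathcal{D}_d,\mathcal{D},\mathcal{P})$ to $(E',L'_d,\mathcal{D}'_d,\mathcal{D}',\mathcal{P}')$ (bundles $\phi:E\to M$, $\phi':E'\to M'$) is a map $\Upsilon:C'(E)\to C'(E')$ such that: (1) $\Upsilon$ is a surjective submersion; (2) $D_1(p_2\circ\Upsilon)=0$; (3) for all $((\epsilon_0,m_1),(\epsilon_1,m_2))\in C''(E)$, $p_2(\Upsilon(\epsilon_0,m_1))=\phi'(p_1(\Upsilon(\epsilon_1,m_2)))$, so that $\Upsilon\times\Upsilon$ restricts to $\Upsilon^{(2)}:C''(E)\to C''(E')$; (4) $L_d=L'_d\circ\Upsilon$; (5) $\mathcal{D}'_d=\Upsilon(\mathcal{D}_d)$; (6) $\mathcal{D}'=d\Upsilon(\mathcal{D})$, i.e. $\mathcal{D}'_{\Upsilon(x)}=d\Upsilon(x)(\mathcal{D}_x)$ for all $x\in C'(E)$; (7) for all $((\epsilon_0,m_1),(\epsilon_1,m_2))\in C''(E)$ and $(\delta\epsilon_1,0)\in\mathcal{D}_{(\epsilon_1,m_2)}$, $\mathcal{P}'(\Upsilon^{(2)}((\epsilon_0,m_1),(\epsilon_1,m_2)))(d\Upsilon(\epsilon_1,m_2)(\delta\epsilon_1,0))=d(p_1\circ\Upsilon)(\epsilon_0,m_1)\big(\mathcal{P}((\epsilon_0,m_1),(\epsilon_1,m_2))(\delta\epsilon_1,0),d\phi(\epsilon_1)(\delta\epsilon_1)\big)$.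 Composition is composition of maps; an isomorphism is a morphism whose inverse exists and is a morphism. Group actions. A Lie group $G$ acts on the fiber bundle $\phi:E\to M$ with fiber $F_0$ if there are free left $G$-actions on $E$ and $M$ and a right $G$-action on $F_0$ such that $\pi^{M,G}:M\to M/G$ is a principal $G$-bundle, $\phi$ is $G$-equivariant, and every $m\in M$ has a $G$-invariant open neighborhood $U$ with a trivialization $\Phi_U:\phi^{-1}(U)\to U\times F_0$ that is equivariant for $g\cdot(m,f)=(g\cdot m,f\cdot g^{-1})$. $G$ acts diagonally on $C'(E)$ and on $C''(E)$. For a left action of $G$ on $X$, $\pi^{X,G}:X\to X/G$ is the quotient map. $G$ is a symmetry group of the DLDPS $\mathcal{M}$ if $G$ acts on the fiber bundle $\phi$, $L_d$ and $\mathcal{D}_d$ are invariant under the diagonal action, $\mathcal{D}$ is invariant under the lifted (differential) action, and $\mathcal{P}$ is equivariant for the induced actions on $\tilde p_{34}^*\mathcal{D}$ and on $\ker d\phi\subset TE$. Discrete connections. An (affine) discrete connection $\mathcal{A}_d$ on a principal $G$-bundle $\pi^{M,G}:M\to M/G$ is given by a submanifold $Hor\subset M\times M$, invariant under the diagonal $G$-action and containing $\{(m,\gamma(m)\cdot m):m\in M\}$ for some smooth $\gamma:M\to G$ with $\gamma(g\cdot m)=g\gamma(m)g^{-1}$, such that $(id_M\times\pi^{M,G})|_{Hor}:Hor\to M\times(M/G)$ is an injective local diffeomorphism. Its domain is $\{(m_0,g\cdot m_1):(m_0,m_1)\in Hor,\ g\in G\}$, and for $(m_0,m_1)$ in the domain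 $\mathcal{A}_d(m_0,m_1)\in G$ is the unique $g$ with $(m_0,g^{-1}\cdot m_1)\in Hor$; it is smooth and $\mathcal{A}_d(g_0\cdot m_0,g_1\cdot m_1)=g_1\mathcal{A}_d(m_0,m_1)g_0^{-1}$. Convention: the domain is all of $M\times M$. Reduction. Let $\widetilde{G}_E:=(E\times G)/G$ for the action $g\cdot(\epsilon,w)=(g\cdot\epsilon,gwg^{-1})$, a fiber bundle over $M/G$ via $p^{M/G}(\pi^{E\times G,G}(\epsilon,w)):=\pi^{M,G}(\phi(\epsilon))$. Define $\Upsilon_{\mathcal{A}_d}:C'(E)\to C'(\widetilde{G}_E)=\widetilde{G}_E\times(M/G)$ by $\Upsilon_{\mathcal{A}_d}(\epsilon,m):=(\pi^{E\times G,G}(\epsilon,\mathcal{A}_d(\phi(\epsilon),m)),\pi^{M,G}(m))$; it is a principal $G$-bundle for the diagonal action. The reduced system $\mathcal{M}/(G,\mathcal{A}_d)=(\widetilde{G}_E,\check L_d,\check{\mathcal{D}}_d,\check{\mathcal{D}},\check{\mathcal{P}})$ is the DLDPS over $p^{M/G}$ with $\check L_d\circ\Upsilon_{\mathcal{A}_d}=L_d$, $\check{\mathcal{D}}_d:=\Upsilon_{\mathcal{A}_d}(\mathcal{D}_d)$, $\check{\mathcal{D}}:=d\Upsilon_{\mathcal{A}_d}(\mathcal{D})$ and $\check{\mathcal{P}}((v_0,r_1),(v_1,r_2))(\delta v_1,0):=d(p_1\circ\Upsilon_{\mathcal{A}_d})(\epsilon_0,m_1)\big(\mathcal{P}((\epsilon_0,m_1),(\epsilon_1,m_2))(\delta\epsilon_1,0),d\phi(\epsilon_1)(\delta\epsilon_1)\big)$,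 for any $((\epsilon_0,m_1),(\epsilon_1,m_2))\in C''(E)$ with $\Upsilon_{\mathcal{A}_d}(\epsilon_0,m_1)=(v_0,r_1)$, $\Upsilon_{\mathcal{A}_d}(\epsilon_1,m_2)=(v_1,r_2)$ and the unique $(\delta\epsilon_1,0)\in\mathcal{D}_{(\epsilon_1,m_2)}$ with $d\Upsilon_{\mathcal{A}_d}(\epsilon_1,m_2)(\delta\epsilon_1,0)=(\delta v_1,0)$ (this is well defined). *)

theory Defs
  imports "HOL-Analysis.Analysis" "HOL-Algebra.Group_Action"
begin

section \<open>Smooth maps between subsets of Euclidean spaces\<close>

primrec Ck_on :: "nat \<Rightarrow> 'c::euclidean_space set \<Rightarrow> ('c \<Rightarrow> 'd::euclidean_space) \<Rightarrow> bool" where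
  "Ck_on 0 S f = continuous_on S f"
| "Ck_on (Suc k) S f =
     ((\<forall>x\<in>S. f differentiable (at x)) \<and> (\<forall>v. Ck_on k S (\<lambda>x. frechet_derivative f (at x) v)))"

text \<open>On a set that need not be open, smooth means: locally the restriction of a
  \<open>C\<^sup>\<infinity>\<close> function defined on an open subset of the ambient space.\<close>

definition smooth_fun_on :: "'c::euclidean_space set \<Rightarrow> ('c \<Rightarrow> 'd::euclidean_space) \<Rightarrow> bool" where
  "smooth_fun_on S f \<longleftrightarrow>
     (\<forall>x\<in>S. \<exists>U F. open U \<and> x \<in> U \<and> (\<forall>k. Ck_on k U F) \<and> (\<forall>y\<in>S \<inter> U. F y = f y))"


section \<open>Manifolds\<close>

text \<open>An \<open>n\<close>-dimensional manifold is modelled on an \<open>n\<close>-dimensional linear subspace \<open>mf_model\<close> of a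
  Euclidean space; in this way \<open>n\<close> is not tied to a type and can be any natural number, \<open>0\<close>
  included. A chart is a pair of its domain and its coordinate map. As part of the data, each point
  \<open>x\<close> has a preferred chart \<open>mf_chart_at x\<close>. It serves only to represent tangent vectors: the
  tangent space at \<open>x\<close> is the model space, a vector being written in the preferred chart at \<open>x\<close>.\<close>

type_synonym ('a, 'c) chart = "'a set \<times> ('a \<Rightarrow> 'c)"

record ('a, 'c) manifold =
  mf_top :: "'a topology"
  mf_model :: "'c set"
  mf_atlas :: "('a, 'c) chart set"
  mf_chart_at :: "'a \<Rightarrow> ('a, 'c) chart"

abbreviation pts :: "('a, 'c) manifold \<Rightarrow> 'a set" where
  "pts X \<equiv> topspace (mf_top X)"

abbreviation chart_inv :: "('a, 'c) chart \<Rightarrow> 'c \<Rightarrow> 'a" where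
  "chart_inv C \<equiv> inv_into (fst C) (snd C)"

definition smooth_manifold :: "('a, 'c::euclidean_space) manifold \<Rightarrow> bool" where
  "smooth_manifold X \<longleftrightarrow>
     Hausdorff_space (mf_top X) \<and> second_countable (mf_top X) \<and> subspace (mf_model X) \<and>
     (\<forall>(U, c) \<in> mf_atlas X.
        openin (mf_top X) U \<and> openin (top_of_set (mf_model X)) (c ` U) \<and>
        homeomorphic_map (subtopology (mf_top X) U) (top_of_set (c ` U)) c) \<and>
     (\<forall>C \<in> mf_atlas X. \<forall>D \<in> mf_atlas X.
        smooth_fun_on (snd C ` (fst C \<inter> fst D)) (snd D \<circ> chart_inv C)) \<and>
     (\<forall>x \<in> pts X. mf_chart_at X x \<in> mf_atlas X \<and> x \<in> fst (mf_chart_at X x))"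

definition vec_manifold :: "'c::euclidean_space set \<Rightarrow> ('c, 'c) manifold" where
  "vec_manifold V =
     \<lparr>mf_top = top_of_set V, mf_model = V, mf_atlas = {(V, id)}, mf_chart_at = (\<lambda>_. (V, id))\<rparr>"

definition prod_chart :: "('a, 'c) chart \<Rightarrow> ('b, 'd) chart \<Rightarrow> ('a \<times> 'b, 'c \<times> 'd) chart" where
  "prod_chart C D = (fst C \<times> fst D, map_prod (snd C) (snd D))"

text \<open>The preferred charts of a product are products of preferred charts, so that the tangent space
  of the product at \<open>(x, y)\<close> is literally the product of the tangent spaces at \<open>x\<close> and \<open>y\<close>.\<close>

definition prod_manifold ::
    "('a, 'c) manifold \<Rightarrow> ('b, 'd) manifold \<Rightarrow> ('a \<times> 'b, 'c \<times> 'd) manifold" where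
  "prod_manifold X Y =
     \<lparr>mf_top = prod_topology (mf_top X) (mf_top Y),
      mf_model = mf_model X \<times> mf_model Y,
      mf_atlas = {prod_chart C D |C D. C \<in> mf_atlas X \<and> D \<in> mf_atlas Y},
      mf_chart_at = (\<lambda>(x, y). prod_chart (mf_chart_at X x) (mf_chart_at Y y))\<rparr>"

text \<open>Smoothness on an arbitrary subset \<open>A\<close> of \<open>X\<close>, again in the sense of local extendability; for
  \<open>A\<close> open or an embedded submanifold this is smoothness for the induced manifold structure.\<close>

definition smooth_on ::
    "'a set \<Rightarrow> ('a, 'c::euclidean_space) manifold \<Rightarrow> ('b, 'd::euclidean_space) manifold
      \<Rightarrow> ('a \<Rightarrow> 'b) \<Rightarrow> bool" where
  "smooth_on A X Y f \<longleftrightarrow> A \<subseteq> pts X \<and>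
     (\<forall>x\<in>A. \<exists>C \<in> mf_atlas X. \<exists>D \<in> mf_atlas Y. \<exists>W.
        openin (mf_top X) W \<and> x \<in> W \<and> W \<subseteq> fst C \<and> f ` (W \<inter> A) \<subseteq> fst D \<and>
        smooth_fun_on (snd C ` (W \<inter> A)) (snd D \<circ> f \<circ> chart_inv C))"

definition smooth_map ::
    "('a, 'c::euclidean_space) manifold \<Rightarrow> ('b, 'd::euclidean_space) manifold \<Rightarrow> ('a \<Rightarrow> 'b) \<Rightarrow> bool"
  where "smooth_map X Y f \<longleftrightarrow> f ` pts X \<subseteq> pts Y \<and> smooth_on (pts X) X Y f"

definition diffeo_on ::
    "'a set \<Rightarrow> ('a, 'c::euclidean_space) manifold \<Rightarrow> 'b set \<Rightarrow> ('b, 'd::euclidean_space) manifold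
      \<Rightarrow> ('a \<Rightarrow> 'b) \<Rightarrow> bool" where
  "diffeo_on A X B Y f \<longleftrightarrow>
     bij_betw f A B \<and> smooth_on A X Y f \<and> smooth_on B Y X (inv_into A f)"

text \<open>The differential \<open>df(x)\<close> in preferred charts, as a directional derivative. It is meaningful on
  the tangent space \<open>mf_model X\<close> only.\<close>

definition dmap ::
    "('a, 'c::euclidean_space) manifold \<Rightarrow> ('b, 'd::euclidean_space) manifold
      \<Rightarrow> ('a \<Rightarrow> 'b) \<Rightarrow> 'a \<Rightarrow> 'c \<Rightarrow> 'd" where
  "dmap X Y f x v =
     vector_derivative
       (\<lambda>t. snd (mf_chart_at Y (f x))
              (f (chart_inv (mf_chart_at X x) (snd (mf_chart_at X x) x + t *\<^sub>R v)))) (at 0)"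

definition submersion ::
    "('a, 'c::euclidean_space) manifold \<Rightarrow> ('b, 'd::euclidean_space) manifold \<Rightarrow> ('a \<Rightarrow> 'b) \<Rightarrow> bool"
  where "submersion X Y f \<longleftrightarrow>
     smooth_map X Y f \<and> (\<forall>x \<in> pts X. dmap X Y f x ` mf_model X = mf_model Y)"

text \<open>A chart \<open>(U, c)\<close> of \<open>X\<close> induces on the tangent bundle the chart \<open>(x, v) \<mapsto> (c x, dc(x) v)\<close>.\<close>

definition tangent_chart ::
    "('a, 'c::euclidean_space) manifold \<Rightarrow> ('a, 'c) chart \<Rightarrow> ('a \<times> 'c, 'c \<times> 'c) chart" where
  "tangent_chart X C =
     (fst C \<times> mf_model X,
      \<lambda>(x, v). (snd C x, dmap X (vec_manifold (mf_model X)) (snd C) x v))"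

definition tangent_bundle ::
    "('a, 'c::euclidean_space) manifold \<Rightarrow> ('a \<times> 'c, 'c \<times> 'c) manifold" where
  "tangent_bundle X =
     \<lparr>mf_top = topology (\<lambda>W. W \<subseteq> pts X \<times> mf_model X \<and>
         (\<forall>C \<in> mf_atlas X. openin (top_of_set (mf_model X \<times> mf_model X))
            (snd (tangent_chart X C) ` (W \<inter> fst (tangent_chart X C))))),
      mf_model = mf_model X \<times> mf_model X,
      mf_atlas = tangent_chart X ` mf_atlas X,
      mf_chart_at = (\<lambda>(x, v). tangent_chart X (mf_chart_at X x))\<rparr>"

text \<open>Regular (embedded) submanifolds, by slice charts.\<close>

definition embedded_submanifold :: "('a, 'c::euclidean_space) manifold \<Rightarrow> 'a set \<Rightarrow> bool" where
  "embedded_submanifold X S \<longleftrightarrow> S \<subseteq> pts X \<and>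
     (\<exists>L. subspace L \<and> L \<subseteq> mf_model X \<and>
       (\<forall>x\<in>S. \<exists>U c. openin (mf_top X) U \<and> x \<in> U \<and> openin (top_of_set (mf_model X)) (c ` U) \<and>
          diffeo_on U X (c ` U) (vec_manifold (mf_model X)) c \<and> c ` (U \<inter> S) = c ` U \<inter> L))"

definition local_diffeo_on ::
    "'a set \<Rightarrow> ('a, 'c::euclidean_space) manifold \<Rightarrow> ('b, 'd::euclidean_space) manifold
      \<Rightarrow> ('a \<Rightarrow> 'b) \<Rightarrow> bool" where
  "local_diffeo_on S X Y f \<longleftrightarrow>
     (\<forall>x\<in>S. \<exists>W V. openin (mf_top X) W \<and> x \<in> W \<and> openin (mf_top Y) V \<and>
        diffeo_on (S \<inter> W) X V Y f)"

text \<open>Vector subbundles of \<open>TX\<close>, given by their fibers, with local smooth frames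
  \<open>s 0, \<dots>, s (k - 1)\<close>.\<close>

definition vector_subbundle ::
    "('a, 'c::euclidean_space) manifold \<Rightarrow> ('a \<Rightarrow> 'c set) \<Rightarrow> bool" where
  "vector_subbundle X D \<longleftrightarrow>
     (\<forall>x \<in> pts X. subspace (D x) \<and> D x \<subseteq> mf_model X) \<and>
     (\<exists>k. \<forall>x \<in> pts X. \<exists>U (s :: nat \<Rightarrow> 'a \<Rightarrow> 'c). openin (mf_top X) U \<and> x \<in> U \<and>
        (\<forall>i<k. smooth_on U X (tangent_bundle X) (\<lambda>y. (y, s i y))) \<and>
        (\<forall>y\<in>U. inj_on (\<lambda>i. s i y) {..<k} \<and> independent ((\<lambda>i. s i y) ` {..<k}) \<and>
           span ((\<lambda>i. s i y) ` {..<k}) = D y))"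

definition fiber_bundle ::
    "('e, 'ce::euclidean_space) manifold \<Rightarrow> ('m, 'cm::euclidean_space) manifold
      \<Rightarrow> ('f, 'cf::euclidean_space) manifold \<Rightarrow> ('e \<Rightarrow> 'm) \<Rightarrow> bool" where
  "fiber_bundle E M F \<phi> \<longleftrightarrow>
     smooth_manifold E \<and> smooth_manifold M \<and> smooth_manifold F \<and>
     smooth_map E M \<phi> \<and> \<phi> ` pts E = pts M \<and>
     (\<forall>m \<in> pts M. \<exists>U \<Phi>. openin (mf_top M) U \<and> m \<in> U \<and>
        diffeo_on {\<epsilon> \<in> pts E. \<phi> \<epsilon> \<in> U} E (U \<times> pts F) (prod_manifold M F) \<Phi> \<and>
        (\<forall>\<epsilon> \<in> pts E. \<phi> \<epsilon> \<in> U \<longrightarrow> fst (\<Phi> \<epsilon>) = \<phi> \<epsilon>))"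


section \<open>Lie groups, actions and quotients\<close>

definition lie_group :: "'g monoid \<Rightarrow> ('g, 'cg::euclidean_space) manifold \<Rightarrow> bool" where
  "lie_group G GM \<longleftrightarrow> group G \<and> smooth_manifold GM \<and> pts GM = carrier G \<and>
     smooth_map (prod_manifold GM GM) GM (\<lambda>(g, h). g \<otimes>\<^bsub>G\<^esub> h) \<and>
     smooth_map GM GM (\<lambda>g. inv\<^bsub>G\<^esub> g)"

definition smooth_left_action ::
    "'g monoid \<Rightarrow> ('g, 'cg::euclidean_space) manifold \<Rightarrow> ('a, 'c::euclidean_space) manifold
      \<Rightarrow> ('g \<Rightarrow> 'a \<Rightarrow> 'a) \<Rightarrow> bool" where
  "smooth_left_action G GM X a \<longleftrightarrow> group_action G (pts X) a \<and>
     smooth_map (prod_manifold GM X) X (\<lambda>(g, x). a g x)"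

definition free_action :: "'g monoid \<Rightarrow> 'a set \<Rightarrow> ('g \<Rightarrow> 'a \<Rightarrow> 'a) \<Rightarrow> bool" where
  "free_action G X a \<longleftrightarrow> (\<forall>x\<in>X. \<forall>g \<in> carrier G. a g x = x \<longrightarrow> g = \<one>\<^bsub>G\<^esub>)"

definition smooth_right_action ::
    "'g monoid \<Rightarrow> ('g, 'cg::euclidean_space) manifold \<Rightarrow> ('a, 'c::euclidean_space) manifold
      \<Rightarrow> ('a \<Rightarrow> 'g \<Rightarrow> 'a) \<Rightarrow> bool" where
  "smooth_right_action G GM X r \<longleftrightarrow>
     (\<forall>x \<in> pts X. r x \<one>\<^bsub>G\<^esub> = x) \<and>
     (\<forall>x \<in> pts X. \<forall>g \<in> carrier G. \<forall>h \<in> carrier G. r (r x g) h = r x (g \<otimes>\<^bsub>G\<^esub> h)) \<and>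
     smooth_map (prod_manifold X GM) X (\<lambda>(x, g). r x g)"

definition quotient_top :: "'g monoid \<Rightarrow> 'a topology \<Rightarrow> ('g \<Rightarrow> 'a \<Rightarrow> 'a) \<Rightarrow> 'a set topology" where
  "quotient_top G T a = topology (\<lambda>W. W \<subseteq> orbits G (topspace T) a \<and>
     openin T {x \<in> topspace T. orbit G a x \<in> W})"

definition quotient_model ::
    "('a, 'c::euclidean_space) manifold \<Rightarrow> ('g, 'cg::euclidean_space) manifold \<Rightarrow> 'c set" where
  "quotient_model X GM =
     (SOME V. subspace V \<and> V \<subseteq> mf_model X \<and> dim V = dim (mf_model X) - dim (mf_model GM))"

text \<open>The charts of \<open>X/G\<close> are the homeomorphisms \<open>c\<close> between open sets for which \<open>c \<circ> \<pi>\<close> is a smooth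
  submersion. If \<open>X/G\<close> carries a manifold structure making \<open>\<pi>\<close> a submersion, this is its maximal
  atlas.\<close>

definition quotient_atlas ::
    "'g monoid \<Rightarrow> ('g, 'cg::euclidean_space) manifold \<Rightarrow> ('a, 'c::euclidean_space) manifold
      \<Rightarrow> ('g \<Rightarrow> 'a \<Rightarrow> 'a) \<Rightarrow> ('a set, 'c) chart set" where
  "quotient_atlas G GM X a =
     (let T = quotient_top G (mf_top X) a; V = quotient_model X GM in
      {(U, c). openin T U \<and> openin (top_of_set V) (c ` U) \<and>
         homeomorphic_map (subtopology T U) (top_of_set (c ` U)) c \<and>
         smooth_on {x \<in> pts X. orbit G a x \<in> U} X (vec_manifold V) (c \<circ> orbit G a) \<and>
         (\<forall>x \<in> pts X. orbit G a x \<in> U \<longrightarrow>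
            dmap X (vec_manifold V) (c \<circ> orbit G a) x ` mf_model X = V)})"

definition quotient_manifold ::
    "'g monoid \<Rightarrow> ('g, 'cg::euclidean_space) manifold \<Rightarrow> ('a, 'c::euclidean_space) manifold
      \<Rightarrow> ('g \<Rightarrow> 'a \<Rightarrow> 'a) \<Rightarrow> ('a set, 'c) manifold" where
  "quotient_manifold G GM X a =
     \<lparr>mf_top = quotient_top G (mf_top X) a,
      mf_model = quotient_model X GM,
      mf_atlas = quotient_atlas G GM X a,
      mf_chart_at = (\<lambda>q. SOME C. C \<in> quotient_atlas G GM X a \<and> q \<in> fst C)\<rparr>"

definition principal_bundle ::
    "'g monoid \<Rightarrow> ('g, 'cg::euclidean_space) manifold \<Rightarrow> ('m, 'cm::euclidean_space) manifold
      \<Rightarrow> ('g \<Rightarrow> 'm \<Rightarrow> 'm) \<Rightarrow> bool" where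
  "principal_bundle G GM M a \<longleftrightarrow>
     smooth_manifold M \<and> smooth_left_action G GM M a \<and>
     smooth_manifold (quotient_manifold G GM M a) \<and>
     smooth_map M (quotient_manifold G GM M a) (orbit G a) \<and>
     (\<forall>q \<in> pts (quotient_manifold G GM M a). \<exists>V \<psi>.
        openin (mf_top (quotient_manifold G GM M a)) V \<and> q \<in> V \<and>
        diffeo_on {m \<in> pts M. orbit G a m \<in> V} M
          (V \<times> pts GM) (prod_manifold (quotient_manifold G GM M a) GM) \<psi> \<and>
        (\<forall>m \<in> pts M. orbit G a m \<in> V \<longrightarrow> fst (\<psi> m) = orbit G a m \<and>
           (\<forall>g \<in> carrier G. snd (\<psi> (a g m)) = g \<otimes>\<^bsub>G\<^esub> snd (\<psi> m))))"

definition acts_on_fiber_bundle ::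
    "'g monoid \<Rightarrow> ('g, 'cg::euclidean_space) manifold \<Rightarrow> ('e, 'ce::euclidean_space) manifold
      \<Rightarrow> ('m, 'cm::euclidean_space) manifold \<Rightarrow> ('f, 'cf::euclidean_space) manifold \<Rightarrow> ('e \<Rightarrow> 'm)
      \<Rightarrow> ('g \<Rightarrow> 'e \<Rightarrow> 'e) \<Rightarrow> ('g \<Rightarrow> 'm \<Rightarrow> 'm) \<Rightarrow> bool" where
  "acts_on_fiber_bundle G GM E M F \<phi> aE aM \<longleftrightarrow>
     smooth_left_action G GM E aE \<and> free_action G (pts E) aE \<and>
     smooth_left_action G GM M aM \<and> free_action G (pts M) aM \<and>
     principal_bundle G GM M aM \<and>
     (\<forall>g \<in> carrier G. \<forall>\<epsilon> \<in> pts E. \<phi> (aE g \<epsilon>) = aM g (\<phi> \<epsilon>)) \<and>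
     (\<exists>r. smooth_right_action G GM F r \<and>
       (\<forall>m \<in> pts M. \<exists>U \<Phi>. openin (mf_top M) U \<and> m \<in> U \<and>
          (\<forall>g \<in> carrier G. aM g ` U \<subseteq> U) \<and>
          diffeo_on {\<epsilon> \<in> pts E. \<phi> \<epsilon> \<in> U} E (U \<times> pts F) (prod_manifold M F) \<Phi> \<and>
          (\<forall>\<epsilon> \<in> pts E. \<phi> \<epsilon> \<in> U \<longrightarrow> fst (\<Phi> \<epsilon>) = \<phi> \<epsilon> \<and>
             (\<forall>g \<in> carrier G.
                \<Phi> (aE g \<epsilon>) = (aM g (fst (\<Phi> \<epsilon>)), r (snd (\<Phi> \<epsilon>)) (inv\<^bsub>G\<^esub> g))))))"


section \<open>Discrete Lagrange--D'Alembert--Poincare systems\<close>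

text \<open>\<open>ds_D\<close> gives the fibers of the bundle of variations, as sets of vectors \<open>(\<delta>\<epsilon>, 0)\<close> tangent to
  \<open>E \<times> M\<close>; \<open>ds_P z\<close>, for \<open>z\<close> in \<open>C''(E)\<close>, takes such vectors to vectors tangent to \<open>E\<close>. The typical
  fiber of the bundle is part of the data.\<close>

record ('e, 'ce, 'm, 'cm, 'f, 'cf) dldps_data =
  ds_E :: "('e, 'ce) manifold"
  ds_M :: "('m, 'cm) manifold"
  ds_F :: "('f, 'cf) manifold"
  ds_phi :: "'e \<Rightarrow> 'm"
  ds_L :: "'e \<times> 'm \<Rightarrow> real"
  ds_Dd :: "('e \<times> 'm) set"
  ds_D :: "'e \<times> 'm \<Rightarrow> ('ce \<times> 'cm) set"
  ds_P :: "('e \<times> 'm) \<times> ('e \<times> 'm) \<Rightarrow> 'ce \<times> 'cm \<Rightarrow> 'ce"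

definition C1 :: "('e, 'ce, 'm, 'cm, 'f, 'cf) dldps_data \<Rightarrow> ('e \<times> 'm, 'ce \<times> 'cm) manifold" where
  "C1 S = prod_manifold (ds_E S) (ds_M S)"

definition C2 :: "('e, 'ce, 'm, 'cm, 'f, 'cf) dldps_data \<Rightarrow> (('e \<times> 'm) \<times> ('e \<times> 'm)) set" where
  "C2 S = {((\<epsilon>0, m1), (\<epsilon>1, m2)). (\<epsilon>0, m1) \<in> pts (C1 S) \<and> (\<epsilon>1, m2) \<in> pts (C1 S) \<and>
             ds_phi S \<epsilon>1 = m1}"

definition dldps ::
    "('e, 'ce::euclidean_space, 'm, 'cm::euclidean_space, 'f, 'cf::euclidean_space) dldps_data
      \<Rightarrow> bool" where
  "dldps S \<longleftrightarrow>
     fiber_bundle (ds_E S) (ds_M S) (ds_F S) (ds_phi S) \<and>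
     smooth_map (C1 S) (vec_manifold UNIV) (ds_L S) \<and>
     embedded_submanifold (C1 S) (ds_Dd S) \<and>
     vector_subbundle (C1 S) (ds_D S) \<and>
     (\<forall>x \<in> pts (C1 S). ds_D S x \<subseteq> mf_model (ds_E S) \<times> {0}) \<and>
     (\<forall>z \<in> C2 S.
        (\<forall>v \<in> ds_D S (snd z).
           ds_P S z v \<in> mf_model (ds_E S) \<and>
           dmap (ds_E S) (ds_M S) (ds_phi S) (fst (fst z)) (ds_P S z v) = 0) \<and>
        (\<forall>v \<in> ds_D S (snd z). \<forall>w \<in> ds_D S (snd z). ds_P S z (v + w) = ds_P S z v + ds_P S z w) \<and>
        (\<forall>v \<in> ds_D S (snd z). \<forall>r. ds_P S z (r *\<^sub>R v) = r *\<^sub>R ds_P S z v)) \<and>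
     \<comment> \<open>smoothness of \<open>P\<close> as a map from the total space of the pullback bundle to \<open>TE\<close>\<close>
     smooth_on {(z, (x, v)). z \<in> C2 S \<and> x = snd z \<and> v \<in> ds_D S x}
       (prod_manifold (prod_manifold (C1 S) (C1 S)) (tangent_bundle (C1 S)))
       (tangent_bundle (ds_E S)) (\<lambda>(z, (x, v)). (fst (fst z), ds_P S z v))"

definition dldps_morphism ::
    "('e, 'ce::euclidean_space, 'm, 'cm::euclidean_space, 'f, 'cf::euclidean_space) dldps_data
      \<Rightarrow> ('e2, 'ce2::euclidean_space, 'm2, 'cm2::euclidean_space, 'f2, 'cf2::euclidean_space) dldps_data
      \<Rightarrow> ('e \<times> 'm \<Rightarrow> 'e2 \<times> 'm2) \<Rightarrow> bool" where
  "dldps_morphism S S' \<Upsilon> \<longleftrightarrow>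
     dldps S \<and> dldps S' \<and>
     submersion (C1 S) (C1 S') \<Upsilon> \<and> \<Upsilon> ` pts (C1 S) = pts (C1 S') \<and>
     (\<forall>(\<epsilon>, m) \<in> pts (C1 S). \<forall>v \<in> mf_model (ds_E S).
        dmap (ds_E S) (ds_M S') (\<lambda>\<epsilon>'. snd (\<Upsilon> (\<epsilon>', m))) \<epsilon> v = 0) \<and>
     (\<forall>(x0, x1) \<in> C2 S. snd (\<Upsilon> x0) = ds_phi S' (fst (\<Upsilon> x1))) \<and>
     (\<forall>x \<in> pts (C1 S). ds_L S x = ds_L S' (\<Upsilon> x)) \<and>
     ds_Dd S' = \<Upsilon> ` ds_Dd S \<and>
     (\<forall>x \<in> pts (C1 S). ds_D S' (\<Upsilon> x) = dmap (C1 S) (C1 S') \<Upsilon> x ` ds_D S x) \<and>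
     (\<forall>(x0, x1) \<in> C2 S. \<forall>v \<in> ds_D S x1.
        ds_P S' (\<Upsilon> x0, \<Upsilon> x1) (dmap (C1 S) (C1 S') \<Upsilon> x1 v) =
        dmap (C1 S) (ds_E S') (fst \<circ> \<Upsilon>) x0
          (ds_P S (x0, x1) v, dmap (ds_E S) (ds_M S) (ds_phi S) (fst x1) (fst v)))"

definition dldps_isomorphic ::
    "('e, 'ce::euclidean_space, 'm, 'cm::euclidean_space, 'f, 'cf::euclidean_space) dldps_data
      \<Rightarrow> ('e2, 'ce2::euclidean_space, 'm2, 'cm2::euclidean_space, 'f2, 'cf2::euclidean_space) dldps_data
      \<Rightarrow> bool" where
  "dldps_isomorphic S S' \<longleftrightarrow>
     (\<exists>\<Upsilon> \<Upsilon>'. dldps_morphism S S' \<Upsilon> \<and> dldps_morphism S' S \<Upsilon>' \<and>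
        (\<forall>x \<in> pts (C1 S). \<Upsilon>' (\<Upsilon> x) = x) \<and> (\<forall>y \<in> pts (C1 S'). \<Upsilon> (\<Upsilon>' y) = y))"


section \<open>Symmetry groups\<close>

text \<open>Actions are extensional outside the space acted on, as in the library's \<open>group_action\<close>.\<close>

definition diag_action ::
    "('g \<Rightarrow> 'e \<Rightarrow> 'e) \<Rightarrow> ('g \<Rightarrow> 'm \<Rightarrow> 'm) \<Rightarrow> ('e \<times> 'm) set \<Rightarrow> 'g \<Rightarrow> 'e \<times> 'm \<Rightarrow> 'e \<times> 'm" where
  "diag_action aE aM X g = restrict (\<lambda>(\<epsilon>, m). (aE g \<epsilon>, aM g m)) X"

definition symmetry_group ::
    "'g monoid \<Rightarrow> ('g, 'cg::euclidean_space) manifold \<Rightarrow> ('g \<Rightarrow> 'e \<Rightarrow> 'e) \<Rightarrow> ('g \<Rightarrow> 'm \<Rightarrow> 'm)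
      \<Rightarrow> ('e, 'ce::euclidean_space, 'm, 'cm::euclidean_space, 'f, 'cf::euclidean_space) dldps_data
      \<Rightarrow> bool" where
  "symmetry_group G GM aE aM S \<longleftrightarrow>
     lie_group G GM \<and>
     acts_on_fiber_bundle G GM (ds_E S) (ds_M S) (ds_F S) (ds_phi S) aE aM \<and>
     (let d = diag_action aE aM (pts (C1 S)) in
       (\<forall>g \<in> carrier G. \<forall>x \<in> pts (C1 S). ds_L S (d g x) = ds_L S x) \<and>
       (\<forall>g \<in> carrier G. d g ` ds_Dd S = ds_Dd S) \<and>
       (\<forall>g \<in> carrier G. \<forall>x \<in> pts (C1 S).
          dmap (C1 S) (C1 S) (d g) x ` ds_D S x = ds_D S (d g x)) \<and>
       (\<forall>g \<in> carrier G. \<forall>(x0, x1) \<in> C2 S. \<forall>v \<in> ds_D S x1.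
          ds_P S (d g x0, d g x1) (dmap (C1 S) (C1 S) (d g) x1 v) =
          dmap (ds_E S) (ds_E S) (aE g) (fst x0) (ds_P S (x0, x1) v)))"


section \<open>Discrete connections and reduced systems\<close>

text \<open>A discrete connection is given by its horizontal submanifold. The last clause is the
  convention that its domain is the whole of \<open>M \<times> M\<close>.\<close>

definition discrete_connection ::
    "'g monoid \<Rightarrow> ('g, 'cg::euclidean_space) manifold \<Rightarrow> ('m, 'cm::euclidean_space) manifold
      \<Rightarrow> ('g \<Rightarrow> 'm \<Rightarrow> 'm) \<Rightarrow> ('m \<times> 'm) set \<Rightarrow> bool" where
  "discrete_connection G GM M a Hor \<longleftrightarrow>
     embedded_submanifold (prod_manifold M M) Hor \<and>
     (\<forall>g \<in> carrier G. \<forall>(m0, m1) \<in> Hor. (a g m0, a g m1) \<in> Hor) \<and>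
     (\<exists>\<gamma>. smooth_map M GM \<gamma> \<and>
        (\<forall>g \<in> carrier G. \<forall>m \<in> pts M. \<gamma> (a g m) = g \<otimes>\<^bsub>G\<^esub> \<gamma> m \<otimes>\<^bsub>G\<^esub> inv\<^bsub>G\<^esub> g) \<and>
        (\<forall>m \<in> pts M. (m, a (\<gamma> m) m) \<in> Hor)) \<and>
     inj_on (\<lambda>(m0, m1). (m0, orbit G a m1)) Hor \<and>
     local_diffeo_on Hor (prod_manifold M M) (prod_manifold M (quotient_manifold G GM M a))
       (\<lambda>(m0, m1). (m0, orbit G a m1)) \<and>
     {(m0, a g m1) |m0 g m1. (m0, m1) \<in> Hor \<and> g \<in> carrier G} = pts M \<times> pts M"

definition conn_map :: "'g monoid \<Rightarrow> ('g \<Rightarrow> 'm \<Rightarrow> 'm) \<Rightarrow> ('m \<times> 'm) set \<Rightarrow> 'm \<Rightarrow> 'm \<Rightarrow> 'g" where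
  "conn_map G a Hor m0 m1 = (THE g. g \<in> carrier G \<and> (m0, a (inv\<^bsub>G\<^esub> g) m1) \<in> Hor)"

definition conj_action ::
    "'g monoid \<Rightarrow> ('g \<Rightarrow> 'e \<Rightarrow> 'e) \<Rightarrow> 'e set \<Rightarrow> 'g \<Rightarrow> 'e \<times> 'g \<Rightarrow> 'e \<times> 'g" where
  "conj_action G aE E g =
     restrict (\<lambda>(\<epsilon>, w). (aE g \<epsilon>, g \<otimes>\<^bsub>G\<^esub> w \<otimes>\<^bsub>G\<^esub> inv\<^bsub>G\<^esub> g)) (E \<times> carrier G)"

definition red_E ::
    "'g monoid \<Rightarrow> ('g, 'cg::euclidean_space) manifold \<Rightarrow> ('g \<Rightarrow> 'e \<Rightarrow> 'e)
      \<Rightarrow> ('e, 'ce::euclidean_space, 'm, 'cm, 'f, 'cf) dldps_data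
      \<Rightarrow> (('e \<times> 'g) set, 'ce \<times> 'cg) manifold" where
  "red_E G GM aE S =
     quotient_manifold G GM (prod_manifold (ds_E S) GM) (conj_action G aE (pts (ds_E S)))"

definition red_M ::
    "'g monoid \<Rightarrow> ('g, 'cg::euclidean_space) manifold \<Rightarrow> ('g \<Rightarrow> 'm \<Rightarrow> 'm)
      \<Rightarrow> ('e, 'ce, 'm, 'cm::euclidean_space, 'f, 'cf) dldps_data \<Rightarrow> ('m set, 'cm) manifold" where
  "red_M G GM aM S = quotient_manifold G GM (ds_M S) aM"

definition red_phi ::
    "'g monoid \<Rightarrow> ('g \<Rightarrow> 'm \<Rightarrow> 'm) \<Rightarrow> ('e, 'ce, 'm, 'cm, 'f, 'cf) dldps_data
      \<Rightarrow> ('e \<times> 'g) set \<Rightarrow> 'm set" where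
  "red_phi G aM S v = (THE r. \<exists>(\<epsilon>, w) \<in> v. r = orbit G aM (ds_phi S \<epsilon>))"

definition red_map ::
    "'g monoid \<Rightarrow> ('g \<Rightarrow> 'e \<Rightarrow> 'e) \<Rightarrow> ('g \<Rightarrow> 'm \<Rightarrow> 'm) \<Rightarrow> ('m \<times> 'm) set
      \<Rightarrow> ('e, 'ce, 'm, 'cm, 'f, 'cf) dldps_data \<Rightarrow> 'e \<times> 'm \<Rightarrow> ('e \<times> 'g) set \<times> 'm set" where
  "red_map G aE aM Hor S = (\<lambda>(\<epsilon>, m).
     (orbit G (conj_action G aE (pts (ds_E S))) (\<epsilon>, conn_map G aM Hor (ds_phi S \<epsilon>) m),
      orbit G aM m))"

text \<open>The typical fiber of the reduced bundle is \<open>F\<^sub>0 \<times> G\<close>.\<close>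

definition reduced_system ::
    "'g monoid \<Rightarrow> ('g, 'cg::euclidean_space) manifold \<Rightarrow> ('g \<Rightarrow> 'e \<Rightarrow> 'e) \<Rightarrow> ('g \<Rightarrow> 'm \<Rightarrow> 'm)
      \<Rightarrow> ('e, 'ce::euclidean_space, 'm, 'cm::euclidean_space, 'f, 'cf::euclidean_space) dldps_data
      \<Rightarrow> ('m \<times> 'm) set
      \<Rightarrow> (('e \<times> 'g) set, 'ce \<times> 'cg, 'm set, 'cm, 'f \<times> 'g, 'cf \<times> 'cg) dldps_data" where
  "reduced_system G GM aE aM S Hor =
     (let E' = red_E G GM aE S; M' = red_M G GM aM S; \<Upsilon> = red_map G aE aM Hor S;
          d\<Upsilon> = dmap (C1 S) (prod_manifold E' M') \<Upsilon>
      in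
     \<lparr>ds_E = E',
      ds_M = M',
      ds_F = prod_manifold (ds_F S) GM,
      ds_phi = red_phi G aM S,
      ds_L = (\<lambda>y. THE l. \<exists>x \<in> pts (C1 S). \<Upsilon> x = y \<and> l = ds_L S x),
      ds_Dd = \<Upsilon> ` ds_Dd S,
      ds_D = (\<lambda>y. {d\<Upsilon> x v |x v. x \<in> pts (C1 S) \<and> \<Upsilon> x = y \<and> v \<in> ds_D S x}),
      ds_P = (\<lambda>(y0, y1) w. THE u. \<exists>x0 x1 v.
                (x0, x1) \<in> C2 S \<and> \<Upsilon> x0 = y0 \<and> \<Upsilon> x1 = y1 \<and> v \<in> ds_D S x1 \<and> d\<Upsilon> x1 v = w \<and>
                u = dmap (C1 S) E' (fst \<circ> \<Upsilon>) x0
                      (ds_P S (x0, x1) v, dmap (ds_E S) (ds_M S) (ds_phi S) (fst x1) (fst v)))\<rparr>)"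

end

theory Submission imports Defs begin

text \<open>Both reduced systems live on the same bundle over \<open>M/G\<close>, and each \<open>\<Upsilon>\<^sub>i\<close> is the quotient map of the same
  free action of \<open>G\<close> on \<open>C'(E)\<close>. Hence \<open>\<Theta> \<circ> \<Upsilon>\<^sub>1 = \<Upsilon>\<^sub>2\<close> defines a bijection, smooth because \<open>\<Upsilon>\<^sub>1\<close> has smooth local
  sections, and the chain rule turns the formulas for \<open>\<Upsilon>\<^sub>1\<close> and \<open>\<Upsilon>\<^sub>2\<close> into the morphism axioms; the inverse
  arises by exchanging the two connections. The main work is that each reduced system is a system at all:
  a local section \<open>\<sigma>\<close> of \<open>\<Upsilon>\<close> with \<open>\<sigma>(\<Upsilon>(\<epsilon>, m)) = (\<epsilon>, m)\<close> whenever \<open>m\<close> is the second entry of some value of \<open>\<sigma>\<close> carries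
  slice charts, subbundle frames and \<open>P\<close> from \<open>C'(E)\<close> down to the quotient.\<close>

section \<open>Calculus of smooth maps between Euclidean spaces\<close>

text \<open>The preferred charts and the model space of a quotient come from a choice operator, so
  differentials into or out of \<open>(E \<times> G)/G\<close> and \<open>M/G\<close> are not
  computed in coordinates: they are controlled by the chain rule along factorizations through
  \<open>\<Upsilon>\<close> and its local sections. The first obstacle is that
  \<open>(E \<times> G)/G\<close> is a manifold at all. Its charts are only required to become
  submersions after composition with the projection; their compatibility costs an inverse function
  theorem, and hence the calculus below. The sections come from the connection: for a representative
  \<open>(\<epsilon>, w)\<close> and an orbit \<open>r\<close> in \<open>M\<close>, the equation
  \<open>A (\<phi> \<epsilon>) m = w\<close> has exactly one solution in \<open>r\<close>, namely
  \<open>w\<close> acting on the horizontal lift of \<open>r\<close> at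
  \<open>\<phi> \<epsilon>\<close>. A further translation moves \<open>m\<close> onto a section of
  the projection to \<open>M/G\<close>, so that the second entry depends on \<open>r\<close> alone.
  A variation with zero second component then stays inside the image of the section, because the
  action on \<open>M\<close> is free.\<close>

lemma Ck_on_subset: "Ck_on k S f \<Longrightarrow> T \<subseteq> S \<Longrightarrow> Ck_on k T f"
proof (induction k arbitrary: f)
  case 0
  then show ?case by (auto intro: continuous_on_subset)
next
  case (Suc k)
  then show ?case by (simp, blast)
qed

lemma frechet_derivative_eq: "(f has_derivative f') (at x) \<Longrightarrow> frechet_derivative f (at x) = f'"
  by (rule frechet_derivative_at[symmetric])

text \<open>A derivative at \<open>x\<close> depends on the values near \<open>x\<close>; openness
  of \<open>S\<close> is what lets pointwise agreement survive differentiation.\<close>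

lemma Ck_on_cong:
  assumes "open S" "\<And>x. x \<in> S \<Longrightarrow> f x = g x" "Ck_on k S f"
  shows "Ck_on k S g"
  using assms
proof (induction k arbitrary: f g)
  case 0
  then show ?case using continuous_on_cong by fastforce
next
  case (Suc k)
  have der: "(g has_derivative frechet_derivative f (at x)) (at x)" if "x \<in> S" for x
  proof -
    have "(f has_derivative frechet_derivative f (at x)) (at x)"
      using Suc.prems(3) that by (simp add: frechet_derivative_works[symmetric])
    then show ?thesis
      by (rule has_derivative_transform_within_open[OF _ Suc.prems(1) that]) (rule Suc.prems(2))
  qed
  then have eq: "frechet_derivative g (at x) = frechet_derivative f (at x)" if "x \<in> S" for x
    using that frechet_derivative_eq[OF der] by blast
  show ?case
    using Suc.prems(3) der Suc.IH[OF Suc.prems(1)] eq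
    by (auto simp: differentiable_def)
qed

text \<open>Derivatives at points of a Euclidean space are unique, so any explicit derivative may
  stand in for \<open>frechet_derivative\<close>. The inductions on \<open>k\<close> below work with
  such explicit formulas.\<close>

lemma Ck_on_SucI:
  assumes "open S" "\<And>x. x \<in> S \<Longrightarrow> (f has_derivative f' x) (at x)" "\<And>v. Ck_on k S (\<lambda>x. f' x v)"
  shows "Ck_on (Suc k) S f"
proof -
  have "frechet_derivative f (at x) = f' x" if "x \<in> S" for x
    using frechet_derivative_eq[OF assms(2)[OF that]] .
  then have "Ck_on k S (\<lambda>x. frechet_derivative f (at x) v)" for v
    using Ck_on_cong[OF assms(1) _ assms(3)] by simp
  then show ?thesis using assms(2) by (auto simp: differentiable_def)
qed

lemma Ck_on_SucD:
  assumes "Ck_on (Suc k) S f"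
  shows "\<And>x. x \<in> S \<Longrightarrow> (f has_derivative frechet_derivative f (at x)) (at x)"
    and "\<And>v. Ck_on k S (\<lambda>x. frechet_derivative f (at x) v)"
  using assms by (auto simp: frechet_derivative_works[symmetric])

lemma Ck_on_SucD_le: "Ck_on (Suc k) S f \<Longrightarrow> Ck_on k S f"
proof (induction k arbitrary: f)
  case 0
  then show ?case
    by (auto intro!: continuous_at_imp_continuous_on differentiable_imp_continuous_within)
next
  case (Suc k)
  then show ?case by (metis Ck_on.simps(2))
qed

lemma Ck_on_const: "Ck_on k S (\<lambda>x. c)"
proof (induction k arbitrary: c)
  case (Suc k)
  have "frechet_derivative (\<lambda>x. c) (at x) = (\<lambda>v. 0)" for x :: 'a
    by (metis frechet_derivative_const)
  then show ?case using Suc by simp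
qed simp

lemma Ck_on_bounded_linear:
  assumes "bounded_linear L" shows "Ck_on k S L"
proof (cases k)
  case 0
  then show ?thesis using assms by (simp add: linear_continuous_on)
next
  case (Suc k)
  have "frechet_derivative L (at x) = L" for x
    using assms frechet_derivative_eq bounded_linear_imp_has_derivative by blast
  then show ?thesis
    using assms Suc by (simp add: Ck_on_const bounded_linear_imp_differentiable)
qed

lemma Ck_on_linear_comp:
  assumes "open S" "bounded_linear L" "Ck_on k S f"
  shows "Ck_on k S (\<lambda>x. L (f x))"
  using assms(3)
proof (induction k arbitrary: f)
  case 0
  then show ?case using assms(2) by (simp add: bounded_linear.continuous_on)
next
  case (Suc k)
  show ?case
    by (rule Ck_on_SucI[OF assms(1), where f' = "\<lambda>x v. L (frechet_derivative f (at x) v)"])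
       (simp_all add: Ck_on_SucD[OF Suc.prems] Suc.IH bounded_linear.has_derivative[OF assms(2)])
qed

lemma Ck_on_add:
  assumes "open S" "Ck_on k S f" "Ck_on k S g"
  shows "Ck_on k S (\<lambda>x. f x + g x)"
  using assms(2,3)
proof (induction k arbitrary: f g)
  case 0
  then show ?case by (simp add: continuous_on_add)
next
  case (Suc k)
  show ?case
    by (rule Ck_on_SucI[OF assms(1), where f' = "\<lambda>x v. frechet_derivative f (at x) v + frechet_derivative g (at x) v"])
       (use Ck_on_SucD[OF Suc.prems(1)] Ck_on_SucD[OF Suc.prems(2)] Suc.IH in \<open>auto intro!: has_derivative_add\<close>)
qed

lemma Ck_on_sum:
  assumes "open S" "finite I" "\<And>i. i \<in> I \<Longrightarrow> Ck_on k S (f i)"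
  shows "Ck_on k S (\<lambda>x. \<Sum>i\<in>I. f i x)"
  using assms(2,3) by (induction I) (simp_all add: Ck_on_const Ck_on_add[OF assms(1)])

lemma Ck_on_scaleR:
  fixes a :: "'a::euclidean_space \<Rightarrow> real"
  assumes "open S" "Ck_on k S a" "Ck_on k S f"
  shows "Ck_on k S (\<lambda>x. a x *\<^sub>R f x)"
  using assms(2,3)
proof (induction k arbitrary: a f)
  case 0
  then show ?case by (simp add: continuous_on_scaleR)
next
  case (Suc k)
  note 1 = Ck_on_SucD[OF Suc.prems(1)] Ck_on_SucD_le[OF Suc.prems(1)]
  note 2 = Ck_on_SucD[OF Suc.prems(2)] Ck_on_SucD_le[OF Suc.prems(2)]
  show ?case
    by (rule Ck_on_SucI[OF assms(1), where f' = "\<lambda>x v. a x *\<^sub>R frechet_derivative f (at x) v +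
           frechet_derivative a (at x) v *\<^sub>R f x"])
       (use 1 2 Suc.IH in \<open>auto intro!: has_derivative_scaleR Ck_on_add[OF assms(1)]\<close>)
qed

lemma Ck_on_Pair:
  assumes "open S" "Ck_on k S f" "Ck_on k S g"
  shows "Ck_on k S (\<lambda>x. (f x, g x))"
proof -
  have "Ck_on k S (\<lambda>x. (f x, 0))"
    by (rule Ck_on_linear_comp[OF assms(1) _ assms(2)]) (auto intro!: bounded_linear_intros)
  moreover have "Ck_on k S (\<lambda>x. (0, g x))"
    by (rule Ck_on_linear_comp[OF assms(1) _ assms(3)]) (auto intro!: bounded_linear_intros)
  ultimately have "Ck_on k S (\<lambda>x. (f x, 0) + (0, g x))"
    by (rule Ck_on_add[OF assms(1)])
  then show ?thesis by simp
qed

lemma linear_expand: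
  fixes L :: "'a::euclidean_space \<Rightarrow> 'b::real_vector"
  assumes "linear L" shows "L v = (\<Sum>b\<in>Basis. (v \<bullet> b) *\<^sub>R L b)"
  using assms by (metis (no_types, lifting) euclidean_representation linear_scale linear_sum sum.cong)

text \<open>Smoothness of a family of linear maps is recorded one fixed vector at a time. Expanding
  the moving argument \<open>w x\<close> in \<open>Basis\<close> turns the evaluation into a finite
  sum of real functions times such fixed-vector values.\<close>

lemma Ck_on_apply_linear:
  fixes L :: "'c::euclidean_space \<Rightarrow> 'a::euclidean_space \<Rightarrow> 'b::euclidean_space"
  assumes "open S" "\<And>x. x \<in> S \<Longrightarrow> linear (L x)" "\<And>v. Ck_on k S (\<lambda>x. L x v)" "Ck_on k S w"
  shows "Ck_on k S (\<lambda>x. L x (w x))"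
proof -
  have "Ck_on k S (\<lambda>x. \<Sum>b\<in>Basis. (w x \<bullet> b) *\<^sub>R L x b)"
    by (intro Ck_on_sum Ck_on_scaleR assms(1,3) finite_Basis Ck_on_linear_comp[OF assms(1) _ assms(4)]
        bounded_linear_inner_left)
  then show ?thesis
    by (rule Ck_on_cong[OF assms(1), rotated]) (metis assms(2) linear_expand)
qed

lemma Ck_on_compose:
  fixes f :: "'a::euclidean_space \<Rightarrow> 'b::euclidean_space" and g :: "'b \<Rightarrow> 'c::euclidean_space"
  assumes "open S" "open T" "f ` S \<subseteq> T" "Ck_on k S f" "Ck_on k T g"
  shows "Ck_on k S (\<lambda>x. g (f x))"
  using assms(4,5)
proof (induction k arbitrary: g)
  case 0
  then show ?case using continuous_on_compose2[of T g S f] assms(3) by simp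
next
  case (Suc k)
  note 1 = Ck_on_SucD[OF Suc.prems(1)]
  note 2 = Ck_on_SucD[OF Suc.prems(2)]
  \<comment> \<open>The inner map \<open>f\<close> stays fixed in the induction and only loses an
    order; the outer map changes from \<open>g\<close> to its directional derivatives, which is why
    \<open>g\<close> alone is generalized.\<close>
  have IH: "Ck_on k T h \<Longrightarrow> Ck_on k S (\<lambda>x. h (f x))" for h :: "'b \<Rightarrow> 'c"
    using Suc.IH Ck_on_SucD_le[OF Suc.prems(1)] by blast
  show ?case
  proof (rule Ck_on_SucI[OF assms(1), where f' = "\<lambda>x v. frechet_derivative g (at (f x)) (frechet_derivative f (at x) v)"])
    fix x assume x: "x \<in> S"
    then have "f x \<in> T" using assms(3) by auto
    from diff_chain_at[OF 1(1)[OF x] 2(1)[OF this]]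
    show "((\<lambda>x. g (f x)) has_derivative (\<lambda>v. frechet_derivative g (at (f x)) (frechet_derivative f (at x) v))) (at x)"
      by (simp add: o_def)
  next
    fix v
    show "Ck_on k S (\<lambda>x. frechet_derivative g (at (f x)) (frechet_derivative f (at x) v))"
      by (rule Ck_on_apply_linear[OF assms(1) _ IH[OF 2(2)] 1(2)])
         (use assms(3) in \<open>auto intro!: has_derivative_linear 2(1)\<close>)
  qed
qed

section \<open>Smooth functions on open sets, their tangent maps and their local inverses\<close>

definition Cinf_on :: "'c::euclidean_space set \<Rightarrow> ('c \<Rightarrow> 'd::euclidean_space) \<Rightarrow> bool" where
  "Cinf_on U f \<longleftrightarrow> open U \<and> (\<forall>k. Ck_on k U f)"

lemma Cinf_on_open: "Cinf_on U f \<Longrightarrow> open U"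
  by (simp add: Cinf_on_def)

lemma Cinf_on_subset: "Cinf_on U f \<Longrightarrow> open V \<Longrightarrow> V \<subseteq> U \<Longrightarrow> Cinf_on V f"
  unfolding Cinf_on_def using Ck_on_subset by blast

lemma Cinf_on_compose:
  assumes "Cinf_on U f" "Cinf_on V g" "f ` U \<subseteq> V"
  shows "Cinf_on U (\<lambda>x. g (f x))"
  using assms unfolding Cinf_on_def using Ck_on_compose by blast

lemma Cinf_on_Pair: "Cinf_on U f \<Longrightarrow> Cinf_on U g \<Longrightarrow> Cinf_on U (\<lambda>x. (f x, g x))"
  unfolding Cinf_on_def using Ck_on_Pair by blast

lemma Cinf_on_linear: "open U \<Longrightarrow> linear L \<Longrightarrow> Cinf_on U L"
  unfolding Cinf_on_def by (simp add: Ck_on_bounded_linear linear_conv_bounded_linear)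

lemma Cinf_on_linear_comp: "linear L \<Longrightarrow> Cinf_on U f \<Longrightarrow> Cinf_on U (\<lambda>x. L (f x))"
  unfolding Cinf_on_def using Ck_on_linear_comp linear_conv_bounded_linear by blast

lemma Cinf_on_add: "Cinf_on U f \<Longrightarrow> Cinf_on U g \<Longrightarrow> Cinf_on U (\<lambda>x. f x + g x)"
  unfolding Cinf_on_def using Ck_on_add by blast

lemma Cinf_on_const: "open U \<Longrightarrow> Cinf_on U (\<lambda>x. c)"
  unfolding Cinf_on_def by (simp add: Ck_on_const)

lemma Cinf_on_continuous: "Cinf_on U f \<Longrightarrow> continuous_on U f"
  unfolding Cinf_on_def by (metis Ck_on.simps(1))

lemma Cinf_on_open_vimage: "Cinf_on U f \<Longrightarrow> open V \<Longrightarrow> open (U \<inter> f -` V)"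
  using Cinf_on_continuous Cinf_on_open continuous_open_preimage by blast

lemma Cinf_on_has_derivative:
  "Cinf_on U f \<Longrightarrow> x \<in> U \<Longrightarrow> (f has_derivative frechet_derivative f (at x)) (at x)"
  unfolding Cinf_on_def using Ck_on_SucD(1) by blast

lemma Cinf_on_linear_derivative: "Cinf_on U f \<Longrightarrow> x \<in> U \<Longrightarrow> linear (frechet_derivative f (at x))"
  using Cinf_on_has_derivative has_derivative_linear by blast

lemma Cinf_on_derivative: "Cinf_on U f \<Longrightarrow> Cinf_on U (\<lambda>x. frechet_derivative f (at x) v)"
  unfolding Cinf_on_def using Ck_on_SucD(2) by blast

lemma Cinf_on_apply_linear:
  assumes "\<And>x. x \<in> S \<Longrightarrow> linear (L x)" "\<And>v. Cinf_on S (\<lambda>x. L x v)" "Cinf_on S w"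
  shows "Cinf_on S (\<lambda>x. L x (w x))"
  using assms Ck_on_apply_linear[of S L] unfolding Cinf_on_def by blast

text \<open>This is the local expression of a tangent map. The derivative is applied to a varying
  vector, the case treated by \<open>Cinf_on_apply_linear\<close>.\<close>

lemma Cinf_on_tangent:
  assumes "Cinf_on U f"
  shows "Cinf_on (U \<times> UNIV) (\<lambda>(x, v). (f x, frechet_derivative f (at x) v))"
proof -
  have op: "open (U \<times> UNIV)" using assms Cinf_on_open open_Times by blast
  have fst: "Cinf_on (U \<times> UNIV) fst" and snd: "Cinf_on (U \<times> UNIV) snd"
    using op by (auto intro: Cinf_on_linear linear_fst linear_snd)
  have 1: "Cinf_on (U \<times> UNIV) (\<lambda>z. f (fst z))"
    using Cinf_on_compose[OF fst assms] by auto
  have 2: "Cinf_on (U \<times> UNIV) (\<lambda>z. frechet_derivative f (at (fst z)) (snd z))"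
    by (rule Cinf_on_apply_linear[OF _ _ snd])
       (use Cinf_on_linear_derivative[OF assms] Cinf_on_compose[OF fst Cinf_on_derivative[OF assms]] in auto)
  show ?thesis using Cinf_on_Pair[OF 1 2] by (simp add: case_prod_beta')
qed

lemma frechet_derivative_compose_Cinf:
  assumes "Cinf_on U f" "Cinf_on V g" "x \<in> U" "f x \<in> V"
  shows "frechet_derivative (\<lambda>x. g (f x)) (at x) v = frechet_derivative g (at (f x)) (frechet_derivative f (at x) v)"
proof -
  have "(g \<circ> f has_derivative frechet_derivative g (at (f x)) \<circ> frechet_derivative f (at x)) (at x)"
    using assms by (intro diff_chain_at Cinf_on_has_derivative)
  then have "((\<lambda>x. g (f x)) has_derivative (\<lambda>v. frechet_derivative g (at (f x)) (frechet_derivative f (at x) v))) (at x)"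
    by (simp add: o_def)
  then show ?thesis by (simp add: frechet_derivative_eq)
qed

text \<open>The tangent map of \<open>f\<close> has the inverse \<open>(y, w) \<mapsto> (g y, Df(g y)\<^sup>-\<^sup>1 w)\<close>; this yields the derivative
  of \<open>Df(g y)\<^sup>-\<^sup>1\<close> in \<open>y\<close> without any appeal to the continuity of inversion.\<close>

lemma Cinf_on_inverse:
  fixes f :: "'a::euclidean_space \<Rightarrow> 'a"
  assumes f: "Cinf_on U f" and V: "open V" "V = f ` U" and gf: "\<And>x. x \<in> U \<Longrightarrow> g (f x) = x"
    and bij: "\<And>x. x \<in> U \<Longrightarrow> bij (frechet_derivative f (at x))"
  shows "Cinf_on V g"
proof -
  define A where "A y = inv_into UNIV (frechet_derivative f (at (g y)))" for y
  have U: "open U" using f Cinf_on_open by blast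
  have gV: "g y \<in> U" "f (g y) = y" if "y \<in> V" for y using that V gf by auto
  have linD: "linear (frechet_derivative f (at x))" if "x \<in> U" for x
    using Cinf_on_linear_derivative[OF f that] .
  have linA: "linear (A y)" if "y \<in> V" for y
    unfolding A_def using linear_injective_left_inverse linD[OF gV(1)[OF that]] bij[OF gV(1)[OF that]]
    by (metis bij_betw_def inj_linear_imp_inv_linear)
  have AD: "A y (frechet_derivative f (at (g y)) v) = v" "frechet_derivative f (at (g y)) (A y v) = v"
    if "y \<in> V" for y v
    using bij[OF gV(1)[OF that]] unfolding A_def by (simp_all add: bij_is_inj bij_is_surj surj_f_inv_f)
  define H where "H i x = frechet_derivative (\<lambda>x. frechet_derivative f (at x) i) (at x)" for i x
  have Hder: "((\<lambda>x. frechet_derivative f (at x) i) has_derivative H i x) (at x)" if "x \<in> U" for i x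
    unfolding H_def using Cinf_on_has_derivative[OF Cinf_on_derivative[OF f] that] .
  have linH: "linear (H i x)" if "x \<in> U" for i x using Hder that has_derivative_linear by blast
  have Hinf: "Cinf_on U (\<lambda>x. H i x v)" for i v
    unfolding H_def using Cinf_on_derivative[OF Cinf_on_derivative[OF f]] .
  \<comment> \<open>The expected derivative of \<open>A y v\<close> in direction \<open>c\<close>:
    differentiating \<open>Df(g y) (A y v) = v\<close> in \<open>y\<close> gives minus
    \<open>A y\<close> applied to the second derivative of \<open>f\<close> at \<open>g y\<close>,
    evaluated at \<open>A y c\<close> and \<open>A y v\<close>.\<close>
  define K where "K y v c = - A y (\<Sum>i\<in>Basis. (A y v \<bullet> i) *\<^sub>R H i (g y) (A y c))" for y v c
  have derA: "((\<lambda>y. A y w) has_derivative K y w) (at y)" and derg: "(g has_derivative A y) (at y)"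
    if y: "y \<in> V" for y w
  proof -
    let ?\<Phi> = "\<lambda>z. (f (fst z), \<Sum>i\<in>Basis. (snd z \<bullet> i) *\<^sub>R frechet_derivative f (at (fst z)) i)"
    let ?\<Phi>' = "\<lambda>z d. (frechet_derivative f (at (fst z)) (fst d), \<Sum>i\<in>Basis. (snd z \<bullet> i) *\<^sub>R H i (fst z) (fst d) +
                (snd d \<bullet> i) *\<^sub>R frechet_derivative f (at (fst z)) i)"
    let ?\<Psi> = "\<lambda>z. (g (fst z), A (fst z) (snd z))"
    \<comment> \<open>\<open>?\<Phi>'\<close> is block triangular: the first component of
      \<open>d\<close> is recovered by \<open>A\<close>, its contribution to the second component is
      subtracted, and \<open>A\<close> is applied to the rest.\<close>
    let ?\<Psi>' = "\<lambda>z d. (A (f (fst z)) (fst d), A (f (fst z)) (snd d - (\<Sum>i\<in>Basis. (snd z \<bullet> i) *\<^sub>R H i (fst z) (A (f (fst z)) (fst d)))))"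
    have fin: "f (fst z) \<in> V" "g (f (fst z)) = fst z" if "z \<in> U \<times> UNIV" for z :: "'a \<times> 'a"
      using that V gf by auto
    have d\<Phi>: "(?\<Phi> has_derivative ?\<Phi>' z) (at z)" if "z \<in> U \<times> UNIV" for z
    proof -
      have z: "fst z \<in> U" using that by auto
      have a: "((\<lambda>z. f (fst z)) has_derivative (\<lambda>d. frechet_derivative f (at (fst z)) (fst d))) (at z)"
        using has_derivative_compose[OF has_derivative_fst[OF has_derivative_ident] Cinf_on_has_derivative[OF f z]]
        by simp
      have b: "((\<lambda>z. frechet_derivative f (at (fst z)) i) has_derivative (\<lambda>d. H i (fst z) (fst d))) (at z)" for i
        using has_derivative_compose[OF has_derivative_fst[OF has_derivative_ident] Hder[OF z]]
        by simp
      show ?thesis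
        by (intro has_derivative_Pair has_derivative_sum has_derivative_scaleR a b derivative_eq_intros)
           auto
    qed
    have exp: "(\<Sum>i\<in>Basis. (u \<bullet> i) *\<^sub>R frechet_derivative f (at x) i) = frechet_derivative f (at x) u"
      if "x \<in> U" for x u using linear_expand[OF linD[OF that]] by metis
    have left: "?\<Psi> (?\<Phi> z) = z" if "z \<in> U \<times> UNIV" for z
    proof -
      have z: "fst z \<in> U" "g (f (fst z)) = fst z" using that gf by auto
      show ?thesis using AD(1)[OF fin(1)[OF that]] z
        by (simp add: exp prod_eq_iff)
    qed
    have comp: "?\<Phi>' z \<circ> ?\<Psi>' z = id" if "z \<in> U \<times> UNIV" for z
    proof -
      have z: "fst z \<in> U" "g (f (fst z)) = fst z" using that gf by auto
      show ?thesis
        using AD(2)[OF fin(1)[OF that]] z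
        by (auto simp: fun_eq_iff sum.distrib exp prod_eq_iff)
    qed
    have "(?\<Psi> has_derivative ?\<Psi>' (g y, A y w)) (at (?\<Phi> (g y, A y w)))"
    proof (rule has_derivative_inverse_on[where f = ?\<Phi> and g = ?\<Psi> and f' = ?\<Phi>' and g' = ?\<Psi>' and S = "U \<times> UNIV"])
      show "open (U \<times> (UNIV :: 'a set))" using U by (simp add: open_Times)
      show "(g y, A y w) \<in> U \<times> UNIV" using gV(1)[OF y] by simp
      then show "?\<Phi>' (g y, A y w) \<circ> ?\<Psi>' (g y, A y w) = id" by (rule comp)
    qed (fact d\<Phi> left)+
    moreover have "?\<Phi> (g y, A y w) = (y, w)"
      using exp[OF gV(1)[OF y]] gV(2)[OF y] AD(2)[OF y] by simp
    ultimately have D: "(?\<Psi> has_derivative ?\<Psi>' (g y, A y w)) (at (y, w))" by simp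
    have "((\<lambda>y. (y, w)) has_derivative (\<lambda>c. (c, 0))) (at y)"
      by (auto intro!: derivative_eq_intros)
    from has_derivative_compose[OF this D]
    have E: "((\<lambda>y. (g y, A y w)) has_derivative (\<lambda>c. ?\<Psi>' (g y, A y w) (c, 0))) (at y)"
      by simp
    show "((\<lambda>y. A y w) has_derivative K y w) (at y)"
      using has_derivative_snd[OF E] gV(2)[OF y] linA[OF y]
      by (simp add: K_def[abs_def] linear_neg flip: fun_eq_iff)
    show "(g has_derivative A y) (at y)"
      using has_derivative_fst[OF E] gV(2)[OF y] by simp
  qed
  \<comment> \<open>One joint induction: the derivative of \<open>g\<close> is \<open>A\<close>, and
    that of \<open>A\<close> is built from \<open>A\<close> and from second derivatives of
    \<open>f\<close> at \<open>g y\<close>, so each round raises the order of both.\<close>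
  have "Ck_on k V g \<and> (\<forall>v. Ck_on k V (\<lambda>y. A y v))" for k
  proof (induction k)
    case 0
    show ?case
      using derA derg V(1)
      by (auto simp: continuous_on_eq_continuous_at intro: has_derivative_continuous)
  next
    case (Suc k)
    have gk: "Ck_on k V g" and Ak: "\<And>v. Ck_on k V (\<lambda>y. A y v)" using Suc by auto
    have Hk: "Ck_on k V (\<lambda>y. H i (g y) v)" for i v
      using Ck_on_compose[OF V(1) U _ gk, of "\<lambda>x. H i x v"] Hinf gV(1) unfolding Cinf_on_def by blast
    have "Ck_on k V (\<lambda>y. K y v c)" for v c
    proof -
      have HA: "Ck_on k V (\<lambda>y. H i (g y) (A y c))" for i
        by (rule Ck_on_apply_linear[OF V(1) _ Hk Ak]) (use linH gV(1) in blast)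
      have "Ck_on k V (\<lambda>y. \<Sum>i\<in>Basis. (A y v \<bullet> i) *\<^sub>R H i (g y) (A y c))"
        by (intro Ck_on_sum Ck_on_scaleR V(1) finite_Basis HA Ck_on_linear_comp[OF V(1) _ Ak]
            bounded_linear_inner_left)
      from Ck_on_apply_linear[OF V(1) linA Ak this]
      show ?thesis unfolding K_def
        by (rule Ck_on_linear_comp[OF V(1) bounded_linear_minus[OF bounded_linear_ident]])
    qed
    then show ?case
      using Ck_on_SucI[OF V(1) derg Ak] Ck_on_SucI[OF V(1) derA] by blast
  qed
  then show ?thesis using V(1) unfolding Cinf_on_def by blast
qed

text \<open>The inverse function theorem for continuously differentiable maps gives a homeomorphic
  inverse and bijective derivatives nearby; \<open>Cinf_on_inverse\<close> upgrades this inverse to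
  a smooth one.\<close>

lemma Cinf_on_local_inverse:
  fixes f :: "'a::euclidean_space \<Rightarrow> 'a"
  assumes f: "Cinf_on U f" and x: "x \<in> U" and inj: "inj (frechet_derivative f (at x))"
  obtains N g where "open N" "x \<in> N" "N \<subseteq> U" "Cinf_on (f ` N) g" "\<And>x. x \<in> N \<Longrightarrow> g (f x) = x"
proof -
  define f' where "f' x = Blinfun (frechet_derivative f (at x))" for x
  have f': "blinfun_apply (f' x) = frechet_derivative f (at x)" if "x \<in> U" for x
    unfolding f'_def using Cinf_on_linear_derivative[OF f that]
    by (simp add: bounded_linear_Blinfun_apply linear_conv_bounded_linear)
  have U: "open U" using f Cinf_on_open by blast
  have der: "(f has_derivative blinfun_apply (f' x)) (at x)" if "x \<in> U" for x
    using Cinf_on_has_derivative[OF f that] f'[OF that] by simp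
  have cont: "continuous_on U f'"
    by (rule continuous_on_blinfun_componentwise)
       (simp add: f' Cinf_on_continuous[OF Cinf_on_derivative[OF f]] cong: continuous_on_cong)
  have lin: "linear (frechet_derivative f (at x))" using Cinf_on_linear_derivative[OF f x] .
  obtain h where h: "linear h" "h \<circ> frechet_derivative f (at x) = id"
    using linear_injective_left_inverse[OF lin inj] by blast
  have "Blinfun h o\<^sub>L f' x = id_blinfun"
    using h f'[OF x] by (intro blinfun_eqI)
      (simp add: bounded_linear_Blinfun_apply linear_conv_bounded_linear pointfree_idE)
  from inverse_function_theorem[OF U der cont x this]
  obtain N V g g' where N: "open N" "N \<subseteq> U" "x \<in> N" "open V" "f x \<in> V" "homeomorphism N V f g"
    "\<And>y. y \<in> V \<Longrightarrow> bij (blinfun_apply (f'(g y)))" by metis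
  have V: "V = f ` N" and gf: "\<And>x. x \<in> N \<Longrightarrow> g (f x) = x"
    using N(6) unfolding homeomorphism_def by auto
  have "Cinf_on V g"
  proof (rule Cinf_on_inverse[OF Cinf_on_subset[OF f N(1,2)] N(4) V gf])
    fix z assume "z \<in> N"
    then show "bij (frechet_derivative f (at z))"
      using N(7)[of "f z"] V gf f' N(2) by auto
  qed
  then show ?thesis using that N gf V by blast
qed

section \<open>Smooth maps in local coordinates\<close>

text \<open>The tangent bundle is only needed as a target and source of smooth maps, so that neither
  the Hausdorff property nor second countability has to be established for it.\<close>

definition premanifold :: "('a, 'c::euclidean_space) manifold \<Rightarrow> bool" where
  "premanifold X \<longleftrightarrow> subspace (mf_model X) \<and>
     (\<forall>(U, c) \<in> mf_atlas X.
        openin (mf_top X) U \<and> openin (top_of_set (mf_model X)) (c ` U) \<and>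
        homeomorphic_map (subtopology (mf_top X) U) (top_of_set (c ` U)) c) \<and>
     (\<forall>C \<in> mf_atlas X. \<forall>D \<in> mf_atlas X.
        smooth_fun_on (snd C ` (fst C \<inter> fst D)) (snd D \<circ> chart_inv C)) \<and>
     (\<forall>x \<in> pts X. mf_chart_at X x \<in> mf_atlas X \<and> x \<in> fst (mf_chart_at X x))"

lemma smooth_manifold_iff:
  "smooth_manifold X \<longleftrightarrow>
     Hausdorff_space (mf_top X) \<and> second_countable (mf_top X) \<and> premanifold X"
  unfolding smooth_manifold_def premanifold_def by blast

lemma smooth_manifold_premanifold: "smooth_manifold X \<Longrightarrow> premanifold X"
  by (simp add: smooth_manifold_iff)

text \<open>Since \<open>U\<close> and its image are open, open sets of the two subspaces are just
  open sets of \<open>T\<close> and \<open>V\<close> inside them. In this form the chart conditions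
  can be checked on images of sets, without subspace topologies.\<close>

lemma homeo_top_of_set_iff:
  assumes "openin T U" "openin (top_of_set V) (c ` U)"
  shows "homeomorphic_map (subtopology T U) (top_of_set (c ` U)) c \<longleftrightarrow>
    inj_on c U \<and> (\<forall>W. W \<subseteq> U \<longrightarrow> (openin T W \<longleftrightarrow> openin (top_of_set V) (c ` W)))"
    (is "?L \<longleftrightarrow> ?R")
proof -
  have UT: "U \<subseteq> topspace T" using assms(1) openin_subset by blast
  have cV: "c ` U \<subseteq> V" using assms(2) openin_subset by force
  have opU: "openin (subtopology T U) W \<longleftrightarrow> openin T W" if "W \<subseteq> U" for W
    using that assms(1) by (simp add: openin_open_subtopology)
  have opV: "openin (top_of_set (c ` U)) Z \<longleftrightarrow> openin (top_of_set V) Z" if "Z \<subseteq> c ` U" for Z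
  proof -
    have "top_of_set (c ` U) = subtopology (top_of_set V) (c ` U)"
      using cV by (simp add: subtopology_subtopology inf.absorb2)
    then show ?thesis using openin_open_subtopology[OF assms(2)] that by simp
  qed
  show ?thesis
  proof
    assume L: ?L
    have "inj_on c U"
      using homeomorphic_imp_injective_map[OF L] UT by (simp add: inf.absorb2)
    moreover have "openin T W \<longleftrightarrow> openin (top_of_set V) (c ` W)" if "W \<subseteq> U" for W
      using homeomorphic_map_openness[OF L, of W] that UT opU[OF that] opV[of "c ` W"]
      by (auto simp: inf.absorb2)
    ultimately show ?R by blast
  next
    assume R: ?R
    show ?L
    proof (rule bijective_open_imp_homeomorphic_map)
      show "open_map (subtopology T U) (top_of_set (c ` U)) c"
        unfolding open_map_def
        by (metis R image_mono opU opV openin_subset openin_subtopology_Int2 topspace_subtopology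
             le_inf_iff)
      show "continuous_map (subtopology T U) (top_of_set (c ` U)) c"
        unfolding continuous_map_alt
      proof (intro conjI allI impI)
        fix Z assume Z: "openin (top_of_set (c ` U)) Z"
        then have "Z \<subseteq> c ` U" by (metis openin_imp_subset)
        then have "Z = c ` (c -` Z \<inter> U)" by auto
        moreover have "openin (top_of_set V) Z" using Z opV \<open>Z \<subseteq> c ` U\<close> by blast
        ultimately have "openin T (c -` Z \<inter> U)" using R by (metis inf_le2)
        then show "openin (subtopology T U) (c -` Z \<inter> topspace (subtopology T U))"
          using opU[of "c -` Z \<inter> U"] UT by (simp add: inf.absorb2)
      qed (use UT in auto)
    qed (use R UT in \<open>auto simp: inf.absorb2\<close>)
  qed
qed

lemma premanifoldI:
  assumes "subspace (mf_model X)"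
    and "\<And>C. C \<in> mf_atlas X \<Longrightarrow> openin (mf_top X) (fst C) \<and> openin (top_of_set (mf_model X)) (snd C ` fst C) \<and>
        inj_on (snd C) (fst C) \<and>
        (\<forall>W. W \<subseteq> fst C \<longrightarrow> (openin (mf_top X) W \<longleftrightarrow> openin (top_of_set (mf_model X)) (snd C ` W)))"
    and "\<And>C D. C \<in> mf_atlas X \<Longrightarrow> D \<in> mf_atlas X \<Longrightarrow>
        smooth_fun_on (snd C ` (fst C \<inter> fst D)) (snd D \<circ> chart_inv C)"
    and "\<And>x. x \<in> pts X \<Longrightarrow> mf_chart_at X x \<in> mf_atlas X \<and> x \<in> fst (mf_chart_at X x)"
  shows "premanifold X"
proof -
  have "openin (mf_top X) U \<and> openin (top_of_set (mf_model X)) (c ` U) \<and>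
        homeomorphic_map (subtopology (mf_top X) U) (top_of_set (c ` U)) c"
    if "(U, c) \<in> mf_atlas X" for U c
    using assms(2)[OF that] homeo_top_of_set_iff[of "mf_top X" U "mf_model X" c] by simp
  then show ?thesis unfolding premanifold_def using assms(1,3,4) by blast
qed

context
  fixes X :: "('a, 'c::euclidean_space) manifold"
  assumes X: "premanifold X"
begin

lemma premanifold_subspace: "subspace (mf_model X)"
  using X by (simp add: premanifold_def)

lemma chart_open: "C \<in> mf_atlas X \<Longrightarrow> openin (mf_top X) (fst C)"
  using X by (cases C) (auto simp: premanifold_def)

lemma chart_subset: "C \<in> mf_atlas X \<Longrightarrow> fst C \<subseteq> pts X"
  using chart_open openin_subset by blast

lemma chart_image_open: "C \<in> mf_atlas X \<Longrightarrow> openin (top_of_set (mf_model X)) (snd C ` fst C)"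
  using X by (cases C) (auto simp: premanifold_def)

lemma chart_inj_open_iff:
  assumes "C \<in> mf_atlas X"
  shows "inj_on (snd C) (fst C) \<and>
    (\<forall>W. W \<subseteq> fst C \<longrightarrow> (openin (mf_top X) W \<longleftrightarrow> openin (top_of_set (mf_model X)) (snd C ` W)))"
proof -
  have "homeomorphic_map (subtopology (mf_top X) (fst C)) (top_of_set (snd C ` fst C)) (snd C)"
    using X assms by (cases C) (auto simp: premanifold_def)
  then show ?thesis using homeo_top_of_set_iff[OF chart_open[OF assms] chart_image_open[OF assms]] by blast
qed

lemma chart_inj: "C \<in> mf_atlas X \<Longrightarrow> inj_on (snd C) (fst C)"
  using chart_inj_open_iff by blast

lemma chart_open_iff:
  "C \<in> mf_atlas X \<Longrightarrow> W \<subseteq> fst C \<Longrightarrow> openin (mf_top X) W \<longleftrightarrow> openin (top_of_set (mf_model X)) (snd C ` W)"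
  using chart_inj_open_iff by blast

lemma chart_in_model: "C \<in> mf_atlas X \<Longrightarrow> x \<in> fst C \<Longrightarrow> snd C x \<in> mf_model X"
  using chart_image_open openin_imp_subset by blast

lemma chart_inv_chart: "C \<in> mf_atlas X \<Longrightarrow> x \<in> fst C \<Longrightarrow> chart_inv C (snd C x) = x"
  by (simp add: chart_inj)

lemma chart_vimage_open:
  assumes "C \<in> mf_atlas X" "open Z"
  shows "openin (mf_top X) {x \<in> fst C. snd C x \<in> Z}"
proof -
  have "snd C ` {x \<in> fst C. snd C x \<in> Z} = snd C ` fst C \<inter> Z" by auto
  then show ?thesis using chart_open_iff[OF assms(1), of "{x \<in> fst C. snd C x \<in> Z}"]
    openin_Int_open[OF chart_image_open[OF assms(1)] assms(2)] by auto
qed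

lemma chart_image_openE:
  assumes "C \<in> mf_atlas X" "openin (mf_top X) W" "W \<subseteq> fst C"
  obtains N where "open N" "snd C ` W = mf_model X \<inter> N"
  using assms chart_open_iff by (metis openin_open)

lemma chart_at: "x \<in> pts X \<Longrightarrow> mf_chart_at X x \<in> mf_atlas X" "x \<in> pts X \<Longrightarrow> x \<in> fst (mf_chart_at X x)"
  using X by (auto simp: premanifold_def)

lemma chart_smooth: "C \<in> mf_atlas X \<Longrightarrow> D \<in> mf_atlas X \<Longrightarrow>
    smooth_fun_on (snd C ` (fst C \<inter> fst D)) (snd D \<circ> chart_inv C)"
  using X by (simp add: premanifold_def)

end

text \<open>\<open>F\<close> extends the coordinate expression of \<open>f\<close> to an ambient
  open set and has to agree with it on \<open>A\<close> only. The charts are parameters here, while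
  \<open>smooth_on\<close> leaves them existential, so that they can be matched when maps are
  composed.\<close>

definition local_rep ::
  "('a, 'c::euclidean_space) manifold \<Rightarrow> ('a, 'c) chart \<Rightarrow> ('b, 'd::euclidean_space) chart \<Rightarrow>
    'a set \<Rightarrow> ('a \<Rightarrow> 'b) \<Rightarrow> 'a \<Rightarrow> bool" where
  "local_rep X C D A f x \<longleftrightarrow> (\<exists>W U F. openin (mf_top X) W \<and> x \<in> W \<and> W \<subseteq> fst C \<and> f ` (W \<inter> A) \<subseteq> fst D \<and>
     Cinf_on U F \<and> snd C ` W \<subseteq> U \<and> (\<forall>x'\<in>W \<inter> A. F (snd C x') = snd D (f x')))"

lemma local_repE:
  assumes "local_rep X C D A f x"
  obtains W U F where "openin (mf_top X) W" "x \<in> W" "W \<subseteq> fst C" "f ` (W \<inter> A) \<subseteq> fst D"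
    "Cinf_on U F" "snd C ` W \<subseteq> U" "\<And>x'. x' \<in> W \<inter> A \<Longrightarrow> F (snd C x') = snd D (f x')"
  using assms unfolding local_rep_def
  apply (elim exE conjE)
  subgoal for W U F by (rule that[of W U F]) auto
  done

lemma local_rep_cong: "local_rep X C D A f x \<Longrightarrow> (\<And>y. y \<in> A \<Longrightarrow> f y = g y) \<Longrightarrow> local_rep X C D A g x"
  unfolding local_rep_def by (smt (verit) IntD2 image_cong)

lemma local_rep_subset: "local_rep X C D A f x \<Longrightarrow> B \<subseteq> A \<Longrightarrow> local_rep X C D B f x"
  unfolding local_rep_def by (smt (verit) Int_mono dual_order.refl image_mono order_trans subsetD)

lemma local_rep_localize:
  "local_rep X C D (A \<inter> W) f x \<Longrightarrow> openin (mf_top X) W \<Longrightarrow> x \<in> W \<Longrightarrow> local_rep X C D A f x"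
  unfolding local_rep_def
  apply (elim exE conjE)
  subgoal for W' U F
    apply (rule exI[of _ "W' \<inter> W"], rule exI[of _ U], rule exI[of _ F])
    apply (auto simp: Int_ac)
    done
  done

lemma local_rep_compose:
  assumes X: "premanifold X" "C \<in> mf_atlas X" and Y: "premanifold Y" "D \<in> mf_atlas Y"
    and x: "x \<in> A" "f ` A \<subseteq> B" and f: "local_rep X C D A f x" and g: "local_rep Y D D' B g (f x)"
  shows "local_rep X C D' A (\<lambda>x. g (f x)) x"
proof -
  obtain W1 O1 F where 1: "openin (mf_top X) W1" "x \<in> W1" "W1 \<subseteq> fst C" "f ` (W1 \<inter> A) \<subseteq> fst D"
     "Cinf_on O1 F" "snd C ` W1 \<subseteq> O1" "\<And>x'. x' \<in> W1 \<inter> A \<Longrightarrow> F (snd C x') = snd D (f x')"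
    by (rule local_repE[OF f]) metis
  obtain W2 O2 H where 2: "openin (mf_top Y) W2" "f x \<in> W2" "W2 \<subseteq> fst D" "g ` (W2 \<inter> B) \<subseteq> fst D'"
     "Cinf_on O2 H" "snd D ` W2 \<subseteq> O2" "\<And>x'. x' \<in> W2 \<inter> B \<Longrightarrow> H (snd D x') = snd D' (g x')"
    by (rule local_repE[OF g]) metis
  \<comment> \<open>The chart image of \<open>W2\<close> is cut out of the model space by the open
    set \<open>N\<close>, so whether \<open>f y\<close> lies in \<open>W2\<close> can be read off
    from \<open>F (snd C y)\<close>. This takes the place of continuity of \<open>f\<close>.\<close>
  obtain N where N: "open N" "snd D ` W2 = mf_model Y \<inter> N"
    using chart_image_openE[OF Y 2(1,3)] by blast
  define O3 where "O3 = O1 \<inter> F -` (O2 \<inter> N)"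
  have O3: "open O3"
    unfolding O3_def using Cinf_on_open_vimage[OF 1(5)] Cinf_on_open[OF 2(5)] N(1) by blast
  define W3 where "W3 = W1 \<inter> {y \<in> fst C. snd C y \<in> O3}"
  have W3: "openin (mf_top X) W3"
    unfolding W3_def using chart_vimage_open[OF X O3] 1(1) by blast
  have fW: "f y \<in> W2 \<inter> B" if "y \<in> W3 \<inter> A" for y
  proof -
    have y: "y \<in> W1 \<inter> A" "F (snd C y) \<in> N" using that by (auto simp: W3_def O3_def)
    then have "f y \<in> fst D" "snd D (f y) \<in> N" using 1(4,7) by force+
    then have "snd D (f y) \<in> snd D ` W2" using N(2) chart_in_model[OF Y] by blast
    then have "f y \<in> W2" using chart_inj[OF Y] \<open>f y \<in> fst D\<close> 2(3)
      by (meson inj_on_image_mem_iff)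
    then show ?thesis using x(2) that by auto
  qed
  have xW: "x \<in> W3"
  proof -
    have "F (snd C x) = snd D (f x)" using 1(2,7) x(1) by blast
    moreover have "snd D (f x) \<in> N \<inter> O2" using 2(2,6) N(2) by blast
    ultimately show ?thesis using 1(2,3,6) unfolding W3_def O3_def by auto
  qed
  have "Cinf_on O3 (\<lambda>z. H (F z))"
    by (rule Cinf_on_compose[OF Cinf_on_subset[OF 1(5) O3] 2(5)]) (auto simp: O3_def)
  moreover have "H (F (snd C y)) = snd D' (g (f y))" if "y \<in> W3 \<inter> A" for y
    using 1(7)[of y] 2(7)[OF fW[OF that]] that by (simp add: W3_def)
  moreover have "(\<lambda>x. g (f x)) ` (W3 \<inter> A) \<subseteq> fst D'" using fW 2(4) by blast
  ultimately show ?thesis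
    unfolding local_rep_def using W3 xW by (intro exI[of _ W3] exI[of _ O3] exI) (auto simp: W3_def)
qed

text \<open>A change of charts is the identity map seen in two charts; in this form, replacing
  charts becomes an instance of \<open>local_rep_compose\<close>.\<close>

lemma local_rep_chart_change:
  assumes X: "premanifold X" "C \<in> mf_atlas X" "D \<in> mf_atlas X" and x: "x \<in> fst C" "x \<in> fst D"
  shows "local_rep X C D A (\<lambda>x. x) x"
proof -
  obtain U F where U: "open U" "snd C x \<in> U" "\<forall>k. Ck_on k U F"
    "\<And>y. y \<in> snd C ` (fst C \<inter> fst D) \<inter> U \<Longrightarrow> F y = (snd D \<circ> chart_inv C) y"
    using chart_smooth[OF X] x unfolding smooth_fun_on_def by (metis IntI imageI)
  define W where "W = fst D \<inter> {y \<in> fst C. snd C y \<in> U}"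
  have "F (snd C y) = snd D y" if "y \<in> W" for y
  proof -
    have y: "y \<in> fst C" "y \<in> fst D" "snd C y \<in> U" using that by (auto simp: W_def)
    then show ?thesis using U(4)[of "snd C y"] chart_inv_chart[OF X(1,2) y(1)] by auto
  qed
  moreover have "openin (mf_top X) W"
    unfolding W_def using chart_vimage_open[OF X(1,2) U(1)] chart_open[OF X(1,3)] by blast
  moreover have "Cinf_on U F" using U by (simp add: Cinf_on_def)
  ultimately show ?thesis unfolding local_rep_def
    by (intro exI[of _ W] exI[of _ U] exI[of _ F]) (use x U W_def in auto)
qed

text \<open>Smoothness concerns germs: from an extension valid near \<open>x\<close> a
  representation arises by shrinking \<open>W\<close> to its domain, and conversely one
  representation extends the map around every point of its patch.\<close>

lemma smooth_on_iff_local_rep: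
  assumes X: "premanifold X"
  shows "smooth_on A X Y f \<longleftrightarrow> A \<subseteq> pts X \<and>
    (\<forall>x\<in>A. \<exists>C \<in> mf_atlas X. \<exists>D \<in> mf_atlas Y. local_rep X C D A f x)"
proof -
  have "(\<exists>W. openin (mf_top X) W \<and> x \<in> W \<and> W \<subseteq> fst C \<and> f ` (W \<inter> A) \<subseteq> fst D \<and>
        smooth_fun_on (snd C ` (W \<inter> A)) (snd D \<circ> f \<circ> chart_inv C)) \<longleftrightarrow> local_rep X C D A f x"
    if x: "x \<in> A" and C: "C \<in> mf_atlas X" and D: "D \<in> mf_atlas Y" for x C D
  proof
    assume "\<exists>W. openin (mf_top X) W \<and> x \<in> W \<and> W \<subseteq> fst C \<and> f ` (W \<inter> A) \<subseteq> fst D \<and>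
        smooth_fun_on (snd C ` (W \<inter> A)) (snd D \<circ> f \<circ> chart_inv C)"
    then obtain W where W: "openin (mf_top X) W" "x \<in> W" "W \<subseteq> fst C" "f ` (W \<inter> A) \<subseteq> fst D"
        "smooth_fun_on (snd C ` (W \<inter> A)) (snd D \<circ> f \<circ> chart_inv C)" by blast
    then obtain U F where U: "open U" "snd C x \<in> U" "\<forall>k. Ck_on k U F"
      "\<And>y. y \<in> snd C ` (W \<inter> A) \<inter> U \<Longrightarrow> F y = (snd D \<circ> f \<circ> chart_inv C) y"
      using x unfolding smooth_fun_on_def by (metis IntI imageI)
    define W' where "W' = W \<inter> {y \<in> fst C. snd C y \<in> U}"
    have "F (snd C y) = snd D (f y)" if "y \<in> W' \<inter> A" for y
    proof -
      have y: "y \<in> fst C" "y \<in> W" "y \<in> A" "snd C y \<in> U" using that by (auto simp: W'_def)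
      then show ?thesis using U(4)[of "snd C y"] chart_inv_chart[OF X C y(1)] by auto
    qed
    moreover have "openin (mf_top X) W'"
      unfolding W'_def using chart_vimage_open[OF X C U(1)] W(1) by blast
    moreover have "Cinf_on U F" using U by (simp add: Cinf_on_def)
    ultimately show "local_rep X C D A f x" unfolding local_rep_def
      by (intro exI[of _ W'] exI[of _ U] exI[of _ F]) (use x U W W'_def in auto)
  next
    assume "local_rep X C D A f x"
    then obtain W U F where W: "openin (mf_top X) W" "x \<in> W" "W \<subseteq> fst C" "f ` (W \<inter> A) \<subseteq> fst D"
      "Cinf_on U F" "snd C ` W \<subseteq> U" "\<And>x'. x' \<in> W \<inter> A \<Longrightarrow> F (snd C x') = snd D (f x')"
      by (rule local_repE) metis
    have "smooth_fun_on (snd C ` (W \<inter> A)) (snd D \<circ> f \<circ> chart_inv C)"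
      unfolding smooth_fun_on_def
    proof (intro ballI exI conjI)
      show "open U" "\<forall>k. Ck_on k U F" using W(5) by (auto simp: Cinf_on_def)
      show "F y = (snd D \<circ> f \<circ> chart_inv C) y" if "y \<in> snd C ` (W \<inter> A) \<inter> U" for y
        using that W(3,7) chart_inv_chart[OF X C] by auto
    qed (use W in auto)
    then show "\<exists>W. openin (mf_top X) W \<and> x \<in> W \<and> W \<subseteq> fst C \<and> f ` (W \<inter> A) \<subseteq> fst D \<and>
        smooth_fun_on (snd C ` (W \<inter> A)) (snd D \<circ> f \<circ> chart_inv C)" using W by blast
  qed
  then show ?thesis unfolding smooth_on_def by (smt (verit))
qed

lemma local_rep_mem: "local_rep X C D A f x \<Longrightarrow> x \<in> A \<Longrightarrow> x \<in> fst C \<and> f x \<in> fst D"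
  unfolding local_rep_def by blast

lemma smooth_on_image:
  assumes "premanifold Y" "smooth_on A X Y f" shows "f ` A \<subseteq> pts Y"
  using assms(2) chart_subset[OF assms(1)] unfolding smooth_on_def by blast

lemma smooth_on_pts: "smooth_on A X Y f \<Longrightarrow> A \<subseteq> pts X"
  by (simp add: smooth_on_def)

text \<open>Composing with changes of charts on both sides frees smoothness from the charts that
  happen to witness it.\<close>

lemma smooth_on_local_rep:
  assumes X: "premanifold X" and Y: "premanifold Y" and f: "smooth_on A X Y f" and x: "x \<in> A"
    and C: "C \<in> mf_atlas X" "x \<in> fst C" and D: "D \<in> mf_atlas Y" "f x \<in> fst D"
  shows "local_rep X C D A f x"
proof -
  obtain C0 D0 where 0: "C0 \<in> mf_atlas X" "D0 \<in> mf_atlas Y" "local_rep X C0 D0 A f x"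
    using f x unfolding smooth_on_iff_local_rep[OF X] by blast
  have mem: "x \<in> fst C0" "f x \<in> fst D0" using local_rep_mem[OF 0(3) x] by auto
  have "local_rep X C D0 A (\<lambda>x. f x) x"
    by (rule local_rep_compose[OF X C(1) X 0(1) x _ local_rep_chart_change[OF X C(1) 0(1) C(2) mem(1)], of A])
       (use 0(3) in auto)
  from local_rep_compose[OF X C(1) Y 0(2) x order_refl this local_rep_chart_change[OF Y 0(2) D(1) mem(2) D(2)]]
  show ?thesis .
qed

lemma smooth_onI:
  assumes "premanifold X" "A \<subseteq> pts X"
    "\<And>x. x \<in> A \<Longrightarrow> \<exists>C \<in> mf_atlas X. \<exists>D \<in> mf_atlas Y. local_rep X C D A f x"
  shows "smooth_on A X Y f"
  using assms by (simp add: smooth_on_iff_local_rep)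

lemma smooth_on_compose:
  assumes X: "premanifold X" and Y: "premanifold Y" and f: "smooth_on A X Y f" and g: "smooth_on B Y Z g"
    and "f ` A \<subseteq> B"
  shows "smooth_on A X Z (\<lambda>x. g (f x))"
proof (rule smooth_onI[OF X smooth_on_pts[OF f]])
  fix x assume x: "x \<in> A"
  obtain C D where C: "C \<in> mf_atlas X" "D \<in> mf_atlas Y" "local_rep X C D A f x"
    using f x unfolding smooth_on_iff_local_rep[OF X] by blast
  obtain D1 D2 where D: "D1 \<in> mf_atlas Y" "D2 \<in> mf_atlas Z" "local_rep Y D1 D2 B g (f x)"
    using g x assms(5) unfolding smooth_on_iff_local_rep[OF Y] by blast
  have "f x \<in> fst D1" using local_rep_mem[OF D(3)] x assms(5) by blast
  then have "local_rep X C D1 A f x"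
    using smooth_on_local_rep[OF X Y f x C(1) _ D(1)] local_rep_mem[OF C(3) x] by blast
  from local_rep_compose[OF X C(1) Y D(1) x assms(5) this D(3)] C(1) D(2)
  show "\<exists>C\<in>mf_atlas X. \<exists>D\<in>mf_atlas Z. local_rep X C D A (\<lambda>x. g (f x)) x" by blast
qed

lemma smooth_on_cong:
  assumes "premanifold X" "smooth_on A X Y f" "\<And>x. x \<in> A \<Longrightarrow> f x = g x" shows "smooth_on A X Y g"
  using assms(2) local_rep_cong[of X _ _ A f _ g, OF _ assms(3)]
  unfolding smooth_on_iff_local_rep[OF assms(1)] by meson

lemma smooth_on_subset:
  assumes "premanifold X" "smooth_on A X Y f" "B \<subseteq> A" shows "smooth_on B X Y f"
  using assms(2,3) local_rep_subset[OF _ assms(3)]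
  unfolding smooth_on_iff_local_rep[OF assms(1)] by (meson subset_trans subsetD)

text \<open>The gluing principle for later constructions by local sections and trivializations; only
  relatively open pieces of \<open>A\<close> are inspected.\<close>

lemma smooth_on_local:
  assumes "premanifold X" "\<And>x. x \<in> A \<Longrightarrow> \<exists>W. openin (mf_top X) W \<and> x \<in> W \<and> smooth_on (A \<inter> W) X Y f"
  shows "smooth_on A X Y f"
proof (rule smooth_onI[OF assms(1)])
  show "A \<subseteq> pts X" using assms(2) openin_subset by blast
  fix x assume x: "x \<in> A"
  then obtain W where W: "openin (mf_top X) W" "x \<in> W" "smooth_on (A \<inter> W) X Y f" using assms(2) by blast
  then obtain C D where "C \<in> mf_atlas X" "D \<in> mf_atlas Y" "local_rep X C D (A \<inter> W) f x"
    unfolding smooth_on_iff_local_rep[OF assms(1)] using x by blast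
  then show "\<exists>C\<in>mf_atlas X. \<exists>D\<in>mf_atlas Y. local_rep X C D A f x"
    using local_rep_localize[OF _ W(1,2)] by blast
qed

lemma smooth_on_ident:
  assumes "premanifold X" "A \<subseteq> pts X" shows "smooth_on A X X (\<lambda>x. x)"
  by (rule smooth_onI[OF assms])
     (use assms(2) local_rep_chart_change[OF assms(1)] chart_at[OF assms(1)] in blast)

lemma smooth_on_const:
  assumes X: "premanifold X" and A: "A \<subseteq> pts X" and Y: "premanifold Y" and c: "c \<in> pts Y"
  shows "smooth_on A X Y (\<lambda>x. c)"
proof (rule smooth_onI[OF X A])
  fix x assume "x \<in> A"
  then have C: "mf_chart_at X x \<in> mf_atlas X" "x \<in> fst (mf_chart_at X x)" using chart_at[OF X] A by auto
  have "local_rep X (mf_chart_at X x) (mf_chart_at Y c) A (\<lambda>x. c) x"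
    unfolding local_rep_def using chart_open[OF X C(1)] C(2) chart_at[OF Y c]
    by (intro exI[of _ "fst (mf_chart_at X x)"] exI[of _ UNIV] exI[of _ "\<lambda>_. snd (mf_chart_at Y c) c"])
       (auto intro: Cinf_on_const)
  then show "\<exists>C\<in>mf_atlas X. \<exists>D\<in>mf_atlas Y. local_rep X C D A (\<lambda>x. c) x"
    using C chart_at[OF Y c] by blast
qed

text \<open>Smooth maps are continuous. As \<open>A\<close> may be any subset, preimages are open
  relative to \<open>A\<close>: around each point the extension \<open>F\<close> cuts out an open
  piece, and these pieces are united.\<close>

lemma smooth_on_open_vimage:
  assumes X: "premanifold X" and Y: "premanifold Y" and f: "smooth_on A X Y f" and V: "openin (mf_top Y) V"
  obtains W where "openin (mf_top X) W" "{x \<in> A. f x \<in> V} = A \<inter> W"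
proof -
  have "\<exists>W. openin (mf_top X) W \<and> x \<in> W \<and> A \<inter> W \<subseteq> {x \<in> A. f x \<in> V}" if x: "x \<in> A" "f x \<in> V" for x
  proof -
    define D where "D = mf_chart_at Y (f x)"
    have fx: "f x \<in> pts Y" using smooth_on_image[OF Y f] x by blast
    have D: "D \<in> mf_atlas Y" "f x \<in> fst D" using chart_at[OF Y fx] by (auto simp: D_def)
    have xX: "x \<in> pts X" using smooth_on_pts[OF f] x by blast
    define C where "C = mf_chart_at X x"
    have C: "C \<in> mf_atlas X" "x \<in> fst C" using chart_at[OF X xX] by (auto simp: C_def)
    obtain W U F where W: "openin (mf_top X) W" "x \<in> W" "W \<subseteq> fst C" "f ` (W \<inter> A) \<subseteq> fst D"
      "Cinf_on U F" "snd C ` W \<subseteq> U" "\<And>x'. x' \<in> W \<inter> A \<Longrightarrow> F (snd C x') = snd D (f x')"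
      by (rule local_repE[OF smooth_on_local_rep[OF X Y f x(1) C D]]) metis
    obtain N where N: "open N" "snd D ` (V \<inter> fst D) = mf_model Y \<inter> N"
      using chart_image_openE[OF Y D(1), of "V \<inter> fst D"] chart_open[OF Y D(1)] V by blast
    have op: "open (U \<inter> F -` N)" using Cinf_on_open_vimage[OF W(5) N(1)] .
    define W' where "W' = W \<inter> {y \<in> fst C. snd C y \<in> U \<inter> F -` N}"
    have "openin (mf_top X) W'" unfolding W'_def using chart_vimage_open[OF X C(1) op] W(1) by blast
    moreover have "x \<in> W'"
    proof -
      have "snd D (f x) \<in> N" using N(2) x(2) D(2) by blast
      then show ?thesis unfolding W'_def using W C x by auto
    qed
    moreover have "f y \<in> V" if "y \<in> A \<inter> W'" for y
    proof -
      have y: "y \<in> W \<inter> A" "F (snd C y) \<in> N" using that by (auto simp: W'_def)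
      then have fy: "f y \<in> fst D" "snd D (f y) \<in> N" using W(4,7) by force+
      then have "snd D (f y) \<in> snd D ` (V \<inter> fst D)" using N(2) chart_in_model[OF Y D(1)] by blast
      then have "f y \<in> V \<inter> fst D" using inj_on_image_mem_iff[OF chart_inj[OF Y D(1)] fy(1)] by blast
      then show ?thesis by blast
    qed
    ultimately show ?thesis by blast
  qed
  then obtain w where w: "\<And>x. x \<in> A \<Longrightarrow> f x \<in> V \<Longrightarrow> openin (mf_top X) (w x) \<and> x \<in> w x \<and> A \<inter> w x \<subseteq> {x \<in> A. f x \<in> V}"
    by metis
  show ?thesis
  proof (rule that[of "\<Union>(w ` {x \<in> A. f x \<in> V})"])
    show "openin (mf_top X) (\<Union>(w ` {x \<in> A. f x \<in> V}))" using w by (intro openin_Union) auto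
    show "{x \<in> A. f x \<in> V} = A \<inter> \<Union>(w ` {x \<in> A. f x \<in> V})" using w by auto
  qed
qed

lemma smooth_on_openin_vimage:
  assumes "premanifold X" "premanifold Y" "smooth_on A X Y f" "openin (mf_top X) A" "openin (mf_top Y) V"
  shows "openin (mf_top X) {x \<in> A. f x \<in> V}"
  using smooth_on_open_vimage[OF assms(1,2,3,5)] assms(4) by (metis openin_Int)

section \<open>Products and vector spaces\<close>

lemma prod_manifold_simps [simp]:
  "pts (prod_manifold X Y) = pts X \<times> pts Y"
  "mf_top (prod_manifold X Y) = prod_topology (mf_top X) (mf_top Y)"
  "mf_model (prod_manifold X Y) = mf_model X \<times> mf_model Y"
  "mf_chart_at (prod_manifold X Y) (x, y) = prod_chart (mf_chart_at X x) (mf_chart_at Y y)"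
  by (simp_all add: prod_manifold_def)

lemma prod_chart_simps [simp]:
  "fst (prod_chart C D) = fst C \<times> fst D"
  "snd (prod_chart C D) (x, y) = (snd C x, snd D y)"
  "snd (prod_chart C D) z = (snd C (fst z), snd D (snd z))"
  by (simp_all add: prod_chart_def map_prod_def case_prod_beta')

lemma prod_atlas: "mf_atlas (prod_manifold X Y) = {prod_chart C D |C D. C \<in> mf_atlas X \<and> D \<in> mf_atlas Y}"
  by (simp add: prod_manifold_def)

lemma prod_chart_in_atlas:
  "C \<in> mf_atlas X \<Longrightarrow> D \<in> mf_atlas Y \<Longrightarrow> prod_chart C D \<in> mf_atlas (prod_manifold X Y)"
  unfolding prod_atlas by blast

lemma prod_chart_open_iff:
  assumes X: "premanifold X" and Y: "premanifold Y" and C: "C \<in> mf_atlas X" and D: "D \<in> mf_atlas Y"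
    and W: "W \<subseteq> fst C \<times> fst D"
  shows "openin (prod_topology (mf_top X) (mf_top Y)) W \<longleftrightarrow>
     openin (top_of_set (mf_model X \<times> mf_model Y)) (snd (prod_chart C D) ` W)"
proof -
  have top: "top_of_set (mf_model X \<times> mf_model Y) = prod_topology (top_of_set (mf_model X)) (top_of_set (mf_model Y))"
    by (simp add: subtopology_Times[symmetric])
  show ?thesis
  proof
    assume op: "openin (prod_topology (mf_top X) (mf_top Y)) W"
    show "openin (top_of_set (mf_model X \<times> mf_model Y)) (snd (prod_chart C D) ` W)"
      unfolding top openin_prod_topology_alt
    proof (intro allI impI)
      fix z w assume "(z, w) \<in> snd (prod_chart C D) ` W"
      then obtain x y where xy: "(x, y) \<in> W" "z = snd C x" "w = snd D y" by auto
      obtain U V where UV: "openin (mf_top X) U" "openin (mf_top Y) V" "x \<in> U" "y \<in> V" "U \<times> V \<subseteq> W"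
        using op xy(1) unfolding openin_prod_topology_alt by meson
      have sub: "U \<subseteq> fst C" "V \<subseteq> fst D" using UV W by auto
      have "openin (top_of_set (mf_model X)) (snd C ` U)" "openin (top_of_set (mf_model Y)) (snd D ` V)"
        using chart_open_iff[OF X C sub(1)] chart_open_iff[OF Y D sub(2)] UV by auto
      moreover have "snd C ` U \<times> snd D ` V \<subseteq> snd (prod_chart C D) ` W"
        using UV(5) by (force simp: image_iff)
      ultimately show "\<exists>U V. openin (top_of_set (mf_model X)) U \<and> openin (top_of_set (mf_model Y)) V \<and>
           z \<in> U \<and> w \<in> V \<and> U \<times> V \<subseteq> snd (prod_chart C D) ` W"
        using UV xy by blast
    qed
  next
    assume op: "openin (top_of_set (mf_model X \<times> mf_model Y)) (snd (prod_chart C D) ` W)"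
    show "openin (prod_topology (mf_top X) (mf_top Y)) W"
      unfolding openin_prod_topology_alt
    proof (intro allI impI)
      fix x y assume xy: "(x, y) \<in> W"
      then have "(snd C x, snd D y) \<in> snd (prod_chart C D) ` W" by (force simp: image_iff)
      then obtain U V where UV: "openin (top_of_set (mf_model X)) U" "openin (top_of_set (mf_model Y)) V"
        "snd C x \<in> U" "snd D y \<in> V" "U \<times> V \<subseteq> snd (prod_chart C D) ` W"
        using op unfolding top openin_prod_topology_alt by meson
      obtain U' V' where U': "open U'" "U = mf_model X \<inter> U'" and V': "open V'" "V = mf_model Y \<inter> V'"
        using UV by (metis openin_open)
      let ?U = "{x \<in> fst C. snd C x \<in> U'}" and ?V = "{x \<in> fst D. snd D x \<in> V'}"
      have "?U \<times> ?V \<subseteq> W"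
      proof clarify
        fix a b assume a: "a \<in> fst C" "snd C a \<in> U'" and b: "b \<in> fst D" "snd D b \<in> V'"
        then have "(snd C a, snd D b) \<in> U \<times> V"
          using U' V' chart_in_model[OF X C] chart_in_model[OF Y D] by blast
        then obtain a' b' where "(a', b') \<in> W" "snd C a = snd C a'" "snd D b = snd D b'"
          using UV(5) by fastforce
        then show "(a, b) \<in> W" using W a b chart_inj[OF X C] chart_inj[OF Y D]
          by (metis SigmaE2 inj_onD subsetD)
      qed
      then show "\<exists>U V. openin (mf_top X) U \<and> openin (mf_top Y) V \<and> x \<in> U \<and> y \<in> V \<and> U \<times> V \<subseteq> W"
        using chart_vimage_open[OF X C U'(1)] chart_vimage_open[OF Y D V'(1)] U' V' UV xy W
        by (intro exI[of _ ?U] exI[of _ ?V]) auto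
    qed
  qed
qed

lemma Cinf_on_prod:
  assumes "Cinf_on U F" "Cinf_on V H"
  shows "Cinf_on (U \<times> V) (\<lambda>z. (F (fst z), H (snd z)))"
proof -
  have op: "open (U \<times> V)" by (intro open_Times Cinf_on_open[OF assms(1)] Cinf_on_open[OF assms(2)])
  show ?thesis
    using Cinf_on_Pair[OF Cinf_on_compose[OF Cinf_on_linear[OF op linear_fst] assms(1)]
        Cinf_on_compose[OF Cinf_on_linear[OF op linear_snd] assms(2)]] by auto
qed

lemma premanifold_prod:
  assumes X: "premanifold X" and Y: "premanifold Y"
  shows "premanifold (prod_manifold X Y)"
proof (rule premanifoldI)
  show "subspace (mf_model (prod_manifold X Y))"
    using premanifold_subspace[OF X] premanifold_subspace[OF Y] by (simp add: subspace_Times)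
next
  fix E assume "E \<in> mf_atlas (prod_manifold X Y)"
  then obtain C D where E: "E = prod_chart C D" and C: "C \<in> mf_atlas X" and D: "D \<in> mf_atlas Y"
    by (auto simp: prod_atlas)
  have "openin (prod_topology (mf_top X) (mf_top Y)) (fst C \<times> fst D)"
    using chart_open[OF X C] chart_open[OF Y D] by (simp add: openin_prod_Times_iff)
  then show "openin (mf_top (prod_manifold X Y)) (fst E) \<and>
      openin (top_of_set (mf_model (prod_manifold X Y))) (snd E ` fst E) \<and>
      inj_on (snd E) (fst E) \<and>
      (\<forall>W. W \<subseteq> fst E \<longrightarrow> openin (mf_top (prod_manifold X Y)) W =
         openin (top_of_set (mf_model (prod_manifold X Y))) (snd E ` W))"
    using prod_chart_open_iff[OF X Y C D] chart_inj[OF X C] chart_inj[OF Y D]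
    unfolding E by (auto simp: inj_on_def)
next
  fix E E' assume "E \<in> mf_atlas (prod_manifold X Y)" "E' \<in> mf_atlas (prod_manifold X Y)"
  then obtain C D C' D' where E: "E = prod_chart C D" "E' = prod_chart C' D'"
    and C: "C \<in> mf_atlas X" "C' \<in> mf_atlas X" and D: "D \<in> mf_atlas Y" "D' \<in> mf_atlas Y"
    by (auto simp: prod_atlas)
  have inv: "chart_inv E (snd C x, snd D y) = (x, y)" if "x \<in> fst C" "y \<in> fst D" for x y
  proof -
    have "inj_on (snd E) (fst E)"
      using chart_inj[OF X C(1)] chart_inj[OF Y D(1)] unfolding E by (auto simp: inj_on_def)
    from inv_into_f_f[OF this, of "(x, y)"] show ?thesis using that by (simp add: E)
  qed
  show "smooth_fun_on (snd E ` (fst E \<inter> fst E')) (snd E' \<circ> chart_inv E)"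
    unfolding smooth_fun_on_def
  proof
    fix p assume "p \<in> snd E ` (fst E \<inter> fst E')"
    then obtain x y where x: "x \<in> fst C \<inter> fst C'" and y: "y \<in> fst D \<inter> fst D'" and p: "p = (snd C x, snd D y)"
      by (auto simp: E)
    obtain U F where U: "open U" "snd C x \<in> U" "\<forall>k. Ck_on k U F"
      "\<And>y. y \<in> snd C ` (fst C \<inter> fst C') \<inter> U \<Longrightarrow> F y = (snd C' \<circ> chart_inv C) y"
      using chart_smooth[OF X C] x unfolding smooth_fun_on_def by (metis imageI)
    obtain V H where V: "open V" "snd D y \<in> V" "\<forall>k. Ck_on k V H"
      "\<And>y. y \<in> snd D ` (fst D \<inter> fst D') \<inter> V \<Longrightarrow> H y = (snd D' \<circ> chart_inv D) y"
      using chart_smooth[OF Y D] y unfolding smooth_fun_on_def by (metis imageI)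
    have "Cinf_on (U \<times> V) (\<lambda>z. (F (fst z), H (snd z)))"
      by (rule Cinf_on_prod) (use U V in \<open>auto simp: Cinf_on_def\<close>)
    moreover have "(F (fst q), H (snd q)) = (snd E' \<circ> chart_inv E) q"
      if "q \<in> snd E ` (fst E \<inter> fst E') \<inter> U \<times> V" for q
    proof -
      have "q \<in> snd E ` (fst E \<inter> fst E')" using that by blast
      then obtain a b where a: "a \<in> fst C \<inter> fst C'" and b: "b \<in> fst D \<inter> fst D'" and q: "q = (snd C a, snd D b)"
        by (auto simp: E)
      have "snd C a \<in> U" "snd D b \<in> V" using that q by auto
      then show ?thesis
        using U(4)[of "snd C a"] V(4)[of "snd D b"] a b inv[of a b] chart_inv_chart[OF X C(1), of a]
          chart_inv_chart[OF Y D(1), of b]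
        by (auto simp: q E)
    qed
    ultimately show "\<exists>U F. open U \<and> p \<in> U \<and> (\<forall>k. Ck_on k U F) \<and>
         (\<forall>y\<in>snd E ` (fst E \<inter> fst E') \<inter> U. F y = (snd E' \<circ> chart_inv E) y)"
      unfolding Cinf_on_def using U V p by (intro exI[of _ "U \<times> V"] exI) auto
  qed
next
  fix p assume "p \<in> pts (prod_manifold X Y)"
  then show "mf_chart_at (prod_manifold X Y) p \<in> mf_atlas (prod_manifold X Y) \<and>
       p \<in> fst (mf_chart_at (prod_manifold X Y) p)"
    using chart_at[OF X] chart_at[OF Y] by (cases p) (auto intro: prod_chart_in_atlas)
qed

lemma second_countable_prod_topology:
  assumes "second_countable S" "second_countable T"
  shows "second_countable (prod_topology S T)"
proof -
  obtain A where A: "countable A" "\<And>V. V \<in> A \<Longrightarrow> openin S V" "\<And>U x. openin S U \<and> x \<in> U \<Longrightarrow> (\<exists>V \<in> A. x \<in> V \<and> V \<subseteq> U)"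
    using assms(1) unfolding second_countable_def by metis
  obtain B where B: "countable B" "\<And>V. V \<in> B \<Longrightarrow> openin T V" "\<And>U x. openin T U \<and> x \<in> U \<Longrightarrow> (\<exists>V \<in> B. x \<in> V \<and> V \<subseteq> U)"
    using assms(2) unfolding second_countable_def by metis
  show ?thesis
    unfolding second_countable_def
  proof (intro exI[of _ "(\<lambda>(U, V). U \<times> V) ` (A \<times> B)"] conjI allI impI)
    show "countable ((\<lambda>(U, V). U \<times> V) ` (A \<times> B))" using A B by blast
    show "\<forall>V\<in>(\<lambda>(U, V). U \<times> V) ` (A \<times> B). openin (prod_topology S T) V"
      using A B by (auto simp: openin_prod_Times_iff)
    fix U p assume p: "openin (prod_topology S T) U \<and> p \<in> U"
    then obtain U1 U2 where 1: "openin S U1" "openin T U2" "fst p \<in> U1" "snd p \<in> U2" "U1 \<times> U2 \<subseteq> U"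
      unfolding openin_prod_topology_alt by (metis prod.collapse)
    obtain V1 V2 where "V1 \<in> A" "fst p \<in> V1" "V1 \<subseteq> U1" "V2 \<in> B" "snd p \<in> V2" "V2 \<subseteq> U2"
      using A(3)[of U1 "fst p"] B(3)[of U2 "snd p"] 1 by blast
    then show "\<exists>V\<in>(\<lambda>(U, V). U \<times> V) ` (A \<times> B). p \<in> V \<and> V \<subseteq> U"
      using 1(5) by (intro bexI[of _ "V1 \<times> V2"]) (auto simp: mem_Times_iff)
  qed
qed

lemma smooth_manifold_prod:
  "smooth_manifold X \<Longrightarrow> smooth_manifold Y \<Longrightarrow> smooth_manifold (prod_manifold X Y)"
  by (simp add: smooth_manifold_iff premanifold_prod Hausdorff_space_prod_topology second_countable_prod_topology)

lemma smooth_on_Pair: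
  assumes Z: "premanifold Z" and X: "premanifold X" and Y: "premanifold Y"
    and f: "smooth_on A Z X f" and g: "smooth_on A Z Y g"
  shows "smooth_on A Z (prod_manifold X Y) (\<lambda>z. (f z, g z))"
proof (rule smooth_onI[OF Z smooth_on_pts[OF f]])
  fix z assume z: "z \<in> A"
  define B C D where "B = mf_chart_at Z z" and "C = mf_chart_at X (f z)" and "D = mf_chart_at Y (g z)"
  have zZ: "z \<in> pts Z" "f z \<in> pts X" "g z \<in> pts Y"
    using z smooth_on_pts[OF f] smooth_on_image[OF X f] smooth_on_image[OF Y g] by auto
  have B: "B \<in> mf_atlas Z" "z \<in> fst B" and C: "C \<in> mf_atlas X" "f z \<in> fst C" and D: "D \<in> mf_atlas Y" "g z \<in> fst D"
    using chart_at[OF Z zZ(1)] chart_at[OF X zZ(2)] chart_at[OF Y zZ(3)] by (auto simp: B_def C_def D_def)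
  obtain W U F where W: "openin (mf_top Z) W" "z \<in> W" "W \<subseteq> fst B" "f ` (W \<inter> A) \<subseteq> fst C"
      "Cinf_on U F" "snd B ` W \<subseteq> U" "\<And>x'. x' \<in> W \<inter> A \<Longrightarrow> F (snd B x') = snd C (f x')"
      by (rule local_repE[OF smooth_on_local_rep[OF Z X f z B C]]) metis
  obtain W' U' F' where W': "openin (mf_top Z) W'" "z \<in> W'" "W' \<subseteq> fst B" "g ` (W' \<inter> A) \<subseteq> fst D"
      "Cinf_on U' F'" "snd B ` W' \<subseteq> U'" "\<And>x'. x' \<in> W' \<inter> A \<Longrightarrow> F' (snd B x') = snd D (g x')"
      by (rule local_repE[OF smooth_on_local_rep[OF Z Y g z B D]]) metis
  have op: "open (U \<inter> U')" by (intro open_Int Cinf_on_open[OF W(5)] Cinf_on_open[OF W'(5)])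
  have "Cinf_on (U \<inter> U') (\<lambda>z. (F z, F' z))"
    using Cinf_on_Pair[OF Cinf_on_subset[OF W(5) op] Cinf_on_subset[OF W'(5) op]] by auto
  then have "local_rep Z B (prod_chart C D) A (\<lambda>z. (f z, g z)) z"
    unfolding local_rep_def using W W'
    by (intro exI[of _ "W \<inter> W'"] exI[of _ "U \<inter> U'"] exI[of _ "\<lambda>z. (F z, F' z)"]) auto
  then show "\<exists>C\<in>mf_atlas Z. \<exists>D\<in>mf_atlas (prod_manifold X Y). local_rep Z C D A (\<lambda>z. (f z, g z)) z"
    using B C D prod_chart_in_atlas by blast
qed

lemma smooth_on_fst:
  assumes X: "premanifold X" and Y: "premanifold Y" and A: "A \<subseteq> pts X \<times> pts Y"
  shows "smooth_on A (prod_manifold X Y) X fst"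
proof (rule smooth_onI[OF premanifold_prod[OF X Y]])
  fix z assume "z \<in> A"
  then have z: "fst z \<in> pts X" "snd z \<in> pts Y" using A by auto
  let ?C = "mf_chart_at X (fst z)" and ?D = "mf_chart_at Y (snd z)"
  have "local_rep (prod_manifold X Y) (prod_chart ?C ?D) ?C A fst z"
    unfolding local_rep_def using chart_at[OF X z(1)] chart_at[OF Y z(2)] chart_open[OF X] chart_open[OF Y]
    by (intro exI[of _ "fst ?C \<times> fst ?D"] exI[of _ UNIV] exI[of _ fst])
       (auto simp: openin_prod_Times_iff mem_Times_iff intro: Cinf_on_linear linear_fst)
  then show "\<exists>C\<in>mf_atlas (prod_manifold X Y). \<exists>D\<in>mf_atlas X. local_rep (prod_manifold X Y) C D A fst z"
    using chart_at[OF X z(1)] chart_at[OF Y z(2)] prod_chart_in_atlas by blast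
qed (use A in auto)

lemma smooth_on_snd:
  assumes X: "premanifold X" and Y: "premanifold Y" and A: "A \<subseteq> pts X \<times> pts Y"
  shows "smooth_on A (prod_manifold X Y) Y snd"
proof (rule smooth_onI[OF premanifold_prod[OF X Y]])
  fix z assume "z \<in> A"
  then have z: "fst z \<in> pts X" "snd z \<in> pts Y" using A by auto
  let ?C = "mf_chart_at X (fst z)" and ?D = "mf_chart_at Y (snd z)"
  have "local_rep (prod_manifold X Y) (prod_chart ?C ?D) ?D A snd z"
    unfolding local_rep_def using chart_at[OF X z(1)] chart_at[OF Y z(2)] chart_open[OF X] chart_open[OF Y]
    by (intro exI[of _ "fst ?C \<times> fst ?D"] exI[of _ UNIV] exI[of _ snd])
       (auto simp: openin_prod_Times_iff mem_Times_iff intro: Cinf_on_linear linear_snd)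
  then show "\<exists>C\<in>mf_atlas (prod_manifold X Y). \<exists>D\<in>mf_atlas Y. local_rep (prod_manifold X Y) C D A snd z"
    using chart_at[OF X z(1)] chart_at[OF Y z(2)] prod_chart_in_atlas by blast
qed (use A in auto)

section \<open>Vector spaces as manifolds, and charts as smooth maps\<close>

lemma vec_manifold_simps [simp]:
  "pts (vec_manifold V) = V" "mf_top (vec_manifold V) = top_of_set V" "mf_model (vec_manifold V) = V"
  "mf_atlas (vec_manifold V) = {(V, id)}" "mf_chart_at (vec_manifold V) x = (V, id)"
  by (simp_all add: vec_manifold_def)

lemma premanifold_vec:
  assumes "subspace V" shows "premanifold (vec_manifold V)"
proof (rule premanifoldI)
  fix C D assume "C \<in> mf_atlas (vec_manifold V)" "D \<in> mf_atlas (vec_manifold V)"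
  then have CD: "C = (V, id)" "D = (V, id)" by auto
  have "inv_into V id y = y" if "y \<in> V" for y
    using inv_into_f_f[of id V y] that by simp
  then show "smooth_fun_on (snd C ` (fst C \<inter> fst D)) (snd D \<circ> chart_inv C)"
    unfolding smooth_fun_on_def CD using Cinf_on_linear[OF open_UNIV linear_id]
    by (intro ballI exI[of _ UNIV] exI[of _ id]) (auto simp: Cinf_on_def)
qed (use assms in auto)

lemma smooth_on_vecI:
  assumes "subspace V" "subspace V'" "Cinf_on U F" "A \<subseteq> V \<inter> U" "F ` A \<subseteq> V'"
  shows "smooth_on A (vec_manifold V) (vec_manifold V') F"
proof (rule smooth_onI[OF premanifold_vec[OF assms(1)]])
  fix x assume x: "x \<in> A"
  have "local_rep (vec_manifold V) (V, id) (V', id) A F x"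
    unfolding local_rep_def using assms x Cinf_on_open[OF assms(3)]
    by (intro exI[of _ "V \<inter> U"] exI[of _ U] exI[of _ F]) (auto simp: openin_open)
  then show "\<exists>C\<in>mf_atlas (vec_manifold V). \<exists>D\<in>mf_atlas (vec_manifold V'). local_rep (vec_manifold V) C D A F x"
    by auto
qed (use assms in auto)

lemma smooth_on_linear:
  assumes "subspace V" "subspace V'" "linear L" "A \<subseteq> V" "L ` A \<subseteq> V'"
  shows "smooth_on A (vec_manifold V) (vec_manifold V') L"
  using smooth_on_vecI[OF assms(1,2) Cinf_on_linear[OF open_UNIV assms(3)]] assms(4,5) by auto

lemma smooth_on_chart:
  assumes X: "premanifold X" and C: "C \<in> mf_atlas X"
  shows "smooth_on (fst C) X (vec_manifold (mf_model X)) (snd C)"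
proof (rule smooth_onI[OF X chart_subset[OF X C]])
  fix x assume x: "x \<in> fst C"
  have "local_rep X C (mf_model X, id) (fst C) (snd C) x"
    unfolding local_rep_def using chart_open[OF X C] x chart_in_model[OF X C]
    by (intro exI[of _ "fst C"] exI[of _ UNIV] exI[of _ id]) (auto intro: Cinf_on_linear linear_id)
  then show "\<exists>C'\<in>mf_atlas X. \<exists>D\<in>mf_atlas (vec_manifold (mf_model X)). local_rep X C' D (fst C) (snd C) x"
    using C by auto
qed

lemma smooth_on_chart_inv:
  assumes X: "premanifold X" and C: "C \<in> mf_atlas X"
  shows "smooth_on (snd C ` fst C) (vec_manifold (mf_model X)) X (chart_inv C)"
proof (rule smooth_onI[OF premanifold_vec[OF premanifold_subspace[OF X]]])
  show "snd C ` fst C \<subseteq> pts (vec_manifold (mf_model X))" using chart_in_model[OF X C] by auto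
  fix z assume z: "z \<in> snd C ` fst C"
  have "local_rep (vec_manifold (mf_model X)) (mf_model X, id) C (snd C ` fst C) (chart_inv C) z"
    unfolding local_rep_def using chart_image_open[OF X C] z chart_in_model[OF X C] chart_inv_chart[OF X C]
    by (intro exI[of _ "snd C ` fst C"] exI[of _ UNIV] exI[of _ id]) (auto intro: Cinf_on_linear linear_id)
  then show "\<exists>C'\<in>mf_atlas (vec_manifold (mf_model X)). \<exists>D\<in>mf_atlas X.
       local_rep (vec_manifold (mf_model X)) C' D (snd C ` fst C) (chart_inv C) z"
    using C by auto
qed

section \<open>Differentials\<close>

text \<open>A differential needs values on a whole neighbourhood, which \<open>smooth_on\<close> for
  an arbitrary subset does not provide.\<close>

definition smooth_at ::
  "('a, 'c::euclidean_space) manifold \<Rightarrow> ('b, 'd::euclidean_space) manifold \<Rightarrow> ('a \<Rightarrow> 'b) \<Rightarrow> 'a \<Rightarrow> bool" where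
  "smooth_at X Y f x \<longleftrightarrow> (\<exists>U. openin (mf_top X) U \<and> x \<in> U \<and> smooth_on U X Y f)"

lemma smooth_atI: "smooth_on U X Y f \<Longrightarrow> openin (mf_top X) U \<Longrightarrow> x \<in> U \<Longrightarrow> smooth_at X Y f x"
  unfolding smooth_at_def by blast

lemma smooth_at_pts: "smooth_at X Y f x \<Longrightarrow> x \<in> pts X"
  unfolding smooth_at_def smooth_on_def by blast

lemma smooth_at_image: "premanifold Y \<Longrightarrow> smooth_at X Y f x \<Longrightarrow> f x \<in> pts Y"
  unfolding smooth_at_def using smooth_on_image by blast

lemma smooth_at_compose:
  assumes X: "premanifold X" and Y: "premanifold Y" and f: "smooth_at X Y f x" and g: "smooth_at Y Z g (f x)"
  shows "smooth_at X Z (\<lambda>x. g (f x)) x"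
proof -
  obtain U where U: "openin (mf_top X) U" "x \<in> U" "smooth_on U X Y f" using f unfolding smooth_at_def by blast
  obtain V where V: "openin (mf_top Y) V" "f x \<in> V" "smooth_on V Y Z g" using g unfolding smooth_at_def by blast
  let ?W = "{x \<in> U. f x \<in> V}"
  have "smooth_on ?W X Z (\<lambda>x. g (f x))"
    by (rule smooth_on_compose[OF X Y smooth_on_subset[OF X U(3)] V(3)]) auto
  then show ?thesis
    using smooth_on_openin_vimage[OF X Y U(3,1) V(1)] U V by (intro smooth_atI[of ?W]) auto
qed

lemma smooth_at_Pair:
  assumes Z: "premanifold Z" and X: "premanifold X" and Y: "premanifold Y"
    and f: "smooth_at Z X f z" and g: "smooth_at Z Y g z"
  shows "smooth_at Z (prod_manifold X Y) (\<lambda>z. (f z, g z)) z"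
proof -
  obtain U where U: "openin (mf_top Z) U" "z \<in> U" "smooth_on U Z X f" using f unfolding smooth_at_def by blast
  obtain V where V: "openin (mf_top Z) V" "z \<in> V" "smooth_on V Z Y g" using g unfolding smooth_at_def by blast
  have "smooth_on (U \<inter> V) Z (prod_manifold X Y) (\<lambda>z. (f z, g z))"
    by (intro smooth_on_Pair Z X Y smooth_on_subset[OF Z U(3)] smooth_on_subset[OF Z V(3)]) auto
  then show ?thesis by (rule smooth_atI) (use U V in auto)
qed

lemma smooth_at_ident: "premanifold X \<Longrightarrow> x \<in> pts X \<Longrightarrow> smooth_at X X (\<lambda>x. x) x"
  by (rule smooth_atI[OF smooth_on_ident]) auto

lemma smooth_at_const: "premanifold X \<Longrightarrow> premanifold Y \<Longrightarrow> x \<in> pts X \<Longrightarrow> c \<in> pts Y \<Longrightarrow> smooth_at X Y (\<lambda>x. c) x"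
  by (rule smooth_atI[OF smooth_on_const]) auto

lemma smooth_at_fst:
  assumes "premanifold X" "premanifold Y" "z \<in> pts X \<times> pts Y"
  shows "smooth_at (prod_manifold X Y) X fst z"
  by (rule smooth_atI[OF smooth_on_fst[OF assms(1,2) order_refl]]) (use assms(3) openin_topspace[of "mf_top (prod_manifold X Y)"] in auto)

lemma smooth_at_snd:
  assumes "premanifold X" "premanifold Y" "z \<in> pts X \<times> pts Y"
  shows "smooth_at (prod_manifold X Y) Y snd z"
  by (rule smooth_atI[OF smooth_on_snd[OF assms(1,2) order_refl]]) (use assms(3) openin_topspace[of "mf_top (prod_manifold X Y)"] in auto)

lemma smooth_on_open_repE:
  assumes X: "premanifold X" and Y: "premanifold Y" and f: "smooth_on A X Y f" and x: "x \<in> A" and A: "openin (mf_top X) A"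
    and C: "C \<in> mf_atlas X" "x \<in> fst C" and D: "D \<in> mf_atlas Y" "f x \<in> fst D"
  obtains W U F where "openin (mf_top X) W" "x \<in> W" "W \<subseteq> A" "W \<subseteq> fst C" "f ` W \<subseteq> fst D"
    "Cinf_on U F" "snd C ` W \<subseteq> U" "\<And>y. y \<in> W \<Longrightarrow> F (snd C y) = snd D (f y)"
proof -
  obtain W U F where W: "openin (mf_top X) W" "x \<in> W" "W \<subseteq> fst C" "f ` (W \<inter> A) \<subseteq> fst D"
    "Cinf_on U F" "snd C ` W \<subseteq> U" "\<And>x'. x' \<in> W \<inter> A \<Longrightarrow> F (snd C x') = snd D (f x')"
    by (rule local_repE[OF smooth_on_local_rep[OF X Y f x C D]]) metis
  show ?thesis by (rule that[of "W \<inter> A" U F]) (use W A x in auto)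
qed

lemma smooth_at_repE:
  assumes X: "premanifold X" and Y: "premanifold Y" and f: "smooth_at X Y f x"
    and C: "C \<in> mf_atlas X" "x \<in> fst C" and D: "D \<in> mf_atlas Y" "f x \<in> fst D"
  obtains W U F where "openin (mf_top X) W" "x \<in> W" "W \<subseteq> fst C" "f ` W \<subseteq> fst D"
    "Cinf_on U F" "snd C ` W \<subseteq> U" "\<And>y. y \<in> W \<Longrightarrow> F (snd C y) = snd D (f y)"
proof -
  obtain A where A: "openin (mf_top X) A" "x \<in> A" "smooth_on A X Y f" using f unfolding smooth_at_def by blast
  show ?thesis by (rule smooth_on_open_repE[OF X Y A(3,2,1) C D]) (metis that)
qed

text \<open>\<open>dmap\<close> differentiates along a coordinate line. In a direction of the model
  space the line stays in the relatively open chart image for small \<open>t\<close>, so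
  \<open>chart_inv\<close> is a genuine inverse along it.\<close>

lemma chart_lineE:
  assumes X: "premanifold X" and C: "C \<in> mf_atlas X" and W: "openin (mf_top X) W" "x \<in> W" "W \<subseteq> fst C"
    and v: "v \<in> mf_model X"
  obtains S :: "real set" where "open S" "0 \<in> S"
    "\<And>t. t \<in> S \<Longrightarrow> chart_inv C (snd C x + t *\<^sub>R v) \<in> W \<and> snd C (chart_inv C (snd C x + t *\<^sub>R v)) = snd C x + t *\<^sub>R v"
proof -
  obtain N where N: "open N" "snd C ` W = mf_model X \<inter> N" using chart_image_openE[OF X C W(1,3)] by blast
  have "continuous_on UNIV (\<lambda>t::real. snd C x + t *\<^sub>R v)" by (intro continuous_intros)
  from open_vimage[OF N(1) this] have "open ((\<lambda>t::real. snd C x + t *\<^sub>R v) -` N)" .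
  moreover have "0 \<in> (\<lambda>t::real. snd C x + t *\<^sub>R v) -` N" using N(2) W by auto
  moreover have "chart_inv C (snd C x + t *\<^sub>R v) \<in> W \<and> snd C (chart_inv C (snd C x + t *\<^sub>R v)) = snd C x + t *\<^sub>R v"
    if "t \<in> (\<lambda>t::real. snd C x + t *\<^sub>R v) -` N" for t
  proof -
    have "snd C x \<in> mf_model X" using chart_in_model[OF X C] W by blast
    then have "snd C x + t *\<^sub>R v \<in> mf_model X"
      using premanifold_subspace[OF X] v by (simp add: subspace_add subspace_mul)
    then have "snd C x + t *\<^sub>R v \<in> snd C ` W" unfolding N(2) using that by simp
    then obtain y where "y \<in> W" "snd C x + t *\<^sub>R v = snd C y" by (metis imageE)
    then show ?thesis using chart_inv_chart[OF X C] W(3) by auto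
  qed
  ultimately show ?thesis by (rule that)
qed

lemma dmap_cong:
  assumes X: "premanifold X" and W: "openin (mf_top X) W" "x \<in> W" "\<And>y. y \<in> W \<Longrightarrow> f y = g y"
    and v: "v \<in> mf_model X"
  shows "dmap X Y f x v = dmap X Y g x v"
proof -
  have x: "x \<in> pts X" using W openin_subset by blast
  let ?C = "mf_chart_at X x"
  note C = chart_at[OF X x]
  have W': "openin (mf_top X) (W \<inter> fst ?C)" "x \<in> W \<inter> fst ?C" "W \<inter> fst ?C \<subseteq> fst ?C"
    using W C chart_open[OF X C(1)] by auto
  obtain S :: "real set" where S: "open S" "0 \<in> S" "\<And>t. t \<in> S \<Longrightarrow> chart_inv ?C (snd ?C x + t *\<^sub>R v) \<in> W \<inter> fst ?C"
    using chart_lineE[OF X C(1) W' v] by metis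
  have "f x = g x" using W by blast
  then show ?thesis unfolding dmap_def
    by (intro vector_derivative_cong_eq)
       (use W(3) eventually_nhds S in \<open>auto intro!: eventually_mono[OF eventually_nhds_in_open[OF S(1,2)]]\<close>)
qed

text \<open>The extension \<open>F\<close> is not unique off the model space, but in directions of
  the model space its derivative is determined, because the coordinate lines of \<open>dmap\<close>
  stay inside the chart.\<close>

lemma dmap_rep:
  assumes X: "premanifold X" and C: "C = mf_chart_at X x" and W: "openin (mf_top X) W" "x \<in> W" "W \<subseteq> fst C"
    and F: "Cinf_on U F" "snd C x \<in> U" "\<And>y. y \<in> W \<Longrightarrow> F (snd C y) = snd (mf_chart_at Y (f x)) (f y)"
    and v: "v \<in> mf_model X"
  shows "dmap X Y f x v = frechet_derivative F (at (snd C x)) v"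
    and "((\<lambda>t. snd (mf_chart_at Y (f x)) (f (chart_inv C (snd C x + t *\<^sub>R v))))
           has_vector_derivative frechet_derivative F (at (snd C x)) v) (at 0)"
proof -
  have x: "x \<in> pts X" using W openin_subset by blast
  have C': "C \<in> mf_atlas X" using chart_at[OF X x] C by simp
  obtain S :: "real set" where S: "open S" "0 \<in> S" "\<And>t. t \<in> S \<Longrightarrow> chart_inv C (snd C x + t *\<^sub>R v) \<in> W"
    "\<And>t. t \<in> S \<Longrightarrow> snd C (chart_inv C (snd C x + t *\<^sub>R v)) = snd C x + t *\<^sub>R v"
    using chart_lineE[OF X C' W v] by metis
  have l: "((\<lambda>t::real. snd C x + t *\<^sub>R v) has_vector_derivative v) (at 0)"
    by (auto intro!: derivative_eq_intros simp: has_vector_derivative_def)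
  have "((\<lambda>t. F (snd C x + t *\<^sub>R v)) has_derivative (\<lambda>t. frechet_derivative F (at (snd C x)) (t *\<^sub>R v))) (at 0)"
    by (rule has_derivative_compose[OF l[unfolded has_vector_derivative_def]])
       (use Cinf_on_has_derivative[OF F(1,2)] in simp)
  then have "((\<lambda>t. F (snd C x + t *\<^sub>R v)) has_vector_derivative frechet_derivative F (at (snd C x)) v) (at 0)"
    unfolding has_vector_derivative_def using linear_scale[OF Cinf_on_linear_derivative[OF F(1,2)]] by simp
  then show "((\<lambda>t. snd (mf_chart_at Y (f x)) (f (chart_inv C (snd C x + t *\<^sub>R v))))
           has_vector_derivative frechet_derivative F (at (snd C x)) v) (at 0)"
    by (rule has_vector_derivative_transform_within_open[OF _ S(1,2)]) (use F(3) S in metis)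
  then show "dmap X Y f x v = frechet_derivative F (at (snd C x)) v"
    unfolding dmap_def C[symmetric] by (rule vector_derivative_at)
qed

lemma subspace_projection:
  fixes V :: "'c::euclidean_space set"
  assumes "subspace V" obtains P where "linear P" "range P \<subseteq> V" "\<And>x. x \<in> V \<Longrightarrow> P x = x"
proof -
  have "\<exists>g. g ` UNIV \<subseteq> V \<and> linear g \<and> (\<forall>v\<in>V. g (id v) = v)"
    by (rule linear_exists_left_inverse_on[OF linear_id assms]) auto
  then show ?thesis using that by auto
qed

text \<open>The definition makes \<open>dmap\<close> meaningful on the model space only. The
  derivative of a local extension is linear everywhere and agrees with \<open>dmap\<close> there, so
  that facts about linear maps become applicable through \<open>L\<close>.\<close>

lemma dmap_linear:
  assumes X: "premanifold X" and Y: "premanifold Y" and f: "smooth_at X Y f x"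
  obtains L where "linear L" "\<And>v. v \<in> mf_model X \<Longrightarrow> dmap X Y f x v = L v"
    "\<And>v. v \<in> mf_model X \<Longrightarrow> L v \<in> mf_model Y"
proof -
  have x: "x \<in> pts X" "f x \<in> pts Y" using smooth_at_pts[OF f] smooth_at_image[OF Y f] .
  let ?C = "mf_chart_at X x" and ?D = "mf_chart_at Y (f x)"
  note C = chart_at[OF X x(1)] and D = chart_at[OF Y x(2)]
  obtain W U F where W: "openin (mf_top X) W" "x \<in> W" "W \<subseteq> fst ?C" "f ` W \<subseteq> fst ?D"
    "Cinf_on U F" "snd ?C ` W \<subseteq> U" "\<And>y. y \<in> W \<Longrightarrow> F (snd ?C y) = snd ?D (f y)"
    by (rule smooth_at_repE[OF X Y f C D]) blast
  have xU: "snd ?C x \<in> U" using W by blast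
  have d: "dmap X Y f x v = frechet_derivative F (at (snd ?C x)) v" if "v \<in> mf_model X" for v
    by (rule dmap_rep(1)[OF X refl W(1-3) W(5) xU W(7) that])
  have "frechet_derivative F (at (snd ?C x)) v \<in> mf_model Y" if v: "v \<in> mf_model X" for v
  proof -
    \<comment> \<open>The curve runs in the model space of \<open>Y\<close>, so the projection
      \<open>P\<close> fixes it, and hence its velocity.\<close>
    obtain P where P: "linear P" "range P \<subseteq> mf_model Y" "\<And>x. x \<in> mf_model Y \<Longrightarrow> P x = x"
      using subspace_projection[OF premanifold_subspace[OF Y]] by blast
    note der = dmap_rep(2)[OF X refl W(1-3) W(5) xU W(7) v]
    obtain S :: "real set" where S: "open S" "0 \<in> S" "\<And>t. t \<in> S \<Longrightarrow> chart_inv ?C (snd ?C x + t *\<^sub>R v) \<in> W"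
      using chart_lineE[OF X C(1) W(1-3) v] by metis
    have "((\<lambda>t. P (snd ?D (f (chart_inv ?C (snd ?C x + t *\<^sub>R v)))))
           has_vector_derivative P (frechet_derivative F (at (snd ?C x)) v)) (at 0)"
      using bounded_linear.has_vector_derivative[OF _ der] P(1) linear_conv_bounded_linear by blast
    moreover have "P (snd ?D (f (chart_inv ?C (snd ?C x + t *\<^sub>R v)))) = snd ?D (f (chart_inv ?C (snd ?C x + t *\<^sub>R v)))"
      if "t \<in> S" for t
      using S(3)[OF that] W(4) chart_in_model[OF Y D(1)] P(3) by blast
    ultimately have "((\<lambda>t. snd ?D (f (chart_inv ?C (snd ?C x + t *\<^sub>R v))))
           has_vector_derivative P (frechet_derivative F (at (snd ?C x)) v)) (at 0)"
      by (rule has_vector_derivative_transform_within_open[OF _ S(1,2)])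
    then have "P (frechet_derivative F (at (snd ?C x)) v) = frechet_derivative F (at (snd ?C x)) v"
      using der vector_derivative_unique_at by blast
    then show ?thesis using P(2) by (metis rangeI subsetD)
  qed
  then show ?thesis using that[of "frechet_derivative F (at (snd ?C x))"] d Cinf_on_linear_derivative[OF W(5) xU]
    by blast
qed

lemma dmap_in_model:
  "premanifold X \<Longrightarrow> premanifold Y \<Longrightarrow> smooth_at X Y f x \<Longrightarrow> v \<in> mf_model X \<Longrightarrow> dmap X Y f x v \<in> mf_model Y"
  by (metis dmap_linear)

lemma dmap_zero:
  assumes "premanifold X" "premanifold Y" "smooth_at X Y f x" shows "dmap X Y f x 0 = 0"
  using dmap_linear[OF assms] premanifold_subspace[OF assms(1)] linear_0 subspace_0 by metis

lemma dmap_add: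
  assumes "premanifold X" "premanifold Y" "smooth_at X Y f x" "v \<in> mf_model X" "w \<in> mf_model X"
  shows "dmap X Y f x (v + w) = dmap X Y f x v + dmap X Y f x w"
proof -
  obtain L where L: "linear L" "\<And>v. v \<in> mf_model X \<Longrightarrow> dmap X Y f x v = L v"
    using dmap_linear[OF assms(1-3)] by metis
  show ?thesis using L assms(4,5) premanifold_subspace[OF assms(1)] by (simp add: linear_add subspace_add)
qed

lemma dmap_compose:
  assumes X: "premanifold X" and Y: "premanifold Y" and Z: "premanifold Z"
    and f: "smooth_at X Y f x" and g: "smooth_at Y Z g (f x)" and v: "v \<in> mf_model X"
  shows "dmap X Z (\<lambda>x. g (f x)) x v = dmap Y Z g (f x) (dmap X Y f x v)"
proof -
  have x: "x \<in> pts X" "f x \<in> pts Y" "g (f x) \<in> pts Z"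
    using smooth_at_pts[OF f] smooth_at_image[OF Y f] smooth_at_image[OF Z g] .
  let ?C = "mf_chart_at X x" and ?D = "mf_chart_at Y (f x)" and ?B = "mf_chart_at Z (g (f x))"
  note C = chart_at[OF X x(1)] and D = chart_at[OF Y x(2)] and B = chart_at[OF Z x(3)]
  obtain W U F where W: "openin (mf_top X) W" "x \<in> W" "W \<subseteq> fst ?C" "f ` W \<subseteq> fst ?D"
    "Cinf_on U F" "snd ?C ` W \<subseteq> U" "\<And>y. y \<in> W \<Longrightarrow> F (snd ?C y) = snd ?D (f y)"
    by (rule smooth_at_repE[OF X Y f C D]) blast
  obtain W' U' F' where W': "openin (mf_top Y) W'" "f x \<in> W'" "W' \<subseteq> fst ?D" "g ` W' \<subseteq> fst ?B"
    "Cinf_on U' F'" "snd ?D ` W' \<subseteq> U'" "\<And>y. y \<in> W' \<Longrightarrow> F' (snd ?D y) = snd ?B (g y)"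
    by (rule smooth_at_repE[OF Y Z g D B]) blast
  obtain A where A: "openin (mf_top X) A" "x \<in> A" "smooth_on A X Y f" using f unfolding smooth_at_def by blast
  let ?W = "{y \<in> A. f y \<in> W'} \<inter> W"
  have Wo: "openin (mf_top X) ?W" using smooth_on_openin_vimage[OF X Y A(3,1) W'(1)] W(1) by blast
  have op: "open (U \<inter> F -` U')" using Cinf_on_open_vimage[OF W(5) Cinf_on_open[OF W'(5)]] .
  have comp: "Cinf_on (U \<inter> F -` U') (\<lambda>z. F' (F z))"
    by (rule Cinf_on_compose[OF Cinf_on_subset[OF W(5) op] W'(5)]) auto
  have xU: "snd ?C x \<in> U" "F (snd ?C x) \<in> U'" "F (snd ?C x) = snd ?D (f x)" using W W' by auto
  have v': "dmap X Y f x v \<in> mf_model Y" using dmap_in_model[OF X Y f v] .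
  have 1: "dmap X Y f x v = frechet_derivative F (at (snd ?C x)) v"
    by (rule dmap_rep(1)[OF X refl W(1-3) W(5) xU(1) W(7) v])
  have 2: "dmap Y Z g (f x) (dmap X Y f x v) = frechet_derivative F' (at (snd ?D (f x))) (dmap X Y f x v)"
    by (rule dmap_rep(1)[OF Y refl W'(1-3) W'(5) _ W'(7) v']) (use xU in simp)
  have 3: "dmap X Z (\<lambda>x. g (f x)) x v = frechet_derivative (\<lambda>z. F' (F z)) (at (snd ?C x)) v"
    by (rule dmap_rep(1)[OF X refl Wo _ _ comp _ _ v]) (use W W' A xU in auto)
  show ?thesis
    unfolding 2 3 using frechet_derivative_compose_Cinf[OF W(5) W'(5) xU(1,2)] xU(3) 1 by simp
qed

lemma dmap_Pair:
  assumes Z: "premanifold Z" and X: "premanifold X" and Y: "premanifold Y"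
    and f: "smooth_at Z X f z" and g: "smooth_at Z Y g z" and v: "v \<in> mf_model Z"
  shows "dmap Z (prod_manifold X Y) (\<lambda>z. (f z, g z)) z v = (dmap Z X f z v, dmap Z Y g z v)"
proof -
  have z: "z \<in> pts Z" "f z \<in> pts X" "g z \<in> pts Y"
    using smooth_at_pts[OF f] smooth_at_image[OF X f] smooth_at_image[OF Y g] .
  let ?B = "mf_chart_at Z z" and ?C = "mf_chart_at X (f z)" and ?D = "mf_chart_at Y (g z)"
  note B = chart_at[OF Z z(1)] and C = chart_at[OF X z(2)] and D = chart_at[OF Y z(3)]
  obtain W U F where W: "openin (mf_top Z) W" "z \<in> W" "W \<subseteq> fst ?B" "f ` W \<subseteq> fst ?C"
    "Cinf_on U F" "snd ?B ` W \<subseteq> U" "\<And>y. y \<in> W \<Longrightarrow> F (snd ?B y) = snd ?C (f y)"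
    by (rule smooth_at_repE[OF Z X f B C]) blast
  obtain W' U' F' where W': "openin (mf_top Z) W'" "z \<in> W'" "W' \<subseteq> fst ?B" "g ` W' \<subseteq> fst ?D"
    "Cinf_on U' F'" "snd ?B ` W' \<subseteq> U'" "\<And>y. y \<in> W' \<Longrightarrow> F' (snd ?B y) = snd ?D (g y)"
    by (rule smooth_at_repE[OF Z Y g B D]) blast
  have zU: "snd ?B z \<in> U" "snd ?B z \<in> U'" using W W' by auto
  have op: "open (U \<inter> U')" by (intro open_Int Cinf_on_open[OF W(5)] Cinf_on_open[OF W'(5)])
  have P: "Cinf_on (U \<inter> U') (\<lambda>z. (F z, F' z))"
    using Cinf_on_Pair[OF Cinf_on_subset[OF W(5) op] Cinf_on_subset[OF W'(5) op]] by auto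
  have 1: "dmap Z X f z v = frechet_derivative F (at (snd ?B z)) v"
    by (rule dmap_rep(1)[OF Z refl W(1-3) W(5) zU(1) W(7) v])
  have 2: "dmap Z Y g z v = frechet_derivative F' (at (snd ?B z)) v"
    by (rule dmap_rep(1)[OF Z refl W'(1-3) W'(5) zU(2) W'(7) v])
  have 3: "dmap Z (prod_manifold X Y) (\<lambda>z. (f z, g z)) z v = frechet_derivative (\<lambda>z. (F z, F' z)) (at (snd ?B z)) v"
    by (rule dmap_rep(1)[OF Z refl _ _ _ P _ _ v, of "W \<inter> W'"]) (use W W' zU in auto)
  have "frechet_derivative (\<lambda>z. (F z, F' z)) (at (snd ?B z)) = (\<lambda>v. (frechet_derivative F (at (snd ?B z)) v, frechet_derivative F' (at (snd ?B z)) v))"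
    by (intro frechet_derivative_eq has_derivative_Pair Cinf_on_has_derivative[OF W(5) zU(1)] Cinf_on_has_derivative[OF W'(5) zU(2)])
  then show ?thesis using 1 2 3 by simp
qed

lemma frechet_derivative_linear: "linear L \<Longrightarrow> frechet_derivative L (at x) = L"
  for L :: "'a::euclidean_space \<Rightarrow> 'b::euclidean_space"
  by (intro frechet_derivative_eq bounded_linear_imp_has_derivative) (simp add: linear_conv_bounded_linear)

lemma dmap_ident:
  assumes X: "premanifold X" and x: "x \<in> pts X" and v: "v \<in> mf_model X"
  shows "dmap X X (\<lambda>x. x) x v = v"
  using dmap_rep(1)[OF X refl chart_open[OF X chart_at(1)[OF X x]] chart_at(2)[OF X x] order_refl
      Cinf_on_linear[OF open_UNIV linear_id] UNIV_I _ v, where Y = X and f = "\<lambda>x. x"]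
  by (simp add: frechet_derivative_linear[OF linear_id])

lemma dmap_const:
  assumes X: "premanifold X" and x: "x \<in> pts X" and v: "v \<in> mf_model X"
  shows "dmap X Y (\<lambda>x. c) x v = 0"
  using dmap_rep(1)[OF X refl chart_open[OF X chart_at(1)[OF X x]] chart_at(2)[OF X x] order_refl
      Cinf_on_const[OF open_UNIV] UNIV_I _ v, where Y = Y and f = "\<lambda>x. c"]
  by simp

lemma dmap_fst:
  assumes X: "premanifold X" and Y: "premanifold Y" and z: "z \<in> pts X \<times> pts Y" and v: "v \<in> mf_model X \<times> mf_model Y"
  shows "dmap (prod_manifold X Y) X fst z v = fst v"
proof -
  note Z = premanifold_prod[OF X Y]
  have z': "z \<in> pts (prod_manifold X Y)" using z by simp
  have v': "v \<in> mf_model (prod_manifold X Y)" using v by simp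
  show ?thesis
    using dmap_rep(1)[OF Z refl chart_open[OF Z chart_at(1)[OF Z z']] chart_at(2)[OF Z z'] order_refl
      Cinf_on_linear[OF open_UNIV linear_fst] UNIV_I _ v', where Y = X and f = fst]
    by (cases z) (simp add: frechet_derivative_linear[OF linear_fst])
qed

lemma dmap_snd:
  assumes X: "premanifold X" and Y: "premanifold Y" and z: "z \<in> pts X \<times> pts Y" and v: "v \<in> mf_model X \<times> mf_model Y"
  shows "dmap (prod_manifold X Y) Y snd z v = snd v"
proof -
  note Z = premanifold_prod[OF X Y]
  have z': "z \<in> pts (prod_manifold X Y)" using z by simp
  have v': "v \<in> mf_model (prod_manifold X Y)" using v by simp
  show ?thesis
    using dmap_rep(1)[OF Z refl chart_open[OF Z chart_at(1)[OF Z z']] chart_at(2)[OF Z z'] order_refl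
      Cinf_on_linear[OF open_UNIV linear_snd] UNIV_I _ v', where Y = Y and f = snd]
    by (cases z) (simp add: frechet_derivative_linear[OF linear_snd])
qed

lemma dmap_vec:
  assumes V: "subspace V" and F: "Cinf_on U F" and x: "x \<in> V" "x \<in> U" and v: "v \<in> V"
  shows "dmap (vec_manifold V) (vec_manifold V') F x v = frechet_derivative F (at x) v"
  using dmap_rep(1)[OF premanifold_vec[OF V] refl _ _ _ F, where x = x and W = V and Y = "vec_manifold V'" and f = F and v = v] x v
  by simp

lemma dmap_left_inverse:
  assumes X: "premanifold X" and Y: "premanifold Y" and f: "smooth_at X Y f x" and g: "smooth_at Y X g (f x)"
    and W: "openin (mf_top X) W" "x \<in> W" "\<And>y. y \<in> W \<Longrightarrow> g (f y) = y" and v: "v \<in> mf_model X"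
  shows "dmap Y X g (f x) (dmap X Y f x v) = v"
proof -
  have "dmap Y X g (f x) (dmap X Y f x v) = dmap X X (\<lambda>x. g (f x)) x v"
    by (rule dmap_compose[OF X Y X f g v, symmetric])
  also have "\<dots> = dmap X X (\<lambda>x. x) x v"
    by (rule dmap_cong[OF X W v])
  also have "\<dots> = v" by (rule dmap_ident[OF X smooth_at_pts[OF f] v])
  finally show ?thesis .
qed

section \<open>Invariance of dimension and the inverse function theorem on manifolds\<close>

lemma diffeo_on_inverse:
  assumes "diffeo_on A X B Y f" "x \<in> A" shows "inv_into A f (f x) = x"
  using assms unfolding diffeo_on_def bij_betw_def by auto

text \<open>The differentials of a diffeomorphism and of its inverse are mutually inverse on the
  model spaces. Applied to trivializations, this yields the dimension counts for the
  bundles.\<close>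

lemma diffeo_on_dim:
  assumes X: "premanifold X" and Y: "premanifold Y" and d: "diffeo_on A X B Y f"
    and A: "openin (mf_top X) A" and B: "openin (mf_top Y) B" and x: "x \<in> A"
  shows "dim (mf_model X) = dim (mf_model Y)"
proof -
  let ?g = "inv_into A f"
  have bij: "bij_betw f A B" and f: "smooth_on A X Y f" and g: "smooth_on B Y X ?g"
    using d by (auto simp: diffeo_on_def)
  have fx: "f x \<in> B" using bij x by (auto simp: bij_betw_def)
  have gf: "?g (f y) = y" if "y \<in> A" for y using diffeo_on_inverse[OF d that] .
  have fg: "f (?g y) = y" if "y \<in> B" for y using bij that by (metis bij_betw_inv_into_right)
  have fa: "smooth_at X Y f x" using smooth_atI[OF f A x] .
  have ga: "smooth_at Y X ?g (f x)" using smooth_atI[OF g B fx] .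
  obtain L where L: "linear L" "\<And>v. v \<in> mf_model X \<Longrightarrow> dmap X Y f x v = L v"
    "\<And>v. v \<in> mf_model X \<Longrightarrow> L v \<in> mf_model Y" using dmap_linear[OF X Y fa] by metis
  obtain K where K: "linear K" "\<And>v. v \<in> mf_model Y \<Longrightarrow> dmap Y X ?g (f x) v = K v"
    "\<And>v. v \<in> mf_model Y \<Longrightarrow> K v \<in> mf_model X" using dmap_linear[OF Y X ga] by metis
  have 1: "K (L v) = v" if "v \<in> mf_model X" for v
    using dmap_left_inverse[OF X Y fa ga A x gf that] L K that by metis
  have "smooth_at X Y f (?g (f x))" using fa gf[OF x] by simp
  then have 2: "L (K v) = v" if "v \<in> mf_model Y" for v
    using dmap_left_inverse[OF Y X ga _ B fx fg that] L K that gf[OF x] by metis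
  have LX: "L ` mf_model X = mf_model Y" using L K 2 by force
  have KY: "K ` mf_model Y = mf_model X" using L K 1 by force
  show ?thesis using dim_image_le[OF L(1), of "mf_model X"] dim_image_le[OF K(1), of "mf_model Y"]
    unfolding LX KY by simp
qed

text \<open>Coordinate expressions live on subspaces of two different Euclidean spaces. Equal
  dimensions allow a linear isomorphism \<open>T\<close> between the model spaces, and the
  expression is then completed to a self-map \<open>H\<close> of the ambient space by the identity
  on a complement.\<close>

theorem inverse_function_manifold:
  assumes X: "premanifold X" and Y: "premanifold Y" and f: "smooth_on A X Y f"
    and A: "openin (mf_top X) A" and x: "x \<in> A" and dims: "dim (mf_model X) = dim (mf_model Y)"
    and inj: "\<And>v. v \<in> mf_model X \<Longrightarrow> dmap X Y f x v = 0 \<Longrightarrow> v = 0"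
  obtains W V where "openin (mf_top X) W" "x \<in> W" "W \<subseteq> A" "openin (mf_top Y) V" "diffeo_on W X V Y f"
proof -
  have xX: "x \<in> pts X" "f x \<in> pts Y" using x A openin_subset smooth_on_image[OF Y f] by blast+
  define C D where "C = mf_chart_at X x" and "D = mf_chart_at Y (f x)"
  have C: "C \<in> mf_atlas X" "x \<in> fst C" and D: "D \<in> mf_atlas Y" "f x \<in> fst D"
    using chart_at[OF X xX(1)] chart_at[OF Y xX(2)] by (auto simp: C_def D_def)
  obtain W U F where W: "openin (mf_top X) W" "x \<in> W" "W \<subseteq> A" "W \<subseteq> fst C" "f ` W \<subseteq> fst D"
    "Cinf_on U F" "snd C ` W \<subseteq> U" "\<And>y. y \<in> W \<Longrightarrow> F (snd C y) = snd D (f y)"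
    by (rule smooth_on_open_repE[OF X Y f x A C D]) blast
  obtain N0 where N0: "open N0" "snd C ` W = mf_model X \<inter> N0" using chart_image_openE[OF X C(1) W(1,4)] by blast
  obtain T T' where T: "linear T" "linear T'" "T ` mf_model Y = mf_model X"
    "\<And>y. y \<in> mf_model Y \<Longrightarrow> T' (T y) = y"
    by (rule isometries_subspaces[OF premanifold_subspace[OF Y] premanifold_subspace[OF X] dims[symmetric]]) blast
  obtain P where P: "linear P" "range P \<subseteq> mf_model X" "\<And>x. x \<in> mf_model X \<Longrightarrow> P x = x"
    using subspace_projection[OF premanifold_subspace[OF X]] by blast
  have PP: "P (P z) = P z" for z using P(2,3) by blast
  \<comment> \<open>\<open>P\<close> projects onto the model space of \<open>X\<close>. Along it
    \<open>H\<close> acts by \<open>F\<close> followed by \<open>T\<close>, while the remainder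
    \<open>z - P z\<close> is kept; injectivity of \<open>dF\<close> on the model space thus gives
    injectivity of \<open>dH\<close>.\<close>
  define H where "H z = T (F (P z)) + (z - P z)" for z
  define U1 where "U1 = P -` (U \<inter> N0)"
  have U1: "open U1"
    unfolding U1_def by (intro open_vimage open_Int Cinf_on_open[OF W(6)] N0(1) linear_continuous_on)
      (use P(1) linear_conv_bounded_linear in blast)
  have TF: "T (F (P z)) \<in> mf_model X" "\<exists>y\<in>W. P z = snd C y" if "z \<in> U1" for z
  proof -
    have "P z \<in> mf_model X \<inter> N0" using that P(2) unfolding U1_def by auto
    then obtain y where y: "y \<in> W" "P z = snd C y" using N0(2) by auto
    then have "F (P z) \<in> mf_model Y" using W(5,8) chart_in_model[OF Y D(1)] by auto
    then show "T (F (P z)) \<in> mf_model X" "\<exists>y\<in>W. P z = snd C y" using T(3) y by auto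
  qed
  have FP: "Cinf_on U1 (\<lambda>z. F (P z))"
    by (rule Cinf_on_compose[OF Cinf_on_linear[OF U1 P(1)] W(6)]) (auto simp: U1_def)
  have lin: "linear (\<lambda>z. z - P z)" using P(1) by (intro linear_compose_sub linear_ident)
  have H: "Cinf_on U1 H"
    unfolding H_def[abs_def] by (intro Cinf_on_add Cinf_on_linear_comp[OF T(1)] FP Cinf_on_linear[OF U1 lin])
  define p where "p = snd C x"
  have pX: "p \<in> mf_model X" "P p = p" using chart_in_model[OF X C] P(3) by (auto simp: p_def)
  have pU: "p \<in> U1" "p \<in> U" using pX N0 W unfolding U1_def p_def by auto
  have dF: "dmap X Y f x v = frechet_derivative F (at p) v" if "v \<in> mf_model X" for v
    unfolding p_def by (rule dmap_rep(1)[OF X C_def W(1,2,4,6) _ W(8)[unfolded D_def] that]) (use pU in \<open>simp add: p_def\<close>)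
  have dH: "frechet_derivative H (at p) v = T (frechet_derivative F (at p) (P v)) + (v - P v)" for v
  proof -
    have "((\<lambda>z. F (P z)) has_derivative (\<lambda>v. frechet_derivative F (at p) (P v))) (at p)"
      by (rule has_derivative_compose[OF bounded_linear_imp_has_derivative])
         (use P(1) Cinf_on_has_derivative[OF W(6) pU(2)] pX in \<open>auto simp: linear_conv_bounded_linear\<close>)
    then have "(H has_derivative (\<lambda>v. T (frechet_derivative F (at p) (P v)) + (v - P v))) (at p)"
      unfolding H_def[abs_def]
      by (intro has_derivative_add bounded_linear.has_derivative[of T] bounded_linear_imp_has_derivative[of "\<lambda>z. z - P z"])
         (use T(1) lin in \<open>auto simp: linear_conv_bounded_linear\<close>)
    from frechet_derivative_eq[OF this] show ?thesis by simp
  qed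
  have "inj (frechet_derivative H (at p))"
    unfolding linear_injective_0[OF Cinf_on_linear_derivative[OF H pU(1)]]
  proof (intro allI impI)
    fix v assume 0: "frechet_derivative H (at p) v = 0"
    have Pv: "P v \<in> mf_model X" using P(2) by auto
    have fY: "frechet_derivative F (at p) (P v) \<in> mf_model Y"
      using dF[OF Pv] dmap_in_model[OF X Y smooth_atI[OF f A x] Pv] by simp
    then have TX: "T (frechet_derivative F (at p) (P v)) \<in> mf_model X" using T(3) by auto
    have "P (T (frechet_derivative F (at p) (P v)) + (v - P v)) = T (frechet_derivative F (at p) (P v))"
      using P(1) P(3)[OF TX] PP by (simp add: linear_add linear_diff)
    then have T0: "T (frechet_derivative F (at p) (P v)) = 0" using 0 dH linear_0[OF P(1)] by simp
    then have "v = P v" using 0 dH by simp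
    moreover have "frechet_derivative F (at p) (P v) = 0" using T(4)[OF fY] T0 linear_0[OF T(2)] by simp
    ultimately show "v = 0" using inj[OF Pv] dF[OF Pv] by simp
  qed
  from Cinf_on_local_inverse[OF H pU(1) this]
  obtain N g where N: "open N" "p \<in> N" "N \<subseteq> U1" "Cinf_on (H ` N) g" "\<And>z. z \<in> N \<Longrightarrow> g (H z) = z" by metis
  define W1 where "W1 = W \<inter> {y \<in> fst C. snd C y \<in> N}"
  define V where "V = {y \<in> fst D. snd D y \<in> T -` (H ` N)}"
  have opT: "open (T -` (H ` N))"
    by (intro open_vimage Cinf_on_open[OF N(4)] linear_continuous_on) (use T(1) linear_conv_bounded_linear in blast)
  have W1: "openin (mf_top X) W1" unfolding W1_def using W(1) chart_vimage_open[OF X C(1) N(1)] by blast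
  have V: "openin (mf_top Y) V" unfolding V_def by (rule chart_vimage_open[OF Y D(1) opT])
  have HC: "H (snd C y) = T (snd D (f y))" if "y \<in> W1" for y
  proof -
    have "P (snd C y) = snd C y" using that W(4) chart_in_model[OF X C(1)] P(3) unfolding W1_def by blast
    then show ?thesis using that W(8) unfolding H_def W1_def by simp
  qed
  have g: "g (T (snd D (f y))) = snd C y" if "y \<in> W1" for y
    using HC[OF that] N(5)[of "snd C y"] that by (simp add: W1_def)
  have inj: "inj_on f W1"
    by (rule inj_onI) (metis (no_types, lifting) C(1) Int_iff W(4) W1_def X chart_inj g inj_onD subsetD)
  have im: "f ` W1 = V"
  proof
    show "f ` W1 \<subseteq> V"
    proof clarify
      fix y assume y: "y \<in> W1"
      have "T (snd D (f y)) \<in> H ` N" using HC[OF y] y unfolding W1_def by (metis (no_types, lifting) IntD2 imageI mem_Collect_eq)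
      then show "f y \<in> V" using y W(5) unfolding V_def W1_def by auto
    qed
    show "V \<subseteq> f ` W1"
    proof
      fix q assume q: "q \<in> V"
      then obtain n where n: "n \<in> N" "T (snd D q) = H n" unfolding V_def by auto
      have qD: "q \<in> fst D" "snd D q \<in> mf_model Y" using q chart_in_model[OF Y D(1)] unfolding V_def by auto
      then have HX: "H n \<in> mf_model X" using T(3) n(2) by (metis imageI)
      have nU: "n \<in> U1" using n N by auto
      \<comment> \<open>A value in the model space can only come from the model space: applying
        \<open>P\<close> to \<open>H n\<close> shows that the kept part \<open>n - P n\<close>
        vanishes.\<close>
      have "P (H n) = T (F (P n))" unfolding H_def using P(1) P(3)[OF TF(1)[OF nU]] PP by (simp add: linear_add linear_diff)
      then have "n = P n" using P(3)[OF HX] unfolding H_def by simp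
      then obtain y where y: "y \<in> W" "n = snd C y" using TF(2)[OF nU] by auto
      then have y1: "y \<in> W1" using W(4) n(1) unfolding W1_def by auto
      have "T (snd D q) = T (snd D (f y))" using n(2) HC[OF y1] y by simp
      moreover have fy: "f y \<in> fst D" using y W(5) by auto
      ultimately have "snd D q = snd D (f y)" using T(4) qD(2) chart_in_model[OF Y D(1)] by metis
      then have "q = f y" using chart_inj[OF Y D(1)] qD(1) fy by (meson inj_onD)
      then show "q \<in> f ` W1" using y1 by blast
    qed
  qed
  have "smooth_on V Y X (inv_into W1 f)"
  proof (rule smooth_onI[OF Y])
    show "V \<subseteq> pts Y" using V openin_subset by blast
    fix q assume q: "q \<in> V"
    have rep: "g (T (snd D q)) = snd C (inv_into W1 f q)" "inv_into W1 f q \<in> fst C" if qV: "q \<in> V" for q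
    proof -
      obtain y where y: "y \<in> W1" "q = f y" using im qV by blast
      then show "g (T (snd D q)) = snd C (inv_into W1 f q)" "inv_into W1 f q \<in> fst C"
        using g inj W(4) by (auto simp: W1_def)
    qed
    have "Cinf_on (T -` (H ` N)) (\<lambda>z. g (T z))"
      by (rule Cinf_on_compose[OF Cinf_on_linear[OF opT T(1)] N(4)]) auto
    then have "local_rep Y D C V (inv_into W1 f) q"
      unfolding local_rep_def using V q rep
      by (intro exI[of _ V] exI[of _ "T -` (H ` N)"] exI[of _ "\<lambda>z. g (T z)"]) (auto simp: V_def)
    then show "\<exists>C\<in>mf_atlas Y. \<exists>D\<in>mf_atlas X. local_rep Y C D V (inv_into W1 f) q" using C D by blast
  qed
  then have "diffeo_on W1 X V Y f"
    unfolding diffeo_on_def bij_betw_def using inj im smooth_on_subset[OF X f, of W1] W(3) by (auto simp: W1_def)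
  moreover have "x \<in> W1" using W C N unfolding W1_def p_def by auto
  ultimately show ?thesis using that[of W1 V] W1 V W(3) by (auto simp: W1_def)
qed

section \<open>The tangent bundle\<close>

lemma chart_smooth_at:
  "premanifold X \<Longrightarrow> C \<in> mf_atlas X \<Longrightarrow> x \<in> fst C \<Longrightarrow> smooth_at X (vec_manifold (mf_model X)) (snd C) x"
  by (rule smooth_atI[OF smooth_on_chart chart_open])

text \<open>\<open>dmap\<close> refers to the preferred chart at each single point, a tangent chart
  to one chart over a whole region. The chain rule through \<open>snd C\<close> and
  \<open>snd D\<close> translates between the two.\<close>

lemma dchart_map:
  assumes X: "premanifold X" and Y: "premanifold Y" and C: "C \<in> mf_atlas X" and D: "D \<in> mf_atlas Y"
    and W: "openin (mf_top X) W" "W \<subseteq> fst C" "f ` W \<subseteq> fst D" and f: "smooth_on W X Y f"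
    and F: "Cinf_on U F" "snd C ` W \<subseteq> U" "\<And>y. y \<in> W \<Longrightarrow> F (snd C y) = snd D (f y)"
    and y: "y \<in> W" and v: "v \<in> mf_model X"
  shows "dmap Y (vec_manifold (mf_model Y)) (snd D) (f y) (dmap X Y f y v) =
         frechet_derivative F (at (snd C y)) (dmap X (vec_manifold (mf_model X)) (snd C) y v)"
proof -
  let ?VX = "vec_manifold (mf_model X)" and ?VY = "vec_manifold (mf_model Y)"
  note VX = premanifold_vec[OF premanifold_subspace[OF X]] and VY = premanifold_vec[OF premanifold_subspace[OF Y]]
  have yC: "y \<in> fst C" "f y \<in> fst D" using W y by auto
  have FW: "smooth_on (snd C ` W) ?VX ?VY F"
    by (rule smooth_on_vecI[OF premanifold_subspace[OF X] premanifold_subspace[OF Y] F(1)])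
       (use W(2,3) F(2,3) chart_in_model[OF X C] chart_in_model[OF Y D] in auto)
  have Fat: "smooth_at ?VX ?VY F (snd C y)"
    by (rule smooth_atI[OF FW]) (use chart_open_iff[OF X C W(2)] W(1) y in auto)
  have dv: "dmap X ?VX (snd C) y v \<in> mf_model X"
    using dmap_in_model[OF X VX chart_smooth_at[OF X C yC(1)] v] by simp
  have "dmap Y ?VY (snd D) (f y) (dmap X Y f y v) = dmap X ?VY (\<lambda>x. snd D (f x)) y v"
    by (rule dmap_compose[OF X Y VY smooth_atI[OF f W(1) y] chart_smooth_at[OF Y D yC(2)] v, symmetric])
  also have "\<dots> = dmap X ?VY (\<lambda>x. F (snd C x)) y v"
    by (rule dmap_cong[OF X W(1) y _ v]) (use F(3) in simp)
  also have "\<dots> = dmap ?VX ?VY F (snd C y) (dmap X ?VX (snd C) y v)"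
    by (rule dmap_compose[OF X VX VY chart_smooth_at[OF X C yC(1)] Fat v])
  also have "\<dots> = frechet_derivative F (at (snd C y)) (dmap X ?VX (snd C) y v)"
    by (rule dmap_vec[OF premanifold_subspace[OF X] F(1) _ _ dv])
       (use chart_in_model[OF X C yC(1)] F(2) y in auto)
  finally show ?thesis .
qed

lemma dchart_inverse:
  assumes X: "premanifold X" and C: "C \<in> mf_atlas X" and y: "y \<in> fst C" and v: "v \<in> mf_model X"
  shows "dmap (vec_manifold (mf_model X)) X (chart_inv C) (snd C y) (dmap X (vec_manifold (mf_model X)) (snd C) y v) = v"
    and "dmap X (vec_manifold (mf_model X)) (snd C) y (dmap (vec_manifold (mf_model X)) X (chart_inv C) (snd C y) v) = v"
proof -
  let ?V = "vec_manifold (mf_model X)"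
  note V = premanifold_vec[OF premanifold_subspace[OF X]]
  have inv: "smooth_at ?V X (chart_inv C) (snd C y)"
    by (rule smooth_atI[OF smooth_on_chart_inv[OF X C]]) (use chart_image_open[OF X C] y in auto)
  have yy: "chart_inv C (snd C y) = y" by (rule chart_inv_chart[OF X C y])
  show "dmap ?V X (chart_inv C) (snd C y) (dmap X ?V (snd C) y v) = v"
    by (rule dmap_left_inverse[OF X V chart_smooth_at[OF X C y] inv chart_open[OF X C] y _ v])
       (rule chart_inv_chart[OF X C])
  have "dmap X ?V (snd C) (chart_inv C (snd C y)) (dmap ?V X (chart_inv C) (snd C y) v) = v"
    by (rule dmap_left_inverse[OF V X inv, of _ "snd C ` fst C"])
       (use chart_smooth_at[OF X C y] yy chart_image_open[OF X C] y v chart_inv_chart[OF X C] in auto)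
  then show "dmap X ?V (snd C) y (dmap ?V X (chart_inv C) (snd C y) v) = v" by (simp only: yy)
qed

lemma dchart_in_model:
  assumes X: "premanifold X" and C: "C \<in> mf_atlas X" and y: "y \<in> fst C" and v: "v \<in> mf_model X"
  shows "dmap X (vec_manifold (mf_model X)) (snd C) y v \<in> mf_model X"
    and "dmap (vec_manifold (mf_model X)) X (chart_inv C) (snd C y) v \<in> mf_model X"
proof -
  note V = premanifold_vec[OF premanifold_subspace[OF X]]
  show "dmap X (vec_manifold (mf_model X)) (snd C) y v \<in> mf_model X"
    using dmap_in_model[OF X V chart_smooth_at[OF X C y] v] by simp
  have "smooth_at (vec_manifold (mf_model X)) X (chart_inv C) (snd C y)"
    by (rule smooth_atI[OF smooth_on_chart_inv[OF X C]]) (use chart_image_open[OF X C] y in auto)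
  then show "dmap (vec_manifold (mf_model X)) X (chart_inv C) (snd C y) v \<in> mf_model X"
    using dmap_in_model[OF V X] v by simp
qed

lemma tangent_chart_simps [simp]:
  "fst (tangent_chart X C) = fst C \<times> mf_model X"
  "snd (tangent_chart X C) (x, v) = (snd C x, dmap X (vec_manifold (mf_model X)) (snd C) x v)"
  by (simp_all add: tangent_chart_def)

lemma tangent_chart_inj:
  assumes X: "premanifold X" and C: "C \<in> mf_atlas X"
  shows "inj_on (snd (tangent_chart X C)) (fst (tangent_chart X C))"
proof (rule inj_onI, clarsimp)
  fix x v y w assume *: "x \<in> fst C" "v \<in> mf_model X" "y \<in> fst C" "w \<in> mf_model X" "snd C x = snd C y"
    "dmap X (vec_manifold (mf_model X)) (snd C) x v = dmap X (vec_manifold (mf_model X)) (snd C) y w"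
  then have "x = y" using chart_inj[OF X C] by (meson inj_onD)
  then show "x = y \<and> v = w" using * dchart_inverse(1)[OF X C] by metis
qed

lemma tangent_chart_image:
  assumes X: "premanifold X" and C: "C \<in> mf_atlas X" and W: "W \<subseteq> fst C"
  shows "snd (tangent_chart X C) ` (W \<times> mf_model X) = snd C ` W \<times> mf_model X"
proof
  show "snd (tangent_chart X C) ` (W \<times> mf_model X) \<subseteq> snd C ` W \<times> mf_model X"
    using dchart_in_model(1)[OF X C] W by auto
  show "snd C ` W \<times> mf_model X \<subseteq> snd (tangent_chart X C) ` (W \<times> mf_model X)"
  proof clarify
    fix y w assume y: "y \<in> W" and w: "w \<in> mf_model X"
    have yC: "y \<in> fst C" using y W by blast
    let ?v = "dmap (vec_manifold (mf_model X)) X (chart_inv C) (snd C y) w"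
    have eq: "(snd C y, w) = snd (tangent_chart X C) (y, ?v)" using dchart_inverse(2)[OF X C yC w] by simp
    have "?v \<in> mf_model X" using dchart_in_model(2)[OF X C yC w] .
    then show "(snd C y, w) \<in> snd (tangent_chart X C) ` (W \<times> mf_model X)" by (intro image_eqI[where x = "(y, ?v)"], intro eq) (use y in simp)
  qed
qed

text \<open>\<open>\<Phi>\<close> is the tangent map of the chart change, defined near the base
  point for all vectors at once. It serves both the topology and the smooth structure of the tangent
  bundle.\<close>

lemma tangent_chart_change:
  assumes X: "premanifold X" and C: "C \<in> mf_atlas X" and D: "D \<in> mf_atlas X" and x: "x \<in> fst C" "x \<in> fst D"
  obtains Z \<Phi> where "open Z" "snd D x \<in> Z" "Cinf_on (Z \<times> UNIV) \<Phi>"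
    "\<And>y v. y \<in> fst D \<Longrightarrow> snd D y \<in> Z \<Longrightarrow> v \<in> mf_model X \<Longrightarrow>
       y \<in> fst C \<and> \<Phi> (snd (tangent_chart X D) (y, v)) = snd (tangent_chart X C) (y, v)"
proof -
  obtain W U F where W: "openin (mf_top X) W" "x \<in> W" "W \<subseteq> fst D" "(\<lambda>x. x) ` W \<subseteq> fst C"
    "Cinf_on U F" "snd D ` W \<subseteq> U" "\<And>y. y \<in> W \<Longrightarrow> F (snd D y) = snd C y"
    by (rule smooth_at_repE[OF X X smooth_at_ident[OF X] D x(2) C x(1)]) (use x chart_subset[OF X C] in \<open>auto\<close>)
  obtain N where N: "open N" "snd D ` W = mf_model X \<inter> N" using chart_image_openE[OF X D W(1,3)] by blast
  have op: "open (U \<inter> N)" using N Cinf_on_open[OF W(5)] by blast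
  show ?thesis
  proof (rule that[of "U \<inter> N", OF op])
    show "snd D x \<in> U \<inter> N" using W N by blast
    show "Cinf_on ((U \<inter> N) \<times> UNIV) (\<lambda>(z, v). (F z, frechet_derivative F (at z) v))"
      by (rule Cinf_on_tangent[OF Cinf_on_subset[OF W(5) op]]) auto
    fix y v assume y: "y \<in> fst D" "snd D y \<in> U \<inter> N" and v: "v \<in> mf_model X"
    have "snd D y \<in> snd D ` W" using N(2) y chart_in_model[OF X D] by blast
    then have yW: "y \<in> W" using chart_inj[OF X D] y W(3) by (meson inj_on_image_mem_iff)
    have "dmap X (vec_manifold (mf_model X)) (snd C) y (dmap X X (\<lambda>x. x) y v) =
         frechet_derivative F (at (snd D y)) (dmap X (vec_manifold (mf_model X)) (snd D) y v)"
      by (rule dchart_map[OF X X D C W(1,3,4) smooth_on_ident[OF X] W(5-7) yW v])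
         (use W chart_subset[OF X D] in auto)
    moreover have "dmap X X (\<lambda>x. x) y v = v"
      by (rule dmap_ident[OF X _ v]) (use y chart_subset[OF X D] in auto)
    ultimately show "y \<in> fst C \<and> (\<lambda>(z, v). (F z, frechet_derivative F (at z) v)) (snd (tangent_chart X D) (y, v)) =
        snd (tangent_chart X C) (y, v)"
      using W(4,7) yW by auto
  qed
qed

lemma tangent_bundle_simps [simp]:
  "mf_model (tangent_bundle X) = mf_model X \<times> mf_model X"
  "mf_atlas (tangent_bundle X) = tangent_chart X ` mf_atlas X"
  "mf_chart_at (tangent_bundle X) (x, v) = tangent_chart X (mf_chart_at X x)"
  by (simp_all add: tangent_bundle_def)

text \<open>The predicate in \<open>tangent_bundle\<close> has to be recognized as a topology before
  \<open>topology\<close> can be unfolded; intersections are preserved because tangent charts are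
  injective.\<close>

lemma openin_tangent_bundle:
  assumes X: "premanifold X"
  shows "openin (mf_top (tangent_bundle X)) W \<longleftrightarrow> W \<subseteq> pts X \<times> mf_model X \<and>
         (\<forall>C \<in> mf_atlas X. openin (top_of_set (mf_model X \<times> mf_model X))
            (snd (tangent_chart X C) ` (W \<inter> fst (tangent_chart X C))))"
proof -
  let ?P = "\<lambda>W. W \<subseteq> pts X \<times> mf_model X \<and>
         (\<forall>C \<in> mf_atlas X. openin (top_of_set (mf_model X \<times> mf_model X))
            (snd (tangent_chart X C) ` (W \<inter> fst (tangent_chart X C))))"
  have "istopology ?P"
    unfolding istopology_def
  proof (intro conjI allI impI)
    fix S T assume S: "?P S" and T: "?P T"
    have "snd (tangent_chart X C) ` (S \<inter> T \<inter> fst (tangent_chart X C)) =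
      snd (tangent_chart X C) ` (S \<inter> fst (tangent_chart X C)) \<inter> snd (tangent_chart X C) ` (T \<inter> fst (tangent_chart X C))"
      if "C \<in> mf_atlas X" for C
      using inj_on_image_Int[OF tangent_chart_inj[OF X that], of "S \<inter> fst (tangent_chart X C)" "T \<inter> fst (tangent_chart X C)"]
      by (simp add: Int_ac)
    then show "S \<inter> T \<subseteq> pts X \<times> mf_model X"
      "\<forall>C \<in> mf_atlas X. openin (top_of_set (mf_model X \<times> mf_model X))
            (snd (tangent_chart X C) ` (S \<inter> T \<inter> fst (tangent_chart X C)))"
      using S T by auto
  next
    fix K assume K: "\<forall>S\<in>K. ?P S"
    then show "\<Union>K \<subseteq> pts X \<times> mf_model X" by auto
    show "\<forall>C \<in> mf_atlas X. openin (top_of_set (mf_model X \<times> mf_model X))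
            (snd (tangent_chart X C) ` (\<Union>K \<inter> fst (tangent_chart X C)))"
    proof
      fix C assume C: "C \<in> mf_atlas X"
      have "snd (tangent_chart X C) ` (\<Union>K \<inter> fst (tangent_chart X C)) =
        \<Union>((\<lambda>S. snd (tangent_chart X C) ` (S \<inter> fst (tangent_chart X C))) ` K)" by blast
      then show "openin (top_of_set (mf_model X \<times> mf_model X))
            (snd (tangent_chart X C) ` (\<Union>K \<inter> fst (tangent_chart X C)))"
        using K C by (simp only:) (rule openin_Union, blast)
    qed
  qed
  then show ?thesis unfolding tangent_bundle_def by (simp add: topology_inverse')
qed

text \<open>Openness in one tangent chart forces openness in every other, by pulling back along the
  smooth change of charts; hence a single chart decides.\<close>

lemma tangent_chart_open_iff:
  assumes X: "premanifold X" and C: "C \<in> mf_atlas X" and W: "W \<subseteq> fst (tangent_chart X C)"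
  shows "openin (mf_top (tangent_bundle X)) W \<longleftrightarrow>
    openin (top_of_set (mf_model X \<times> mf_model X)) (snd (tangent_chart X C) ` W)"
proof
  assume "openin (mf_top (tangent_bundle X)) W"
  then have "openin (top_of_set (mf_model X \<times> mf_model X)) (snd (tangent_chart X C) ` (W \<inter> fst (tangent_chart X C)))"
    unfolding openin_tangent_bundle[OF X] using C by blast
  then show "openin (top_of_set (mf_model X \<times> mf_model X)) (snd (tangent_chart X C) ` W)"
    using W by (simp add: Int_absorb2 del: tangent_chart_simps)
next
  assume W': "openin (top_of_set (mf_model X \<times> mf_model X)) (snd (tangent_chart X C) ` W)"
  then obtain N where N: "open N" "snd (tangent_chart X C) ` W = (mf_model X \<times> mf_model X) \<inter> N"
    by (metis openin_open)
  show "openin (mf_top (tangent_bundle X)) W"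
    unfolding openin_tangent_bundle[OF X]
  proof (intro conjI ballI)
    show "W \<subseteq> pts X \<times> mf_model X" using W chart_subset[OF X C] by auto
    fix D assume D: "D \<in> mf_atlas X"
    let ?I = "snd (tangent_chart X D) ` (W \<inter> fst (tangent_chart X D))"
    have loc: "\<exists>Z. open Z \<and> p \<in> Z \<and> Z \<inter> (mf_model X \<times> mf_model X) \<subseteq> ?I" if p: "p \<in> ?I" for p
    proof -
      obtain x v where x: "(x, v) \<in> W" "x \<in> fst D" "v \<in> mf_model X" "p = snd (tangent_chart X D) (x, v)"
        using p by auto
      have xC: "x \<in> fst C" using x W by auto
      obtain Z \<Phi> where Zo: "open Z" and Z: "snd D x \<in> Z" "Cinf_on (Z \<times> UNIV) \<Phi>"
        "\<And>y v. y \<in> fst D \<Longrightarrow> snd D y \<in> Z \<Longrightarrow> v \<in> mf_model X \<Longrightarrow>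
           y \<in> fst C \<and> \<Phi> (snd (tangent_chart X D) (y, v)) = snd (tangent_chart X C) (y, v)"
        using tangent_chart_change[OF X C D xC x(2)] by metis
      obtain N' where N': "open N'" "snd D ` fst D = mf_model X \<inter> N'"
        using chart_image_open[OF X D] by (metis openin_open)
      let ?Z = "(Z \<times> UNIV) \<inter> \<Phi> -` N \<inter> N' \<times> UNIV"
      have "open ?Z" by (rule open_Int[OF Cinf_on_open_vimage[OF Z(2) N(1)] open_Times[OF N'(1) open_UNIV]])
      moreover have "p \<in> ?Z"
      proof -
        have "\<Phi> p = snd (tangent_chart X C) (x, v)" using Z(3)[OF x(2) Z(1) x(3)] x(4) by simp
        then have "\<Phi> p \<in> snd (tangent_chart X C) ` W" using imageI[OF x(1)] by metis
        then have "\<Phi> p \<in> N" using N(2) by blast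
        then show ?thesis using x Z N' by auto
      qed
      moreover have "q \<in> ?I" if q: "q \<in> ?Z \<inter> (mf_model X \<times> mf_model X)" for q
      proof -
        have "q \<in> snd D ` fst D \<times> mf_model X" using q N'(2) by auto
        then have "q \<in> snd (tangent_chart X D) ` (fst D \<times> mf_model X)"
          using tangent_chart_image[OF X D order_refl] by blast
        then obtain y u where y: "y \<in> fst D" "u \<in> mf_model X" "q = snd (tangent_chart X D) (y, u)" by blast
        have yZ: "snd D y \<in> Z" using q y by auto
        note * = Z(3)[OF y(1) yZ y(2)]
        have "\<Phi> q \<in> N" using q by blast
        then have "snd (tangent_chart X C) (y, u) \<in> N" using * y(3) by metis
        moreover have "snd (tangent_chart X C) (y, u) \<in> mf_model X \<times> mf_model X"
          using dchart_in_model(1)[OF X C _ y(2)] chart_in_model[OF X C] * by simp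
        ultimately have "snd (tangent_chart X C) (y, u) \<in> (mf_model X \<times> mf_model X) \<inter> N" by blast
        then have mem: "snd (tangent_chart X C) (y, u) \<in> snd (tangent_chart X C) ` W" unfolding N(2) .
        have "(y, u) \<in> fst (tangent_chart X C)" using * y(2) by simp
        from iffD1[OF inj_on_image_mem_iff[OF tangent_chart_inj[OF X C] this W] mem]
        have "(y, u) \<in> W" .
        then show ?thesis unfolding y(3) by (rule imageI[OF IntI]) (use y(1,2) in simp)
      qed
      ultimately show ?thesis by blast
    qed
    have "\<forall>p\<in>?I. \<exists>T. openin (top_of_set (mf_model X \<times> mf_model X)) T \<and> p \<in> T \<and> T \<subseteq> ?I"
    proof (intro ballI)
      fix p assume p: "p \<in> ?I"
      obtain Z where Z: "open Z" "p \<in> Z" "Z \<inter> (mf_model X \<times> mf_model X) \<subseteq> ?I" using loc[OF p] by blast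
      have "p \<in> mf_model X \<times> mf_model X" using p chart_in_model[OF X D] dchart_in_model(1)[OF X D] by auto
      then show "\<exists>T. openin (top_of_set (mf_model X \<times> mf_model X)) T \<and> p \<in> T \<and> T \<subseteq> ?I"
        using Z by (intro exI[of _ "(mf_model X \<times> mf_model X) \<inter> Z"]) (auto simp: openin_open)
    qed
    then show "openin (top_of_set (mf_model X \<times> mf_model X)) ?I" using openin_subopen by blast
  qed
qed

lemma tangent_open:
  assumes X: "premanifold X" and C: "C \<in> mf_atlas X" and W: "openin (mf_top X) W" "W \<subseteq> fst C"
  shows "openin (mf_top (tangent_bundle X)) (W \<times> mf_model X)"
proof -
  have "openin (top_of_set (mf_model X \<times> mf_model X)) (snd C ` W \<times> mf_model X)"
    using chart_open_iff[OF X C W(2)] W(1) by (simp add: openin_Times)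
  then show ?thesis
    using tangent_chart_open_iff[OF X C, of "W \<times> mf_model X"] W tangent_chart_image[OF X C W(2)] by auto
qed

lemma pts_tangent_bundle [simp]:
  assumes X: "premanifold X" shows "pts (tangent_bundle X) = pts X \<times> mf_model X"
proof
  show "pts (tangent_bundle X) \<subseteq> pts X \<times> mf_model X"
    using openin_topspace[of "mf_top (tangent_bundle X)"] unfolding openin_tangent_bundle[OF X] by blast
  show "pts X \<times> mf_model X \<subseteq> pts (tangent_bundle X)"
  proof clarify
    fix x v assume x: "x \<in> pts X" and v: "v \<in> mf_model X"
    have "openin (mf_top (tangent_bundle X)) (fst (mf_chart_at X x) \<times> mf_model X)"
      by (rule tangent_open[OF X chart_at(1)[OF X x] chart_open[OF X chart_at(1)[OF X x]] order_refl])
    then show "(x, v) \<in> pts (tangent_bundle X)"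
      using chart_at(2)[OF X x] v openin_subset by blast
  qed
qed

lemma premanifold_tangent_bundle:
  assumes X: "premanifold X" shows "premanifold (tangent_bundle X)"
proof (rule premanifoldI)
  show "subspace (mf_model (tangent_bundle X))" using premanifold_subspace[OF X] by (simp add: subspace_Times)
next
  fix E assume "E \<in> mf_atlas (tangent_bundle X)"
  then obtain C where E: "E = tangent_chart X C" and C: "C \<in> mf_atlas X" by auto
  have op: "openin (mf_top (tangent_bundle X)) (fst C \<times> mf_model X)"
    by (rule tangent_open[OF X C chart_open[OF X C] order_refl])
  then show "openin (mf_top (tangent_bundle X)) (fst E) \<and>
      openin (top_of_set (mf_model (tangent_bundle X))) (snd E ` fst E) \<and> inj_on (snd E) (fst E) \<and>
      (\<forall>W. W \<subseteq> fst E \<longrightarrow> openin (mf_top (tangent_bundle X)) W =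
         openin (top_of_set (mf_model (tangent_bundle X))) (snd E ` W))"
    unfolding E using tangent_chart_open_iff[OF X C] tangent_chart_inj[OF X C] by auto
next
  fix E E' assume "E \<in> mf_atlas (tangent_bundle X)" "E' \<in> mf_atlas (tangent_bundle X)"
  then obtain C D where E: "E = tangent_chart X D" "E' = tangent_chart X C" and C: "C \<in> mf_atlas X" and D: "D \<in> mf_atlas X"
    by auto
  show "smooth_fun_on (snd E ` (fst E \<inter> fst E')) (snd E' \<circ> chart_inv E)"
    unfolding smooth_fun_on_def
  proof
    fix p assume "p \<in> snd E ` (fst E \<inter> fst E')"
    then obtain x v where x: "x \<in> fst C" "x \<in> fst D" and v: "v \<in> mf_model X" and p: "p = snd E (x, v)"
      unfolding E by auto
    obtain Z \<Phi> where Zo: "open Z" and Z: "snd D x \<in> Z" "Cinf_on (Z \<times> UNIV) \<Phi>"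
        "\<And>y v. y \<in> fst D \<Longrightarrow> snd D y \<in> Z \<Longrightarrow> v \<in> mf_model X \<Longrightarrow>
           y \<in> fst C \<and> \<Phi> (snd (tangent_chart X D) (y, v)) = snd (tangent_chart X C) (y, v)"
        using tangent_chart_change[OF X C D x] by metis
    have "\<Phi> q = (snd E' \<circ> chart_inv E) q" if q: "q \<in> snd E ` (fst E \<inter> fst E') \<inter> Z \<times> UNIV" for q
    proof -
      obtain y u where y: "y \<in> fst D" "u \<in> mf_model X" "q = snd E (y, u)" using q unfolding E by auto
      have "chart_inv E q = (y, u)" unfolding y(3) E using tangent_chart_inj[OF X D] y by (intro inv_into_f_f) auto
      then show ?thesis using Z(3)[of y u] y q unfolding E by auto
    qed
    then show "\<exists>U F. open U \<and> p \<in> U \<and> (\<forall>k. Ck_on k U F) \<and>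
         (\<forall>y\<in>snd E ` (fst E \<inter> fst E') \<inter> U. F y = (snd E' \<circ> chart_inv E) y)"
      using Z p unfolding Cinf_on_def E by (intro exI[of _ "Z \<times> UNIV"] exI[of _ \<Phi>]) auto
  qed
next
  fix p assume "p \<in> pts (tangent_bundle X)"
  then show "mf_chart_at (tangent_bundle X) p \<in> mf_atlas (tangent_bundle X) \<and> p \<in> fst (mf_chart_at (tangent_bundle X) p)"
    using chart_at[OF X] X by (cases p) auto
qed

lemma smooth_on_tangent_map:
  assumes X: "premanifold X" and Y: "premanifold Y" and f: "smooth_on A X Y f" and A: "openin (mf_top X) A"
  shows "smooth_on (A \<times> mf_model X) (tangent_bundle X) (tangent_bundle Y) (\<lambda>(x, v). (f x, dmap X Y f x v))"
proof (rule smooth_onI[OF premanifold_tangent_bundle[OF X]])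
  show "A \<times> mf_model X \<subseteq> pts (tangent_bundle X)" using A openin_subset X by auto
  fix p assume "p \<in> A \<times> mf_model X"
  then obtain x v where p: "p = (x, v)" and x: "x \<in> A" and v: "v \<in> mf_model X" by auto
  have xX: "x \<in> pts X" "f x \<in> pts Y" using x smooth_on_pts[OF f] smooth_on_image[OF Y f] by auto
  let ?C = "mf_chart_at X x" and ?D = "mf_chart_at Y (f x)"
  note C = chart_at[OF X xX(1)] and D = chart_at[OF Y xX(2)]
  obtain W U F where W: "openin (mf_top X) W" "x \<in> W" "W \<subseteq> A" "W \<subseteq> fst ?C" "f ` W \<subseteq> fst ?D"
    "Cinf_on U F" "snd ?C ` W \<subseteq> U" "\<And>y. y \<in> W \<Longrightarrow> F (snd ?C y) = snd ?D (f y)"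
    by (rule smooth_on_open_repE[OF X Y f x A C D]) blast
  have fa: "smooth_at X Y f y" if "y \<in> W" for y using smooth_atI[OF f A] that W(3) by blast
  have "local_rep (tangent_bundle X) (tangent_chart X ?C) (tangent_chart Y ?D) (A \<times> mf_model X)
      (\<lambda>(x, v). (f x, dmap X Y f x v)) p"
    unfolding local_rep_def
  proof (intro exI[of _ "W \<times> mf_model X"] exI[of _ "U \<times> UNIV"] exI[of _ "\<lambda>(z, v). (F z, frechet_derivative F (at z) v)"] conjI)
    show "openin (mf_top (tangent_bundle X)) (W \<times> mf_model X)" by (rule tangent_open[OF X C(1) W(1,4)])
    show "Cinf_on (U \<times> UNIV) (\<lambda>(z, v). (F z, frechet_derivative F (at z) v))" by (rule Cinf_on_tangent[OF W(6)])
    show "(\<lambda>(x, v). (f x, dmap X Y f x v)) ` (W \<times> mf_model X \<inter> A \<times> mf_model X) \<subseteq> fst (tangent_chart Y ?D)"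
      using W(5) dmap_in_model[OF X Y fa] by auto
    show "\<forall>x'\<in>W \<times> mf_model X \<inter> A \<times> mf_model X. (\<lambda>(z, v). (F z, frechet_derivative F (at z) v)) (snd (tangent_chart X ?C) x') =
       snd (tangent_chart Y ?D) ((\<lambda>(x, v). (f x, dmap X Y f x v)) x')"
      using dchart_map[OF X Y C(1) D(1) W(1,4,5) smooth_on_subset[OF X f W(3)] W(6-8)] W(8) by auto
  qed (use p v W in auto)
  then show "\<exists>C\<in>mf_atlas (tangent_bundle X). \<exists>D\<in>mf_atlas (tangent_bundle Y).
       local_rep (tangent_bundle X) C D (A \<times> mf_model X) (\<lambda>(x, v). (f x, dmap X Y f x v)) p"
    using C D by auto
qed

lemma smooth_on_tangent_base:
  assumes X: "premanifold X" and A: "A \<subseteq> pts X \<times> mf_model X"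
  shows "smooth_on A (tangent_bundle X) X fst"
proof (rule smooth_onI[OF premanifold_tangent_bundle[OF X]])
  fix p assume "p \<in> A"
  then obtain x v where p: "p = (x, v)" and x: "x \<in> pts X" and v: "v \<in> mf_model X" using A by auto
  let ?C = "mf_chart_at X x"
  note C = chart_at[OF X x]
  have "local_rep (tangent_bundle X) (tangent_chart X ?C) ?C A fst p"
    unfolding local_rep_def using tangent_open[OF X C(1) chart_open[OF X C(1)] order_refl] p v C
    by (intro exI[of _ "fst ?C \<times> mf_model X"] exI[of _ UNIV] exI[of _ fst]) (auto intro: Cinf_on_linear linear_fst)
  then show "\<exists>C\<in>mf_atlas (tangent_bundle X). \<exists>D\<in>mf_atlas X. local_rep (tangent_bundle X) C D A fst p"
    using C by auto
qed (use A X in auto)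

lemma dchart_prod:
  assumes X: "premanifold X" and Y: "premanifold Y" and C: "C \<in> mf_atlas X" "x \<in> fst C" and D: "D \<in> mf_atlas Y" "y \<in> fst D"
    and v: "v \<in> mf_model X" and w: "w \<in> mf_model Y"
  shows "dmap (prod_manifold X Y) (vec_manifold (mf_model X \<times> mf_model Y)) (snd (prod_chart C D)) (x, y) (v, w) =
     (dmap X (vec_manifold (mf_model X)) (snd C) x v, dmap Y (vec_manifold (mf_model Y)) (snd D) y w)"
proof -
  let ?VX = "vec_manifold (mf_model X)" and ?VY = "vec_manifold (mf_model Y)" and ?Z = "prod_manifold X Y"
  note VX = premanifold_vec[OF premanifold_subspace[OF X]] and VY = premanifold_vec[OF premanifold_subspace[OF Y]]
  note Z = premanifold_prod[OF X Y]
  have xy: "(x, y) \<in> pts X \<times> pts Y" using C D chart_subset[OF X C(1)] chart_subset[OF Y D(1)] by auto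
  note f = smooth_at_fst[OF X Y xy] and s = smooth_at_snd[OF X Y xy]
  have Cf: "smooth_at X ?VX (snd C) (fst (x, y))" and Ds: "smooth_at Y ?VY (snd D) (snd (x, y))"
    using chart_smooth_at[OF X C] chart_smooth_at[OF Y D] by auto
  have vw: "(v, w) \<in> mf_model ?Z" "(v, w) \<in> mf_model X \<times> mf_model Y" using v w by auto
  have "dmap ?Z (vec_manifold (mf_model X \<times> mf_model Y)) (snd (prod_chart C D)) (x, y) (v, w) =
      dmap ?Z (prod_manifold ?VX ?VY) (\<lambda>p. (snd C (fst p), snd D (snd p))) (x, y) (v, w)"
    unfolding dmap_def by (simp add: prod_chart_def map_prod_def case_prod_beta' prod_manifold_def)
  also have "\<dots> = (dmap ?Z ?VX (\<lambda>p. snd C (fst p)) (x, y) (v, w), dmap ?Z ?VY (\<lambda>p. snd D (snd p)) (x, y) (v, w))"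
    by (rule dmap_Pair[OF Z VX VY smooth_at_compose[OF Z X f Cf] smooth_at_compose[OF Z Y s Ds] vw(1)])
  also have "\<dots> = (dmap X ?VX (snd C) x v, dmap Y ?VY (snd D) y w)"
    using dmap_compose[OF Z X VX f Cf vw(1)] dmap_compose[OF Z Y VY s Ds vw(1)]
      dmap_fst[OF X Y xy vw(2)] dmap_snd[OF X Y xy vw(2)] by simp
  finally show ?thesis .
qed

text \<open>The tangent bundle of a product is the product of the tangent bundles up to the order of
  coordinates, and \<open>?H\<close> is this reordering. It is used to assemble a value of
  \<open>P\<close> and a vector tangent to \<open>M\<close> into one vector tangent to
  \<open>E \<times> M\<close>.\<close>

lemma smooth_on_tangent_Pair:
  fixes X :: "('a, 'c::euclidean_space) manifold" and Y :: "('b, 'd::euclidean_space) manifold"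
  assumes Z: "premanifold Z" and X: "premanifold X" and Y: "premanifold Y"
    and f: "smooth_on A Z (tangent_bundle X) (\<lambda>z. (f z, f' z))" and g: "smooth_on A Z (tangent_bundle Y) (\<lambda>z. (g z, g' z))"
  shows "smooth_on A Z (tangent_bundle (prod_manifold X Y)) (\<lambda>z. ((f z, g z), (f' z, g' z)))"
proof (rule smooth_onI[OF Z smooth_on_pts[OF f]])
  fix z assume z: "z \<in> A"
  note TX = premanifold_tangent_bundle[OF X] and TY = premanifold_tangent_bundle[OF Y]
  have zZ: "z \<in> pts Z" using z smooth_on_pts[OF f] by auto
  have fz: "f z \<in> pts X" "f' z \<in> mf_model X" and gz: "g z \<in> pts Y" "g' z \<in> mf_model Y"
    using z smooth_on_image[OF TX f] smooth_on_image[OF TY g] X Y by auto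
  let ?B = "mf_chart_at Z z" and ?C = "mf_chart_at X (f z)" and ?D = "mf_chart_at Y (g z)"
  note B = chart_at[OF Z zZ] and C = chart_at[OF X fz(1)] and D = chart_at[OF Y gz(1)]
  obtain W U F where W: "openin (mf_top Z) W" "z \<in> W" "W \<subseteq> fst ?B" "(\<lambda>z. (f z, f' z)) ` (W \<inter> A) \<subseteq> fst (tangent_chart X ?C)"
      "Cinf_on U F" "snd ?B ` W \<subseteq> U" "\<And>x'. x' \<in> W \<inter> A \<Longrightarrow> F (snd ?B x') = snd (tangent_chart X ?C) (f x', f' x')"
    by (rule local_repE[OF smooth_on_local_rep[OF Z TX f z B, of "tangent_chart X ?C"]]) (use C fz in auto)
  obtain W' U' F' where W': "openin (mf_top Z) W'" "z \<in> W'" "W' \<subseteq> fst ?B" "(\<lambda>z. (g z, g' z)) ` (W' \<inter> A) \<subseteq> fst (tangent_chart Y ?D)"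
      "Cinf_on U' F'" "snd ?B ` W' \<subseteq> U'" "\<And>x'. x' \<in> W' \<inter> A \<Longrightarrow> F' (snd ?B x') = snd (tangent_chart Y ?D) (g x', g' x')"
    by (rule local_repE[OF smooth_on_local_rep[OF Z TY g z B, of "tangent_chart Y ?D"]]) (use D gz in auto)
  have op: "open (U \<inter> U')" by (intro open_Int Cinf_on_open[OF W(5)] Cinf_on_open[OF W'(5)])
  let ?H = "\<lambda>(p :: ('c \<times> 'c) \<times> 'd \<times> 'd). ((fst (fst p), fst (snd p)), (snd (fst p), snd (snd p)))"
  have lin: "linear ?H" by (rule linearI) auto
  have H: "Cinf_on (U \<inter> U') (\<lambda>z. ?H (F z, F' z))"
    by (rule Cinf_on_linear_comp[OF lin Cinf_on_Pair[OF Cinf_on_subset[OF W(5) op] Cinf_on_subset[OF W'(5) op]]]) auto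
  have "local_rep Z ?B (tangent_chart (prod_manifold X Y) (prod_chart ?C ?D)) A (\<lambda>z. ((f z, g z), (f' z, g' z))) z"
    unfolding local_rep_def
  proof (intro exI[of _ "W \<inter> W'"] exI[of _ "U \<inter> U'"] exI[of _ "\<lambda>z. ?H (F z, F' z)"] conjI)
    show "\<forall>x'\<in>W \<inter> W' \<inter> A. ?H (F (snd ?B x'), F' (snd ?B x')) =
       snd (tangent_chart (prod_manifold X Y) (prod_chart ?C ?D)) ((f x', g x'), f' x', g' x')"
    proof
      fix y assume y: "y \<in> W \<inter> W' \<inter> A"
      have m: "f y \<in> fst ?C" "f' y \<in> mf_model X" "g y \<in> fst ?D" "g' y \<in> mf_model Y"
        using y W(4) W'(4) by auto
      show "?H (F (snd ?B y), F' (snd ?B y)) =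
       snd (tangent_chart (prod_manifold X Y) (prod_chart ?C ?D)) ((f y, g y), f' y, g' y)"
        using W(7)[of y] W'(7)[of y] y dchart_prod[OF X Y C(1) m(1) D(1) m(3,2,4)] by simp
    qed
  qed (use W W' H in auto)
  then show "\<exists>C\<in>mf_atlas Z. \<exists>D\<in>mf_atlas (tangent_bundle (prod_manifold X Y)). local_rep Z C D A (\<lambda>z. ((f z, g z), (f' z, g' z))) z"
    using B(1) prod_chart_in_atlas[OF C(1) D(1)] unfolding tangent_bundle_simps by blast
qed

section \<open>Maps with smooth local sections\<close>

text \<open>A working substitute for surjective submersions: descent of smooth maps requires one
  smooth local section around each point of the target.\<close>

definition has_sections ::
  "('a, 'c::euclidean_space) manifold \<Rightarrow> ('b, 'd::euclidean_space) manifold \<Rightarrow> ('a \<Rightarrow> 'b) \<Rightarrow> bool" where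
  "has_sections X Y p \<longleftrightarrow> (\<forall>y\<in>pts Y. \<exists>V s. openin (mf_top Y) V \<and> y \<in> V \<and> smooth_on V Y X s \<and> (\<forall>y\<in>V. p (s y) = y))"

lemma has_sectionsE:
  assumes "has_sections X Y p" "y \<in> pts Y"
  obtains V s where "openin (mf_top Y) V" "y \<in> V" "smooth_on V Y X s" "\<And>y. y \<in> V \<Longrightarrow> p (s y) = y"
proof -
  obtain V s where "openin (mf_top Y) V \<and> y \<in> V \<and> smooth_on V Y X s \<and> (\<forall>y\<in>V. p (s y) = y)"
    using bspec[OF assms(1)[unfolded has_sections_def] assms(2)] by (elim exE)
  then show ?thesis by (intro that[of V s]) auto
qed

text \<open>Locally \<open>f\<close> is \<open>f \<circ> p\<close> composed with a section of
  \<open>p\<close>, and both factors are smooth.\<close>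

lemma smooth_on_descend:
  assumes X: "premanifold X" and Y: "premanifold Y" and p: "has_sections X Y p" and V: "openin (mf_top Y) V"
    and f: "smooth_on {x \<in> pts X. p x \<in> V} X Z (\<lambda>x. f (p x))"
  shows "smooth_on V Y Z f"
proof (rule smooth_on_local[OF Y])
  fix y assume y: "y \<in> V"
  then have "y \<in> pts Y" using V openin_subset by blast
  then obtain U s where U: "openin (mf_top Y) U" "y \<in> U" "smooth_on U Y X s" "\<And>y. y \<in> U \<Longrightarrow> p (s y) = y"
    by (rule has_sectionsE[OF p]) metis
  have "smooth_on (V \<inter> U) Y Z (\<lambda>y. f (p (s y)))"
    by (rule smooth_on_compose[OF Y X smooth_on_subset[OF Y U(3)] f])
       (use smooth_on_image[OF X U(3)] U(4) in auto)
  then have "smooth_on (V \<inter> U) Y Z f" by (rule smooth_on_cong[OF Y]) (use U(4) in simp)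
  then show "\<exists>W. openin (mf_top Y) W \<and> y \<in> W \<and> smooth_on (V \<inter> W) Y Z f" using U by blast
qed

section \<open>Lie groups and smooth actions\<close>

locale lie =
  fixes G :: "'g monoid" (structure) and GM :: "('g, 'cg::euclidean_space) manifold"
  assumes lie_group: "lie_group G GM"
begin

lemma is_group: "group G" and GM_manifold: "smooth_manifold GM" and pts_GM: "pts GM = carrier G"
  using lie_group by (auto simp: lie_group_def)

lemma GM: "premanifold GM" using GM_manifold smooth_manifold_premanifold by blast

sublocale group G by (rule is_group)

lemma smooth_on_mult:
  assumes Z: "premanifold Z" and f: "smooth_on A Z GM f" and g: "smooth_on A Z GM g"
  shows "smooth_on A Z GM (\<lambda>z. f z \<otimes> g z)"
proof -
  have "smooth_on (pts (prod_manifold GM GM)) (prod_manifold GM GM) GM (\<lambda>(g, h). g \<otimes> h)"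
    using lie_group unfolding lie_group_def smooth_map_def by (elim conjE) assumption
  from smooth_on_compose[OF Z premanifold_prod[OF GM GM] smooth_on_Pair[OF Z GM GM f g] this]
  show ?thesis using smooth_on_image[OF GM f] smooth_on_image[OF GM g] by auto
qed

lemma smooth_on_m_inv:
  assumes Z: "premanifold Z" and f: "smooth_on A Z GM f"
  shows "smooth_on A Z GM (\<lambda>z. inv (f z))"
proof -
  have "smooth_on (pts GM) GM GM (\<lambda>g. inv g)"
    using lie_group unfolding lie_group_def smooth_map_def by (elim conjE) assumption
  from smooth_on_compose[OF Z GM f this] show ?thesis using smooth_on_image[OF GM f] by auto
qed

end

locale smooth_action = lie G GM for G :: "'g monoid" (structure) and GM :: "('g, 'cg::euclidean_space) manifold" +
  fixes X :: "('a, 'c::euclidean_space) manifold" and a :: "'g \<Rightarrow> 'a \<Rightarrow> 'a"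
  assumes X: "premanifold X" and action: "smooth_left_action G GM X a"
begin

lemma group_action: "group_action G (pts X) a" using action by (simp add: smooth_left_action_def)

lemma act_closed: "g \<in> carrier G \<Longrightarrow> x \<in> pts X \<Longrightarrow> a g x \<in> pts X"
  using group_action.element_image[OF group_action] by blast

lemma act_mult: "g \<in> carrier G \<Longrightarrow> h \<in> carrier G \<Longrightarrow> x \<in> pts X \<Longrightarrow> a (g \<otimes> h) x = a g (a h x)"
  using group_action.composition_rule[OF group_action] by blast

lemma act_one: "x \<in> pts X \<Longrightarrow> a \<one> x = x"
  using group_action.id_eq_one[OF group_action] by (metis restrict_apply')

lemma act_inv:
  assumes "g \<in> carrier G" "x \<in> pts X" shows "a (inv g) (a g x) = x" "a g (a (inv g) x) = x"
  using act_mult[of "inv g" g x] act_mult[of g "inv g" x] assms act_one by auto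

lemma orbit_eq_iff:
  assumes "x \<in> pts X" "y \<in> pts X"
  shows "orbit G a x = orbit G a y \<longleftrightarrow> (\<exists>g\<in>carrier G. a g x = y)"
proof
  assume "orbit G a x = orbit G a y"
  then have "y \<in> orbit G a x" using group_action.orbit_refl[OF group_action assms(2)] by simp
  then show "\<exists>g\<in>carrier G. a g x = y" unfolding orbit_def by blast
next
  assume "\<exists>g\<in>carrier G. a g x = y"
  then obtain g where g: "g \<in> carrier G" "a g x = y" by blast
  show "orbit G a x = orbit G a y"
    unfolding orbit_def
  proof (intro Set.set_eqI iffI; clarify)
    fix h assume h: "h \<in> carrier G"
    have "a h x = a (h \<otimes> inv g) y"
      using act_mult[of h "inv g" y] act_inv(1)[OF g(1) assms(1)] g h assms by simp
    then show "\<exists>k. a h x = a k y \<and> k \<in> carrier G" using g h by blast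
    have "a h y = a (h \<otimes> g) x" using act_mult[of h g x] g h assms by simp
    then show "\<exists>k. a h y = a k x \<and> k \<in> carrier G" using g h by blast
  qed
qed

lemma orbit_act: "g \<in> carrier G \<Longrightarrow> x \<in> pts X \<Longrightarrow> orbit G a (a g x) = orbit G a x"
  using orbit_eq_iff act_closed by metis

lemma orbit_mem: "x \<in> pts X \<Longrightarrow> x \<in> orbit G a x"
  using group_action.orbit_refl[OF group_action] .

lemma orbitE:
  assumes "y \<in> orbit G a x" obtains g where "g \<in> carrier G" "y = a g x"
  using assms unfolding orbit_def by blast

lemma smooth_on_act:
  assumes Z: "premanifold Z" and g: "smooth_on A Z GM \<gamma>" and f: "smooth_on A Z X f"
  shows "smooth_on A Z X (\<lambda>z. a (\<gamma> z) (f z))"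
proof -
  have "smooth_on (pts (prod_manifold GM X)) (prod_manifold GM X) X (\<lambda>(g, x). a g x)"
    using action by (simp add: smooth_left_action_def smooth_map_def)
  from smooth_on_compose[OF Z premanifold_prod[OF GM X] smooth_on_Pair[OF Z GM X g f] this]
  show ?thesis using smooth_on_image[OF GM g] smooth_on_image[OF X f] by auto
qed

lemma smooth_on_act_const:
  assumes Z: "premanifold Z" and g: "g \<in> carrier G" and f: "smooth_on A Z X f"
  shows "smooth_on A Z X (\<lambda>z. a g (f z))"
  by (rule smooth_on_act[OF Z smooth_on_const[OF Z smooth_on_pts[OF f] GM] f]) (use g pts_GM in simp)

lemma act_smooth_at: "g \<in> carrier G \<Longrightarrow> x \<in> pts X \<Longrightarrow> smooth_at X X (a g) x"
  using smooth_on_act_const[OF X _ smooth_on_ident[OF X order_refl]] by (intro smooth_atI) auto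

section \<open>Topology and charts of the orbit space\<close>

abbreviation proj :: "'a \<Rightarrow> 'a set" where "proj \<equiv> orbit G a"
abbreviation Q :: "('a set, 'c) manifold" where "Q \<equiv> quotient_manifold G GM X a"

lemma quotient_simps:
  "mf_top Q = quotient_top G (mf_top X) a" "mf_model Q = quotient_model X GM"
  "mf_atlas Q = quotient_atlas G GM X a"
  by (simp_all add: quotient_manifold_def)

lemma openin_quotient:
  "openin (mf_top Q) W \<longleftrightarrow> W \<subseteq> orbits G (pts X) a \<and> openin (mf_top X) {x \<in> pts X. proj x \<in> W}"
proof -
  let ?P = "\<lambda>W. W \<subseteq> orbits G (pts X) a \<and> openin (mf_top X) {x \<in> pts X. proj x \<in> W}"
  have "istopology ?P"
    unfolding istopology_def
  proof (intro conjI allI impI)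
    fix S T assume "?P S" "?P T"
    moreover have "{x \<in> pts X. proj x \<in> S \<inter> T} = {x \<in> pts X. proj x \<in> S} \<inter> {x \<in> pts X. proj x \<in> T}" by auto
    ultimately show "S \<inter> T \<subseteq> orbits G (pts X) a" "openin (mf_top X) {x \<in> pts X. proj x \<in> S \<inter> T}" by auto
  next
    fix K assume K: "\<forall>S\<in>K. ?P S"
    then show "\<Union>K \<subseteq> orbits G (pts X) a" by auto
    have eq: "{x \<in> pts X. proj x \<in> \<Union>K} = \<Union>((\<lambda>S. {x \<in> pts X. proj x \<in> S}) ` K)" by auto
    show "openin (mf_top X) {x \<in> pts X. proj x \<in> \<Union>K}" unfolding eq using K by (intro openin_Union) auto
  qed
  then show ?thesis by (simp add: quotient_simps quotient_top_def topology_inverse')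
qed

lemma pts_quotient: "pts Q = proj ` pts X"
proof -
  have "openin (mf_top Q) (proj ` pts X)"
  proof -
    have "{x \<in> pts X. proj x \<in> proj ` pts X} = pts X" by blast
    then show ?thesis unfolding openin_quotient orbits_def by auto
  qed
  moreover have "pts Q \<subseteq> proj ` pts X"
    using openin_topspace[of "mf_top Q"] unfolding openin_quotient orbits_def by blast
  ultimately show ?thesis using openin_subset by blast
qed

lemma orbits_eq: "orbits G (pts X) a = pts Q"
  unfolding pts_quotient orbits_def by blast

lemma openin_quotient_vimage: "openin (mf_top Q) W \<Longrightarrow> openin (mf_top X) {x \<in> pts X. proj x \<in> W}"
  by (simp add: openin_quotient)

text \<open>The saturation of \<open>U\<close> is the union of its translates, each of which is
  open.\<close>

lemma openin_proj_image:
  assumes U: "openin (mf_top X) U" shows "openin (mf_top Q) (proj ` U)"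
proof -
  have UX: "U \<subseteq> pts X" using U openin_subset by blast
  have "{x \<in> pts X. proj x \<in> proj ` U} = \<Union>((\<lambda>g. {x \<in> pts X. a g x \<in> U}) ` carrier G)"
  proof (intro Set.set_eqI iffI)
    fix x assume "x \<in> {x \<in> pts X. proj x \<in> proj ` U}"
    then obtain u where "x \<in> pts X" "u \<in> U" "proj x = proj u" by auto
    then show "x \<in> \<Union>((\<lambda>g. {x \<in> pts X. a g x \<in> U}) ` carrier G)"
      using orbit_eq_iff[of x u] UX by blast
  next
    fix x assume "x \<in> \<Union>((\<lambda>g. {x \<in> pts X. a g x \<in> U}) ` carrier G)"
    then obtain g where "g \<in> carrier G" "x \<in> pts X" "a g x \<in> U" by auto
    then show "x \<in> {x \<in> pts X. proj x \<in> proj ` U}" using orbit_act[of g x] by (metis (mono_tags, lifting) imageI mem_Collect_eq)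
  qed
  moreover have "openin (mf_top X) {x \<in> pts X. a g x \<in> U}" if "g \<in> carrier G" for g
    by (rule smooth_on_openin_vimage[OF X X smooth_on_act_const[OF X that smooth_on_ident[OF X order_refl]] _ U]) simp
  ultimately have "openin (mf_top X) {x \<in> pts X. proj x \<in> proj ` U}" by (simp only:) (intro openin_Union, auto)
  then show ?thesis unfolding openin_quotient orbits_def using UX by auto
qed

text \<open>Second countability passes along continuous open surjections.\<close>

lemma second_countable_quotient:
  assumes "second_countable (mf_top X)" shows "second_countable (mf_top Q)"
proof (rule second_countable_open_map_image[OF _ _ _ assms])
  show "continuous_map (mf_top X) (mf_top Q) proj"
    unfolding continuous_map using pts_quotient openin_quotient_vimage by auto
  show "open_map (mf_top X) (mf_top Q) proj" unfolding open_map_def using openin_proj_image by blast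
  show "proj ` pts X = pts Q" using pts_quotient by simp
qed

text \<open>The choice in \<open>quotient_model\<close> cannot fail: truncated subtraction keeps the
  required dimension at most that of the model space of \<open>X\<close>.\<close>

lemma quotient_model:
  "subspace (quotient_model X GM)" "quotient_model X GM \<subseteq> mf_model X"
  "dim (quotient_model X GM) = dim (mf_model X) - dim (mf_model GM)"
proof -
  have "dim (mf_model X) - dim (mf_model GM) \<le> dim (mf_model X)" by simp
  then obtain V where "subspace V" "V \<subseteq> span (mf_model X)" "dim V = dim (mf_model X) - dim (mf_model GM)"
    by (rule choose_subspace_of_subspace)
  moreover have "span (mf_model X) = mf_model X" using premanifold_subspace[OF X] span_eq_iff by blast
  ultimately have "\<exists>V. subspace V \<and> V \<subseteq> mf_model X \<and> dim V = dim (mf_model X) - dim (mf_model GM)" by metis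
  from someI_ex[OF this]
  show "subspace (quotient_model X GM)" "quotient_model X GM \<subseteq> mf_model X"
    "dim (quotient_model X GM) = dim (mf_model X) - dim (mf_model GM)"
    unfolding quotient_model_def by auto
qed

abbreviation VQ :: "('c, 'c) manifold" where "VQ \<equiv> vec_manifold (quotient_model X GM)"

lemma VQ: "premanifold VQ" by (rule premanifold_vec[OF quotient_model(1)])

lemma quotient_atlas_iff:
  "C \<in> quotient_atlas G GM X a \<longleftrightarrow>
     openin (mf_top Q) (fst C) \<and> openin (top_of_set (quotient_model X GM)) (snd C ` fst C) \<and>
     inj_on (snd C) (fst C) \<and>
     (\<forall>W. W \<subseteq> fst C \<longrightarrow> (openin (mf_top Q) W \<longleftrightarrow> openin (top_of_set (quotient_model X GM)) (snd C ` W))) \<and>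
     smooth_on {x \<in> pts X. proj x \<in> fst C} X VQ (\<lambda>x. snd C (proj x)) \<and>
     (\<forall>x \<in> pts X. proj x \<in> fst C \<longrightarrow> dmap X VQ (\<lambda>x. snd C (proj x)) x ` mf_model X = quotient_model X GM)"
  unfolding quotient_atlas_def Let_def quotient_simps
  using homeo_top_of_set_iff[of "quotient_top G (mf_top X) a" "fst C" "quotient_model X GM" "snd C"]
  by (cases C) (auto simp: o_def)

text \<open>A section of the projection, written over the coordinate image of \<open>C\<close>. Only
  a vector space and \<open>X\<close> carry the smoothness condition, so it makes sense before the
  orbit space is known to be a manifold.\<close>

definition chart_section :: "('a set, 'c) chart \<Rightarrow> ('c \<Rightarrow> 'a) \<Rightarrow> bool" where
  "chart_section C s \<longleftrightarrow> smooth_on (snd C ` fst C) VQ X s \<and>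
     (\<forall>z \<in> snd C ` fst C. proj (s z) \<in> fst C \<and> snd C (proj (s z)) = z)"

text \<open>In finite dimension a right inverse of \<open>L\<close> on \<open>V\<close> is
  injective, hence onto \<open>V\<close>, so that \<open>v\<close> lies in its range.\<close>

lemma linear_subspace_surj_inj:
  fixes L :: "'c \<Rightarrow> 'c"
  assumes "linear L" "subspace V" "L ` V = V" "v \<in> V" "L v = 0"
  shows "v = 0"
proof -
  obtain K where K: "range K \<subseteq> V" "linear K" "\<And>v. v \<in> V \<Longrightarrow> L (K v) = v"
    using linear_exists_right_inverse_on[OF assms(1,2)] assms(3) by auto
  have "inj_on K (span V)" using K(3) assms(2) by (metis inj_onI span_eq_iff)
  then have "dim (K ` V) = dim V" by (rule dim_image_eq[OF K(2)])
  then have "K ` V = V"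
    using K(1) by (intro subspace_dim_equal linear_subspace_image K(2) assms(2)) auto
  then obtain w where "w \<in> V" "v = K w" using assms(4) by blast
  then show ?thesis using K(2,3) assms(5) linear_0 by metis
qed

text \<open>A subspace carries a single chart, so smoothness between subspaces unfolds to the
  extendability demanded of chart changes.\<close>

lemma smooth_on_vec_smooth_fun_on:
  assumes V: "subspace V" "subspace V'" and f: "smooth_on A (vec_manifold V) (vec_manifold V') f"
  shows "smooth_fun_on A f"
  unfolding smooth_fun_on_def
proof
  fix x assume x: "x \<in> A"
  have A: "A \<subseteq> V" using smooth_on_pts[OF f] by simp
  have fx: "f x \<in> V'" using smooth_on_image[OF premanifold_vec[OF V(2)] f] x by auto
  have "local_rep (vec_manifold V) (V, id) (V', id) A f x"
    by (rule smooth_on_local_rep[OF premanifold_vec[OF V(1)] premanifold_vec[OF V(2)] f x]) (use A x fx in auto)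
  then obtain W U F where W: "openin (top_of_set V) W" "x \<in> W" "Cinf_on U F" "W \<subseteq> U" "\<And>y. y \<in> W \<inter> A \<Longrightarrow> F y = f y"
    unfolding local_rep_def by auto
  obtain N where N: "open N" "W = V \<inter> N" using W(1) by (metis openin_open)
  have op: "open (U \<inter> N)" using N Cinf_on_open[OF W(3)] by blast
  have "Cinf_on (U \<inter> N) F" by (rule Cinf_on_subset[OF W(3) op]) auto
  then show "\<exists>U F. open U \<and> x \<in> U \<and> (\<forall>k. Ck_on k U F) \<and> (\<forall>y\<in>A \<inter> U. F y = f y)"
    unfolding Cinf_on_def by (intro exI[of _ "U \<inter> N"] exI[of _ F]) (use W N A in auto)
qed

text \<open>If around each point there is a chart with a smooth section, then any other chart is compatible
  with it by the inverse function theorem.\<close>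

lemma quotient_charts_compatible:
  assumes C: "C \<in> quotient_atlas G GM X a" and D: "D \<in> quotient_atlas G GM X a"
    and sec: "\<And>q. q \<in> pts Q \<Longrightarrow> \<exists>C s. C \<in> quotient_atlas G GM X a \<and> q \<in> fst C \<and> chart_section C s"
  shows "smooth_fun_on (snd C ` (fst C \<inter> fst D)) (snd D \<circ> chart_inv C)"
  unfolding smooth_fun_on_def
proof
  let ?V = "quotient_model X GM"
  note C' = C[unfolded quotient_atlas_iff] and D' = D[unfolded quotient_atlas_iff]
  fix z assume "z \<in> snd C ` (fst C \<inter> fst D)"
  then obtain q where q: "q \<in> fst C" "q \<in> fst D" "z = snd C q" by auto
  have qQ: "q \<in> pts Q" using q(1) openin_subset[OF conjunct1[OF C']] by blast
  obtain N s where N: "N \<in> quotient_atlas G GM X a" "q \<in> fst N" and cs: "chart_section N s" using sec[OF qQ] by blast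
  note N' = N(1)[unfolded quotient_atlas_iff]
  note op = conjunct1[OF C'] conjunct1[OF D'] conjunct1[OF N']
  have s: "smooth_on (snd N ` fst N) VQ X s" and ps: "\<And>z. z \<in> snd N ` fst N \<Longrightarrow> proj (s z) \<in> fst N \<and> snd N (proj (s z)) = z"
    using cs by (auto simp: chart_section_def)
  define w0 where "w0 = snd N q"
  have injN: "inj_on (snd N) (fst N)" and injC: "inj_on (snd C) (fst C)" using N' C' by auto
  have psN: "proj (s (snd N r)) = r" if "r \<in> fst N" for r
    using ps[of "snd N r"] injN that by (meson imageI inj_onD)
  have CD: "openin (mf_top Q) (fst C \<inter> fst D)" using op by blast
  \<comment> \<open>\<open>B\<close> is the common domain of \<open>C\<close> and \<open>D\<close>
    inside the chart \<open>N\<close>, in coordinates of \<open>N\<close>. Through the section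
    \<open>s\<close> both charts become functions of these coordinates.\<close>
  define B where "B = {w \<in> snd N ` fst N. s w \<in> {x \<in> pts X. proj x \<in> fst C \<inter> fst D}}"
  have opN: "openin (top_of_set ?V) (snd N ` fst N)" using N' by auto
  have B: "openin (mf_top VQ) B"
    unfolding B_def by (rule smooth_on_openin_vimage[OF VQ X s _ openin_quotient_vimage[OF CD]]) (use opN in simp)
  have sX: "s w \<in> pts X" if "w \<in> snd N ` fst N" for w using smooth_on_image[OF X s] that by auto
  have w0: "w0 \<in> snd N ` fst N" "proj (s w0) = q" using N(2) psN unfolding w0_def by auto
  then have w0B: "w0 \<in> B" using q sX unfolding B_def by auto
  have sB: "smooth_on B VQ X s" by (rule smooth_on_subset[OF VQ s]) (auto simp: B_def)
  have smC: "smooth_on {x \<in> pts X. proj x \<in> fst C} X VQ (\<lambda>x. snd C (proj x))"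
    and smD: "smooth_on {x \<in> pts X. proj x \<in> fst D} X VQ (\<lambda>x. snd D (proj x))"
    and smN: "smooth_on {x \<in> pts X. proj x \<in> fst N} X VQ (\<lambda>x. snd N (proj x))"
    using C' D' N' by auto
  have h1: "smooth_on B VQ VQ (\<lambda>w. snd C (proj (s w)))" and h2: "smooth_on B VQ VQ (\<lambda>w. snd D (proj (s w)))"
    by (rule smooth_on_compose[OF VQ X sB smC], force simp: B_def)
       (rule smooth_on_compose[OF VQ X sB smD], force simp: B_def)
  have h1at: "smooth_at VQ VQ (\<lambda>w. snd C (proj (s w))) w0" by (rule smooth_atI[OF h1 B w0B])
  obtain L where L: "linear L" "\<And>v. v \<in> ?V \<Longrightarrow> dmap VQ VQ (\<lambda>w. snd C (proj (s w))) w0 v = L v" "\<And>v. v \<in> ?V \<Longrightarrow> L v \<in> ?V"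
    using dmap_linear[OF VQ VQ h1at] by (metis vec_manifold_simps(3))
  have Nat: "smooth_at X VQ (\<lambda>x. snd N (proj x)) (s w0)"
    by (rule smooth_atI[OF smN]) (use op(3) N(2) w0 sX openin_quotient_vimage in auto)
  \<comment> \<open>\<open>snd C\<close> composed with \<open>proj\<close> is a submersion and near
    \<open>s w0\<close> factors through the coordinates of \<open>N\<close>, so the remaining factor
    has a surjective differential; by dimension it is then injective.\<close>
  have "L ` ?V = ?V"
  proof
    show "L ` ?V \<subseteq> ?V" using L(3) by blast
    show "?V \<subseteq> L ` ?V"
    proof
      fix u assume "u \<in> ?V"
      then obtain v where v: "v \<in> mf_model X" "u = dmap X VQ (\<lambda>x. snd C (proj x)) (s w0) v"
        using C' w0 q sX[OF w0(1)] by blast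
      let ?O = "{x \<in> pts X. proj x \<in> fst N \<inter> fst C}"
      have "u = dmap X VQ (\<lambda>x. snd C (proj (s (snd N (proj x))))) (s w0) v"
        unfolding v(2) by (rule dmap_cong[OF X, of ?O])
          (use openin_quotient_vimage[OF openin_Int[OF op(3,1)]] N(2) q w0 sX v(1) psN in auto)
      also have "\<dots> = dmap VQ VQ (\<lambda>w. snd C (proj (s w))) (snd N (proj (s w0))) (dmap X VQ (\<lambda>x. snd N (proj x)) (s w0) v)"
        by (rule dmap_compose[OF X VQ VQ Nat _ v(1)]) (use h1at w0 in \<open>simp add: w0_def\<close>)
      also have "\<dots> = L (dmap X VQ (\<lambda>x. snd N (proj x)) (s w0) v)"
        using L(2) dmap_in_model[OF X VQ Nat v(1)] w0 by (simp add: w0_def)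
      finally show "u \<in> L ` ?V" using dmap_in_model[OF X VQ Nat v(1)] by simp
    qed
  qed
  then have "v = 0" if "v \<in> mf_model VQ" "dmap VQ VQ (\<lambda>w. snd C (proj (s w))) w0 v = 0" for v
    using linear_subspace_surj_inj[OF L(1) quotient_model(1)] L(2) that by simp
  from inverse_function_manifold[OF VQ VQ h1 B w0B refl this]
  obtain W V1 where W: "openin (mf_top VQ) W" "w0 \<in> W" "W \<subseteq> B" "openin (mf_top VQ) V1"
    and d: "diffeo_on W VQ V1 VQ (\<lambda>w. snd C (proj (s w)))" by metis
  let ?g = "inv_into W (\<lambda>w. snd C (proj (s w)))"
  have bij: "bij_betw (\<lambda>w. snd C (proj (s w))) W V1" and g: "smooth_on V1 VQ VQ ?g"
    using d by (auto simp: diffeo_on_def)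
  have gW: "?g y \<in> W" "snd C (proj (s (?g y))) = y" if "y \<in> V1" for y
    using bij_betw_inv_into_right[OF bij that] inv_into_into[of y "\<lambda>w. snd C (proj (s w))" W] that
      bij_betw_imp_surj_on[OF bij] by auto
  \<comment> \<open>The change from \<open>C\<close> to \<open>D\<close> passes through the
    coordinates of \<open>N\<close>: first the local inverse \<open>?g\<close>, then the expression
    of \<open>D\<close> in these coordinates.\<close>
  have "smooth_on V1 VQ VQ (\<lambda>y. snd D (proj (s (?g y))))"
    by (rule smooth_on_compose[OF VQ VQ g h2]) (use gW(1) W(3) in auto)
  then have "smooth_fun_on V1 (\<lambda>y. snd D (proj (s (?g y))))"
    by (rule smooth_on_vec_smooth_fun_on[OF quotient_model(1) quotient_model(1)])
  moreover have "z \<in> V1" using bij W(2) w0(2) q(3) by (auto simp: bij_betw_def)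
  ultimately obtain U F where U: "open U" "z \<in> U" "\<forall>k. Ck_on k U F"
    "\<And>y. y \<in> V1 \<inter> U \<Longrightarrow> F y = snd D (proj (s (?g y)))" unfolding smooth_fun_on_def by metis
  obtain O1 where O1: "open O1" "V1 = ?V \<inter> O1" using W(4) by (auto simp: openin_open)
  show "\<exists>U F. open U \<and> z \<in> U \<and> (\<forall>k. Ck_on k U F) \<and>
         (\<forall>y\<in>snd C ` (fst C \<inter> fst D) \<inter> U. F y = (snd D \<circ> chart_inv C) y)"
  proof (intro exI conjI)
    show "open (U \<inter> O1)" using U O1 by blast
    show "z \<in> U \<inter> O1" using U \<open>z \<in> V1\<close> O1 by blast
    show "\<forall>k. Ck_on k (U \<inter> O1) F" using U(3) Ck_on_subset by blast
    show "\<forall>y\<in>snd C ` (fst C \<inter> fst D) \<inter> (U \<inter> O1). F y = (snd D \<circ> chart_inv C) y"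
    proof
      fix y assume y: "y \<in> snd C ` (fst C \<inter> fst D) \<inter> (U \<inter> O1)"
      have "snd C ` fst C \<subseteq> ?V" by (rule openin_imp_subset[OF conjunct1[OF conjunct2[OF C']]])
      then have yV: "y \<in> V1 \<inter> U" using y O1(2) by blast
      have "?g y \<in> B" using gW(1) yV W(3) by blast
      then have "proj (s (?g y)) \<in> fst C" by (auto simp: B_def)
      then have "chart_inv C y = proj (s (?g y))" using inv_into_f_f[OF injC] gW(2) yV by fastforce
      then show "F y = (snd D \<circ> chart_inv C) y" using U(4)[OF yV] by simp
    qed
  qed
qed

lemma quotient_premanifold:
  assumes sec: "\<And>q. q \<in> pts Q \<Longrightarrow> \<exists>C s. C \<in> quotient_atlas G GM X a \<and> q \<in> fst C \<and> chart_section C s"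
  shows "premanifold Q"
proof (rule premanifoldI)
  show "subspace (mf_model Q)" using quotient_model(1) by (simp add: quotient_simps)
next
  fix C assume "C \<in> mf_atlas Q"
  then show "openin (mf_top Q) (fst C) \<and> openin (top_of_set (mf_model Q)) (snd C ` fst C) \<and> inj_on (snd C) (fst C) \<and>
      (\<forall>W. W \<subseteq> fst C \<longrightarrow> openin (mf_top Q) W = openin (top_of_set (mf_model Q)) (snd C ` W))"
    unfolding quotient_simps(2,3) quotient_atlas_iff by blast
next
  fix C D assume "C \<in> mf_atlas Q" "D \<in> mf_atlas Q"
  then show "smooth_fun_on (snd C ` (fst C \<inter> fst D)) (snd D \<circ> chart_inv C)"
    using quotient_charts_compatible[OF _ _ sec] by (simp add: quotient_simps)
next
  fix q assume "q \<in> pts Q"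
  then have "\<exists>C. C \<in> quotient_atlas G GM X a \<and> q \<in> fst C" using sec by blast
  from someI_ex[OF this] show "mf_chart_at Q q \<in> mf_atlas Q \<and> q \<in> fst (mf_chart_at Q q)"
    unfolding quotient_manifold_def by simp
qed

lemma smooth_on_proj:
  assumes Q: "premanifold Q" shows "smooth_on (pts X) X Q proj"
proof (rule smooth_on_local[OF X])
  fix x assume x: "x \<in> pts X"
  have q: "proj x \<in> pts Q" using x pts_quotient by blast
  define C where "C = mf_chart_at Q (proj x)"
  have C: "C \<in> mf_atlas Q" "proj x \<in> fst C" using chart_at[OF Q q] by (auto simp: C_def)
  note C' = C(1)[unfolded quotient_simps quotient_atlas_iff]
  let ?U = "{x \<in> pts X. proj x \<in> fst C}"
  have Uo: "openin (mf_top X) ?U" using openin_quotient_vimage[OF chart_open[OF Q C(1)]] .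
  have sm: "smooth_on ?U X VQ (\<lambda>x. snd C (proj x))"
    using C' by blast
  have "smooth_on ?U X Q (\<lambda>x. chart_inv C (snd C (proj x)))"
    by (rule smooth_on_compose[OF X VQ sm smooth_on_chart_inv[OF Q C(1), unfolded quotient_simps]]) auto
  then have "smooth_on ?U X Q proj"
    by (rule smooth_on_cong[OF X]) (use chart_inv_chart[OF Q C(1)] in auto)
  then have "smooth_on (pts X \<inter> ?U) X Q proj" by (simp add: Int_absorb1 Collect_conj_eq)
  then show "\<exists>W. openin (mf_top X) W \<and> x \<in> W \<and> smooth_on (pts X \<inter> W) X Q proj"
    using Uo x C(2) by blast
qed

lemma quotient_has_sections:
  assumes sec: "\<And>q. q \<in> pts Q \<Longrightarrow> \<exists>C s. C \<in> quotient_atlas G GM X a \<and> q \<in> fst C \<and> chart_section C s"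
  shows "has_sections X Q proj"
  unfolding has_sections_def
proof
  fix q assume "q \<in> pts Q"
  then obtain C s where C: "C \<in> quotient_atlas G GM X a" "q \<in> fst C" and cs: "chart_section C s" using sec by blast
  note Q = quotient_premanifold[OF sec]
  have C1: "C \<in> mf_atlas Q" using C by (simp add: quotient_simps)
  have s: "smooth_on (snd C ` fst C) VQ X s" and ps: "\<And>z. z \<in> snd C ` fst C \<Longrightarrow> proj (s z) \<in> fst C \<and> snd C (proj (s z)) = z"
    using cs by (auto simp: chart_section_def)
  have "smooth_on (fst C) Q X (\<lambda>r. s (snd C r))"
    by (rule smooth_on_compose[OF Q VQ smooth_on_chart[OF Q C1, unfolded quotient_simps] s order_refl])
  moreover have "\<forall>r\<in>fst C. proj (s (snd C r)) = r"
    using ps chart_inj[OF Q C1] by (meson imageI inj_onD)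
  ultimately show "\<exists>V s. openin (mf_top Q) V \<and> q \<in> V \<and> smooth_on V Q X s \<and> (\<forall>y\<in>V. proj (s y) = y)"
    using chart_open[OF Q C1] C(2) by (intro exI[of _ "fst C"] exI[of _ "\<lambda>r. s (snd C r)"]) auto
qed

text \<open>\<open>t\<close> identifies the orbits in \<open>V0\<close> with the open set
  \<open>A\<close> of a manifold \<open>B\<close>, and \<open>s\<close> picks representatives. A
  chart of \<open>B\<close>, moved into \<open>quotient_model\<close> by a linear isomorphism, is
  then a chart of the orbit space, and \<open>s\<close> yields its section.\<close>

lemma chart_from_trivialization:
  fixes B :: "('b, 'd::euclidean_space) manifold"
  assumes B: "premanifold B" and V0: "openin (mf_top Q) V0" and A: "openin (mf_top B) A"
    and t: "smooth_on {x \<in> pts X. proj x \<in> V0} X B t" "t ` {x \<in> pts X. proj x \<in> V0} \<subseteq> A"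
    and inv: "\<And>g x. g \<in> carrier G \<Longrightarrow> x \<in> pts X \<Longrightarrow> proj x \<in> V0 \<Longrightarrow> t (a g x) = t x"
    and s: "smooth_on A B X s" "\<And>b. b \<in> A \<Longrightarrow> proj (s b) \<in> V0 \<and> t (s b) = b"
    and st: "\<And>x. x \<in> pts X \<Longrightarrow> proj x \<in> V0 \<Longrightarrow> proj (s (t x)) = proj x"
    and dims: "dim (mf_model B) = dim (quotient_model X GM)" and q: "q \<in> V0"
  shows "\<exists>C s. C \<in> quotient_atlas G GM X a \<and> q \<in> fst C \<and> chart_section C s"
proof -
  let ?V = "quotient_model X GM"
  have V0Q: "V0 \<subseteq> pts Q" using V0 openin_subset by blast
  obtain x0 where x0: "x0 \<in> pts X" "q = proj x0" using q V0Q pts_quotient by blast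
  have b0: "t x0 \<in> A" using t(2) x0 q by auto
  have AB: "A \<subseteq> pts B" using A openin_subset by blast
  define D where "D = mf_chart_at B (t x0)"
  have D: "D \<in> mf_atlas B" "t x0 \<in> fst D" using chart_at[OF B] b0 AB by (auto simp: D_def)
  let ?VB = "vec_manifold (mf_model B)"
  note VB = premanifold_vec[OF premanifold_subspace[OF B]]
  obtain T T' where T: "linear T" "linear T'" "T ` mf_model B = ?V" "T' ` ?V = mf_model B"
    "\<And>y. y \<in> mf_model B \<Longrightarrow> T' (T y) = y" "\<And>y. y \<in> ?V \<Longrightarrow> T (T' y) = y"
    by (rule isometries_subspaces[OF premanifold_subspace[OF B] quotient_model(1) dims]) blast
  have TB: "T y \<in> ?V" if "y \<in> mf_model B" for y using T(3) that by blast
  have T'V: "T' y \<in> mf_model B" if "y \<in> ?V" for y using T(4) that by blast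
  define U where "U = {r \<in> V0. \<exists>x\<in>pts X. proj x = r \<and> t x \<in> fst D}"
  \<comment> \<open>An arbitrary representative; invariance of \<open>t\<close> makes
    \<open>c\<close> independent of it on \<open>V0\<close>.\<close>
  define rep where "rep r = (SOME x. x \<in> pts X \<and> proj x = r)" for r
  define c where "c r = T (snd D (t (rep r)))" for r
  have rep: "rep (proj x) \<in> pts X" "proj (rep (proj x)) = proj x" if "x \<in> pts X" for x
    using someI_ex[of "\<lambda>y. y \<in> pts X \<and> proj y = proj x"] that unfolding rep_def by blast+
  have tinv: "t x = t y" if "x \<in> pts X" "y \<in> pts X" "proj x \<in> V0" "proj x = proj y" for x y
    using orbit_eq_iff[OF that(1,2)] inv that by metis
  have cp: "c (proj x) = T (snd D (t x))" if "x \<in> pts X" "proj x \<in> V0" for x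
    unfolding c_def using tinv[OF that(1) rep(1)[OF that(1)] that(2)] rep(2)[OF that(1)] by simp
  have tD: "t x \<in> fst D" if "x \<in> pts X" "proj x \<in> U" for x
  proof -
    obtain y where y: "y \<in> pts X" "proj y = proj x" "t y \<in> fst D" "proj x \<in> V0" using \<open>proj x \<in> U\<close> unfolding U_def by blast
    show ?thesis using tinv[OF that(1) y(1,4) y(2)[symmetric]] y(3) by simp
  qed
  have UV0: "U \<subseteq> V0" by (auto simp: U_def)
  have pUo: "openin (mf_top X) {x \<in> {x \<in> pts X. proj x \<in> V0}. t x \<in> fst D}"
    by (rule smooth_on_openin_vimage[OF X B t(1) openin_quotient_vimage[OF V0] chart_open[OF B D(1)]])
  have pU: "{x \<in> pts X. proj x \<in> U} = {x \<in> {x \<in> pts X. proj x \<in> V0}. t x \<in> fst D}"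
  proof (intro Set.set_eqI iffI)
    fix x assume "x \<in> {x \<in> pts X. proj x \<in> U}"
    then show "x \<in> {x \<in> {x \<in> pts X. proj x \<in> V0}. t x \<in> fst D}" using tD[of x] UV0 by blast
  next
    fix x assume "x \<in> {x \<in> {x \<in> pts X. proj x \<in> V0}. t x \<in> fst D}"
    then show "x \<in> {x \<in> pts X. proj x \<in> U}" unfolding U_def by blast
  qed
  have U: "openin (mf_top Q) U"
    unfolding openin_quotient pU using pUo UV0 V0Q pts_quotient by (auto simp: orbits_def)
  have cU: "c ` U = {z \<in> ?V. T' z \<in> snd D ` (A \<inter> fst D)}"
  proof (intro Set.set_eqI iffI)
    fix z assume "z \<in> c ` U"
    then obtain x where x: "x \<in> pts X" "proj x \<in> U" "z = c (proj x)" unfolding U_def by blast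
    have "z = T (snd D (t x))" "t x \<in> fst D" "t x \<in> A" using cp[OF x(1)] x UV0 tD t(2) by auto
    then show "z \<in> {z \<in> ?V. T' z \<in> snd D ` (A \<inter> fst D)}"
      using TB T(5) chart_in_model[OF B D(1)] by auto
  next
    fix z assume "z \<in> {z \<in> ?V. T' z \<in> snd D ` (A \<inter> fst D)}"
    then obtain b where b: "z \<in> ?V" "b \<in> A" "b \<in> fst D" "T' z = snd D b" by auto
    have sb: "s b \<in> pts X" "proj (s b) \<in> V0" "t (s b) = b" using s(2)[OF b(2)] smooth_on_image[OF X s(1)] b by auto
    then have "proj (s b) \<in> U" unfolding U_def using b by auto
    moreover have "c (proj (s b)) = z" using cp[OF sb(1,2)] sb(3) b(4) T(6)[OF b(1)] by simp
    ultimately show "z \<in> c ` U" by blast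
  qed
  obtain N where N: "open N" "snd D ` (A \<inter> fst D) = mf_model B \<inter> N"
    using chart_image_openE[OF B D(1), of "A \<inter> fst D"] A chart_open[OF B D(1)] by blast
  have "c ` U = ?V \<inter> T' -` N" unfolding cU N(2) using T'V by auto
  moreover have "open (T' -` N)"
    by (intro open_vimage N(1) linear_continuous_on) (use T(2) linear_conv_bounded_linear in blast)
  ultimately have cUo: "openin (top_of_set ?V) (c ` U)" by (metis openin_open)
  define \<sigma> where "\<sigma> z = s (chart_inv D (T' z))" for z
  have \<sigma>: "smooth_on (c ` U) VQ X \<sigma>"
    unfolding \<sigma>_def[abs_def]
  proof (rule smooth_on_compose[OF VQ B _ s(1)])
    show "smooth_on (c ` U) VQ B (\<lambda>z. chart_inv D (T' z))"
      by (rule smooth_on_compose[OF VQ VB smooth_on_linear[OF quotient_model(1) premanifold_subspace[OF B] T(2)] smooth_on_chart_inv[OF B D(1)]])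
         (use cU T'V in auto)
    show "(\<lambda>z. chart_inv D (T' z)) ` c ` U \<subseteq> A" unfolding cU using chart_inv_chart[OF B D(1)] by auto
  qed
  have \<sigma>p: "proj (\<sigma> z) \<in> U" "c (proj (\<sigma> z)) = z" "\<sigma> z \<in> pts X" if z: "z \<in> c ` U" for z
  proof -
    obtain b where b: "z \<in> ?V" "b \<in> A" "b \<in> fst D" "T' z = snd D b" using z unfolding cU by auto
    have sb: "s b \<in> pts X" "proj (s b) \<in> V0" "t (s b) = b" using s(2)[OF b(2)] smooth_on_image[OF X s(1)] b by auto
    have eq: "\<sigma> z = s b" unfolding \<sigma>_def using b chart_inv_chart[OF B D(1)] by simp
    show "proj (\<sigma> z) \<in> U" unfolding eq U_def using sb b by auto
    show "c (proj (\<sigma> z)) = z" unfolding eq using cp[OF sb(1,2)] sb(3) b(4) T(6)[OF b(1)] by simp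
    show "\<sigma> z \<in> pts X" using eq sb by simp
  qed
  have \<sigma>c: "proj (\<sigma> (c r)) = r" if r: "r \<in> U" for r
  proof -
    obtain x where x: "x \<in> pts X" "proj x = r" using r unfolding U_def by blast
    have "\<sigma> (c r) = s (t x)" unfolding \<sigma>_def using cp[OF x(1)] x r UV0 tD[OF x(1)] T(5) chart_in_model[OF B D(1)]
      chart_inv_chart[OF B D(1)] by auto
    then show ?thesis using st[OF x(1)] x r UV0 by auto
  qed
  have inj: "inj_on c U" by (metis \<sigma>c inj_onI)
  have smc: "smooth_on {x \<in> pts X. proj x \<in> U} X VQ (\<lambda>x. c (proj x))"
  proof (rule smooth_on_cong[OF X, of _ _ "\<lambda>x. T (snd D (t x))"])
    have 1: "smooth_on {x \<in> pts X. proj x \<in> U} X ?VB (\<lambda>x. snd D (t x))"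
      by (rule smooth_on_compose[OF X B smooth_on_subset[OF X t(1)] smooth_on_chart[OF B D(1)]])
         (use UV0 tD in auto)
    show "smooth_on {x \<in> pts X. proj x \<in> U} X VQ (\<lambda>x. T (snd D (t x)))"
      by (rule smooth_on_compose[OF X VB 1 smooth_on_linear[OF premanifold_subspace[OF B] quotient_model(1) T(1) order_refl]])
         (use T(3) chart_in_model[OF B D(1)] tD in auto)
  qed (use cp UV0 in auto)
  have open_iff: "openin (mf_top Q) W \<longleftrightarrow> openin (top_of_set ?V) (c ` W)" if W: "W \<subseteq> U" for W
  proof
    assume Wo: "openin (mf_top Q) W"
    have "openin (mf_top VQ) {z \<in> c ` U. \<sigma> z \<in> {x \<in> pts X. proj x \<in> W}}"
      by (rule smooth_on_openin_vimage[OF VQ X \<sigma> _ openin_quotient_vimage[OF Wo]]) (use cUo in simp)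
    moreover have "{z \<in> c ` U. \<sigma> z \<in> {x \<in> pts X. proj x \<in> W}} = c ` W"
      using \<sigma>p \<sigma>c W by force
    ultimately show "openin (top_of_set ?V) (c ` W)" by simp
  next
    assume Wo: "openin (top_of_set ?V) (c ` W)"
    have "openin (mf_top X) {x \<in> {x \<in> pts X. proj x \<in> U}. c (proj x) \<in> c ` W}"
      by (rule smooth_on_openin_vimage[OF X VQ smc openin_quotient_vimage[OF U]]) (use Wo in simp)
    moreover have "{x \<in> {x \<in> pts X. proj x \<in> U}. c (proj x) \<in> c ` W} = {x \<in> pts X. proj x \<in> W}"
      using W inj_on_image_mem_iff[OF inj _ W] by auto
    ultimately show "openin (mf_top Q) W"
      unfolding openin_quotient orbits_eq using W UV0 V0Q by auto
  qed
  have sub: "dmap X VQ (\<lambda>x. c (proj x)) x ` mf_model X = ?V" if x: "x \<in> pts X" "proj x \<in> U" for x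
  proof
    have at: "smooth_at X VQ (\<lambda>x. c (proj x)) x"
      by (rule smooth_atI[OF smc openin_quotient_vimage[OF U]]) (use x in auto)
    show "dmap X VQ (\<lambda>x. c (proj x)) x ` mf_model X \<subseteq> ?V" using dmap_in_model[OF X VQ at] by auto
    show "?V \<subseteq> dmap X VQ (\<lambda>x. c (proj x)) x ` mf_model X"
    proof
      fix u assume u: "u \<in> ?V"
      define z where "z = c (proj x)"
      have z: "z \<in> c ` U" using x z_def by blast
      have "proj (\<sigma> z) = proj x" using \<sigma>c x z_def by blast
      \<comment> \<open>The section passes through one point of the orbit only. Its translate by
        \<open>g\<close> passes through \<open>x\<close> itself, and the differential of this
        translate is a right inverse of the one in question.\<close>
      then obtain g where g: "g \<in> carrier G" "a g (\<sigma> z) = x" using orbit_eq_iff[OF \<sigma>p(3)[OF z] x(1)] by blast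
      have ats: "smooth_at VQ X (\<lambda>z. a g (\<sigma> z)) z"
        by (rule smooth_atI[OF smooth_on_act_const[OF VQ g(1) \<sigma>]]) (use cUo z in auto)
      have "dmap X VQ (\<lambda>x. c (proj x)) (a g (\<sigma> z)) (dmap VQ X (\<lambda>z. a g (\<sigma> z)) z u) = u"
        by (rule dmap_left_inverse[OF VQ X ats, of _ "c ` U"])
           (use at g z cUo u orbit_act[OF g(1)] \<sigma>p in auto)
      moreover have "dmap VQ X (\<lambda>z. a g (\<sigma> z)) z u \<in> mf_model X" using dmap_in_model[OF VQ X ats] u by simp
      ultimately show "u \<in> dmap X VQ (\<lambda>x. c (proj x)) x ` mf_model X" using g by force
    qed
  qed
  have "(U, c) \<in> quotient_atlas G GM X a"
    unfolding quotient_atlas_iff using U cUo inj open_iff smc sub by simp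
  moreover have "q \<in> U" unfolding U_def using x0 q D by auto
  moreover have "chart_section (U, c) \<sigma>" unfolding chart_section_def using \<sigma> \<sigma>p by auto
  ultimately show ?thesis by (metis fst_conv)
qed

end

section \<open>The bundle associated with conjugation\<close>

text \<open>An action is a homomorphism into \<open>BijGroup\<close>, whose elements are extensional
  bijections. Bijectivity comes from \<open>inv g\<close>, and extensionality is what makes the
  homomorphism law an equation between functions.\<close>

lemma group_actionI:
  assumes "group G" and closed: "\<And>g x. g \<in> carrier G \<Longrightarrow> x \<in> E \<Longrightarrow> a g x \<in> E"
    and ext: "\<And>g. g \<in> carrier G \<Longrightarrow> a g \<in> extensional E"
    and one: "\<And>x. x \<in> E \<Longrightarrow> a \<one>\<^bsub>G\<^esub> x = x"
    and mult: "\<And>g h x. g \<in> carrier G \<Longrightarrow> h \<in> carrier G \<Longrightarrow> x \<in> E \<Longrightarrow> a (g \<otimes>\<^bsub>G\<^esub> h) x = a g (a h x)"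
  shows "group_action G E a"
proof -
  interpret group G by fact
  have inv: "a (inv\<^bsub>G\<^esub> g) (a g x) = x" "a g (a (inv\<^bsub>G\<^esub> g) x) = x" if "g \<in> carrier G" "x \<in> E" for g x
    using mult[of "inv\<^bsub>G\<^esub> g" g x] mult[of g "inv\<^bsub>G\<^esub> g" x] one that by auto
  have bij: "a g \<in> Bij E" if g: "g \<in> carrier G" for g
  proof -
    have "bij_betw (a g) E E"
      by (rule bij_betw_byWitness[where f' = "a (inv\<^bsub>G\<^esub> g)"]) (use inv g closed in auto)
    then show ?thesis using ext[OF g] by (simp add: Bij_def)
  qed
  have "a (g \<otimes>\<^bsub>G\<^esub> h) = compose E (a g) (a h)" if "g \<in> carrier G" "h \<in> carrier G" for g h
  proof
    fix x show "a (g \<otimes>\<^bsub>G\<^esub> h) x = compose E (a g) (a h) x"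
      using mult[OF that] ext[OF m_closed[OF that]] by (cases "x \<in> E") (auto simp: compose_def extensional_def)
  qed
  then have "a \<in> hom G (BijGroup E)"
    using bij by (auto simp: hom_def BijGroup_def)
  then show ?thesis
    unfolding group_action_def group_hom_def group_hom_axioms_def using is_group group_BijGroup by blast
qed

locale symmetric_bundle = lie G GM for G :: "'g monoid" (structure) and GM :: "('g, 'cg::euclidean_space) manifold" +
  fixes E :: "('e, 'ce::euclidean_space) manifold" and M :: "('m, 'cm::euclidean_space) manifold"
    and F :: "('f, 'cf::euclidean_space) manifold" and \<phi> :: "'e \<Rightarrow> 'm"
    and aE :: "'g \<Rightarrow> 'e \<Rightarrow> 'e" and aM :: "'g \<Rightarrow> 'm \<Rightarrow> 'm"
  assumes fiber_bundle: "fiber_bundle E M F \<phi>"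
    and acts: "acts_on_fiber_bundle G GM E M F \<phi> aE aM"
begin

lemma manifolds: "smooth_manifold E" "smooth_manifold M" "smooth_manifold F"
  using fiber_bundle by (auto simp: fiber_bundle_def)

lemma pre: "premanifold E" "premanifold M" "premanifold F"
  using manifolds smooth_manifold_premanifold by auto

lemma phi: "smooth_on (pts E) E M \<phi>" "\<phi> ` pts E = pts M"
  using fiber_bundle by (auto simp: fiber_bundle_def smooth_map_def)

lemma phi_pts: "e \<in> pts E \<Longrightarrow> \<phi> e \<in> pts M" using phi(2) by blast

sublocale actE: smooth_action G GM E aE
  by unfold_locales (use acts pre in \<open>auto simp: acts_on_fiber_bundle_def\<close>)

sublocale actM: smooth_action G GM M aM
  by unfold_locales (use acts pre in \<open>auto simp: acts_on_fiber_bundle_def\<close>)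

lemma phi_equivariant: "g \<in> carrier G \<Longrightarrow> e \<in> pts E \<Longrightarrow> \<phi> (aE g e) = aM g (\<phi> e)"
  using acts unfolding acts_on_fiber_bundle_def by blast

lemma free: "m \<in> pts M \<Longrightarrow> g \<in> carrier G \<Longrightarrow> aM g m = m \<Longrightarrow> g = \<one>"
  using acts unfolding acts_on_fiber_bundle_def free_action_def by blast

abbreviation QM :: "('m set, 'cm) manifold" where "QM \<equiv> quotient_manifold G GM M aM"
abbreviation \<pi> :: "'m \<Rightarrow> 'm set" where "\<pi> \<equiv> orbit G aM"

lemma principal: "principal_bundle G GM M aM"
  using acts unfolding acts_on_fiber_bundle_def by blast

lemma QM_manifold: "smooth_manifold QM"
  using principal unfolding principal_bundle_def by blast

lemma QM: "premanifold QM" by (rule smooth_manifold_premanifold[OF QM_manifold])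

lemma smooth_pi: "smooth_on (pts M) M QM \<pi>" by (rule actM.smooth_on_proj[OF QM])

lemma pts_QM: "pts QM = \<pi> ` pts M" by (rule actM.pts_quotient)

lemma pi_pts: "m \<in> pts M \<Longrightarrow> \<pi> m \<in> pts QM" using pts_QM by blast

text \<open>The inverse is kept as \<open>\<theta>\<close> because it supplies sections; the
  dimension equation, a consequence of the diffeomorphism, is recorded for the count of
  \<open>dim (mf_model B)\<close>.\<close>

definition M_triv :: "'m set set \<Rightarrow> ('m \<Rightarrow> 'm set \<times> 'g) \<Rightarrow> ('m set \<times> 'g \<Rightarrow> 'm) \<Rightarrow> bool" where
  "M_triv V \<psi> \<theta> \<longleftrightarrow> openin (mf_top QM) V \<and>
    smooth_on {m \<in> pts M. \<pi> m \<in> V} M (prod_manifold QM GM) \<psi> \<and>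
    smooth_on (V \<times> carrier G) (prod_manifold QM GM) M \<theta> \<and>
    (\<forall>m \<in> pts M. \<pi> m \<in> V \<longrightarrow> fst (\<psi> m) = \<pi> m \<and> snd (\<psi> m) \<in> carrier G \<and> \<theta> (\<psi> m) = m) \<and>
    (\<forall>b \<in> V \<times> carrier G. \<theta> b \<in> pts M \<and> \<pi> (\<theta> b) = fst b \<and> \<psi> (\<theta> b) = b) \<and>
    (\<forall>m \<in> pts M. \<pi> m \<in> V \<longrightarrow> (\<forall>g \<in> carrier G. snd (\<psi> (aM g m)) = g \<otimes> snd (\<psi> m))) \<and>
    dim (mf_model M) = dim (mf_model QM) + dim (mf_model GM)"

lemma M_trivD:
  assumes "M_triv V \<psi> \<theta>"
  shows "openin (mf_top QM) V"
    "smooth_on {m \<in> pts M. \<pi> m \<in> V} M (prod_manifold QM GM) \<psi>"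
    "smooth_on (V \<times> carrier G) (prod_manifold QM GM) M \<theta>"
    "\<And>m. m \<in> pts M \<Longrightarrow> \<pi> m \<in> V \<Longrightarrow> fst (\<psi> m) = \<pi> m \<and> snd (\<psi> m) \<in> carrier G \<and> \<theta> (\<psi> m) = m"
    "\<And>b. b \<in> V \<times> carrier G \<Longrightarrow> \<theta> b \<in> pts M \<and> \<pi> (\<theta> b) = fst b \<and> \<psi> (\<theta> b) = b"
    "\<And>g m. m \<in> pts M \<Longrightarrow> \<pi> m \<in> V \<Longrightarrow> g \<in> carrier G \<Longrightarrow> snd (\<psi> (aM g m)) = g \<otimes> snd (\<psi> m)"
    "dim (mf_model M) = dim (mf_model QM) + dim (mf_model GM)"
  using assms unfolding M_triv_def by meson+

lemma M_trivialization:
  assumes "q \<in> pts QM"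
  obtains V \<psi> \<theta> where "M_triv V \<psi> \<theta>" "q \<in> V"
proof -
  have "\<forall>q\<in>pts QM. \<exists>V \<psi>. openin (mf_top QM) V \<and> q \<in> V \<and>
        diffeo_on {m \<in> pts M. \<pi> m \<in> V} M (V \<times> pts GM) (prod_manifold QM GM) \<psi> \<and>
        (\<forall>m \<in> pts M. \<pi> m \<in> V \<longrightarrow> fst (\<psi> m) = \<pi> m \<and>
           (\<forall>g \<in> carrier G. snd (\<psi> (aM g m)) = g \<otimes> snd (\<psi> m)))"
    using principal unfolding principal_bundle_def by (elim conjE) assumption
  from bspec[OF this assms]
  obtain V \<psi> where V: "openin (mf_top QM) V" "q \<in> V"
    and d: "diffeo_on {m \<in> pts M. \<pi> m \<in> V} M (V \<times> carrier G) (prod_manifold QM GM) \<psi>"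
    and fe: "\<forall>m \<in> pts M. \<pi> m \<in> V \<longrightarrow> fst (\<psi> m) = \<pi> m \<and>
           (\<forall>g \<in> carrier G. snd (\<psi> (aM g m)) = g \<otimes> snd (\<psi> m))"
    unfolding pts_GM by (elim exE conjE) (rule that; assumption)
  have f: "\<And>m. m \<in> pts M \<Longrightarrow> \<pi> m \<in> V \<Longrightarrow> fst (\<psi> m) = \<pi> m"
    and e: "\<And>g m. m \<in> pts M \<Longrightarrow> \<pi> m \<in> V \<Longrightarrow> g \<in> carrier G \<Longrightarrow> snd (\<psi> (aM g m)) = g \<otimes> snd (\<psi> m)"
    using fe by simp_all
  let ?A = "{m \<in> pts M. \<pi> m \<in> V}"
  have b: "bij_betw \<psi> ?A (V \<times> carrier G)" and s: "smooth_on ?A M (prod_manifold QM GM) \<psi>"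
    and i: "smooth_on (V \<times> carrier G) (prod_manifold QM GM) M (inv_into ?A \<psi>)"
    using d by (auto simp: diffeo_on_def)
  have 1: "fst (\<psi> m) = \<pi> m \<and> snd (\<psi> m) \<in> carrier G \<and> inv_into ?A \<psi> (\<psi> m) = m" if m: "m \<in> pts M" "\<pi> m \<in> V" for m
  proof -
    have mA: "m \<in> ?A" using m by blast
    have "\<psi> m \<in> V \<times> carrier G" using bij_betwE[OF b] mA by blast
    then show ?thesis using f[OF m] bij_betw_inv_into_left[OF b mA] by auto
  qed
  have 2: "inv_into ?A \<psi> p \<in> pts M \<and> \<pi> (inv_into ?A \<psi> p) = fst p \<and> \<psi> (inv_into ?A \<psi> p) = p" if p: "p \<in> V \<times> carrier G" for p
  proof -
    have *: "\<psi> (inv_into ?A \<psi> p) = p" by (rule bij_betw_inv_into_right[OF b p])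
    have "inv_into ?A \<psi> p \<in> ?A" using bij_betwE[OF bij_betw_inv_into[OF b]] p by blast
    then show ?thesis using * f[of "inv_into ?A \<psi> p"] by auto
  qed
  obtain m where m: "m \<in> pts M" "q = \<pi> m" using assms pts_QM by blast
  have "dim (mf_model M) = dim (mf_model (prod_manifold QM GM))"
  proof (rule diffeo_on_dim[OF pre(2) premanifold_prod[OF QM GM] d])
    show "openin (mf_top M) ?A" by (rule actM.openin_quotient_vimage[OF V(1)])
    show "openin (mf_top (prod_manifold QM GM)) (V \<times> carrier G)"
      using V(1) openin_topspace[of "mf_top GM"] pts_GM by (simp add: openin_prod_Times_iff)
    show "m \<in> ?A" using m V by blast
  qed
  then have "dim (mf_model M) = dim (mf_model QM) + dim (mf_model GM)"
    using dim_Times[OF premanifold_subspace[OF QM] premanifold_subspace[OF GM]] by simp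
  then have "M_triv V \<psi> (inv_into ?A \<psi>)" unfolding M_triv_def using V s i 1 2 e by simp
  then show ?thesis using that V(2) by blast
qed

text \<open>The division map of the principal bundle, meaningful for two points of one
  orbit.\<close>

definition \<delta> :: "'m \<Rightarrow> 'm \<Rightarrow> 'g" where
  "\<delta> m m' = (THE g. g \<in> carrier G \<and> aM g m = m')"

lemma act_inj:
  assumes "g \<in> carrier G" "h \<in> carrier G" "m \<in> pts M" "aM g m = aM h m" shows "g = h"
proof -
  have "aM (inv h \<otimes> g) m = m"
    using assms actM.act_mult[of "inv h" g m] actM.act_inv(1)[of h m] by simp
  then have "inv h \<otimes> g = \<one>" using free assms by simp
  then show ?thesis using assms by (metis inv_closed inv_equality inv_inv)
qed

lemma delta_eq: "g \<in> carrier G \<Longrightarrow> m \<in> pts M \<Longrightarrow> \<delta> m (aM g m) = g"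
  unfolding \<delta>_def by (rule the_equality) (use act_inj in auto)

lemma delta:
  assumes "m \<in> pts M" "m' \<in> pts M" "\<pi> m = \<pi> m'" shows "\<delta> m m' \<in> carrier G" "aM (\<delta> m m') m = m'"
proof -
  obtain g where "g \<in> carrier G" "aM g m = m'" using actM.orbit_eq_iff[OF assms(1,2)] assms(3) by blast
  then show "\<delta> m m' \<in> carrier G" "aM (\<delta> m m') m = m'" using delta_eq[of g m] assms by auto
qed

text \<open>In an equivariant trivialization the division map is the group coordinate of the second
  point times the inverse of that of the first, which is smooth.\<close>

lemma smooth_on_delta:
  assumes Z: "premanifold Z" and f: "smooth_on A Z M f" and f': "smooth_on A Z M f'"
    and eq: "\<And>z. z \<in> A \<Longrightarrow> \<pi> (f z) = \<pi> (f' z)"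
  shows "smooth_on A Z GM (\<lambda>z. \<delta> (f z) (f' z))"
proof (rule smooth_on_local[OF Z])
  fix z assume z: "z \<in> A"
  have fM: "f y \<in> pts M" "f' y \<in> pts M" if "y \<in> A" for y
    using smooth_on_image[OF pre(2) f] smooth_on_image[OF pre(2) f'] that by auto
  obtain V \<psi> \<theta> where T: "M_triv V \<psi> \<theta>" "\<pi> (f z) \<in> V"
    using M_trivialization[OF pi_pts[OF fM(1)[OF z]]] by blast
  note V = M_trivD[OF T(1)]
  let ?A = "{m \<in> pts M. \<pi> m \<in> V}"
  obtain W where W: "openin (mf_top Z) W" "{y \<in> A. f y \<in> ?A} = A \<inter> W"
    by (rule smooth_on_open_vimage[OF Z pre(2) f actM.openin_quotient_vimage[OF V(1)]])
  have inA: "f y \<in> ?A" "f' y \<in> ?A" if "y \<in> A \<inter> W" for y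
  proof -
    show "f y \<in> ?A" using W(2) that by blast
    then show "f' y \<in> ?A" using eq[of y] fM that by auto
  qed
  note P = premanifold_prod[OF QM GM]
  have "smooth_on ?A M GM (\<lambda>m. snd (\<psi> m))"
    by (rule smooth_on_compose[OF pre(2) P V(2) smooth_on_snd[OF QM GM order_refl]])
       (use smooth_on_image[OF P V(2)] in simp)
  note sp = smooth_on_compose[OF Z pre(2) _ this]
  have "smooth_on (A \<inter> W) Z GM (\<lambda>z. snd (\<psi> (f' z)) \<otimes> inv (snd (\<psi> (f z))))"
    by (intro smooth_on_mult smooth_on_m_inv Z sp smooth_on_subset[OF Z f] smooth_on_subset[OF Z f'])
       (use inA in auto)
  moreover have "snd (\<psi> (f' y)) \<otimes> inv (snd (\<psi> (f y))) = \<delta> (f y) (f' y)" if y: "y \<in> A \<inter> W" for y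
  proof -
    have m: "f y \<in> pts M" "\<pi> (f y) \<in> V" "f' y \<in> pts M" using inA[OF y] by auto
    have d: "\<delta> (f y) (f' y) \<in> carrier G" "aM (\<delta> (f y) (f' y)) (f y) = f' y"
      using delta[OF m(1,3) eq] y by auto
    have "snd (\<psi> (f' y)) = \<delta> (f y) (f' y) \<otimes> snd (\<psi> (f y))" using V(6)[OF m(1,2) d(1)] d(2) by simp
    then show ?thesis using d(1) V(4)[OF m(1,2)] by (simp add: m_assoc)
  qed
  ultimately have "smooth_on (A \<inter> W) Z GM (\<lambda>z. \<delta> (f z) (f' z))" by (rule smooth_on_cong[OF Z])
  moreover have "z \<in> W" using W(2) z T(2) fM by blast
  ultimately show "\<exists>W. openin (mf_top Z) W \<and> z \<in> W \<and> smooth_on (A \<inter> W) Z GM (\<lambda>z. \<delta> (f z) (f' z))"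
    using W(1) by blast
qed

text \<open>Holding the group coordinate at that of \<open>m0\<close> gives a section through
  \<open>m0\<close>; the prescribed value is what lets \<open>adapted_section\<close> pass through a
  prescribed point.\<close>

lemma M_section:
  assumes m0: "m0 \<in> pts M"
  obtains V \<sigma> where "openin (mf_top QM) V" "\<pi> m0 \<in> V" "smooth_on V QM M \<sigma>" "\<And>r. r \<in> V \<Longrightarrow> \<pi> (\<sigma> r) = r"
    "\<sigma> (\<pi> m0) = m0"
proof -
  obtain V \<psi> \<theta> where T: "M_triv V \<psi> \<theta>" "\<pi> m0 \<in> V"
    using M_trivialization[OF pi_pts[OF m0]] by blast
  note V = M_trivD(1)[OF T(1)] T(2) M_trivD(3,4,5)[OF T(1)]
  have g: "snd (\<psi> m0) \<in> carrier G" using V(4)[OF m0 V(2)] by blast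
  have VQ: "V \<subseteq> pts QM" using V(1) openin_subset by blast
  have "smooth_on V QM M (\<lambda>r. \<theta> (r, snd (\<psi> m0)))"
    by (rule smooth_on_compose[OF QM premanifold_prod[OF QM GM] smooth_on_Pair[OF QM QM GM smooth_on_ident[OF QM VQ] smooth_on_const[OF QM VQ GM]] V(3)])
       (use g pts_GM in auto)
  moreover have "\<theta> (\<pi> m0, snd (\<psi> m0)) = m0" using V(4)[OF m0 V(2)] by (metis prod.collapse)
  ultimately show ?thesis using that[of V "\<lambda>r. \<theta> (r, snd (\<psi> m0))"] V g by auto
qed

section \<open>The quotient of \<open>E \<times> G\<close> by the conjugation action\<close>

abbreviation XE :: "('e \<times> 'g, 'ce \<times> 'cg) manifold" where "XE \<equiv> prod_manifold E GM"
abbreviation cE :: "'g \<Rightarrow> 'e \<times> 'g \<Rightarrow> 'e \<times> 'g" where "cE \<equiv> conj_action G aE (pts E)"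

lemma XE: "premanifold XE" by (rule premanifold_prod[OF pre(1) GM])

lemma conj_action: "e \<in> pts E \<Longrightarrow> w \<in> carrier G \<Longrightarrow> cE g (e, w) = (aE g e, g \<otimes> w \<otimes> inv g)"
  by (simp add: conj_action_def)

lemma conj_group_action: "group_action G (pts XE) cE"
proof (rule group_actionI[OF is_group])
  fix g h x assume gh: "g \<in> carrier G" "h \<in> carrier G" and "x \<in> pts XE"
  then obtain e w where x: "x = (e, w)" "e \<in> pts E" "w \<in> carrier G" using pts_GM by auto
  have "g \<otimes> h \<otimes> w \<otimes> inv (g \<otimes> h) = g \<otimes> (h \<otimes> w \<otimes> inv h) \<otimes> inv g"
    using gh x by (simp add: inv_mult_group m_assoc)
  then show "cE (g \<otimes> h) x = cE g (cE h x)"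
    using gh x actE.act_mult[of g h e] actE.act_closed[of h e] by (simp add: conj_action)
next
  fix g show "cE g \<in> extensional (pts XE)" using pts_GM by (simp add: conj_action_def)
qed (use pts_GM conj_action actE.act_closed actE.act_one in auto)

sublocale actX: smooth_action G GM XE cE
proof
  show "premanifold XE" by (rule XE)
  let ?P = "prod_manifold GM XE"
  note P = premanifold_prod[OF GM XE]
  have g: "smooth_on (pts ?P) ?P GM fst" and x: "smooth_on (pts ?P) ?P XE snd"
    using smooth_on_fst[OF GM XE order_refl] smooth_on_snd[OF GM XE order_refl] by auto
  have e: "smooth_on (pts ?P) ?P E (\<lambda>p. fst (snd p))"
    by (rule smooth_on_compose[OF P XE x smooth_on_fst[OF pre(1) GM order_refl]]) auto
  have w: "smooth_on (pts ?P) ?P GM (\<lambda>p. snd (snd p))"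
    by (rule smooth_on_compose[OF P XE x smooth_on_snd[OF pre(1) GM order_refl]]) auto
  have "smooth_on (pts ?P) ?P XE (\<lambda>p. (aE (fst p) (fst (snd p)), fst p \<otimes> snd (snd p) \<otimes> inv (fst p)))"
    by (intro smooth_on_Pair P pre(1) GM actE.smooth_on_act smooth_on_mult smooth_on_m_inv g e w)
  then have "smooth_on (pts ?P) ?P XE (\<lambda>(g, x). cE g x)"
    by (rule smooth_on_cong[OF P]) (use pts_GM conj_action in auto)
  then show "smooth_left_action G GM XE cE"
    unfolding smooth_left_action_def smooth_map_def
    using conj_group_action smooth_on_image[OF XE] by blast
qed

abbreviation QE :: "(('e \<times> 'g) set, 'ce \<times> 'cg) manifold" where "QE \<equiv> quotient_manifold G GM XE cE"
abbreviation \<pi>E :: "'e \<times> 'g \<Rightarrow> ('e \<times> 'g) set" where "\<pi>E \<equiv> orbit G cE"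
abbreviation B :: "('m set \<times> 'f \<times> 'g, 'cm \<times> 'cf \<times> 'cg) manifold" where "B \<equiv> prod_manifold QM (prod_manifold F GM)"

lemma FG: "premanifold (prod_manifold F GM)" by (rule premanifold_prod[OF pre(3) GM])
lemma B: "premanifold B" by (rule premanifold_prod[OF QM FG])

text \<open>The projection of the reduced bundle onto \<open>M/G\<close>, in the wording of
  \<open>red_phi\<close> so that the two can be identified.\<close>

definition \<phi>Q :: "('e \<times> 'g) set \<Rightarrow> 'm set" where
  "\<phi>Q v = (THE r. \<exists>(e, w) \<in> v. r = \<pi> (\<phi> e))"

text \<open>Equivariance of \<open>\<phi>\<close> makes \<open>\<pi> (\<phi> e)\<close> constant
  along an orbit, so the description by \<open>THE\<close> has a unique solution.\<close>

lemma phiQ: assumes "x \<in> pts XE" shows "\<phi>Q (\<pi>E x) = \<pi> (\<phi> (fst x))"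
proof -
  obtain e w where x: "x = (e, w)" "e \<in> pts E" "w \<in> carrier G" using assms pts_GM by auto
  have *: "\<pi> (\<phi> e') = \<pi> (\<phi> e)" if y: "(e', w') \<in> \<pi>E x" for e' w'
  proof -
    obtain g where g: "g \<in> carrier G" "(e', w') = cE g x" using actX.orbitE[OF y] by blast
    then have "e' = aE g e" using x conj_action by simp
    then show ?thesis using phi_equivariant[OF g(1) x(2)] actM.orbit_act[OF g(1) phi_pts[OF x(2)]] by simp
  qed
  show ?thesis unfolding \<phi>Q_def
  proof (rule the_equality)
    show "\<exists>(e, w)\<in>\<pi>E x. \<pi> (\<phi> (fst x)) = \<pi> (\<phi> e)" using actX.orbit_mem[OF assms] x by auto
    fix r assume "\<exists>(e, w)\<in>\<pi>E x. r = \<pi> (\<phi> e)"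
    then show "r = \<pi> (\<phi> (fst x))" using * x by auto
  qed
qed

lemma smooth_piphi: "smooth_on (pts XE) XE QM (\<lambda>x. \<pi> (\<phi> (fst x)))"
proof -
  have 1: "smooth_on (pts XE) XE E fst" using smooth_on_fst[OF pre(1) GM order_refl] by simp
  have 2: "smooth_on (pts XE) XE M (\<lambda>x. \<phi> (fst x))" by (rule smooth_on_compose[OF XE pre(1) 1 phi(1)]) auto
  show ?thesis by (rule smooth_on_compose[OF XE pre(2) 2 smooth_pi]) (use phi_pts in auto)
qed

text \<open>The fibers of \<open>t\<close> are the orbits over \<open>V\<close>, and
  \<open>s\<close> picks a representative in each. On the quotient \<open>t\<close> becomes a bundle
  chart with fiber \<open>F \<times> G\<close>; stated upstairs, the conditions involve no smooth
  structure on that quotient.\<close>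

definition E_triv :: "'m set set \<Rightarrow> ('e \<times> 'g \<Rightarrow> 'm set \<times> 'f \<times> 'g) \<Rightarrow> ('m set \<times> 'f \<times> 'g \<Rightarrow> 'e \<times> 'g) \<Rightarrow> bool" where
  "E_triv V t s \<longleftrightarrow> openin (mf_top QM) V \<and>
    smooth_on {x \<in> pts XE. \<pi> (\<phi> (fst x)) \<in> V} XE B t \<and>
    (\<forall>x \<in> pts XE. \<pi> (\<phi> (fst x)) \<in> V \<longrightarrow> t x \<in> V \<times> (pts F \<times> carrier G) \<and> fst (t x) = \<pi> (\<phi> (fst x))
        \<and> \<pi>E (s (t x)) = \<pi>E x) \<and>
    (\<forall>x \<in> pts XE. \<pi> (\<phi> (fst x)) \<in> V \<longrightarrow> (\<forall>g \<in> carrier G. t (cE g x) = t x)) \<and>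
    smooth_on (V \<times> (pts F \<times> carrier G)) B XE s \<and>
    (\<forall>b \<in> V \<times> (pts F \<times> carrier G). s b \<in> pts XE \<and> \<pi> (\<phi> (fst (s b))) = fst b \<and> t (s b) = b) \<and>
    dim (mf_model B) = dim (mf_model E)"

lemma E_trivD:
  assumes "E_triv V t s"
  shows "openin (mf_top QM) V"
    "smooth_on {x \<in> pts XE. \<pi> (\<phi> (fst x)) \<in> V} XE B t"
    "\<And>x. x \<in> pts XE \<Longrightarrow> \<pi> (\<phi> (fst x)) \<in> V \<Longrightarrow> t x \<in> V \<times> (pts F \<times> carrier G) \<and> fst (t x) = \<pi> (\<phi> (fst x))
        \<and> \<pi>E (s (t x)) = \<pi>E x"
    "\<And>x g. x \<in> pts XE \<Longrightarrow> \<pi> (\<phi> (fst x)) \<in> V \<Longrightarrow> g \<in> carrier G \<Longrightarrow> t (cE g x) = t x"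
    "smooth_on (V \<times> (pts F \<times> carrier G)) B XE s"
    "\<And>b. b \<in> V \<times> (pts F \<times> carrier G) \<Longrightarrow> s b \<in> pts XE \<and> \<pi> (\<phi> (fst (s b))) = fst b \<and> t (s b) = b"
    "dim (mf_model B) = dim (mf_model E)"
proof -
  note * = assms[unfolded E_triv_def]
  show "openin (mf_top QM) V" using * by (elim conjE)
  show "smooth_on {x \<in> pts XE. \<pi> (\<phi> (fst x)) \<in> V} XE B t" using * by (elim conjE)
  show "smooth_on (V \<times> (pts F \<times> carrier G)) B XE s" using * by (elim conjE)
  show "dim (mf_model B) = dim (mf_model E)" using * by (elim conjE)
  show "\<And>x. x \<in> pts XE \<Longrightarrow> \<pi> (\<phi> (fst x)) \<in> V \<Longrightarrow> t x \<in> V \<times> (pts F \<times> carrier G) \<and> fst (t x) = \<pi> (\<phi> (fst x))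
        \<and> \<pi>E (s (t x)) = \<pi>E x"
    "\<And>x g. x \<in> pts XE \<Longrightarrow> \<pi> (\<phi> (fst x)) \<in> V \<Longrightarrow> g \<in> carrier G \<Longrightarrow> t (cE g x) = t x"
    "\<And>b. b \<in> V \<times> (pts F \<times> carrier G) \<Longrightarrow> s b \<in> pts XE \<and> \<pi> (\<phi> (fst (s b))) = fst b \<and> t (s b) = b"
    using * by meson+
qed

text \<open>Every orbit over \<open>V\<close> is normalized: acting on \<open>(e, w)\<close> by the
  inverse of the group coordinate \<open>\<gamma> e\<close> moves \<open>e\<close> over the unit
  section \<open>\<sigma>\<close> of \<open>M\<close>. What remains is the orbit in
  \<open>M\<close>, the \<open>F\<close>-coordinate and the conjugated group element, and
  \<open>t\<close> lists these three.\<close>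

lemma E_trivialization:
  assumes "q \<in> pts QM"
  obtains V t s where "E_triv V t s" "q \<in> V"
proof -
  obtain V0 \<psi> \<theta> where T: "M_triv V0 \<psi> \<theta>" "q \<in> V0" using M_trivialization[OF assms] by blast
  note V0 = M_trivD(1)[OF T(1)] T(2) M_trivD(2,3)[OF T(1)]
  note psi = M_trivD(4)[OF T(1)] and theta = M_trivD(5)[OF T(1)] and psi_eq = M_trivD(6)[OF T(1)] and dimM = M_trivD(7)[OF T(1)]
  obtain m0 where m0: "m0 \<in> pts M" "q = \<pi> m0" using assms pts_QM by blast
  obtain r where r: "smooth_right_action G GM F r" and
    triv: "\<forall>m \<in> pts M. \<exists>U \<Phi>. openin (mf_top M) U \<and> m \<in> U \<and>
          (\<forall>g \<in> carrier G. aM g ` U \<subseteq> U) \<and>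
          diffeo_on {\<epsilon> \<in> pts E. \<phi> \<epsilon> \<in> U} E (U \<times> pts F) (prod_manifold M F) \<Phi> \<and>
          (\<forall>\<epsilon> \<in> pts E. \<phi> \<epsilon> \<in> U \<longrightarrow> fst (\<Phi> \<epsilon>) = \<phi> \<epsilon> \<and>
             (\<forall>g \<in> carrier G. \<Phi> (aE g \<epsilon>) = (aM g (fst (\<Phi> \<epsilon>)), r (snd (\<Phi> \<epsilon>)) (inv g))))"
    using acts unfolding acts_on_fiber_bundle_def by (elim conjE exE) (rule that; assumption)
  from bspec[OF triv m0(1)]
  obtain U \<Phi> where U1: "openin (mf_top M) U" "m0 \<in> U" "\<forall>g \<in> carrier G. aM g ` U \<subseteq> U"
    and d: "diffeo_on {\<epsilon> \<in> pts E. \<phi> \<epsilon> \<in> U} E (U \<times> pts F) (prod_manifold M F) \<Phi>"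
    and Phi: "\<forall>\<epsilon> \<in> pts E. \<phi> \<epsilon> \<in> U \<longrightarrow> fst (\<Phi> \<epsilon>) = \<phi> \<epsilon> \<and>
             (\<forall>g \<in> carrier G. \<Phi> (aE g \<epsilon>) = (aM g (fst (\<Phi> \<epsilon>)), r (snd (\<Phi> \<epsilon>)) (inv g)))"
    by (elim conjE exE) (rule that; assumption)
  have U: "openin (mf_top M) U" "m0 \<in> U" "\<And>g m. g \<in> carrier G \<Longrightarrow> m \<in> U \<Longrightarrow> aM g m \<in> U"
    and Phi1: "\<And>\<epsilon>. \<epsilon> \<in> pts E \<Longrightarrow> \<phi> \<epsilon> \<in> U \<Longrightarrow> fst (\<Phi> \<epsilon>) = \<phi> \<epsilon>"
    and Phi2: "\<And>\<epsilon> g. \<epsilon> \<in> pts E \<Longrightarrow> \<phi> \<epsilon> \<in> U \<Longrightarrow> g \<in> carrier G \<Longrightarrow> \<Phi> (aE g \<epsilon>) = (aM g (fst (\<Phi> \<epsilon>)), r (snd (\<Phi> \<epsilon>)) (inv g))"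
    using U1 Phi by (simp_all add: image_subset_iff)
  let ?D = "{\<epsilon> \<in> pts E. \<phi> \<epsilon> \<in> U}"
  let ?\<Psi> = "inv_into ?D \<Phi>"
  have bij: "bij_betw \<Phi> ?D (U \<times> pts F)" and sPhi: "smooth_on ?D E (prod_manifold M F) \<Phi>"
    and sPsi: "smooth_on (U \<times> pts F) (prod_manifold M F) E ?\<Psi>"
    using d by (auto simp: diffeo_on_def)
  have UM: "U \<subseteq> pts M" using U(1) openin_subset by blast
  have Do: "openin (mf_top E) ?D" by (rule smooth_on_openin_vimage[OF pre(1,2) phi(1) _ U(1)]) simp
  have PhiD: "\<Phi> e \<in> U \<times> pts F" "?\<Psi> (\<Phi> e) = e" if "e \<in> ?D" for e
    using bij_betwE[OF bij] bij_betw_inv_into_left[OF bij] that by blast+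
  have Psi: "?\<Psi> p \<in> ?D" "\<Phi> (?\<Psi> p) = p" "\<phi> (?\<Psi> p) = fst p" if p: "p \<in> U \<times> pts F" for p
  proof -
    show 1: "?\<Psi> p \<in> ?D" using bij_betwE[OF bij_betw_inv_into[OF bij]] p by blast
    show 2: "\<Phi> (?\<Psi> p) = p" by (rule bij_betw_inv_into_right[OF bij p])
    show "\<phi> (?\<Psi> p) = fst p" using Phi1[of "?\<Psi> p"] 1 2 by simp
  qed
  have rsm: "smooth_on (pts F \<times> carrier G) (prod_manifold F GM) F (\<lambda>(x, g). r x g)"
    and r1: "\<And>x. x \<in> pts F \<Longrightarrow> r x \<one> = x"
    and r2: "\<And>x g h. x \<in> pts F \<Longrightarrow> g \<in> carrier G \<Longrightarrow> h \<in> carrier G \<Longrightarrow> r (r x g) h = r x (g \<otimes> h)"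
    using r pts_GM unfolding smooth_right_action_def smooth_map_def by auto
  have rF: "r x g \<in> pts F" if "x \<in> pts F" "g \<in> carrier G" for x g
    using smooth_on_image[OF pre(3) rsm] that by auto
  \<comment> \<open>\<open>U\<close> is invariant, so it contains every orbit that it meets; over
    \<open>V\<close> the trivializations of \<open>M\<close> and of \<open>E\<close> are therefore
    both available.\<close>
  define V where "V = V0 \<inter> \<pi> ` U"
  have V: "openin (mf_top QM) V" unfolding V_def using V0(1) actM.openin_proj_image[OF U(1)] by blast
  have qV: "q \<in> V" unfolding V_def using V0(2) m0 U(2) by blast
  have inU: "m \<in> U" if "m \<in> pts M" "\<pi> m \<in> V" for m
  proof -
    obtain u where u: "u \<in> U" "\<pi> m = \<pi> u" using \<open>\<pi> m \<in> V\<close> unfolding V_def by blast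
    then obtain g where "g \<in> carrier G" "aM g u = m" using actM.orbit_eq_iff[of u m] UM \<open>m \<in> pts M\<close> by auto
    then show ?thesis using U(3) u by blast
  qed
  have inV0: "x \<in> V0" if "x \<in> V" for x using that by (simp add: V_def)
  define \<gamma> where "\<gamma> e = snd (\<psi> (\<phi> e))" for e
  \<comment> \<open>The middle entry is the \<open>F\<close>-coordinate of
    \<open>inv (\<gamma> e)\<close> acting on \<open>e\<close>: the right action enters with an
    inverse, so \<open>\<gamma> e\<close> is inverted twice.\<close>
  define t where "t x = (\<pi> (\<phi> (fst x)), (r (snd (\<Phi> (fst x))) (\<gamma> (fst x)), inv (\<gamma> (fst x)) \<otimes> snd x \<otimes> \<gamma> (fst x)))" for x
  define \<sigma> where "\<sigma> q = \<theta> (q, \<one>)" for q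
  define s where "s b = (?\<Psi> (\<sigma> (fst b), fst (snd b)), snd (snd b))" for b :: "'m set \<times> 'f \<times> 'g"
  let ?X = "{x \<in> pts XE. \<pi> (\<phi> (fst x)) \<in> V}" and ?A = "V \<times> (pts F \<times> carrier G)"
  have gam: "\<gamma> e \<in> carrier G" if "e \<in> pts E" "\<pi> (\<phi> e) \<in> V" for e
    using psi[OF phi_pts[OF that(1)] inV0[OF that(2)]] by (simp add: \<gamma>_def)
  have eD: "e \<in> ?D" if "e \<in> pts E" "\<pi> (\<phi> e) \<in> V" for e using inU[OF phi_pts] that by blast
  have sig: "\<sigma> p \<in> pts M" "\<pi> (\<sigma> p) = p" "\<sigma> p \<in> U" "\<psi> (\<sigma> p) = (p, \<one>)" if p: "p \<in> V" for p
  proof -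
    have *: "(p, \<one>) \<in> V0 \<times> carrier G" using inV0[OF p] by simp
    show "\<sigma> p \<in> pts M" "\<pi> (\<sigma> p) = p" "\<psi> (\<sigma> p) = (p, \<one>)" using theta[OF *] by (auto simp: \<sigma>_def)
    then show "\<sigma> p \<in> U" using inU p by simp
  qed
  have sX: "s b \<in> pts XE \<and> \<pi> (\<phi> (fst (s b))) = fst b \<and> t (s b) = b" if "b \<in> ?A" for b
  proof -
    obtain p f h where b: "b = (p, (f, h))" "p \<in> V" "f \<in> pts F" "h \<in> carrier G" using \<open>b \<in> ?A\<close> by auto
    have pf: "(\<sigma> p, f) \<in> U \<times> pts F" using sig b by auto
    note * = Psi[OF pf]
    have "s b = (?\<Psi> (\<sigma> p, f), h)" by (simp add: s_def b)
    moreover have "\<gamma> (?\<Psi> (\<sigma> p, f)) = \<one>" unfolding \<gamma>_def *(3) using sig(4)[OF b(2)] by simp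
    ultimately show ?thesis
      using *(1,2) *(3) sig(2)[OF b(2)] b pts_GM r1 by (simp add: t_def)
  qed
  have st: "t x \<in> ?A \<and> fst (t x) = \<pi> (\<phi> (fst x)) \<and> \<pi>E (s (t x)) = \<pi>E x" if "x \<in> pts XE" "\<pi> (\<phi> (fst x)) \<in> V" for x
  proof -
    obtain e w where x: "x = (e, w)" "e \<in> pts E" "w \<in> carrier G" "\<pi> (\<phi> e) \<in> V"
      using \<open>x \<in> pts XE\<close> \<open>\<pi> (\<phi> (fst x)) \<in> V\<close> pts_GM by auto
    note g = gam[OF x(2,4)] and D = eD[OF x(2,4)]
    have gi: "inv (\<gamma> e) \<in> carrier G" using g by simp
    let ?f = "snd (\<Phi> e)"
    have f: "?f \<in> pts F" using PhiD(1)[OF D] by auto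
    have tx: "t x = (\<pi> (\<phi> e), (r ?f (\<gamma> e), inv (\<gamma> e) \<otimes> w \<otimes> \<gamma> e))" by (simp add: t_def x)
    \<comment> \<open>The normalized representative: the group coordinate of its base point is the
      unit, so it lies over the section \<open>\<sigma>\<close>.\<close>
    let ?e = "aE (inv (\<gamma> e)) e"
    have eE: "?e \<in> pts E" using actE.act_closed[OF gi x(2)] .
    have phie: "\<phi> ?e = aM (inv (\<gamma> e)) (\<phi> e)" using phi_equivariant[OF gi x(2)] .
    have pie: "\<pi> (\<phi> ?e) = \<pi> (\<phi> e)" unfolding phie by (rule actM.orbit_act[OF gi phi_pts[OF x(2)]])
    have "snd (\<psi> (\<phi> ?e)) = \<one>"
      unfolding phie using psi_eq[OF phi_pts[OF x(2)] inV0[OF x(4)] gi] g by (simp add: \<gamma>_def)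
    then have "\<psi> (\<phi> ?e) = (\<pi> (\<phi> e), \<one>)" using psi[OF phi_pts[OF eE]] inV0[OF x(4)] pie by (metis prod.collapse)
    then have "\<sigma> (\<pi> (\<phi> e)) = \<phi> ?e" unfolding \<sigma>_def using psi[OF phi_pts[OF eE]] inV0[OF x(4)] pie by metis
    moreover have "\<Phi> ?e = (\<phi> ?e, r ?f (\<gamma> e))" using Phi2[of e "inv (\<gamma> e)"] D gi g Phi1[of e] phie by simp
    ultimately have "?\<Psi> (\<sigma> (\<pi> (\<phi> e)), r ?f (\<gamma> e)) = ?e" using PhiD(2)[of ?e] eD[OF eE] pie x(4) by simp
    then have "s (t x) = (?e, inv (\<gamma> e) \<otimes> w \<otimes> \<gamma> e)" by (simp add: s_def tx)
    also have "\<dots> = cE (inv (\<gamma> e)) x" using conj_action[OF x(2,3)] x(1) g by simp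
    finally have "\<pi>E (s (t x)) = \<pi>E x" using actX.orbit_act[OF gi \<open>x \<in> pts XE\<close>] by simp
    then show ?thesis using tx x g f rF by simp
  qed
  have tinv: "t (cE g x) = t x" if "x \<in> pts XE" "\<pi> (\<phi> (fst x)) \<in> V" "g \<in> carrier G" for x g
  proof -
    obtain e w where x: "x = (e, w)" "e \<in> pts E" "w \<in> carrier G" "\<pi> (\<phi> e) \<in> V"
      using \<open>x \<in> pts XE\<close> \<open>\<pi> (\<phi> (fst x)) \<in> V\<close> pts_GM by auto
    note g = gam[OF x(2,4)] and D = eD[OF x(2,4)]
    have f: "snd (\<Phi> e) \<in> pts F" using PhiD(1)[OF D] by auto
    have phie: "\<phi> (aE g e) = aM g (\<phi> e)" using phi_equivariant[OF that(3) x(2)] .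
    have gg: "\<gamma> (aE g e) = g \<otimes> \<gamma> e" unfolding \<gamma>_def phie using psi_eq[OF phi_pts[OF x(2)] inV0[OF x(4)] that(3)] .
    have "snd (\<Phi> (aE g e)) = r (snd (\<Phi> e)) (inv g)" using Phi2[of e g] D that(3) by simp
    then have 1: "r (snd (\<Phi> (aE g e))) (\<gamma> (aE g e)) = r (snd (\<Phi> e)) (\<gamma> e)"
      using r2[OF f, of "inv g" "g \<otimes> \<gamma> e"] that(3) g gg by (simp add: m_assoc[symmetric])
    have 2: "inv (g \<otimes> \<gamma> e) \<otimes> (g \<otimes> w \<otimes> inv g) \<otimes> (g \<otimes> \<gamma> e) = inv (\<gamma> e) \<otimes> w \<otimes> \<gamma> e"
    proof -
      have "inv (g \<otimes> \<gamma> e) \<otimes> (g \<otimes> w \<otimes> inv g) = inv (\<gamma> e) \<otimes> (w \<otimes> inv g)"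
        using that(3) g x(3) by (simp add: inv_mult_group m_assoc inv_solve_left')
      moreover have "inv (\<gamma> e) \<otimes> (w \<otimes> inv g) \<otimes> (g \<otimes> \<gamma> e) = inv (\<gamma> e) \<otimes> w \<otimes> \<gamma> e"
        using that(3) g x(3) by (simp add: m_assoc inv_solve_left')
      ultimately show ?thesis by simp
    qed
    have "\<pi> (\<phi> (aE g e)) = \<pi> (\<phi> e)" unfolding phie by (rule actM.orbit_act[OF that(3) phi_pts[OF x(2)]])
    then show ?thesis using conj_action[OF x(2,3)] 1 2 gg by (simp add: t_def x(1))
  qed
  have t: "smooth_on ?X XE B t"
  proof -
    have sub: "?X \<subseteq> pts XE" by auto
    note cp = smooth_on_subset[OF XE _ sub]
    have e: "smooth_on ?X XE E fst" and w: "smooth_on ?X XE GM snd"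
      using smooth_on_fst[OF pre(1) GM] smooth_on_snd[OF pre(1) GM] sub by auto
    have eXD: "fst ` ?X \<subseteq> ?D" using eD pts_GM by auto
    have Ph: "smooth_on ?X XE (prod_manifold M F) (\<lambda>x. \<Phi> (fst x))"
      by (rule smooth_on_compose[OF XE pre(1) e sPhi eXD])
    have f: "smooth_on ?X XE F (\<lambda>x. snd (\<Phi> (fst x)))"
      by (rule smooth_on_compose[OF XE premanifold_prod[OF pre(2,3)] Ph smooth_on_snd[OF pre(2,3) order_refl]])
         (use smooth_on_image[OF premanifold_prod[OF pre(2,3)] Ph] in simp)
    have p: "smooth_on ?X XE M (\<lambda>x. \<phi> (fst x))"
      by (rule smooth_on_compose[OF XE pre(1) e phi(1)]) auto
    have ps: "smooth_on ?X XE (prod_manifold QM GM) (\<lambda>x. \<psi> (\<phi> (fst x)))"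
      by (rule smooth_on_compose[OF XE pre(2) p V0(3)]) (use phi_pts inV0 in auto)
    have g: "smooth_on ?X XE GM (\<lambda>x. \<gamma> (fst x))"
      unfolding \<gamma>_def
      by (rule smooth_on_compose[OF XE premanifold_prod[OF QM GM] ps smooth_on_snd[OF QM GM order_refl]])
         (use smooth_on_image[OF premanifold_prod[OF QM GM] ps] in simp)
    have rf: "smooth_on ?X XE F (\<lambda>x. (\<lambda>(x, g). r x g) (snd (\<Phi> (fst x)), \<gamma> (fst x)))"
      by (rule smooth_on_compose[OF XE FG smooth_on_Pair[OF XE pre(3) GM f g] rsm])
         (use smooth_on_image[OF pre(3) f] smooth_on_image[OF GM g] pts_GM in auto)
    have rf: "smooth_on ?X XE F (\<lambda>x. r (snd (\<Phi> (fst x))) (\<gamma> (fst x)))"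
      using rf by simp
    show ?thesis
      unfolding t_def[abs_def]
      by (intro smooth_on_Pair XE QM FG GM pre(3) smooth_on_mult smooth_on_m_inv g w rf cp[OF smooth_piphi])
  qed
  have s: "smooth_on ?A B XE s"
  proof -
    have VQ: "V \<subseteq> pts QM" using V openin_subset by blast
    then have sub: "?A \<subseteq> pts QM \<times> pts (prod_manifold F GM)" using pts_GM by auto
    have q: "smooth_on ?A B QM fst" and fh: "smooth_on ?A B (prod_manifold F GM) snd"
      using smooth_on_fst[OF QM FG sub] smooth_on_snd[OF QM FG sub] by auto
    have f: "smooth_on ?A B F (\<lambda>b. fst (snd b))"
      by (rule smooth_on_compose[OF B FG fh smooth_on_fst[OF pre(3) GM order_refl]]) (use pts_GM in auto)
    have h: "smooth_on ?A B GM (\<lambda>b. snd (snd b))"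
      by (rule smooth_on_compose[OF B FG fh smooth_on_snd[OF pre(3) GM order_refl]]) (use pts_GM in auto)
    have sAB: "?A \<subseteq> pts B" using sub by simp
    have sg: "smooth_on ?A B M (\<lambda>b. \<sigma> (fst b))"
      unfolding \<sigma>_def
      by (rule smooth_on_compose[OF B premanifold_prod[OF QM GM] smooth_on_Pair[OF B QM GM q smooth_on_const[OF B sAB GM]] V0(4)])
         (use inV0 pts_GM in auto)
    have "smooth_on ?A B E (\<lambda>b. ?\<Psi> (\<sigma> (fst b), fst (snd b)))"
      by (rule smooth_on_compose[OF B premanifold_prod[OF pre(2,3)] smooth_on_Pair[OF B pre(2,3) sg f] sPsi])
         (use sig in auto)
    then show ?thesis unfolding s_def[abs_def] by (intro smooth_on_Pair B pre(1) GM h)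
  qed
  have "dim (mf_model E) = dim (mf_model (prod_manifold M F))"
  proof -
    obtain e0 where e0: "e0 \<in> pts E" "\<phi> e0 = m0" using m0 phi(2) by (metis imageE)
    show ?thesis
    proof (rule diffeo_on_dim[OF pre(1) premanifold_prod[OF pre(2,3)] d Do])
      show "openin (mf_top (prod_manifold M F)) (U \<times> pts F)" using U(1) by (simp add: openin_prod_Times_iff)
      show "e0 \<in> ?D" using e0 U(2) by blast
    qed
  qed
  then have "dim (mf_model B) = dim (mf_model E)"
    using dimM dim_Times[OF premanifold_subspace[OF pre(2)] premanifold_subspace[OF pre(3)]]
      dim_Times[OF premanifold_subspace[OF QM] premanifold_subspace[OF FG]]
      dim_Times[OF premanifold_subspace[OF pre(3)] premanifold_subspace[OF GM]] by simp
  then have "E_triv V t s" unfolding E_triv_def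
    by (intro conjI V t s ballI impI sX tinv) (use st in \<open>blast+\<close>)
  then show ?thesis using that qV by blast
qed

lemma piE_pts: "x \<in> pts XE \<Longrightarrow> \<pi>E x \<in> pts QE" using actX.pts_quotient by blast

lemma vimage_phiQ:
  "{x \<in> pts XE. \<pi>E x \<in> {v \<in> pts QE. \<phi>Q v \<in> V}} = {x \<in> pts XE. \<pi> (\<phi> (fst x)) \<in> V}"
proof (rule Collect_cong, rule conj_cong[OF refl])
  fix x assume "x \<in> pts XE"
  then show "\<pi>E x \<in> {v \<in> pts QE. \<phi>Q v \<in> V} \<longleftrightarrow> \<pi> (\<phi> (fst x)) \<in> V"
    using phiQ[of x] piE_pts[of x] by simp
qed

lemma openin_phiQ:
  assumes "openin (mf_top QM) V" shows "openin (mf_top QE) {v \<in> pts QE. \<phi>Q v \<in> V}"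
  unfolding actX.openin_quotient actX.orbits_eq vimage_phiQ
  using smooth_on_openin_vimage[OF XE QM smooth_piphi openin_topspace assms] by auto

lemma QE_chart:
  assumes "v \<in> pts QE"
  shows "\<exists>C s. C \<in> quotient_atlas G GM XE cE \<and> v \<in> fst C \<and> actX.chart_section C s"
proof -
  obtain x where x: "x \<in> pts XE" "v = \<pi>E x" using assms actX.pts_quotient by blast
  have r: "\<pi> (\<phi> (fst x)) \<in> pts QM" using x phi_pts pi_pts by auto
  obtain V t s where T: "E_triv V t s" "\<pi> (\<phi> (fst x)) \<in> V" using E_trivialization[OF r] by blast
  note V = E_trivD(1)[OF T(1)] T(2) and t = E_trivD(2)[OF T(1)] and ts = E_trivD(3)[OF T(1)] and tinv = E_trivD(4)[OF T(1)]
    and s = E_trivD(5)[OF T(1)] and st = E_trivD(6)[OF T(1)] and dims = E_trivD(7)[OF T(1)]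
  let ?V = "{v \<in> pts QE. \<phi>Q v \<in> V}"
  have pV: "\<pi>E x \<in> ?V \<longleftrightarrow> \<pi> (\<phi> (fst x)) \<in> V" if "x \<in> pts XE" for x
    using phiQ[OF that] piE_pts[OF that] by simp
  show ?thesis
  proof (rule actX.chart_from_trivialization[OF B openin_phiQ[OF V(1)]])
    show "openin (mf_top B) (V \<times> (pts F \<times> carrier G))"
      using V(1) openin_topspace[of "mf_top GM"] pts_GM by (simp add: openin_prod_Times_iff)
    show "smooth_on {x \<in> pts XE. \<pi>E x \<in> ?V} XE B t" unfolding vimage_phiQ by (rule t)
    show "t ` {x \<in> pts XE. \<pi>E x \<in> ?V} \<subseteq> V \<times> (pts F \<times> carrier G)" unfolding vimage_phiQ using ts by blast
    show "smooth_on (V \<times> (pts F \<times> carrier G)) B XE s" by (rule s)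
    show "\<pi>E (s b) \<in> ?V \<and> t (s b) = b" if "b \<in> V \<times> (pts F \<times> carrier G)" for b
    proof -
      have "fst b \<in> V" using that by auto
      then show ?thesis using st[OF that] pV[of "s b"] by simp
    qed
    show "t (cE g x) = t x" if "g \<in> carrier G" "x \<in> pts XE" "\<pi>E x \<in> ?V" for g x
      using tinv[OF that(2) _ that(1)] pV[OF that(2)] that(3) by blast
    show "\<pi>E (s (t x)) = \<pi>E x" if "x \<in> pts XE" "\<pi>E x \<in> ?V" for x
      using ts[OF that(1)] pV[OF that(1)] that(2) by blast
    \<comment> \<open>The factor \<open>G\<close> of \<open>E \<times> G\<close> makes up for the
      dimension lost to the orbits, so both sides equal the dimension of \<open>E\<close>.\<close>
    show "dim (mf_model B) = dim (quotient_model XE GM)"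
      unfolding dims actX.quotient_model(3)
      using dim_Times[OF premanifold_subspace[OF pre(1)] premanifold_subspace[OF GM]] by simp
    show "v \<in> ?V" using pV[OF x(1)] V(2) x(2) by blast
  qed
qed

lemma QE: "premanifold QE" by (rule actX.quotient_premanifold[OF QE_chart])

lemma QE_sections: "has_sections XE QE \<pi>E" by (rule actX.quotient_has_sections[OF QE_chart])

lemma smooth_piE: "smooth_on (pts XE) XE QE \<pi>E" by (rule actX.smooth_on_proj[OF QE])

lemma smooth_phiQ: "smooth_on (pts QE) QE QM \<phi>Q"
proof (rule smooth_on_descend[OF XE QE QE_sections])
  have eq: "{x \<in> pts XE. \<pi>E x \<in> pts QE} = pts XE" using piE_pts by blast
  show "smooth_on {x \<in> pts XE. \<pi>E x \<in> pts QE} XE QM (\<lambda>x. \<phi>Q (\<pi>E x))"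
    unfolding eq by (rule smooth_on_cong[OF XE smooth_piphi]) (simp add: phiQ)
qed simp

text \<open>\<open>t\<close> is constant on orbits and hence descends to \<open>\<tau>\<close>; the
  inverse of \<open>\<tau>\<close> is \<open>s\<close> followed by \<open>\<pi>E\<close>.\<close>

lemma QE_trivialization:
  assumes "r \<in> pts QM"
  obtains V \<tau> where "openin (mf_top QM) V" "r \<in> V"
    "diffeo_on {v \<in> pts QE. \<phi>Q v \<in> V} QE (V \<times> (pts F \<times> carrier G)) B \<tau>"
    "\<forall>v \<in> pts QE. \<phi>Q v \<in> V \<longrightarrow> fst (\<tau> v) = \<phi>Q v"
proof -
  obtain V t s where T: "E_triv V t s" "r \<in> V" using E_trivialization[OF assms] by blast
  note V = E_trivD(1)[OF T(1)] T(2) and t = E_trivD(2)[OF T(1)] and ts = E_trivD(3)[OF T(1)] and tinv = E_trivD(4)[OF T(1)]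
    and s = E_trivD(5)[OF T(1)] and st = E_trivD(6)[OF T(1)] and dims = E_trivD(7)[OF T(1)]
  let ?V = "{v \<in> pts QE. \<phi>Q v \<in> V}" and ?A = "V \<times> (pts F \<times> carrier G)"
  define \<tau> where "\<tau> v = t (SOME x. x \<in> pts XE \<and> \<pi>E x = v)" for v
  have tau: "\<tau> (\<pi>E x) = t x" if x: "x \<in> pts XE" "\<pi> (\<phi> (fst x)) \<in> V" for x
  proof -
    define y where "y = (SOME y. y \<in> pts XE \<and> \<pi>E y = \<pi>E x)"
    have "y \<in> pts XE \<and> \<pi>E y = \<pi>E x" unfolding y_def by (rule someI[of _ x]) (use x in simp)
    then obtain g where "g \<in> carrier G" "cE g x = y" using actX.orbit_eq_iff[OF x(1), of y] by auto
    then show ?thesis using tinv[OF x] unfolding \<tau>_def y_def[symmetric] by blast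
  qed
  have rep: "\<exists>x\<in>pts XE. v = \<pi>E x \<and> \<pi> (\<phi> (fst x)) \<in> V" if v: "v \<in> ?V" for v
  proof -
    obtain x where "x \<in> pts XE" "v = \<pi>E x" using v actX.pts_quotient by blast
    then show ?thesis using phiQ[of x] v by auto
  qed
  have piEs: "\<pi>E (s b) \<in> ?V" "\<tau> (\<pi>E (s b)) = b" if b: "b \<in> ?A" for b
  proof -
    have "fst b \<in> V" using b by auto
    then show "\<pi>E (s b) \<in> ?V" "\<tau> (\<pi>E (s b)) = b"
      using st[OF b] phiQ[of "s b"] piE_pts[of "s b"] tau[of "s b"] by auto
  qed
  have taus: "\<tau> v \<in> ?A" "\<pi>E (s (\<tau> v)) = v" "fst (\<tau> v) = \<phi>Q v" if v: "v \<in> ?V" for v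
  proof -
    obtain x where x: "x \<in> pts XE" "v = \<pi>E x" "\<pi> (\<phi> (fst x)) \<in> V" using rep[OF v] by blast
    show "\<tau> v \<in> ?A" "\<pi>E (s (\<tau> v)) = v" "fst (\<tau> v) = \<phi>Q v"
      using ts[OF x(1,3)] tau[OF x(1,3)] phiQ[OF x(1)] x(2) by auto
  qed
  have bij: "bij_betw \<tau> ?V ?A"
  proof (rule bij_betw_byWitness[where f' = "\<lambda>b. \<pi>E (s b)"])
    show "\<forall>v\<in>?V. \<pi>E (s (\<tau> v)) = v" using taus(2) by blast
    show "\<forall>b\<in>?A. \<tau> (\<pi>E (s b)) = b" using piEs(2) by blast
    show "\<tau> ` ?V \<subseteq> ?A" by (rule image_subsetI) (rule taus(1))
    show "(\<lambda>b. \<pi>E (s b)) ` ?A \<subseteq> ?V" by (rule image_subsetI) (rule piEs(1))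
  qed
  have "diffeo_on ?V QE ?A B \<tau>"
    unfolding diffeo_on_def
  proof (intro conjI bij)
    show "smooth_on ?V QE B \<tau>"
    proof (rule smooth_on_descend[OF XE QE QE_sections openin_phiQ[OF V(1)]])
      show "smooth_on {x \<in> pts XE. \<pi>E x \<in> ?V} XE B (\<lambda>x. \<tau> (\<pi>E x))"
        unfolding vimage_phiQ by (rule smooth_on_cong[OF XE t]) (use tau in auto)
    qed
    have "smooth_on ?A B QE (\<lambda>b. \<pi>E (s b))"
      by (rule smooth_on_compose[OF B XE s smooth_piE]) (use st in blast)
    then show "smooth_on ?A B QE (inv_into ?V \<tau>)"
    proof (rule smooth_on_cong[OF B])
      fix b assume b: "b \<in> ?A"
      show "\<pi>E (s b) = inv_into ?V \<tau> b"
        using inv_into_f_eq[OF bij_betw_imp_inj_on[OF bij] piEs[OF b]] by simp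
    qed
  qed
  then show ?thesis using that V taus(3) by auto
qed

text \<open>Points over different orbits of \<open>M\<close> are separated in \<open>M/G\<close>,
  which is Hausdorff as the base of the principal bundle; points over the same orbit lie in one
  trivialization and are separated there.\<close>

lemma Hausdorff_QE: "Hausdorff_space (mf_top QE)"
  unfolding Hausdorff_space_def
proof (intro allI impI, elim conjE)
  fix u v assume u: "u \<in> pts QE" and v: "v \<in> pts QE" and uv: "u \<noteq> v"
  have HQM: "Hausdorff_space (mf_top QM)" using QM_manifold smooth_manifold_iff by blast
  have uQ: "\<phi>Q u \<in> pts QM" and vQ: "\<phi>Q v \<in> pts QM" using smooth_on_image[OF QM smooth_phiQ] u v by auto
  show "\<exists>U V. openin (mf_top QE) U \<and> openin (mf_top QE) V \<and> u \<in> U \<and> v \<in> V \<and> disjnt U V"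
  proof (cases "\<phi>Q u = \<phi>Q v")
    case False
    then obtain U V where "openin (mf_top QM) U" "openin (mf_top QM) V" "\<phi>Q u \<in> U" "\<phi>Q v \<in> V" "disjnt U V"
      using HQM uQ vQ unfolding Hausdorff_space_def by metis
    then show ?thesis using openin_phiQ u v
      by (intro exI[of _ "{v \<in> pts QE. \<phi>Q v \<in> U}"] exI[of _ "{v \<in> pts QE. \<phi>Q v \<in> V}"]) (auto simp: disjnt_iff)
  next
    case True
    obtain V \<tau> where V: "openin (mf_top QM) V" "\<phi>Q u \<in> V"
      and d: "diffeo_on {v \<in> pts QE. \<phi>Q v \<in> V} QE (V \<times> (pts F \<times> carrier G)) B \<tau>"
      and "\<forall>v \<in> pts QE. \<phi>Q v \<in> V \<longrightarrow> fst (\<tau> v) = \<phi>Q v"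
      by (rule QE_trivialization[OF uQ])
    let ?V = "{v \<in> pts QE. \<phi>Q v \<in> V}"
    have sm: "smooth_on ?V QE B \<tau>" and inj: "inj_on \<tau> ?V" using d by (auto simp: diffeo_on_def bij_betw_def)
    have uv': "u \<in> ?V" "v \<in> ?V" using u v V True by auto
    then have "\<tau> u \<noteq> \<tau> v" using inj uv by (meson inj_onD)
    moreover have "\<tau> u \<in> pts B" "\<tau> v \<in> pts B" using smooth_on_image[OF B sm] uv' by auto
    moreover have "Hausdorff_space (mf_top B)"
      using HQM GM_manifold manifolds(3) by (simp add: smooth_manifold_iff Hausdorff_space_prod_topology)
    ultimately obtain S T where S: "openin (mf_top B) S" "\<tau> u \<in> S" and T: "openin (mf_top B) T" "\<tau> v \<in> T"
      and "disjnt S T"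
      unfolding Hausdorff_space_def by metis
    then have "disjnt {x \<in> ?V. \<tau> x \<in> S} {x \<in> ?V. \<tau> x \<in> T}" unfolding disjnt_def by blast
    then show ?thesis
      using smooth_on_openin_vimage[OF QE B sm openin_phiQ[OF V(1)] S(1)]
        smooth_on_openin_vimage[OF QE B sm openin_phiQ[OF V(1)] T(1)] S(2) T(2) uv' by blast
  qed
qed

lemma QE_manifold: "smooth_manifold QE"
  unfolding smooth_manifold_iff
proof (intro conjI Hausdorff_QE QE actX.second_countable_quotient)
  show "second_countable (mf_top XE)"
    using manifolds(1) GM_manifold by (simp add: smooth_manifold_iff second_countable_prod_topology)
qed

lemma phiQ_image: "\<phi>Q ` pts QE = pts QM"
proof
  show "\<phi>Q ` pts QE \<subseteq> pts QM" using smooth_on_image[OF QM smooth_phiQ] .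
  show "pts QM \<subseteq> \<phi>Q ` pts QE"
  proof
    fix r assume "r \<in> pts QM"
    then obtain e where e: "e \<in> pts E" "r = \<pi> (\<phi> e)" using pts_QM phi(2) by (metis imageE)
    then have "r = \<phi>Q (\<pi>E (e, \<one>))" "\<pi>E (e, \<one>) \<in> pts QE" using phiQ[of "(e, \<one>)"] piE_pts[of "(e, \<one>)"] pts_GM by auto
    then show "r \<in> \<phi>Q ` pts QE" by blast
  qed
qed

theorem fiber_bundle_QE: "fiber_bundle QE QM (prod_manifold F GM) \<phi>Q"
  unfolding fiber_bundle_def
proof (intro conjI ballI)
  show "smooth_manifold (prod_manifold F GM)" by (rule smooth_manifold_prod[OF manifolds(3) GM_manifold])
  show "smooth_map QE QM \<phi>Q" unfolding smooth_map_def using smooth_phiQ phiQ_image by auto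
  fix r assume r: "r \<in> pts QM"
  show "\<exists>U \<Phi>. openin (mf_top QM) U \<and> r \<in> U \<and>
        diffeo_on {\<epsilon> \<in> pts QE. \<phi>Q \<epsilon> \<in> U} QE (U \<times> pts (prod_manifold F GM)) B \<Phi> \<and>
        (\<forall>\<epsilon> \<in> pts QE. \<phi>Q \<epsilon> \<in> U \<longrightarrow> fst (\<Phi> \<epsilon>) = \<phi>Q \<epsilon>)"
    by (rule QE_trivialization[OF r]) (use pts_GM in \<open>simp, blast\<close>)
qed (use QE_manifold QM_manifold phiQ_image in auto)

end

section \<open>Zero sets of submersions\<close>

text \<open>Rank and nullity inside a subspace: a right inverse \<open>R\<close> of \<open>L\<close>
  splits \<open>V\<close> into the kernel and a copy of the image, by sending \<open>(k, w)\<close>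
  to \<open>k + R w\<close>.\<close>

lemma dim_kernel_image:
  fixes L :: "'c::euclidean_space \<Rightarrow> 'd::euclidean_space"
  assumes L: "linear L" and V: "subspace V"
  shows "dim {v \<in> V. L v = 0} + dim (L ` V) = dim V"
proof -
  let ?K = "{v \<in> V. L v = 0}" and ?W = "L ` V"
  obtain R where R: "range R \<subseteq> V" "linear R" "\<And>w. w \<in> ?W \<Longrightarrow> L (R w) = w"
    using linear_exists_right_inverse_on[OF L V] by auto
  have K: "subspace ?K"
    using V L by (auto simp: subspace_def linear_0 linear_add linear_scale)
  have W: "subspace ?W" by (rule linear_subspace_image[OF L V])
  let ?f = "\<lambda>p. fst p + R (snd p)"
  have f: "linear ?f" by (rule linearI) (auto simp: linear_add[OF R(2)] linear_scale[OF R(2)] algebra_simps)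
  have inj: "inj_on ?f (?K \<times> ?W)"
  proof (rule inj_onI)
    fix p q assume p: "p \<in> ?K \<times> ?W" and q: "q \<in> ?K \<times> ?W" and eq: "?f p = ?f q"
    have "L (?f p) = snd p" "L (?f q) = snd q" using p q R(3) by (auto simp: linear_add[OF L])
    then have "snd p = snd q" using eq by simp
    then show "p = q" using eq by (simp add: prod_eq_iff)
  qed
  have "?f ` (?K \<times> ?W) = V"
  proof
    show "?f ` (?K \<times> ?W) \<subseteq> V" using R(1) V by (auto intro!: subspace_add)
    show "V \<subseteq> ?f ` (?K \<times> ?W)"
    proof
      fix v assume v: "v \<in> V"
      have "L (v - R (L v)) = 0" using R(3) v by (simp add: linear_diff[OF L])
      moreover have "v - R (L v) \<in> V" using v R(1) V by (auto intro!: subspace_diff)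
      ultimately have "(v - R (L v), L v) \<in> ?K \<times> ?W" using v by auto
      then show "v \<in> ?f ` (?K \<times> ?W)" by (rule rev_image_eqI) simp
    qed
  qed
  moreover have "dim (?f ` (?K \<times> ?W)) = dim (?K \<times> ?W)"
    by (rule dim_image_eq[OF f]) (unfold span_eq_iff[THEN iffD2, OF subspace_Times[OF K W]], rule inj)
  ultimately show ?thesis using dim_Times[OF K W] by simp
qed

text \<open>\<open>q\<close> subtracts a projection onto \<open>L\<close>, so its image
  \<open>W\<close> is a copy of \<open>V/L\<close> inside \<open>V\<close>, complementary to
  \<open>L\<close>. It turns membership in \<open>L\<close> into an equation, and thereby slice
  charts into local equations.\<close>

lemma subspace_quotient_map:
  fixes V L :: "'c::euclidean_space set"
  assumes V: "subspace V" and L: "subspace L" "L \<subseteq> V"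
  obtains q W where "linear q" "subspace W" "W \<subseteq> V" "q ` V = W" "\<forall>x\<in>V. q x = 0 \<longleftrightarrow> x \<in> L"
    "W \<inter> L \<subseteq> {0}" "dim W + dim L = dim V"
proof -
  obtain P where P: "linear P" "range P \<subseteq> L" "\<And>x. x \<in> L \<Longrightarrow> P x = x"
    using subspace_projection[OF L(1)] by blast
  let ?q = "\<lambda>x. x - P x"
  have PL: "P x \<in> L" for x using P(2) by blast
  have q: "linear ?q" by (intro linear_compose_sub linear_ident P(1))
  have W: "subspace (?q ` V)" by (rule linear_subspace_image[OF q V])
  have iff: "?q x = 0 \<longleftrightarrow> x \<in> L" for x
    using P(3)[of x] PL[of x] by auto
  have "?q ` V \<subseteq> V" using PL L(2) V by (auto intro!: subspace_diff)
  moreover have "?q ` V \<inter> L \<subseteq> {0}"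
  proof
    fix w assume w: "w \<in> ?q ` V \<inter> L"
    then obtain x where x: "w = x - P x" by blast
    have "P w = P x - P (P x)" unfolding x by (rule linear_diff[OF P(1)])
    then have "P w = 0" using P(3)[OF PL[of x]] by simp
    then show "w \<in> {0}" using P(3)[of w] w by simp
  qed
  moreover have "{x \<in> V. ?q x = 0} = L" using iff L(2) by blast
  then have "dim (?q ` V) + dim L = dim V" using dim_kernel_image[OF q V] by simp
  ultimately show ?thesis using that[OF q W _ refl] iff by blast
qed

lemma prod_vec_manifold: "prod_manifold (vec_manifold V) (vec_manifold W) = vec_manifold (V \<times> W)"
proof -
  have "prod_chart (V, id) (W, id) = (V \<times> W, id)"
    by (simp add: prod_chart_def prod.map_id0)
  moreover have "prod_topology (top_of_set V) (top_of_set W) = top_of_set (V \<times> W)"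
    by (simp add: subtopology_Times[symmetric])
  ultimately show ?thesis by (auto simp: prod_manifold_def vec_manifold_def)
qed

lemma dmap_linear_vec:
  assumes V: "subspace V" and L: "linear L" and x: "x \<in> V" and v: "v \<in> V"
  shows "dmap (vec_manifold V) (vec_manifold V') L x v = L v"
  using dmap_vec[OF V Cinf_on_linear[OF open_UNIV L] x UNIV_I v] by (simp add: frechet_derivative_linear[OF L])

text \<open>Tangent vectors at \<open>y\<close> are already written in the preferred chart, so in
  coordinates this chart is the identity.\<close>

lemma dmap_preferred_chart:
  assumes Y: "premanifold Y" and y: "y \<in> pts Y" and v: "v \<in> mf_model Y"
  shows "dmap Y (vec_manifold (mf_model Y)) (snd (mf_chart_at Y y)) y v = v"
  using dmap_rep(1)[OF Y refl chart_open[OF Y chart_at(1)[OF Y y]] chart_at(2)[OF Y y] order_refl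
      Cinf_on_linear[OF open_UNIV linear_id] UNIV_I _ v, where Y = "vec_manifold (mf_model Y)" and f = "snd (mf_chart_at Y y)"]
  by (simp add: frechet_derivative_linear[OF linear_id])

text \<open>The map \<open>F\<close> is completed by the kernel of its differential:
  \<open>j\<close> places the values of \<open>F\<close> in a complement \<open>W'\<close> of
  \<open>L\<close>, while \<open>l\<close> projects the old coordinates to the kernel and identifies
  it with \<open>L\<close>. The sum has an injective differential, so the inverse function theorem
  makes it a chart, in which \<open>F y = 0\<close> reads as membership in \<open>L\<close>.\<close>

theorem submersion_slice_chart:
  fixes Y :: "('b, 'd::euclidean_space) manifold" and W :: "'c::euclidean_space set"
  assumes Y: "premanifold Y" and N: "openin (mf_top Y) N" "y0 \<in> N" and W: "subspace W"
    and F: "smooth_on N Y (vec_manifold W) F"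
    and surj: "W \<subseteq> dmap Y (vec_manifold W) F y0 ` mf_model Y"
    and S: "\<And>y. y \<in> N \<Longrightarrow> y \<in> S \<longleftrightarrow> F y = 0"
    and L: "subspace L" "L \<subseteq> mf_model Y" "dim L + dim W = dim (mf_model Y)"
  shows "\<exists>U c. openin (mf_top Y) U \<and> y0 \<in> U \<and> openin (top_of_set (mf_model Y)) (c ` U) \<and>
          diffeo_on U Y (c ` U) (vec_manifold (mf_model Y)) c \<and> c ` (U \<inter> S) = c ` U \<inter> L"
proof -
  let ?V = "mf_model Y"
  note V = premanifold_subspace[OF Y] and VW = premanifold_vec[OF W]
  note VY = premanifold_vec[OF V]
  have y0: "y0 \<in> pts Y" using N openin_subset by blast
  define C where "C = mf_chart_at Y y0"
  have C: "C \<in> mf_atlas Y" "y0 \<in> fst C" using chart_at[OF Y y0] by (auto simp: C_def)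
  have Fat: "smooth_at Y (vec_manifold W) F y0" by (rule smooth_atI[OF F N])
  obtain dF where dF: "linear dF" "\<And>v. v \<in> ?V \<Longrightarrow> dmap Y (vec_manifold W) F y0 v = dF v" "\<And>v. v \<in> ?V \<Longrightarrow> dF v \<in> W"
    using dmap_linear[OF Y VW Fat] by (metis vec_manifold_simps(3))
  have dFW: "dF ` ?V = W" using surj dF(2,3) by force
  define K where "K = {v \<in> ?V. dF v = 0}"
  have K: "subspace K" unfolding K_def using V dF(1) by (auto simp: subspace_def linear_0 linear_add linear_scale)
  have dimK: "dim K = dim L" using dim_kernel_image[OF dF(1) V] L(3) unfolding dFW K_def by simp
  obtain T T' where T: "linear T" "T ` K = L" "\<And>x. x \<in> K \<Longrightarrow> T' (T x) = x"
    by (rule isometries_subspaces[OF K L(1) dimK]) blast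
  obtain P where P: "linear P" "range P \<subseteq> K" "\<And>x. x \<in> K \<Longrightarrow> P x = x" using subspace_projection[OF K] by blast
  define l where "l x = T (P x)" for x
  have l: "linear l" unfolding l_def[abs_def] using linear_compose[OF P(1) T(1)] by (simp add: o_def)
  have lL: "l x \<in> L" for x using P(2) T(2) unfolding l_def by blast
  obtain q W' where W': "subspace W'" "W' \<subseteq> ?V" "W' \<inter> L \<subseteq> {0}" "dim W' + dim L = dim ?V"
    by (rule subspace_quotient_map[OF V L(1,2)]) blast
  have dimW: "dim W = dim W'" using W'(4) L(3) by simp
  obtain j j' where j: "linear j" "j ` W = W'" "\<And>x. x \<in> W \<Longrightarrow> j' (j x) = x" "linear j'"
    by (rule isometries_subspaces[OF W W'(1) dimW]) blast
  have j0: "w = 0" if "w \<in> W" "j w = 0" for w using j(3)[OF that(1)] that(2) linear_0[OF j(4)] by simp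
  let ?a = "\<lambda>p. j (fst p) + l (snd p)"
  have a: "linear ?a"
    using j(1) l by (intro linearI) (auto simp: linear_add linear_scale algebra_simps)
  define c where "c y = j (F y) + l (snd C y)" for y
  define A where "A = N \<inter> fst C"
  have A: "openin (mf_top Y) A" "y0 \<in> A" unfolding A_def using N chart_open[OF Y C(1)] C(2) by auto
  have FW: "F y \<in> W" if "y \<in> N" for y using smooth_on_image[OF VW F] that by auto
  have pair: "smooth_on A Y (vec_manifold (W \<times> ?V)) (\<lambda>y. (F y, snd C y))"
    unfolding prod_vec_manifold[symmetric]
    by (intro smooth_on_Pair Y VW VY smooth_on_subset[OF Y F] smooth_on_subset[OF Y smooth_on_chart[OF Y C(1)]])
       (auto simp: A_def)
  have aV: "?a p \<in> ?V" if "p \<in> W \<times> ?V" for p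
    using that j(2) W'(2) lL L(2) V by (auto intro!: subspace_add)
  note WV = subspace_Times[OF W V]
  have asm: "smooth_on (W \<times> ?V) (vec_manifold (W \<times> ?V)) (vec_manifold ?V) ?a"
    by (rule smooth_on_linear[OF WV V a order_refl]) (use aV in auto)
  have c: "smooth_on A Y (vec_manifold ?V) c"
    unfolding c_def[abs_def]
    using smooth_on_compose[OF Y premanifold_vec[OF WV] pair asm] FW chart_in_model[OF Y C(1)] by (auto simp: A_def)
  have pat: "smooth_at Y (vec_manifold (W \<times> ?V)) (\<lambda>y. (F y, snd C y)) y0" by (rule smooth_atI[OF pair A])
  have aat: "smooth_at (vec_manifold (W \<times> ?V)) (vec_manifold ?V) ?a (F y0, snd C y0)"
    by (rule smooth_atI[OF asm]) (use FW[OF N(2)] chart_in_model[OF Y C] in auto)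
  have dc: "dmap Y (vec_manifold ?V) c y0 v = j (dF v) + l v" if v: "v \<in> ?V" for v
  proof -
    have "dmap Y (vec_manifold ?V) c y0 v =
       dmap (vec_manifold (W \<times> ?V)) (vec_manifold ?V) ?a (F y0, snd C y0) (dmap Y (vec_manifold (W \<times> ?V)) (\<lambda>y. (F y, snd C y)) y0 v)"
      using dmap_compose[OF Y premanifold_vec[OF WV] VY pat aat v] by (simp add: c_def[abs_def])
    also have "dmap Y (vec_manifold (W \<times> ?V)) (\<lambda>y. (F y, snd C y)) y0 v = (dF v, v)"
      using dmap_Pair[OF Y VW VY Fat chart_smooth_at[OF Y C] v] dF(2)[OF v] dmap_preferred_chart[OF Y y0 v]
      unfolding prod_vec_manifold C_def by simp
    also have "dmap (vec_manifold (W \<times> ?V)) (vec_manifold ?V) ?a (F y0, snd C y0) (dF v, v) = j (dF v) + l v"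
      using dmap_linear_vec[OF WV a, of "(F y0, snd C y0)" "(dF v, v)"] FW[OF N(2)] chart_in_model[OF Y C] dF(3)[OF v] v by simp
    finally show ?thesis .
  qed
  have inj: "v = 0" if v: "v \<in> ?V" "dmap Y (vec_manifold ?V) c y0 v = 0" for v
  proof -
    have 0: "j (dF v) + l v = 0" using dc[OF v(1)] v(2) by simp
    then have "j (dF v) = - l v" by (simp add: eq_neg_iff_add_eq_0)
    then have "j (dF v) \<in> L" using lL[of v] L(1) by (simp add: subspace_neg)
    moreover have "j (dF v) \<in> W'" using j(2) dF(3)[OF v(1)] by blast
    ultimately have j0': "j (dF v) = 0" using W'(3) by blast
    then have "dF v = 0" using j0[OF dF(3)[OF v(1)]] by simp
    then have vK: "v \<in> K" using v(1) by (simp add: K_def)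
    have "T v = 0" using 0 j0' P(3)[OF vK] by (simp add: l_def)
    then have "v = T' 0" using T(3)[OF vK] by simp
    moreover have "T' 0 = 0" using T(3)[of 0] subspace_0[OF K] linear_0[OF T(1)] by simp
    ultimately show "v = 0" by simp
  qed
  obtain U V1 where U: "openin (mf_top Y) U" "y0 \<in> U" "U \<subseteq> A" "openin (mf_top (vec_manifold ?V)) V1"
    and d: "diffeo_on U Y V1 (vec_manifold ?V) c"
    using inverse_function_manifold[OF Y VY c A _ inj] by (metis vec_manifold_simps(3))
  have V1: "V1 = c ` U" using d by (auto simp: diffeo_on_def bij_betw_def)
  have iff: "y \<in> S \<longleftrightarrow> c y \<in> L" if y: "y \<in> U" for y
  proof -
    have yN: "y \<in> N" using y U(3) A_def by blast
    have "c y \<in> L \<longleftrightarrow> j (F y) \<in> L"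
      unfolding c_def using lL[of "snd C y"] L(1) subspace_add subspace_diff by (metis add_diff_cancel_right')
    also have "\<dots> \<longleftrightarrow> F y = 0"
      using j(2) FW[OF yN] W'(3) j0[OF FW[OF yN]] linear_0[OF j(1)] subspace_0[OF L(1)] by auto
    finally show ?thesis using S[OF yN] by simp
  qed
  have "c ` (U \<inter> S) = c ` U \<inter> L" using iff by blast
  then show ?thesis using U d V1 by auto
qed

lemma dmap_partial:
  assumes X: "premanifold X" and Y: "premanifold Y" and Z: "premanifold Z"
    and h: "smooth_at (prod_manifold X Y) Z h (x, y)" and v: "v \<in> mf_model X" and w: "w \<in> mf_model Y"
  shows "dmap (prod_manifold X Y) Z h (x, y) (v, w) = dmap X Z (\<lambda>x. h (x, y)) x v + dmap Y Z (\<lambda>y. h (x, y)) y w"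
proof -
  let ?P = "prod_manifold X Y"
  note P = premanifold_prod[OF X Y]
  have xy: "x \<in> pts X" "y \<in> pts Y" using smooth_at_pts[OF h] by auto
  have v0: "0 \<in> mf_model X" "0 \<in> mf_model Y" using premanifold_subspace[OF X] premanifold_subspace[OF Y] subspace_0 by auto
  have "dmap ?P Z h (x, y) ((v, 0) + (0, w)) = dmap ?P Z h (x, y) (v, 0) + dmap ?P Z h (x, y) (0, w)"
    by (rule dmap_add[OF P Z h]) (use v w v0 in auto)
  moreover have "dmap X Z (\<lambda>x. h (x, y)) x v = dmap ?P Z h (x, y) (v, 0)"
  proof -
    have i: "smooth_at X X (\<lambda>x. x) x" and c: "smooth_at X Y (\<lambda>_. y) x"
      using smooth_at_ident[OF X] smooth_at_const[OF X Y] xy by auto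
    show ?thesis
      using dmap_compose[OF X P Z smooth_at_Pair[OF X X Y i c] h v] dmap_Pair[OF X X Y i c v]
        dmap_ident[OF X xy(1) v] dmap_const[OF X xy(1) v, of Y y] by simp
  qed
  moreover have "dmap Y Z (\<lambda>y. h (x, y)) y w = dmap ?P Z h (x, y) (0, w)"
  proof -
    have i: "smooth_at Y Y (\<lambda>y. y) y" and c: "smooth_at Y X (\<lambda>_. x) y"
      using smooth_at_ident[OF Y] smooth_at_const[OF Y X] xy by auto
    show ?thesis
      using dmap_compose[OF Y P Z smooth_at_Pair[OF Y X Y c i] h w] dmap_Pair[OF Y X Y c i w]
        dmap_ident[OF Y xy(2) w] dmap_const[OF Y xy(2) w, of X x] by simp
  qed
  ultimately show ?thesis by simp
qed

section \<open>Discrete connections\<close>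

locale connection = symmetric_bundle G GM E M F \<phi> aE aM
  for G :: "'g monoid" (structure) and GM :: "('g, 'cg::euclidean_space) manifold"
    and E :: "('e, 'ce::euclidean_space) manifold" and M :: "('m, 'cm::euclidean_space) manifold"
    and F :: "('f, 'cf::euclidean_space) manifold" and \<phi> :: "'e \<Rightarrow> 'm"
    and aE :: "'g \<Rightarrow> 'e \<Rightarrow> 'e" and aM :: "'g \<Rightarrow> 'm \<Rightarrow> 'm" +
  fixes Hor :: "('m \<times> 'm) set"
  assumes conn: "discrete_connection G GM M aM Hor"
begin

abbreviation \<kappa> :: "'m \<times> 'm \<Rightarrow> 'm \<times> 'm set" where "\<kappa> \<equiv> \<lambda>(m0, m1). (m0, \<pi> m1)"

lemma Hor_pts: "Hor \<subseteq> pts M \<times> pts M"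
  using conn unfolding discrete_connection_def embedded_submanifold_def by simp

lemma Hor_invariant: "g \<in> carrier G \<Longrightarrow> (m0, m1) \<in> Hor \<Longrightarrow> (aM g m0, aM g m1) \<in> Hor"
  using conn unfolding discrete_connection_def by blast

lemma Hor_inj: "inj_on \<kappa> Hor"
  using conn unfolding discrete_connection_def by (elim conjE)

lemma Hor_domain: "{(m0, aM g m1) |m0 g m1. (m0, m1) \<in> Hor \<and> g \<in> carrier G} = pts M \<times> pts M"
  using conn unfolding discrete_connection_def by (elim conjE)

lemma Hor_local_diffeo: "local_diffeo_on Hor (prod_manifold M M) (prod_manifold M QM) \<kappa>"
  using conn unfolding discrete_connection_def by (elim conjE)

text \<open>The horizontal lift: the point of the orbit \<open>r\<close> that forms a horizontal
  pair with \<open>m\<close>.\<close>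

definition h :: "'m \<Rightarrow> 'm set \<Rightarrow> 'm" where "h m r = snd (inv_into Hor \<kappa> (m, r))"

lemma h_unique: assumes "(m, m1) \<in> Hor" shows "h m (\<pi> m1) = m1"
  using inv_into_f_f[OF Hor_inj assms] by (simp add: h_def)

text \<open>Existence rests on the convention that the domain is all of \<open>M \<times> M\<close>:
  a pair \<open>(m, m1)\<close> with \<open>m1\<close> in \<open>r\<close> arises from a horizontal
  pair by moving the second entry inside its orbit.\<close>

lemma h:
  assumes m: "m \<in> pts M" and r: "r \<in> pts QM"
  shows "(m, h m r) \<in> Hor" "h m r \<in> pts M" "\<pi> (h m r) = r"
proof -
  obtain m1 where m1: "m1 \<in> pts M" "r = \<pi> m1" using r pts_QM by blast
  have "(m, m1) \<in> {(m0, aM g m1) |m0 g m1. (m0, m1) \<in> Hor \<and> g \<in> carrier G}"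
    unfolding Hor_domain using m m1 by blast
  then obtain g m2 where g: "m1 = aM g m2" "(m, m2) \<in> Hor" "g \<in> carrier G" by blast
  have m2: "m2 \<in> pts M" using g Hor_pts by blast
  have "\<pi> m2 = r" using actM.orbit_act[OF g(3) m2] g(1) m1(2) by simp
  then have "h m r = m2" using h_unique[OF g(2)] by simp
  then show "(m, h m r) \<in> Hor" "h m r \<in> pts M" "\<pi> (h m r) = r" using g m2 \<open>\<pi> m2 = r\<close> by auto
qed

text \<open>Near a horizontal pair \<open>h\<close> is the second entry of a smooth local inverse of
  \<open>\<kappa>\<close>; injectivity of \<open>\<kappa>\<close> on all of \<open>Hor\<close> makes
  the local inverses agree with \<open>h\<close>.\<close>

lemma smooth_h: "smooth_on (pts M \<times> pts QM) (prod_manifold M QM) M (\<lambda>p. h (fst p) (snd p))"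
proof (rule smooth_on_local[OF premanifold_prod[OF pre(2) QM]])
  fix p assume p: "p \<in> pts M \<times> pts QM"
  let ?x = "(fst p, h (fst p) (snd p))"
  have x: "?x \<in> Hor" "\<kappa> ?x = p" using h[of "fst p" "snd p"] p by auto
  obtain W V where W: "openin (mf_top (prod_manifold M M)) W" "?x \<in> W" "openin (mf_top (prod_manifold M QM)) V"
    and d: "diffeo_on (Hor \<inter> W) (prod_manifold M M) V (prod_manifold M QM) \<kappa>"
    using bspec[OF Hor_local_diffeo[unfolded local_diffeo_on_def] x(1)] by (elim exE conjE)
  let ?i = "inv_into (Hor \<inter> W) \<kappa>"
  have bij: "bij_betw \<kappa> (Hor \<inter> W) V" and sm: "smooth_on V (prod_manifold M QM) (prod_manifold M M) ?i"
    using d by (auto simp: diffeo_on_def)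
  have pV: "p \<in> V" using bij_betwE[OF bij] x W(2) by force
  have "smooth_on V (prod_manifold M QM) M (\<lambda>p. snd (?i p))"
    by (rule smooth_on_compose[OF premanifold_prod[OF pre(2) QM] premanifold_prod[OF pre(2) pre(2)] sm smooth_on_snd[OF pre(2) pre(2) order_refl]])
       (use smooth_on_image[OF premanifold_prod[OF pre(2) pre(2)] sm] in simp)
  moreover have "snd (?i p') = h (fst p') (snd p')" if "p' \<in> V" for p'
  proof -
    have 1: "?i p' \<in> Hor" using bij_betwE[OF bij_betw_inv_into[OF bij]] that by blast
    have 2: "\<kappa> (?i p') = p'" by (rule bij_betw_inv_into_right[OF bij that])
    obtain a b where ab: "?i p' = (a, b)" by (cases "?i p'")
    show ?thesis using h_unique[of a b] 1 2 ab by auto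
  qed
  ultimately have "smooth_on V (prod_manifold M QM) M (\<lambda>p. h (fst p) (snd p))"
    by (rule smooth_on_cong[OF premanifold_prod[OF pre(2) QM]])
  then have "smooth_on (pts M \<times> pts QM \<inter> V) (prod_manifold M QM) M (\<lambda>p. h (fst p) (snd p))"
    by (rule smooth_on_subset[OF premanifold_prod[OF pre(2) QM]]) simp
  then show "\<exists>W. openin (mf_top (prod_manifold M QM)) W \<and> p \<in> W \<and>
      smooth_on (pts M \<times> pts QM \<inter> W) (prod_manifold M QM) M (\<lambda>p. h (fst p) (snd p))"
    using W(3) pV by blast
qed

lemma smooth_on_h:
  assumes Z: "premanifold Z" and f: "smooth_on A Z M f" and r: "smooth_on A Z QM r"
  shows "smooth_on A Z M (\<lambda>z. h (f z) (r z))"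
  using smooth_on_compose[OF Z premanifold_prod[OF pre(2) QM] smooth_on_Pair[OF Z pre(2) QM f r] smooth_h]
    smooth_on_image[OF pre(2) f] smooth_on_image[OF QM r] by auto

abbreviation A :: "'m \<Rightarrow> 'm \<Rightarrow> 'g" where "A \<equiv> conn_map G aM Hor"

text \<open>Written through \<open>h\<close> and the division map, the connection inherits
  smoothness and equivariance from them.\<close>

lemma conn_map_eq:
  assumes m: "m \<in> pts M" "m1 \<in> pts M" shows "A m m1 = \<delta> (h m (\<pi> m1)) m1"
proof -
  note H = h[OF m(1) pi_pts[OF m(2)]]
  have d: "\<delta> (h m (\<pi> m1)) m1 \<in> carrier G" "aM (\<delta> (h m (\<pi> m1)) m1) (h m (\<pi> m1)) = m1"
    using delta[OF H(2) m(2) H(3)] .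
  show ?thesis unfolding conn_map_def
  proof (rule the_equality)
    have "aM (inv (\<delta> (h m (\<pi> m1)) m1)) m1 = h m (\<pi> m1)" using actM.act_inv(1)[OF d(1) H(2)] d(2) by simp
    then show "\<delta> (h m (\<pi> m1)) m1 \<in> carrier G \<and> (m, aM (inv (\<delta> (h m (\<pi> m1)) m1)) m1) \<in> Hor"
      using d(1) H(1) by simp
    fix g assume g: "g \<in> carrier G \<and> (m, aM (inv g) m1) \<in> Hor"
    then have "h m (\<pi> m1) = aM (inv g) m1"
      using h_unique[of m "aM (inv g) m1"] actM.orbit_act[of "inv g" m1] m(2) by simp
    then have "aM g (h m (\<pi> m1)) = m1" using actM.act_inv(2)[of g m1] g m(2) by simp
    then show "g = \<delta> (h m (\<pi> m1)) m1" using delta_eq[of g "h m (\<pi> m1)"] g H(2) by simp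
  qed
qed

lemma A_closed: "m \<in> pts M \<Longrightarrow> m1 \<in> pts M \<Longrightarrow> A m m1 \<in> carrier G"
  using conn_map_eq delta(1) h pi_pts by simp

lemma A_act: "m \<in> pts M \<Longrightarrow> m1 \<in> pts M \<Longrightarrow> aM (A m m1) (h m (\<pi> m1)) = m1"
  using conn_map_eq delta(2) h pi_pts by simp

lemma h_equivariant:
  assumes "g \<in> carrier G" "m \<in> pts M" "r \<in> pts QM" shows "h (aM g m) r = aM g (h m r)"
  using h_unique[OF Hor_invariant[OF assms(1) h(1)[OF assms(2,3)]]] actM.orbit_act[OF assms(1) h(2)[OF assms(2,3)]] h(3)[OF assms(2,3)] by simp

lemma A_equivariant:
  assumes g: "g \<in> carrier G" and m: "m \<in> pts M" "m1 \<in> pts M"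
  shows "A (aM g m) (aM g m1) = g \<otimes> A m m1 \<otimes> inv g"
proof -
  note H = h[OF m(1) pi_pts[OF m(2)]]
  have gm: "aM g m \<in> pts M" "aM g m1 \<in> pts M" using actM.act_closed g m by auto
  have "A (aM g m) (aM g m1) = \<delta> (aM g (h m (\<pi> m1))) (aM g m1)"
    using conn_map_eq[OF gm] h_equivariant[OF g m(1) pi_pts[OF m(2)]] actM.orbit_act[OF g m(2)] by simp
  moreover have "aM (g \<otimes> A m m1 \<otimes> inv g) (aM g (h m (\<pi> m1))) = aM g m1"
    using actM.act_mult[of "g \<otimes> A m m1" "inv g" "aM g (h m (\<pi> m1))"] actM.act_inv(1)[OF g H(2)]
      actM.act_mult[of g "A m m1" "h m (\<pi> m1)"] A_act[OF m] A_closed[OF m] g H(2) actM.act_closed by simp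
  moreover have "g \<otimes> A m m1 \<otimes> inv g \<in> carrier G" "aM g (h m (\<pi> m1)) \<in> pts M"
    using g A_closed[OF m] actM.act_closed H(2) by auto
  ultimately show ?thesis using delta_eq[of "g \<otimes> A m m1 \<otimes> inv g" "aM g (h m (\<pi> m1))"] by simp
qed

section \<open>The reduction map and its adapted sections\<close>

abbreviation C :: "('e \<times> 'm, 'ce \<times> 'cm) manifold" where "C \<equiv> prod_manifold E M"
abbreviation CQ :: "(('e \<times> 'g) set \<times> 'm set, ('ce \<times> 'cg) \<times> 'cm) manifold" where "CQ \<equiv> prod_manifold QE QM"

lemma C: "premanifold C" by (rule premanifold_prod[OF pre(1,2)])
lemma CQ: "premanifold CQ" by (rule premanifold_prod[OF QE QM])

definition \<Upsilon> :: "'e \<times> 'm \<Rightarrow> ('e \<times> 'g) set \<times> 'm set" where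
  "\<Upsilon> = (\<lambda>(e, m). (\<pi>E (e, A (\<phi> e) m), \<pi> m))"

lemma Upsilon_pts: "x \<in> pts C \<Longrightarrow> \<Upsilon> x \<in> pts CQ"
  using phi_pts A_closed pts_GM by (auto simp: \<Upsilon>_def intro!: piE_pts pi_pts)

lemma smooth_proj: "smooth_on (pts C) C E fst" "smooth_on (pts C) C M snd" "smooth_on (pts C) C M (\<lambda>x. \<phi> (fst x))"
proof -
  show 1: "smooth_on (pts C) C E fst" "smooth_on (pts C) C M snd"
    using smooth_on_fst[OF pre(1,2) order_refl] smooth_on_snd[OF pre(1,2) order_refl] by auto
  show "smooth_on (pts C) C M (\<lambda>x. \<phi> (fst x))"
    by (rule smooth_on_compose[OF C pre(1) 1(1) phi(1)]) auto
qed

lemma smooth_Upsilon: "smooth_on (pts C) C CQ \<Upsilon>"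
proof -
  have m: "smooth_on (pts C) C QM (\<lambda>x. \<pi> (snd x))"
    by (rule smooth_on_compose[OF C pre(2) smooth_proj(2) smooth_pi]) auto
  have hh: "smooth_on (pts C) C M (\<lambda>x. h (\<phi> (fst x)) (\<pi> (snd x)))"
    by (rule smooth_on_h[OF C smooth_proj(3) m])
  have "smooth_on (pts C) C GM (\<lambda>x. \<delta> (h (\<phi> (fst x)) (\<pi> (snd x))) (snd x))"
    by (rule smooth_on_delta[OF C hh smooth_proj(2)]) (use h phi_pts pi_pts in auto)
  then have "smooth_on (pts C) C GM (\<lambda>x. A (\<phi> (fst x)) (snd x))"
    by (rule smooth_on_cong[OF C]) (use conn_map_eq phi_pts in auto)
  note p = smooth_on_Pair[OF C pre(1) GM smooth_proj(1) this]
  have "smooth_on (pts C) C QE (\<lambda>x. \<pi>E (fst x, A (\<phi> (fst x)) (snd x)))"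
    by (rule smooth_on_compose[OF C XE p smooth_piE]) (use smooth_on_image[OF XE p] in simp)
  then have "smooth_on (pts C) C CQ (\<lambda>x. (\<pi>E (fst x, A (\<phi> (fst x)) (snd x)), \<pi> (snd x)))"
    by (rule smooth_on_Pair[OF C QE QM _ m])
  then show ?thesis by (simp add: \<Upsilon>_def case_prod_beta')
qed

definition act :: "'g \<Rightarrow> 'e \<times> 'm \<Rightarrow> 'e \<times> 'm" where "act g x = (aE g (fst x), aM g (snd x))"

lemma act_pts: "g \<in> carrier G \<Longrightarrow> x \<in> pts C \<Longrightarrow> act g x \<in> pts C"
  using actE.act_closed actM.act_closed by (auto simp: act_def)

lemma Upsilon_act:
  assumes g: "g \<in> carrier G" and x: "x \<in> pts C" shows "\<Upsilon> (act g x) = \<Upsilon> x"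
proof -
  obtain e m where em: "x = (e, m)" "e \<in> pts E" "m \<in> pts M" using x by auto
  have Ac: "A (\<phi> e) m \<in> carrier G" using A_closed[OF phi_pts[OF em(2)] em(3)] .
  have "(aE g e, A (\<phi> (aE g e)) (aM g m)) = cE g (e, A (\<phi> e) m)"
    using conj_action[OF em(2) Ac] phi_equivariant[OF g em(2)] A_equivariant[OF g phi_pts[OF em(2)] em(3)] by simp
  then have "\<pi>E (aE g e, A (\<phi> (aE g e)) (aM g m)) = \<pi>E (e, A (\<phi> e) m)"
    using actX.orbit_act[OF g, of "(e, A (\<phi> e) m)"] em Ac pts_GM by simp
  then show ?thesis using actM.orbit_act[OF g em(3)] em(1) by (simp add: \<Upsilon>_def act_def)
qed

text \<open>Equal first entries give a group element \<open>g\<close> that relates the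
  \<open>E\<close>-components and conjugates the connection values. A point \<open>m\<close> is
  recovered as \<open>A (\<phi> e) m\<close> acting on \<open>h (\<phi> e) (\<pi> m)\<close>, so the
  same \<open>g\<close> relates the second components.\<close>

lemma Upsilon_eqD:
  assumes x: "x \<in> pts C" and y: "y \<in> pts C" and eq: "\<Upsilon> x = \<Upsilon> y"
  obtains g where "g \<in> carrier G" "y = act g x"
proof -
  obtain e m where em: "x = (e, m)" "e \<in> pts E" "m \<in> pts M" using x by auto
  obtain e' m' where em': "y = (e', m')" "e' \<in> pts E" "m' \<in> pts M" using y by auto
  have Ac: "A (\<phi> e) m \<in> carrier G" "A (\<phi> e') m' \<in> carrier G"
    using A_closed[OF phi_pts[OF em(2)] em(3)] A_closed[OF phi_pts[OF em'(2)] em'(3)] .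
  have "\<pi>E (e, A (\<phi> e) m) = \<pi>E (e', A (\<phi> e') m')" and pm: "\<pi> m = \<pi> m'" using eq em em' by (auto simp: \<Upsilon>_def)
  then obtain g where g: "g \<in> carrier G" "cE g (e, A (\<phi> e) m) = (e', A (\<phi> e') m')"
    using actX.orbit_eq_iff[of "(e, A (\<phi> e) m)" "(e', A (\<phi> e') m')"] em em' Ac pts_GM by auto
  have e': "e' = aE g e" and A': "A (\<phi> e') m' = g \<otimes> A (\<phi> e) m \<otimes> inv g" using g conj_action[OF em(2) Ac(1)] by auto
  have phie: "\<phi> e' = aM g (\<phi> e)" using e' phi_equivariant[OF g(1) em(2)] by simp
  have gm: "aM g m \<in> pts M" "\<phi> e' \<in> pts M" using actM.act_closed[OF g(1) em(3)] phi_pts em' by auto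
  have 1: "A (\<phi> e') (aM g m) = A (\<phi> e') m'" using A_equivariant[OF g(1) phi_pts[OF em(2)] em(3)] A' phie by simp
  have 2: "\<pi> (aM g m) = \<pi> m'" using actM.orbit_act[OF g(1) em(3)] pm by simp
  have "aM g m = aM (A (\<phi> e') (aM g m)) (h (\<phi> e') (\<pi> (aM g m)))" by (rule A_act[OF gm(2,1), symmetric])
  also have "\<dots> = m'" unfolding 1 2 by (rule A_act[OF gm(2) em'(3)])
  finally have "aM g m = m'" .
  then show ?thesis using that[OF g(1)] e' em em' by (simp add: act_def)
qed

lemma phiQ_Upsilon: "x \<in> pts C \<Longrightarrow> \<phi>Q (fst (\<Upsilon> x)) = \<pi> (\<phi> (fst x))"
  using phiQ A_closed phi_pts pts_GM by (auto simp: \<Upsilon>_def)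

lemma snd_Upsilon: "snd (\<Upsilon> x) = \<pi> (snd x)"
  by (simp add: \<Upsilon>_def case_prod_beta')

text \<open>The last condition lets \<open>d\<sigma>\<close> recover a vector \<open>(\<delta>\<epsilon>, 0)\<close> from its image under \<open>d\<Upsilon>\<close>.\<close>

definition adapted :: "(('e \<times> 'g) set \<times> 'm set) set \<Rightarrow> (('e \<times> 'g) set \<times> 'm set \<Rightarrow> 'e \<times> 'm) \<Rightarrow> bool" where
  "adapted V \<sigma> \<longleftrightarrow> openin (mf_top CQ) V \<and> smooth_on V CQ C \<sigma> \<and> (\<forall>y\<in>V. \<Upsilon> (\<sigma> y) = y) \<and>
     (\<forall>y\<in>V. \<forall>e\<in>pts E. \<Upsilon> (e, snd (\<sigma> y)) \<in> V \<longrightarrow> \<sigma> (\<Upsilon> (e, snd (\<sigma> y))) = (e, snd (\<sigma> y)))"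

lemma adaptedD:
  assumes "adapted V \<sigma>"
  shows "openin (mf_top CQ) V" "smooth_on V CQ C \<sigma>" "\<And>y. y \<in> V \<Longrightarrow> \<Upsilon> (\<sigma> y) = y"
    "\<And>y e. y \<in> V \<Longrightarrow> e \<in> pts E \<Longrightarrow> \<Upsilon> (e, snd (\<sigma> y)) \<in> V \<Longrightarrow> \<sigma> (\<Upsilon> (e, snd (\<sigma> y))) = (e, snd (\<sigma> y))"
    "\<And>y. y \<in> V \<Longrightarrow> \<sigma> y \<in> pts C" "V \<subseteq> pts CQ"
proof -
  note * = assms[unfolded adapted_def]
  show 1: "openin (mf_top CQ) V" using * by (elim conjE)
  show 2: "smooth_on V CQ C \<sigma>" using * by (elim conjE)
  show "\<And>y. y \<in> V \<Longrightarrow> \<Upsilon> (\<sigma> y) = y"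
    "\<And>y e. y \<in> V \<Longrightarrow> e \<in> pts E \<Longrightarrow> \<Upsilon> (e, snd (\<sigma> y)) \<in> V \<Longrightarrow> \<sigma> (\<Upsilon> (e, snd (\<sigma> y))) = (e, snd (\<sigma> y))"
    using * by meson+
  show "\<And>y. y \<in> V \<Longrightarrow> \<sigma> y \<in> pts C" using smooth_on_image[OF C 2] by blast
  show "V \<subseteq> pts CQ" using openin_subset[OF 1] .
qed

lemma act_fix:
  assumes "g \<in> carrier G" "x \<in> pts C" "snd (act g x) = snd x" shows "act g x = x"
proof -
  have "g = \<one>" using free[of "snd x" g] assms by (auto simp: act_def)
  then show ?thesis using assms(2) actE.act_one actM.act_one by (auto simp: act_def)
qed

text \<open>A section \<open>s\<close> of \<open>E \<times> G\<close> over its quotient gives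
  \<open>(e, w)\<close>, and \<open>mt\<close>, which is \<open>w\<close> acting on the horizontal
  lift, is the second entry with connection value \<open>w\<close>. Translating the pair so that its
  second entry becomes a value of \<open>\<sigma>M\<close> keeps the image under
  \<open>\<Upsilon>\<close> and makes that entry a function of the base \<open>M/G\<close>
  alone.\<close>

lemma adapted_section:
  assumes x0: "x0 \<in> pts C"
  obtains V \<sigma> where "adapted V \<sigma>" "\<Upsilon> x0 \<in> V" "\<sigma> (\<Upsilon> x0) = x0"
proof -
  have x0': "fst x0 \<in> pts E" "snd x0 \<in> pts M" using x0 by auto
  have y0: "fst (\<Upsilon> x0) \<in> pts QE" using Upsilon_pts[OF x0] by (auto simp: mem_Times_iff)
  obtain V1 s where V1: "openin (mf_top QE) V1" "fst (\<Upsilon> x0) \<in> V1" "smooth_on V1 QE XE s" "\<And>q. q \<in> V1 \<Longrightarrow> \<pi>E (s q) = q"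
    by (rule has_sectionsE[OF QE_sections y0]) blast
  obtain V2 \<sigma>M where V2: "openin (mf_top QM) V2" "\<pi> (snd x0) \<in> V2" "smooth_on V2 QM M \<sigma>M" "\<And>r. r \<in> V2 \<Longrightarrow> \<pi> (\<sigma>M r) = r"
    "\<sigma>M (\<pi> (snd x0)) = snd x0"
    by (rule M_section[OF x0'(2)]) blast
  define mt where "mt y = aM (snd (s (fst y))) (h (\<phi> (fst (s (fst y)))) (snd y))" for y
  define \<sigma> where "\<sigma> y = (aE (\<delta> (mt y) (\<sigma>M (snd y))) (fst (s (fst y))), \<sigma>M (snd y))" for y
  let ?V = "V1 \<times> V2"
  have Vo: "openin (mf_top CQ) ?V" using V1(1) V2(1) by (simp add: openin_prod_Times_iff)
  have sub: "?V \<subseteq> pts QE \<times> pts QM" using openin_subset[OF V1(1)] openin_subset[OF V2(1)] by auto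
  have sE: "fst (s q) \<in> pts E" "snd (s q) \<in> carrier G" if "q \<in> V1" for q
    using smooth_on_image[OF XE V1(3)] that pts_GM by (auto simp: mem_Times_iff)
  have sM: "\<sigma>M r \<in> pts M" if "r \<in> V2" for r using smooth_on_image[OF pre(2) V2(3)] that by auto
  have mt: "mt y \<in> pts M" "\<pi> (mt y) = snd y" "\<Upsilon> (fst (s (fst y)), mt y) = y" if y: "y \<in> ?V" for y
  proof -
    have q: "fst y \<in> V1" and r: "snd y \<in> V2" using y by auto
    have rQ: "snd y \<in> pts QM" using sub y by auto
    note H = h[OF phi_pts[OF sE(1)[OF q]] rQ]
    show 1: "mt y \<in> pts M" unfolding mt_def by (rule actM.act_closed[OF sE(2)[OF q] H(2)])
    show 2: "\<pi> (mt y) = snd y" unfolding mt_def using actM.orbit_act[OF sE(2)[OF q] H(2)] H(3) by simp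
    have "A (\<phi> (fst (s (fst y)))) (mt y) = snd (s (fst y))"
      unfolding conn_map_eq[OF phi_pts[OF sE(1)[OF q]] 1] 2 using delta_eq[OF sE(2)[OF q] H(2)] by (simp add: mt_def)
    then show "\<Upsilon> (fst (s (fst y)), mt y) = y" using V1(4)[OF q] 2 by (simp add: \<Upsilon>_def)
  qed
  have d: "\<delta> (mt y) (\<sigma>M (snd y)) \<in> carrier G" "aM (\<delta> (mt y) (\<sigma>M (snd y))) (mt y) = \<sigma>M (snd y)" if y: "y \<in> ?V" for y
    using delta[OF mt(1)[OF y] sM] mt(2)[OF y] V2(4) y by auto
  have sig: "\<sigma> y = act (\<delta> (mt y) (\<sigma>M (snd y))) (fst (s (fst y)), mt y)" if y: "y \<in> ?V" for y
    using d(2)[OF y] by (simp add: \<sigma>_def act_def)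
  have sC: "\<sigma> y \<in> pts C" if y: "y \<in> ?V" for y
    unfolding sig[OF y] by (rule act_pts[OF d(1)[OF y]]) (use mt(1)[OF y] sE y in auto)
  have Us: "\<Upsilon> (\<sigma> y) = y" if y: "y \<in> ?V" for y
    unfolding sig[OF y] using Upsilon_act[OF d(1)[OF y], of "(fst (s (fst y)), mt y)"] mt(1,3)[OF y] sE y by auto
  \<comment> \<open>Two preimages of one point that share the second entry differ by a group element
    fixing a point of \<open>M\<close>, hence coincide by freeness. This yields both the last
    condition of \<open>adapted\<close> and the passage through \<open>x0\<close>.\<close>
  have section_eq: "\<sigma> (\<Upsilon> x) = x" if x: "x \<in> pts C" "\<Upsilon> x \<in> ?V" "snd (\<sigma> (\<Upsilon> x)) = snd x" for x
  proof -
    obtain g where g: "g \<in> carrier G" "\<sigma> (\<Upsilon> x) = act g x"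
      using Upsilon_eqD[OF x(1) sC[OF x(2)]] Us[OF x(2)] by metis
    then show ?thesis using act_fix[OF g(1) x(1)] x(3) by simp
  qed
  have sm: "smooth_on ?V CQ C \<sigma>"
  proof -
    have sub': "?V \<subseteq> pts CQ" using sub by simp
    have q: "smooth_on ?V CQ QE fst" and r: "smooth_on ?V CQ QM snd"
      using smooth_on_fst[OF QE QM sub] smooth_on_snd[OF QE QM sub] by auto
    have sq: "smooth_on ?V CQ XE (\<lambda>y. s (fst y))" by (rule smooth_on_compose[OF CQ QE q V1(3)]) auto
    have e: "smooth_on ?V CQ E (\<lambda>y. fst (s (fst y)))"
      by (rule smooth_on_compose[OF CQ XE sq smooth_on_fst[OF pre(1) GM order_refl]]) (use smooth_on_image[OF XE sq] in simp)
    have w: "smooth_on ?V CQ GM (\<lambda>y. snd (s (fst y)))"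
      by (rule smooth_on_compose[OF CQ XE sq smooth_on_snd[OF pre(1) GM order_refl]]) (use smooth_on_image[OF XE sq] in simp)
    have pe: "smooth_on ?V CQ M (\<lambda>y. \<phi> (fst (s (fst y))))"
      by (rule smooth_on_compose[OF CQ pre(1) e phi(1)]) (use smooth_on_image[OF pre(1) e] in simp)
    have smt: "smooth_on ?V CQ M mt"
      unfolding mt_def[abs_def] by (rule actM.smooth_on_act[OF CQ w smooth_on_h[OF CQ pe r]])
    have sr: "smooth_on ?V CQ M (\<lambda>y. \<sigma>M (snd y))" by (rule smooth_on_compose[OF CQ QM r V2(3)]) auto
    have dd: "smooth_on ?V CQ GM (\<lambda>y. \<delta> (mt y) (\<sigma>M (snd y)))"
      by (rule smooth_on_delta[OF CQ smt sr]) (use mt(2) V2(4) in auto)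
    show ?thesis unfolding \<sigma>_def[abs_def]
      by (rule smooth_on_Pair[OF CQ pre(1,2) actE.smooth_on_act[OF CQ dd e] sr])
  qed
  have x0V: "\<Upsilon> x0 \<in> ?V" using V1(2) V2(2) by (simp add: mem_Times_iff snd_Upsilon)
  have "adapted ?V \<sigma>"
    unfolding adapted_def
  proof (intro conjI Vo sm ballI impI Us)
    fix y e assume y: "y \<in> ?V" and e: "e \<in> pts E" and yV: "\<Upsilon> (e, snd (\<sigma> y)) \<in> ?V"
    have "snd (\<sigma> (\<Upsilon> (e, snd (\<sigma> y)))) = \<sigma>M (\<pi> (\<sigma>M (snd y)))" by (simp add: \<sigma>_def snd_Upsilon)
    also have "\<dots> = snd (\<sigma> y)" using V2(4) y by (auto simp: \<sigma>_def)
    finally show "\<sigma> (\<Upsilon> (e, snd (\<sigma> y))) = (e, snd (\<sigma> y))"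
      using section_eq[of "(e, snd (\<sigma> y))"] yV e sC[OF y] by (auto simp: mem_Times_iff)
  qed
  moreover have "\<sigma> (\<Upsilon> x0) = x0" by (rule section_eq[OF x0 x0V]) (use V2(5) in \<open>simp add: \<sigma>_def snd_Upsilon\<close>)
  ultimately show ?thesis by (rule that[OF _ x0V])
qed

lemma Upsilon_image: "\<Upsilon> ` pts C = pts CQ"
proof
  show "\<Upsilon> ` pts C \<subseteq> pts CQ" using Upsilon_pts by blast
  show "pts CQ \<subseteq> \<Upsilon> ` pts C"
  proof
    fix y assume "y \<in> pts CQ"
    then obtain q r where y: "y = (q, r)" "q \<in> pts QE" "r \<in> pts QM" by auto
    obtain x where x: "x \<in> pts XE" "q = \<pi>E x" using y(2) actX.pts_quotient by blast
    obtain e w where ew: "x = (e, w)" "e \<in> pts E" "w \<in> carrier G" using x(1) pts_GM by auto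
    note H = h[OF phi_pts[OF ew(2)] y(3)]
    \<comment> \<open>The point of the orbit \<open>r\<close> whose connection value at
      \<open>\<phi> e\<close> is \<open>w\<close>.\<close>
    let ?m = "aM w (h (\<phi> e) r)"
    have m: "?m \<in> pts M" "\<pi> ?m = r" using actM.act_closed[OF ew(3) H(2)] actM.orbit_act[OF ew(3) H(2)] H(3) by auto
    have "A (\<phi> e) ?m = w" unfolding conn_map_eq[OF phi_pts[OF ew(2)] m(1)] m(2) by (rule delta_eq[OF ew(3) H(2)])
    then have "\<Upsilon> (e, ?m) = y" using y x ew m by (simp add: \<Upsilon>_def)
    then show "y \<in> \<Upsilon> ` pts C" using ew(2) m(1) by force
  qed
qed

lemma Upsilon_sections: "has_sections C CQ \<Upsilon>"
  unfolding has_sections_def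
proof
  fix y assume "y \<in> pts CQ"
  then obtain x where x: "x \<in> pts C" "\<Upsilon> x = y" using Upsilon_image by (metis imageE)
  obtain V \<sigma> where V: "adapted V \<sigma>" "\<Upsilon> x \<in> V" "\<sigma> (\<Upsilon> x) = x" by (rule adapted_section[OF x(1)])
  show "\<exists>V s. openin (mf_top CQ) V \<and> y \<in> V \<and> smooth_on V CQ C s \<and> (\<forall>y\<in>V. \<Upsilon> (s y) = y)"
    using adaptedD(1-3)[OF V(1)] V(2) x(2) by (intro exI[of _ V] exI[of _ \<sigma>]) simp
qed

end

section \<open>The reduced system\<close>

locale reduction = connection G GM "ds_E S" "ds_M S" "ds_F S" "ds_phi S" aE aM Hor
  for G :: "'g monoid" (structure) and GM :: "('g, 'cg::euclidean_space) manifold"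
    and S :: "('e, 'ce::euclidean_space, 'm, 'cm::euclidean_space, 'f, 'cf::euclidean_space) dldps_data"
    and aE :: "'g \<Rightarrow> 'e \<Rightarrow> 'e" and aM :: "'g \<Rightarrow> 'm \<Rightarrow> 'm" and Hor :: "('m \<times> 'm) set" +
  assumes sys: "dldps S" and sym: "symmetry_group G GM aE aM S"
begin

abbreviation E where "E \<equiv> ds_E S"
abbreviation M where "M \<equiv> ds_M S"
abbreviation F where "F \<equiv> ds_F S"
abbreviation \<phi> where "\<phi> \<equiv> ds_phi S"
abbreviation D where "D \<equiv> ds_D S"
abbreviation P where "P \<equiv> ds_P S"
abbreviation Dd where "Dd \<equiv> ds_Dd S"
abbreviation R where "R \<equiv> reduced_system G GM aE aM S Hor"
abbreviation dU where "dU \<equiv> dmap C CQ \<Upsilon>"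

lemma C1S: "C1 S = C" by (simp add: C1_def)

lemma C_open: "openin (mf_top C) (pts C)" by (rule openin_topspace)

lemma L_smooth: "smooth_on (pts C) C (vec_manifold UNIV) (ds_L S)"
  using sys unfolding dldps_def C1S smooth_map_def by (elim conjE)

lemma Dd_embedded: "embedded_submanifold C Dd"
  using sys unfolding dldps_def C1S by (elim conjE)

lemma Dd_pts: "Dd \<subseteq> pts C" using Dd_embedded by (simp add: embedded_submanifold_def)

lemma D_subbundle: "vector_subbundle C D"
  using sys unfolding dldps_def C1S by (elim conjE)

lemma D_subspace: "x \<in> pts C \<Longrightarrow> subspace (D x)" and D_model: "x \<in> pts C \<Longrightarrow> D x \<subseteq> mf_model C"
  using D_subbundle unfolding vector_subbundle_def by blast+

lemma D_vertical: "x \<in> pts C \<Longrightarrow> D x \<subseteq> mf_model E \<times> {0}"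
proof -
  have "\<forall>x\<in>pts C. D x \<subseteq> mf_model E \<times> {0}"
    using sys unfolding dldps_def C1S by (elim conjE)
  then show "x \<in> pts C \<Longrightarrow> D x \<subseteq> mf_model E \<times> {0}" by (rule bspec)
qed

lemma C2_iff: "(x0, x1) \<in> C2 S \<longleftrightarrow> x0 \<in> pts C \<and> x1 \<in> pts C \<and> \<phi> (fst x1) = snd x0"
  unfolding C2_def C1S by (cases x0; cases x1) simp

lemma P_props:
  assumes "z \<in> C2 S"
  shows "v \<in> D (snd z) \<Longrightarrow> P z v \<in> mf_model E"
    "v \<in> D (snd z) \<Longrightarrow> dmap E M \<phi> (fst (fst z)) (P z v) = 0"
    "v \<in> D (snd z) \<Longrightarrow> w \<in> D (snd z) \<Longrightarrow> P z (v + w) = P z v + P z w"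
    "v \<in> D (snd z) \<Longrightarrow> P z (r *\<^sub>R v) = r *\<^sub>R P z v"
proof -
  have "\<forall>z \<in> C2 S.
        (\<forall>v \<in> D (snd z). P z v \<in> mf_model E \<and> dmap E M \<phi> (fst (fst z)) (P z v) = 0) \<and>
        (\<forall>v \<in> D (snd z). \<forall>w \<in> D (snd z). P z (v + w) = P z v + P z w) \<and>
        (\<forall>v \<in> D (snd z). \<forall>r. P z (r *\<^sub>R v) = r *\<^sub>R P z v)"
    using sys unfolding dldps_def by (elim conjE)
  from bspec[OF this assms]
  show "v \<in> D (snd z) \<Longrightarrow> P z v \<in> mf_model E"
    "v \<in> D (snd z) \<Longrightarrow> dmap E M \<phi> (fst (fst z)) (P z v) = 0"
    "v \<in> D (snd z) \<Longrightarrow> w \<in> D (snd z) \<Longrightarrow> P z (v + w) = P z v + P z w"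
    "v \<in> D (snd z) \<Longrightarrow> P z (r *\<^sub>R v) = r *\<^sub>R P z v"
    by meson+
qed

lemma P_smooth: "smooth_on {(z, (x, v)). z \<in> C2 S \<and> x = snd z \<and> v \<in> D x}
       (prod_manifold (prod_manifold C C) (tangent_bundle C))
       (tangent_bundle E) (\<lambda>(z, (x, v)). (fst (fst z), P z v))"
  using sys unfolding dldps_def C1S by (elim conjE)

lemma act_smooth_on: "g \<in> carrier G \<Longrightarrow> smooth_on (pts C) C C (act g)"
  unfolding act_def[abs_def]
  by (intro smooth_on_Pair C pre actE.smooth_on_act_const actM.smooth_on_act_const smooth_proj)

lemma act_smooth_at: "g \<in> carrier G \<Longrightarrow> x \<in> pts C \<Longrightarrow> smooth_at C C (act g) x"
  by (rule smooth_atI[OF act_smooth_on C_open])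

lemma Upsilon_smooth_at: "x \<in> pts C \<Longrightarrow> smooth_at C CQ \<Upsilon> x"
  by (rule smooth_atI[OF smooth_Upsilon C_open])

lemma diag_act: "x \<in> pts C \<Longrightarrow> diag_action aE aM (pts C) g x = act g x"
  by (simp add: diag_action_def act_def case_prod_beta')

text \<open>\<open>diag_action\<close> is restricted to the points of \<open>C\<close>, an open set
  on which it agrees with \<open>act\<close>, and a differential cannot see the difference
  elsewhere.\<close>

lemma dmap_diag:
  assumes "x \<in> pts C" "v \<in> mf_model C"
  shows "dmap C C (diag_action aE aM (pts C) g) x v = dmap C C (act g) x v"
  by (rule dmap_cong[OF C C_open assms(1) _ assms(2)]) (rule diag_act)

lemma sym_props:
  assumes g: "g \<in> carrier G"
  shows "x \<in> pts C \<Longrightarrow> ds_L S (act g x) = ds_L S x"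
    "x \<in> Dd \<Longrightarrow> act g x \<in> Dd"
    "x \<in> pts C \<Longrightarrow> D (act g x) = dmap C C (act g) x ` D x"
    "(x0, x1) \<in> C2 S \<Longrightarrow> v \<in> D x1 \<Longrightarrow>
       P (act g x0, act g x1) (dmap C C (act g) x1 v) = dmap E E (aE g) (fst x0) (P (x0, x1) v)"
proof -
  let ?d = "diag_action aE aM (pts C)"
  note * = sym[unfolded symmetry_group_def Let_def C1S]
  have 1: "\<forall>g \<in> carrier G. \<forall>x \<in> pts C. ds_L S (?d g x) = ds_L S x" using * by (elim conjE)
  have 2: "\<forall>g \<in> carrier G. ?d g ` Dd = Dd" using * by (elim conjE)
  have 3: "\<forall>g \<in> carrier G. \<forall>x \<in> pts C. dmap C C (?d g) x ` D x = D (?d g x)" using * by (elim conjE)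
  have 4: "\<forall>g \<in> carrier G. \<forall>(x0, x1) \<in> C2 S. \<forall>v \<in> D x1.
          P (?d g x0, ?d g x1) (dmap C C (?d g) x1 v) = dmap E E (aE g) (fst x0) (P (x0, x1) v)"
    using * by (elim conjE)
  show "x \<in> pts C \<Longrightarrow> ds_L S (act g x) = ds_L S x" using 1 g diag_act by metis
  show "act g x \<in> Dd" if x: "x \<in> Dd"
  proof -
    have "?d g x \<in> ?d g ` Dd" using x by (rule imageI)
    then have "?d g x \<in> Dd" unfolding bspec[OF 2 g] .
    moreover have "x \<in> pts C" using x Dd_pts by blast
    ultimately show ?thesis using diag_act[of x g] by simp
  qed
  show "D (act g x) = dmap C C (act g) x ` D x" if x: "x \<in> pts C"
  proof -
    have "D (act g x) = dmap C C (?d g) x ` D x" using bspec[OF bspec[OF 3 g] x, symmetric] unfolding diag_act[OF x] .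
    also have "\<dots> = dmap C C (act g) x ` D x"
      by (rule image_cong[OF refl]) (use dmap_diag[OF x] D_model[OF x] in blast)
    finally show ?thesis .
  qed
  show "P (act g x0, act g x1) (dmap C C (act g) x1 v) = dmap E E (aE g) (fst x0) (P (x0, x1) v)"
    if z: "(x0, x1) \<in> C2 S" and v: "v \<in> D x1"
  proof -
    have x: "x0 \<in> pts C" "x1 \<in> pts C" using z C2_iff by auto
    have "P (?d g x0, ?d g x1) (dmap C C (?d g) x1 v) = dmap E E (aE g) (fst x0) (P (x0, x1) v)"
      using bspec[OF bspec[OF 4 g] z] v by simp
    moreover have "v \<in> mf_model C" using D_model[OF x(2)] v by blast
    ultimately show ?thesis using dmap_diag[OF x(2)] unfolding diag_act[OF x(1)] diag_act[OF x(2)] by simp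
  qed
qed

section \<open>The differential of the reduction map\<close>

lemma dmap_act:
  assumes g: "g \<in> carrier G" and x: "x \<in> pts C" and a: "a \<in> mf_model E" and b: "b \<in> mf_model M"
  shows "dmap C C (act g) x (a, b) = (dmap E E (aE g) (fst x) a, dmap M M (aM g) (snd x) b)"
proof -
  have x': "fst x \<in> pts E" "snd x \<in> pts M" "x \<in> pts E \<times> pts M" using x by auto
  have ab: "(a, b) \<in> mf_model C" "(a, b) \<in> mf_model E \<times> mf_model M" using a b by auto
  note f = smooth_at_fst[OF pre(1,2) x'(3)] and s = smooth_at_snd[OF pre(1,2) x'(3)]
  note ge = actE.act_smooth_at[OF g x'(1)] and gm = actM.act_smooth_at[OF g x'(2)]
  show ?thesis
    unfolding act_def[abs_def]
    using dmap_Pair[OF C pre(1,2) smooth_at_compose[OF C pre(1) f ge] smooth_at_compose[OF C pre(2) s gm] ab(1)]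
      dmap_compose[OF C pre(1) pre(1) f ge ab(1)] dmap_compose[OF C pre(2) pre(2) s gm ab(1)]
      dmap_fst[OF pre(1,2) x'(3) ab(2)] dmap_snd[OF pre(1,2) x'(3) ab(2)] by simp
qed

lemma dU_act:
  assumes g: "g \<in> carrier G" and x: "x \<in> pts C" and v: "v \<in> mf_model C"
  shows "dU (act g x) (dmap C C (act g) x v) = dU x v"
proof -
  have "dU (act g x) (dmap C C (act g) x v) = dmap C CQ (\<lambda>x. \<Upsilon> (act g x)) x v"
    by (rule dmap_compose[OF C C CQ act_smooth_at[OF g x] Upsilon_smooth_at[OF act_pts[OF g x]] v, symmetric])
  also have "\<dots> = dU x v"
    by (rule dmap_cong[OF C C_open x _ v]) (rule Upsilon_act[OF g])
  finally show ?thesis .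
qed

lemma dU_model: "x \<in> pts C \<Longrightarrow> v \<in> mf_model C \<Longrightarrow> dU x v \<in> mf_model CQ"
  by (rule dmap_in_model[OF C CQ Upsilon_smooth_at])

text \<open>With \<open>m\<close> the second entry of \<open>\<sigma> y\<close>, applying
  \<open>\<Upsilon>\<close> and then \<open>\<sigma>\<close> is the identity on those points
  \<open>(e, m)\<close> that \<open>\<Upsilon>\<close> sends into \<open>V\<close>. Differentiating
  along this slice of \<open>E \<times> M\<close> gives the claim.\<close>

lemma adapted_lift:
  assumes V: "adapted V \<sigma>" and y: "y \<in> V" and v: "v \<in> mf_model E \<times> {0}"
  shows "dmap CQ C \<sigma> y (dU (\<sigma> y) v) = v"
proof -
  note AD = adaptedD[OF V]
  obtain e m where em: "\<sigma> y = (e, m)" by (cases "\<sigma> y")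
  have e: "e \<in> pts E" "m \<in> pts M" using AD(5)[OF y] em by auto
  obtain v1 where v1: "v = (v1, 0)" "v1 \<in> mf_model E" using v by auto
  let ?j = "\<lambda>e. (e, m)"
  have i: "smooth_at E E (\<lambda>e. e) e" and c: "smooth_at E M (\<lambda>_. m) e"
    using smooth_at_ident[OF pre(1)] smooth_at_const[OF pre(1,2)] e by auto
  have j: "smooth_at E C ?j e" by (rule smooth_at_Pair[OF pre(1,1,2) i c])
  have dj: "dmap E C ?j e v1 = v"
    using dmap_Pair[OF pre(1,1,2) i c v1(2)] dmap_ident[OF pre(1) e(1) v1(2)] dmap_const[OF pre(1) e(1) v1(2), of M m] v1(1) by simp
  have Us: "\<Upsilon> (e, m) = y" using AD(3)[OF y] em by simp
  have Ua: "smooth_at C CQ \<Upsilon> (e, m)" by (rule Upsilon_smooth_at) (use e in simp)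
  have Uj: "smooth_at E CQ (\<lambda>e. \<Upsilon> (e, m)) e" by (rule smooth_at_compose[OF pre(1) C j Ua])
  have sa: "smooth_at CQ C \<sigma> (\<Upsilon> (e, m))" unfolding Us by (rule smooth_atI[OF AD(2,1) y])
  have jm: "smooth_on (pts E) E C ?j" by (intro smooth_on_Pair pre smooth_on_ident smooth_on_const order_refl e)
  have UjO: "smooth_on (pts E) E CQ (\<lambda>e. \<Upsilon> (e, m))"
    by (rule smooth_on_compose[OF pre(1) C jm smooth_Upsilon]) (use e in auto)
  let ?W = "{e \<in> pts E. \<Upsilon> (e, m) \<in> V}"
  have W: "openin (mf_top E) ?W" by (rule smooth_on_openin_vimage[OF pre(1) CQ UjO openin_topspace AD(1)])
  have "dmap CQ C \<sigma> y (dU (\<sigma> y) v) = dmap CQ C \<sigma> (\<Upsilon> (e, m)) (dmap E CQ (\<lambda>e. \<Upsilon> (e, m)) e v1)"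
    using dmap_compose[OF pre(1) C CQ j Ua v1(2)] dj em Us by simp
  also have "\<dots> = dmap E C (\<lambda>e. \<sigma> (\<Upsilon> (e, m))) e v1"
    by (rule dmap_compose[OF pre(1) CQ C Uj sa v1(2), symmetric])
  also have "\<dots> = dmap E C ?j e v1"
    by (rule dmap_cong[OF pre(1) W _ _ v1(2)]) (use e Us y AD(4)[OF y] em in auto)
  finally show ?thesis using dj by simp
qed

text \<open>Supplies the uniqueness of the lift of a variation, on which the description of the
  reduced \<open>P\<close> by \<open>THE\<close> depends.\<close>

lemma dU_inj:
  assumes x: "x \<in> pts C" and "v \<in> mf_model E \<times> {0}" "w \<in> mf_model E \<times> {0}" "dU x v = dU x w"
  shows "v = w"
proof -
  obtain V \<sigma> where V: "adapted V \<sigma>" "\<Upsilon> x \<in> V" "\<sigma> (\<Upsilon> x) = x" by (rule adapted_section[OF x])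
  show ?thesis using adapted_lift[OF V(1,2) assms(2)] adapted_lift[OF V(1,2) assms(3)] V(3) assms(4) by simp
qed

section \<open>The data of the reduced system\<close>

lemma red_map: "red_map G aE aM Hor S = \<Upsilon>"
  by (simp add: red_map_def \<Upsilon>_def)

lemma red_phi: "red_phi G aM S = \<phi>Q"
  by (simp add: fun_eq_iff red_phi_def \<phi>Q_def)

lemma R_simps:
  "ds_E R = QE" "ds_M R = QM" "ds_F R = prod_manifold F GM" "ds_phi R = \<phi>Q" "C1 R = CQ"
  "ds_L R = (\<lambda>y. THE l. \<exists>x \<in> pts C. \<Upsilon> x = y \<and> l = ds_L S x)"
  "ds_Dd R = \<Upsilon> ` Dd"
  "ds_D R = (\<lambda>y. {dU x v |x v. x \<in> pts C \<and> \<Upsilon> x = y \<and> v \<in> D x})"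
  "ds_P R = (\<lambda>(y0, y1) w. THE u. \<exists>x0 x1 v.
                (x0, x1) \<in> C2 S \<and> \<Upsilon> x0 = y0 \<and> \<Upsilon> x1 = y1 \<and> v \<in> D x1 \<and> dU x1 v = w \<and>
                u = dmap C QE (fst \<circ> \<Upsilon>) x0 (P (x0, x1) v, dmap E M \<phi> (fst x1) (fst v)))"
  by (simp_all add: reduced_system_def Let_def C1_def red_E_def red_M_def red_map red_phi)

lemma L_red: assumes x: "x \<in> pts C" shows "ds_L R (\<Upsilon> x) = ds_L S x"
  unfolding R_simps
proof (rule the_equality)
  show "\<exists>x'\<in>pts C. \<Upsilon> x' = \<Upsilon> x \<and> ds_L S x = ds_L S x'" using x by blast
  fix l assume "\<exists>x'\<in>pts C. \<Upsilon> x' = \<Upsilon> x \<and> l = ds_L S x'"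
  then obtain x' where x': "x' \<in> pts C" "\<Upsilon> x' = \<Upsilon> x" "l = ds_L S x'" by blast
  obtain g where "g \<in> carrier G" "x = act g x'" by (rule Upsilon_eqD[OF x'(1) x x'(2)])
  then show "l = ds_L S x" using sym_props(1)[OF _ x'(1)] x'(3) by simp
qed

lemma L_red_smooth: "smooth_on (pts CQ) CQ (vec_manifold UNIV) (ds_L R)"
proof (rule smooth_on_descend[OF C CQ Upsilon_sections openin_topspace])
  have eq: "{x \<in> pts C. \<Upsilon> x \<in> pts CQ} = pts C" using Upsilon_pts by blast
  show "smooth_on {x \<in> pts C. \<Upsilon> x \<in> pts CQ} C (vec_manifold UNIV) (\<lambda>x. ds_L R (\<Upsilon> x))"
    unfolding eq by (rule smooth_on_cong[OF C L_smooth]) (rule L_red[symmetric])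
qed

text \<open>The variations are invariant and \<open>dU\<close> is compatible with the action, so the
  union over a fiber of \<open>\<Upsilon>\<close> in \<open>ds_D R\<close> is already exhausted by
  any one of its points.\<close>

lemma D_red: assumes x: "x \<in> pts C" shows "ds_D R (\<Upsilon> x) = dU x ` D x"
proof
  show "dU x ` D x \<subseteq> ds_D R (\<Upsilon> x)" unfolding R_simps using x by blast
  show "ds_D R (\<Upsilon> x) \<subseteq> dU x ` D x"
  proof
    fix w assume "w \<in> ds_D R (\<Upsilon> x)"
    then obtain x' v where x': "w = dU x' v" "x' \<in> pts C" "\<Upsilon> x' = \<Upsilon> x" "v \<in> D x'" unfolding R_simps by blast
    obtain g where g: "g \<in> carrier G" "x = act g x'" by (rule Upsilon_eqD[OF x'(2) x x'(3)])
    have vm: "v \<in> mf_model C" using x' D_model by blast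
    have "dmap C C (act g) x' v \<in> D x" using sym_props(3)[OF g(1) x'(2)] g(2) x'(4) by simp
    moreover have "dU x (dmap C C (act g) x' v) = w" using dU_act[OF g(1) x'(2) vm] g(2) x'(1) by simp
    ultimately show "w \<in> dU x ` D x" by blast
  qed
qed

lemma Upsilon_preimage: assumes "y \<in> pts CQ" obtains x where "x \<in> pts C" "\<Upsilon> x = y"
proof -
  have "y \<in> \<Upsilon> ` pts C" using assms unfolding Upsilon_image .
  then show ?thesis using that by blast
qed

lemma C2R_iff: "(y0, y1) \<in> C2 R \<longleftrightarrow> y0 \<in> pts CQ \<and> y1 \<in> pts CQ \<and> \<phi>Q (fst y1) = snd y0"
  unfolding C2_def R_simps by (cases y0; cases y1) simp

lemma C2_Upsilon: "(x0, x1) \<in> C2 S \<Longrightarrow> (\<Upsilon> x0, \<Upsilon> x1) \<in> C2 R"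
  unfolding C2_iff C2R_iff using Upsilon_pts phiQ_Upsilon[of x1] snd_Upsilon[of x0] by auto

text \<open>Preimages chosen separately need not be composable. The two points of \<open>M\<close>
  that should agree lie in one orbit, and a group element acting on the first preimage alone matches
  them without changing its image.\<close>

lemma C2R_lift:
  assumes "(y0, y1) \<in> C2 R"
  obtains x0 x1 where "(x0, x1) \<in> C2 S" "\<Upsilon> x0 = y0" "\<Upsilon> x1 = y1"
proof -
  obtain x1 where x1: "x1 \<in> pts C" "\<Upsilon> x1 = y1" using assms Upsilon_preimage unfolding C2R_iff by metis
  obtain x where x: "x \<in> pts C" "\<Upsilon> x = y0" using assms Upsilon_preimage unfolding C2R_iff by metis
  have m: "snd x \<in> pts M" "\<phi> (fst x1) \<in> pts M" using x x1 phi_pts by auto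
  have "\<pi> (snd x) = \<pi> (\<phi> (fst x1))"
    using assms x x1 phiQ_Upsilon[OF x1(1)] snd_Upsilon[of x] unfolding C2R_iff by simp
  note d = delta[OF m this]
  have "(act (\<delta> (snd x) (\<phi> (fst x1))) x, x1) \<in> C2 S"
    unfolding C2_iff using act_pts[OF d(1) x(1)] x1(1) d(2) by (simp add: act_def)
  then show ?thesis using that Upsilon_act[OF d(1) x(1)] x(2) x1(2) by blast
qed

abbreviation dU1 where "dU1 \<equiv> dmap C QE (fst \<circ> \<Upsilon>)"

lemma Upsilon1: "smooth_on (pts C) C QE (fst \<circ> \<Upsilon>)" "x \<in> pts C \<Longrightarrow> smooth_at C QE (fst \<circ> \<Upsilon>) x"
proof -
  show 1: "smooth_on (pts C) C QE (fst \<circ> \<Upsilon>)"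
    unfolding o_def
    by (rule smooth_on_compose[OF C CQ smooth_Upsilon smooth_on_fst[OF QE QM order_refl]])
       (use smooth_on_image[OF CQ smooth_Upsilon] in simp)
  show "x \<in> pts C \<Longrightarrow> smooth_at C QE (fst \<circ> \<Upsilon>) x" by (rule smooth_atI[OF 1 C_open])
qed

lemma pi_smooth_at: "m \<in> pts M \<Longrightarrow> smooth_at M QM \<pi> m"
  by (rule smooth_atI[OF smooth_pi openin_topspace])

lemma phi_smooth_at: "e \<in> pts E \<Longrightarrow> smooth_at E M \<phi> e"
  by (rule smooth_atI[OF phi(1) openin_topspace])

lemma dU_pair:
  assumes x: "x \<in> pts C" and v: "v \<in> mf_model C"
  shows "dU x v = (dU1 x v, dmap M QM \<pi> (snd x) (snd v))"
proof -
  have x': "snd x \<in> pts M" "x \<in> pts E \<times> pts M" using x by auto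
  note s = smooth_at_snd[OF pre(1,2) x'(2)]
  have "dU x v = dmap C CQ (\<lambda>x. ((fst \<circ> \<Upsilon>) x, \<pi> (snd x))) x v"
    by (rule dmap_cong[OF C C_open x _ v]) (simp add: snd_Upsilon[symmetric])
  also have "\<dots> = (dU1 x v, dmap C QM (\<lambda>x. \<pi> (snd x)) x v)"
    by (rule dmap_Pair[OF C QE QM Upsilon1(2)[OF x] smooth_at_compose[OF C pre(2) s pi_smooth_at[OF x'(1)]] v])
  also have "dmap C QM (\<lambda>x. \<pi> (snd x)) x v = dmap M QM \<pi> (snd x) (snd v)"
    using dmap_compose[OF C pre(2) QM s pi_smooth_at[OF x'(1)] v] dmap_snd[OF pre(1,2) x'(2)] v by simp
  finally show ?thesis .
qed

lemma dphi_fst: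
  assumes x: "x \<in> pts C" and v: "v \<in> mf_model C"
  shows "dmap C M (\<lambda>x. \<phi> (fst x)) x v = dmap E M \<phi> (fst x) (fst v)"
proof -
  have x': "fst x \<in> pts E" "x \<in> pts E \<times> pts M" using x by auto
  show ?thesis
    using dmap_compose[OF C pre(1,2) smooth_at_fst[OF pre(1,2) x'(2)] phi_smooth_at[OF x'(1)] v] dmap_fst[OF pre(1,2) x'(2)] v by simp
qed

lemma P_arg_model:
  assumes z: "(x0, x1) \<in> C2 S" and v: "v \<in> D x1"
  shows "(P (x0, x1) v, dmap E M \<phi> (fst x1) (fst v)) \<in> mf_model C"
proof -
  have x: "x0 \<in> pts C" "x1 \<in> pts C" using z C2_iff by auto
  have "fst v \<in> mf_model E" using D_model[OF x(2)] v by auto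
  then have "dmap E M \<phi> (fst x1) (fst v) \<in> mf_model M"
    using dmap_in_model[OF pre(1,2) phi_smooth_at] x(2) by auto
  then show ?thesis using P_props(1)[OF z, of v] v by simp
qed

text \<open>The content is independence of the chosen lift. Two lifts differ by a single group
  element, under which \<open>P\<close> and \<open>d\<phi>\<close> transform equivariantly while
  \<open>\<Upsilon>\<close> is invariant.\<close>

lemma P_red:
  assumes z: "(x0, x1) \<in> C2 S" and v: "v \<in> D x1"
  shows "ds_P R (\<Upsilon> x0, \<Upsilon> x1) (dU x1 v) = dU1 x0 (P (x0, x1) v, dmap E M \<phi> (fst x1) (fst v))"
proof -
  have "(THE u. \<exists>x0' x1' v'. (x0', x1') \<in> C2 S \<and> \<Upsilon> x0' = \<Upsilon> x0 \<and> \<Upsilon> x1' = \<Upsilon> x1 \<and> v' \<in> D x1' \<and> dU x1' v' = dU x1 v \<and>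
                u = dU1 x0' (P (x0', x1') v', dmap E M \<phi> (fst x1') (fst v'))) =
    dU1 x0 (P (x0, x1) v, dmap E M \<phi> (fst x1) (fst v))"
  proof (rule the_equality)
    show "\<exists>x0' x1' v'. (x0', x1') \<in> C2 S \<and> \<Upsilon> x0' = \<Upsilon> x0 \<and> \<Upsilon> x1' = \<Upsilon> x1 \<and> v' \<in> D x1' \<and> dU x1' v' = dU x1 v \<and>
                dU1 x0 (P (x0, x1) v, dmap E M \<phi> (fst x1) (fst v)) = dU1 x0' (P (x0', x1') v', dmap E M \<phi> (fst x1') (fst v'))"
      using z v by blast
    fix u assume "\<exists>x0' x1' v'. (x0', x1') \<in> C2 S \<and> \<Upsilon> x0' = \<Upsilon> x0 \<and> \<Upsilon> x1' = \<Upsilon> x1 \<and> v' \<in> D x1' \<and> dU x1' v' = dU x1 v \<and>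
                u = dU1 x0' (P (x0', x1') v', dmap E M \<phi> (fst x1') (fst v'))"
    then obtain x0' x1' v' where z': "(x0', x1') \<in> C2 S" and eq: "\<Upsilon> x0' = \<Upsilon> x0" "\<Upsilon> x1' = \<Upsilon> x1" and v': "v' \<in> D x1'" "dU x1' v' = dU x1 v"
      and u: "u = dU1 x0' (P (x0', x1') v', dmap E M \<phi> (fst x1') (fst v'))" by blast
    have x: "x0 \<in> pts C" "x1 \<in> pts C" "\<phi> (fst x1) = snd x0" using z C2_iff by auto
    have x': "x0' \<in> pts C" "x1' \<in> pts C" "\<phi> (fst x1') = snd x0'" using z' C2_iff by auto
    obtain g where g: "g \<in> carrier G" "x0' = act g x0" by (rule Upsilon_eqD[OF x(1) x'(1) eq(1)[symmetric]])
    obtain k where k: "k \<in> carrier G" "x1' = act k x1" by (rule Upsilon_eqD[OF x(2) x'(2) eq(2)[symmetric]])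
    have e1: "fst x1 \<in> pts E" "snd x0 \<in> pts M" using x by auto
    \<comment> \<open>The two entries of a lift could be moved by different group elements
      \<open>g\<close> and \<open>k\<close>. Both lifts are composable, however, so these move the
      same point of \<open>M\<close> to the same place, and freeness makes them equal.\<close>
    have "aM k (snd x0) = aM g (snd x0)"
      using x'(3) phi_equivariant[OF k(1) e1(1)] x(3) unfolding g(2) k(2) by (simp add: act_def)
    then have kg: "k = g" using act_inj[OF k(1) g(1) e1(2)] by simp
    have vm: "v \<in> mf_model C" using D_model[OF x(2)] v by blast
    have vE: "fst v \<in> mf_model E" "v = (fst v, 0)" using D_vertical[OF x(2)] v by auto
    have "dmap C C (act g) x1 v \<in> D x1'" using sym_props(3)[OF g(1) x(2)] v k(2) kg by simp
    moreover have "dU x1' (dmap C C (act g) x1 v) = dU x1' v'"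
      using dU_act[OF g(1) x(2) vm] v'(2) k(2) kg by simp
    \<comment> \<open>Both vectors have zero \<open>M\<close>-component and the same image, so
      \<open>dU_inj\<close> identifies them.\<close>
    ultimately have v'': "dmap C C (act g) x1 v = v'"
      using dU_inj[OF x'(2)] D_vertical[OF x'(2)] v'(1) by blast
    have "0 \<in> mf_model M" using premanifold_subspace[OF pre(2)] subspace_0 by blast
    then have fv': "fst v' = dmap E E (aE g) (fst x1) (fst v)"
      using dmap_act[OF g(1) x(2) vE(1), of 0] vE(2) v'' by (metis fst_conv)
    have P': "P (x0', x1') v' = dmap E E (aE g) (fst x0) (P (x0, x1) v)"
      using sym_props(4)[OF g(1) z v] v'' g(2) k(2) kg by simp
    have ge: "smooth_at E E (aE g) (fst x1)" by (rule actE.act_smooth_at[OF g(1) e1(1)])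
    have gm: "smooth_at M M (aM g) (\<phi> (fst x1))" by (rule actM.act_smooth_at[OF g(1) phi_pts[OF e1(1)]])
    have "dmap E M \<phi> (fst x1') (fst v') = dmap E M \<phi> (aE g (fst x1)) (dmap E E (aE g) (fst x1) (fst v))"
      using fv' k(2) kg by (simp add: act_def)
    also have "\<dots> = dmap E M (\<lambda>e. \<phi> (aE g e)) (fst x1) (fst v)"
      by (rule dmap_compose[OF pre(1,1,2) ge phi_smooth_at[OF actE.act_closed[OF g(1) e1(1)]] vE(1), symmetric])
    also have "\<dots> = dmap E M (\<lambda>e. aM g (\<phi> e)) (fst x1) (fst v)"
      by (rule dmap_cong[OF pre(1) openin_topspace e1(1) _ vE(1)]) (rule phi_equivariant[OF g(1)])
    also have "\<dots> = dmap M M (aM g) (\<phi> (fst x1)) (dmap E M \<phi> (fst x1) (fst v))"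
      by (rule dmap_compose[OF pre(1,2,2) phi_smooth_at[OF e1(1)] gm vE(1)])
    finally have dphi: "dmap E M \<phi> (fst x1') (fst v') = dmap M M (aM g) (snd x0) (dmap E M \<phi> (fst x1) (fst v))"
      using x(3) by simp
    let ?a = "(P (x0, x1) v, dmap E M \<phi> (fst x1) (fst v))"
    have am: "?a \<in> mf_model C" by (rule P_arg_model[OF z v])
    have "(P (x0', x1') v', dmap E M \<phi> (fst x1') (fst v')) = dmap C C (act g) x0 ?a"
      using dmap_act[OF g(1) x(1)] am P' dphi by simp
    then have "u = dU1 (act g x0) (dmap C C (act g) x0 ?a)" using u g(2) by simp
    also have "\<dots> = fst (dU (act g x0) (dmap C C (act g) x0 ?a))"
      using dU_pair[OF act_pts[OF g(1) x(1)] dmap_in_model[OF C C act_smooth_at[OF g(1) x(1)] am]] by simp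
    also have "\<dots> = dU1 x0 ?a" using dU_act[OF g(1) x(1) am] dU_pair[OF x(1) am] by simp
    finally show "u = dU1 x0 ?a" .
  qed
  then show ?thesis unfolding R_simps by simp
qed

lemma D_red_subspace:
  assumes y: "y \<in> pts CQ"
  shows "subspace (ds_D R y)" "ds_D R y \<subseteq> mf_model CQ" "ds_D R y \<subseteq> mf_model QE \<times> {0}"
proof -
  obtain x where x: "x \<in> pts C" "\<Upsilon> x = y" by (rule Upsilon_preimage[OF y])
  obtain L where L: "linear L" "\<And>v. v \<in> mf_model C \<Longrightarrow> dU x v = L v"
    by (rule dmap_linear[OF C CQ Upsilon_smooth_at[OF x(1)]]) blast
  have eq: "ds_D R y = L ` D x"
    unfolding D_red[OF x(1), unfolded x(2)] by (rule image_cong[OF refl]) (use L(2) D_model[OF x(1)] in blast)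
  show "subspace (ds_D R y)" unfolding eq by (rule linear_subspace_image[OF L(1) D_subspace[OF x(1)]])
  show 1: "ds_D R y \<subseteq> mf_model CQ"
    unfolding D_red[OF x(1), unfolded x(2)] using dU_model[OF x(1)] D_model[OF x(1)] by blast
  show "ds_D R y \<subseteq> mf_model QE \<times> {0}"
  proof
    fix w assume w: "w \<in> ds_D R y"
    then obtain v where v: "v \<in> D x" "w = dU x v" using D_red[OF x(1)] x(2) by blast
    have "snd v = 0" "v \<in> mf_model C" using D_vertical[OF x(1)] D_model[OF x(1)] v(1) by auto
    then have "snd w = 0"
      using dU_pair[OF x(1)] v(2) dmap_zero[OF pre(2) QM pi_smooth_at] x(1) by auto
    then show "w \<in> mf_model QE \<times> {0}" using 1 w by (auto simp: mem_Times_iff)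
  qed
qed

text \<open>A frame is pushed down along an adapted section: the frame vectors at
  \<open>\<sigma> y\<close> are mapped by \<open>dU\<close>. They stay independent because
  \<open>dU\<close> is injective on vectors with zero \<open>M\<close>-component.\<close>

lemma D_red_subbundle: "vector_subbundle CQ (ds_D R)"
proof -
  obtain k where k: "\<forall>x \<in> pts C. \<exists>U (s :: nat \<Rightarrow> 'e \<times> 'm \<Rightarrow> 'ce \<times> 'cm). openin (mf_top C) U \<and> x \<in> U \<and>
        (\<forall>i<k. smooth_on U C (tangent_bundle C) (\<lambda>y. (y, s i y))) \<and>
        (\<forall>y\<in>U. inj_on (\<lambda>i. s i y) {..<k} \<and> independent ((\<lambda>i. s i y) ` {..<k}) \<and>
           span ((\<lambda>i. s i y) ` {..<k}) = D y)"
    using D_subbundle unfolding vector_subbundle_def by (elim conjE exE)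
  have "\<exists>U (s :: nat \<Rightarrow> ('e \<times> 'g) set \<times> 'm set \<Rightarrow> ('ce \<times> 'cg) \<times> 'cm). openin (mf_top CQ) U \<and> y \<in> U \<and>
        (\<forall>i<k. smooth_on U CQ (tangent_bundle CQ) (\<lambda>y. (y, s i y))) \<and>
        (\<forall>y\<in>U. inj_on (\<lambda>i. s i y) {..<k} \<and> independent ((\<lambda>i. s i y) ` {..<k}) \<and>
           span ((\<lambda>i. s i y) ` {..<k}) = ds_D R y)" if y: "y \<in> pts CQ" for y
  proof -
    obtain x where x: "x \<in> pts C" "\<Upsilon> x = y" by (rule Upsilon_preimage[OF y])
    obtain V \<sigma> where V: "adapted V \<sigma>" "\<Upsilon> x \<in> V" "\<sigma> (\<Upsilon> x) = x" by (rule adapted_section[OF x(1)])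
    note AD = adaptedD[OF V(1)]
    from bspec[OF k x(1)]
    obtain U and s :: "nat \<Rightarrow> 'e \<times> 'm \<Rightarrow> 'ce \<times> 'cm" where U: "openin (mf_top C) U" "x \<in> U"
      and s: "\<forall>i<k. smooth_on U C (tangent_bundle C) (\<lambda>y. (y, s i y))"
      and b: "\<forall>y\<in>U. inj_on (\<lambda>i. s i y) {..<k} \<and> independent ((\<lambda>i. s i y) ` {..<k}) \<and>
           span ((\<lambda>i. s i y) ` {..<k}) = D y"
      by (elim exE conjE)
    let ?V = "{y \<in> V. \<sigma> y \<in> U}"
    have Vo: "openin (mf_top CQ) ?V" by (rule smooth_on_openin_vimage[OF CQ C AD(2,1) U(1)])
    let ?s = "\<lambda>i y. dU (\<sigma> y) (s i (\<sigma> y))"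
    have sm: "smooth_on ?V CQ (tangent_bundle CQ) (\<lambda>y. (y, ?s i y))" if i: "i < k" for i
    proof -
      have 1: "smooth_on ?V CQ C \<sigma>" by (rule smooth_on_subset[OF CQ AD(2)]) auto
      have si: "smooth_on U C (tangent_bundle C) (\<lambda>y. (y, s i y))" using s i by blast
      have 2: "smooth_on ?V CQ (tangent_bundle C) (\<lambda>y. (\<sigma> y, s i (\<sigma> y)))"
        by (rule smooth_on_compose[OF CQ C 1 si]) auto
      have "smooth_on ?V CQ (tangent_bundle CQ) (\<lambda>y. (\<lambda>(x, v). (\<Upsilon> x, dU x v)) (\<sigma> y, s i (\<sigma> y)))"
        by (rule smooth_on_compose[OF CQ premanifold_tangent_bundle[OF C] 2 smooth_on_tangent_map[OF C CQ smooth_Upsilon C_open]])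
           (use smooth_on_image[OF premanifold_tangent_bundle[OF C] 2] pts_tangent_bundle[OF C] in blast)
      then show ?thesis by (rule smooth_on_cong[OF CQ]) (use AD(3) in auto)
    qed
    have fr: "inj_on (\<lambda>i. ?s i y) {..<k} \<and> independent ((\<lambda>i. ?s i y) ` {..<k}) \<and>
           span ((\<lambda>i. ?s i y) ` {..<k}) = ds_D R y" if y: "y \<in> ?V" for y
    proof -
      have sy: "\<sigma> y \<in> pts C" "\<Upsilon> (\<sigma> y) = y" "\<sigma> y \<in> U" using AD(3,5) y by auto
      let ?B = "(\<lambda>i. s i (\<sigma> y)) ` {..<k}"
      have B: "inj_on (\<lambda>i. s i (\<sigma> y)) {..<k}" "independent ?B" "span ?B = D (\<sigma> y)" using b sy(3) by auto
      obtain L where L: "linear L" "\<And>v. v \<in> mf_model C \<Longrightarrow> dU (\<sigma> y) v = L v"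
        by (rule dmap_linear[OF C CQ Upsilon_smooth_at[OF sy(1)]]) blast
      have LD: "dU (\<sigma> y) v = L v" if "v \<in> D (\<sigma> y)" for v using L(2) D_model[OF sy(1)] that by blast
      have inj: "inj_on L (span ?B)"
        unfolding B(3)
      proof (rule inj_onI)
        fix v w assume v: "v \<in> D (\<sigma> y)" and w: "w \<in> D (\<sigma> y)" and eq: "L v = L w"
        show "v = w" by (rule dU_inj[OF sy(1)]) (use D_vertical[OF sy(1)] v w LD eq in auto)
      qed
      have Bs: "s i (\<sigma> y) \<in> D (\<sigma> y)" if "i < k" for i unfolding B(3)[symmetric] using that by (auto intro: span_base)
      have eqs: "?s i y = L (s i (\<sigma> y))" if "i < k" for i using LD[OF Bs[OF that]] .
      have im: "(\<lambda>i. ?s i y) ` {..<k} = L ` ?B" unfolding image_image by (rule image_cong[OF refl]) (use eqs in auto)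
      have "inj_on (\<lambda>i. ?s i y) {..<k} \<longleftrightarrow> inj_on (\<lambda>i. L (s i (\<sigma> y))) {..<k}" by (rule inj_on_cong) (use eqs in auto)
      moreover have "inj_on (\<lambda>i. L (s i (\<sigma> y))) {..<k}"
        using comp_inj_on[OF B(1) inj_on_subset[OF inj span_superset]] by (simp add: o_def)
      moreover have "independent (L ` ?B)" by (rule linear_independent_injective_image[OF L(1) B(2) inj])
      moreover have "span (L ` ?B) = ds_D R y"
        using linear_span_image[OF L(1), of ?B] B(3) D_red[OF sy(1)] sy(2) LD by (auto simp: image_iff)
      ultimately show ?thesis unfolding im by blast
    qed
    have "y \<in> ?V" using V x(2) U(2) by auto
    then show ?thesis using Vo sm fr by (intro exI[of _ ?V] exI[of _ ?s]) blast
  qed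
  then show ?thesis unfolding vector_subbundle_def using D_red_subspace by blast
qed

section \<open>The reduced constraint submanifold\<close>

lemma Dd_red:
  assumes x: "x \<in> pts C" shows "\<Upsilon> x \<in> ds_Dd R \<longleftrightarrow> x \<in> Dd"
proof
  assume "\<Upsilon> x \<in> ds_Dd R"
  then obtain x' where x': "x' \<in> Dd" "\<Upsilon> x = \<Upsilon> x'" unfolding R_simps by blast
  obtain g where "g \<in> carrier G" "x = act g x'" by (rule Upsilon_eqD[of x' x]) (use x' Dd_pts x in auto)
  then show "x \<in> Dd" using sym_props(2) x' by blast
qed (use R_simps in auto)

text \<open>In a slice chart \<open>c\<close> of \<open>Dd\<close> at \<open>x0\<close>, the set \<open>Dd\<close> is the zero set of \<open>q \<circ> c\<close>. The differential of \<open>q \<circ> c\<close>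
  vanishes on the tangent space of the \<open>G\<close>-orbit, which lies in \<open>Dd\<close>; hence \<open>q \<circ> c \<circ> \<sigma>\<close> remains a
  submersion.\<close>

lemma slice_submersion:
  assumes V: "adapted V \<sigma>" "\<Upsilon> x0 \<in> V" "\<sigma> (\<Upsilon> x0) = x0" and x0: "x0 \<in> Dd"
    and Z: "premanifold Z" and f: "smooth_on U C Z f" and U: "openin (mf_top C) U" "x0 \<in> U"
    and const: "\<And>x. x \<in> U \<Longrightarrow> x \<in> Dd \<Longrightarrow> f x = z0" and v: "v \<in> mf_model C"
  shows "dmap C Z f x0 v = dmap CQ Z (\<lambda>y. f (\<sigma> y)) (\<Upsilon> x0) (dU x0 v)"
proof -
  note AD = adaptedD[OF V(1)]
  have x0C: "x0 \<in> pts C" using x0 Dd_pts by blast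
  define y0 where "y0 = \<Upsilon> x0"
  have y0: "y0 \<in> V" "\<sigma> y0 = x0" using V by (auto simp: y0_def)
  have sm\<sigma>: "smooth_at CQ C \<sigma> y0" by (rule smooth_atI[OF AD(2,1) y0(1)])
  \<comment> \<open>\<open>\<kappa>' x\<close> carries the section point
    \<open>\<sigma> (\<Upsilon> x)\<close> to \<open>x\<close>. Near \<open>x0\<close> the map
    \<open>f\<close> thus becomes a function on group times base, whose differential at the unit
    splits into a group part and a base part.\<close>
  define \<kappa>' where "\<kappa>' x = \<delta> (snd (\<sigma> (\<Upsilon> x))) (snd x)" for x
  let ?W = "{x \<in> pts C. \<Upsilon> x \<in> V}"
  have W: "openin (mf_top C) ?W" by (rule smooth_on_openin_vimage[OF C CQ smooth_Upsilon C_open AD(1)])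
  have x0W: "x0 \<in> ?W" using x0C V(2) by blast
  have \<sigma>U: "smooth_on ?W C C (\<lambda>x. \<sigma> (\<Upsilon> x))"
    by (rule smooth_on_compose[OF C CQ smooth_on_subset[OF C smooth_Upsilon] AD(2)]) auto
  have ps: "\<pi> (snd (\<sigma> (\<Upsilon> x))) = \<pi> (snd x)" if "x \<in> ?W" for x
    using AD(3)[of "\<Upsilon> x"] that snd_Upsilon by (metis (no_types, lifting) mem_Collect_eq)
  have \<kappa>: "smooth_on ?W C GM \<kappa>'"
    unfolding \<kappa>'_def[abs_def]
  proof (rule smooth_on_delta[OF C _ smooth_on_subset[OF C smooth_proj(2)] ps])
    show "smooth_on ?W C M (\<lambda>x. snd (\<sigma> (\<Upsilon> x)))"
      by (rule smooth_on_compose[OF C C \<sigma>U smooth_proj(2)]) (use smooth_on_image[OF C \<sigma>U] in simp)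
  qed auto
  have act\<kappa>: "act (\<kappa>' x) (\<sigma> (\<Upsilon> x)) = x" if x: "x \<in> ?W" for x
  proof -
    have xs: "x \<in> pts C" "\<sigma> (\<Upsilon> x) \<in> pts C" "\<Upsilon> (\<sigma> (\<Upsilon> x)) = \<Upsilon> x" using x AD(3,5) by auto
    obtain g where g: "g \<in> carrier G" "x = act g (\<sigma> (\<Upsilon> x))" by (rule Upsilon_eqD[OF xs(2,1,3)])
    have "snd x = aM g (snd (\<sigma> (\<Upsilon> x)))" using g(2) by (metis act_def snd_conv)
    then have "\<kappa>' x = g" unfolding \<kappa>'_def using delta_eq[OF g(1), of "snd (\<sigma> (\<Upsilon> x))"] xs(2) by auto
    then show ?thesis using g(2) by simp
  qed
  have m0: "snd x0 \<in> pts M" using x0C by auto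
  have \<kappa>1: "\<kappa>' x0 = \<one>" unfolding \<kappa>'_def V(3) using delta_eq[of \<one> "snd x0"] actM.act_one[OF m0] m0 by simp
  have act1: "act \<one> x = x" if "x \<in> pts C" for x using that actE.act_one actM.act_one by (auto simp: act_def)
  let ?P = "prod_manifold GM CQ"
  note P = premanifold_prod[OF GM CQ]
  let ?h = "\<lambda>p. act (fst p) (\<sigma> (snd p))"
  have hsm: "smooth_on (carrier G \<times> V) ?P C ?h"
  proof -
    have sub: "carrier G \<times> V \<subseteq> pts GM \<times> pts CQ" using pts_GM AD(6) by auto
    have g: "smooth_on (carrier G \<times> V) ?P GM fst" and y: "smooth_on (carrier G \<times> V) ?P CQ snd"
      using smooth_on_fst[OF GM CQ sub] smooth_on_snd[OF GM CQ sub] by auto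
    have s: "smooth_on (carrier G \<times> V) ?P C (\<lambda>p. \<sigma> (snd p))" by (rule smooth_on_compose[OF P CQ y AD(2)]) auto
    have 1: "smooth_on (carrier G \<times> V) ?P E (\<lambda>p. fst (\<sigma> (snd p)))"
      by (rule smooth_on_compose[OF P C s smooth_proj(1)]) (use smooth_on_image[OF C s] in simp)
    have 2: "smooth_on (carrier G \<times> V) ?P M (\<lambda>p. snd (\<sigma> (snd p)))"
      by (rule smooth_on_compose[OF P C s smooth_proj(2)]) (use smooth_on_image[OF C s] in simp)
    show ?thesis unfolding act_def
      by (intro smooth_on_Pair P pre actE.smooth_on_act actM.smooth_on_act g 1 2)
  qed
  have hop: "openin (mf_top ?P) (carrier G \<times> V)"
    using AD(1) openin_topspace[of "mf_top GM"] pts_GM by (simp add: openin_prod_Times_iff)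
  have p0: "(\<one>, y0) \<in> carrier G \<times> V" using y0 by simp
  have hat: "smooth_at ?P C ?h (\<one>, y0)" by (rule smooth_atI[OF hsm hop p0])
  have hp0: "?h (\<one>, y0) = x0" using y0 act1[OF x0C] by simp
  have fat: "smooth_at C Z f x0" by (rule smooth_atI[OF f U])
  have fh: "smooth_at ?P Z (\<lambda>p. f (?h p)) (\<one>, y0)"
    by (rule smooth_at_compose[OF P C hat]) (use hp0 fat in simp)
  have \<kappa>at: "smooth_at C GM \<kappa>' x0" by (rule smooth_atI[OF \<kappa> W x0W])
  have Uat: "smooth_at C CQ \<Upsilon> x0" by (rule Upsilon_smooth_at[OF x0C])
  have pair: "smooth_at C ?P (\<lambda>x. (\<kappa>' x, \<Upsilon> x)) x0" by (rule smooth_at_Pair[OF C GM CQ \<kappa>at Uat])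
  have dk: "dmap C GM \<kappa>' x0 v \<in> mf_model GM" "dU x0 v \<in> mf_model CQ"
    using dmap_in_model[OF C GM \<kappa>at v] dU_model[OF x0C v] by auto
  have "dmap C Z f x0 v = dmap C Z (\<lambda>x. f (?h (\<kappa>' x, \<Upsilon> x))) x0 v"
    by (rule dmap_cong[OF C W x0W _ v]) (use act\<kappa> in simp)
  also have "\<dots> = dmap ?P Z (\<lambda>p. f (?h p)) (\<kappa>' x0, \<Upsilon> x0) (dmap C ?P (\<lambda>x. (\<kappa>' x, \<Upsilon> x)) x0 v)"
    by (rule dmap_compose[OF C P Z pair _ v]) (use fh \<kappa>1 in \<open>simp add: y0_def\<close>)
  also have "\<dots> = dmap ?P Z (\<lambda>p. f (?h p)) (\<one>, y0) (dmap C GM \<kappa>' x0 v, dU x0 v)"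
    using dmap_Pair[OF C GM CQ \<kappa>at Uat v] \<kappa>1 by (simp add: y0_def)
  also have "\<dots> = dmap GM Z (\<lambda>g. f (?h (g, y0))) \<one> (dmap C GM \<kappa>' x0 v) + dmap CQ Z (\<lambda>y. f (?h (\<one>, y))) y0 (dU x0 v)"
    by (rule dmap_partial[OF GM CQ Z fh dk])
  also have "dmap GM Z (\<lambda>g. f (?h (g, y0))) \<one> (dmap C GM \<kappa>' x0 v) = dmap GM Z (\<lambda>g. z0) \<one> (dmap C GM \<kappa>' x0 v)"
  proof (rule dmap_cong[OF GM _ _ _ dk(1)])
    have sub: "pts GM \<subseteq> pts GM" by simp
    have og: "smooth_on (pts GM) GM C (\<lambda>g. act g x0)"
      unfolding act_def
      by (intro smooth_on_Pair GM pre actE.smooth_on_act actM.smooth_on_act smooth_on_ident smooth_on_const order_refl)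
         (use x0C in auto)
    show "openin (mf_top GM) {g \<in> pts GM. act g x0 \<in> U}"
      by (rule smooth_on_openin_vimage[OF GM C og openin_topspace U(1)])
    show "\<one> \<in> {g \<in> pts GM. act g x0 \<in> U}" using act1[OF x0C] U(2) pts_GM by simp
    fix g assume "g \<in> {g \<in> pts GM. act g x0 \<in> U}"
    then show "f (?h (g, y0)) = z0" using const[of "act g x0"] sym_props(2)[OF _ x0] pts_GM y0(2) by simp
  qed
  also have "\<dots> = 0" by (rule dmap_const[OF GM _ dk(1)]) (simp add: pts_GM)
  also have "dmap CQ Z (\<lambda>y. f (?h (\<one>, y))) y0 (dU x0 v) = dmap CQ Z (\<lambda>y. f (\<sigma> y)) y0 (dU x0 v)"
    by (rule dmap_cong[OF CQ AD(1) y0(1) _ dk(2)]) (use act1 AD(5) in simp)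
  finally show ?thesis by (simp add: y0_def)
qed

text \<open>Invariance of \<open>Dd\<close> lets \<open>\<sigma>\<close> pull its local equation
  back to a local equation of the reduced set, and \<open>submersion_slice_chart\<close> turns this
  equation into a slice chart.\<close>

lemma Dd_red_embedded: "embedded_submanifold CQ (ds_Dd R)"
proof -
  have sub: "ds_Dd R \<subseteq> pts CQ" unfolding R_simps using Dd_pts Upsilon_pts by blast
  have VC: "subspace (mf_model C)" and VCQ: "subspace (mf_model CQ)"
    using premanifold_subspace[OF C] premanifold_subspace[OF CQ] .
  obtain L where L: "subspace L" "L \<subseteq> mf_model C" and slices: "\<forall>x\<in>Dd. \<exists>U c. openin (mf_top C) U \<and> x \<in> U \<and>
     openin (top_of_set (mf_model C)) (c ` U) \<and> diffeo_on U C (c ` U) (vec_manifold (mf_model C)) c \<and> c ` (U \<inter> Dd) = c ` U \<inter> L"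
    using Dd_embedded unfolding embedded_submanifold_def by (elim conjE exE)
  obtain q W where q: "linear q" "subspace W" and "W \<subseteq> mf_model C"
    and qW: "q ` mf_model C = W" "\<forall>x\<in>mf_model C. q x = 0 \<longleftrightarrow> x \<in> L"
    and "W \<inter> L \<subseteq> {0}" "dim W + dim L = dim (mf_model C)"
    by (rule subspace_quotient_map[OF VC L])
  note q = q qW
  \<comment> \<open>All slice charts share one \<open>L'\<close>, so it is fixed before any point is
    taken. That the subtraction is not truncated becomes known only at a point of the reduced set,
    where a submersion onto \<open>W\<close> is at hand.\<close>
  obtain L' where L': "subspace L'" "L' \<subseteq> span (mf_model CQ)" "dim L' = dim (mf_model CQ) - dim W"
    by (rule choose_subspace_of_subspace[of "dim (mf_model CQ) - dim W" "mf_model CQ"]) simp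
  have L'V: "L' \<subseteq> mf_model CQ" using L'(2) VCQ span_eq_iff by metis
  have "\<exists>U c. openin (mf_top CQ) U \<and> y0 \<in> U \<and> openin (top_of_set (mf_model CQ)) (c ` U) \<and>
          diffeo_on U CQ (c ` U) (vec_manifold (mf_model CQ)) c \<and> c ` (U \<inter> ds_Dd R) = c ` U \<inter> L'"
    if y0: "y0 \<in> ds_Dd R" for y0
  proof -
    obtain x0 where x0: "x0 \<in> Dd" "y0 = \<Upsilon> x0" using y0 unfolding R_simps by blast
    have x0C: "x0 \<in> pts C" using x0 Dd_pts by blast
    obtain V \<sigma> where V: "adapted V \<sigma>" "\<Upsilon> x0 \<in> V" "\<sigma> (\<Upsilon> x0) = x0" by (rule adapted_section[OF x0C])
    note AD = adaptedD[OF V(1)]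
    from bspec[OF slices x0(1)] obtain U c where U: "openin (mf_top C) U" "x0 \<in> U" "openin (top_of_set (mf_model C)) (c ` U)"
      and d: "diffeo_on U C (c ` U) (vec_manifold (mf_model C)) c" and cU: "c ` (U \<inter> Dd) = c ` U \<inter> L"
      by (elim exE conjE)
    let ?VC = "vec_manifold (mf_model C)" and ?VW = "vec_manifold W"
    note VCm = premanifold_vec[OF VC] and VW = premanifold_vec[OF q(2)]
    have cinj: "inj_on c U" and csm: "smooth_on U C ?VC c" and cism: "smooth_on (c ` U) ?VC C (inv_into U c)"
      using d by (auto simp: diffeo_on_def bij_betw_def)
    have cm: "c x \<in> mf_model C" if "x \<in> U" for x using smooth_on_image[OF VCm csm] that by auto
    have cL: "c x \<in> L \<longleftrightarrow> x \<in> Dd" if x: "x \<in> U" for x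
    proof
      assume "c x \<in> L"
      then have "c x \<in> c ` (U \<inter> Dd)" using cU x by blast
      then show "x \<in> Dd" using cinj x by (auto dest: inj_onD)
    next
      assume "x \<in> Dd" then show "c x \<in> L" using cU x by blast
    qed
    let ?f = "\<lambda>x. q (c x)"
    have qsm: "smooth_on (mf_model C) ?VC ?VW q" by (rule smooth_on_linear[OF VC q(2,1)]) (use q(3) in auto)
    have fsm: "smooth_on U C ?VW ?f" by (rule smooth_on_compose[OF C VCm csm qsm]) (use smooth_on_image[OF VCm csm] in simp)
    let ?N = "{y \<in> V. \<sigma> y \<in> U}"
    have No: "openin (mf_top CQ) ?N" by (rule smooth_on_openin_vimage[OF CQ C AD(2,1) U(1)])
    have yN: "y0 \<in> ?N" using V(2,3) U(2) x0(2) by auto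
    have Fsm: "smooth_on ?N CQ ?VW (\<lambda>y. ?f (\<sigma> y))"
      by (rule smooth_on_compose[OF CQ C smooth_on_subset[OF CQ AD(2)] fsm]) auto
    have iff: "y \<in> ds_Dd R \<longleftrightarrow> ?f (\<sigma> y) = 0" if y: "y \<in> ?N" for y
    proof -
      have sy: "\<sigma> y \<in> pts C" "\<Upsilon> (\<sigma> y) = y" "\<sigma> y \<in> U" using y AD(3,5) by auto
      have "y \<in> ds_Dd R \<longleftrightarrow> \<sigma> y \<in> Dd" using Dd_red[OF sy(1)] sy(2) by simp
      also have "\<dots> \<longleftrightarrow> c (\<sigma> y) \<in> L" using cL[OF sy(3)] by simp
      also have "\<dots> \<longleftrightarrow> q (c (\<sigma> y)) = 0" using bspec[OF q(4) cm[OF sy(3)]] by simp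
      finally show ?thesis .
    qed
    have surj: "W \<subseteq> dmap CQ ?VW (\<lambda>y. ?f (\<sigma> y)) y0 ` mf_model CQ"
    proof
      fix w assume "w \<in> W"
      then obtain u where u: "u \<in> mf_model C" "w = q u" using q(3) by blast
      have cat: "smooth_at C ?VC c x0" by (rule smooth_atI[OF csm U(1,2)])
      have ciat: "smooth_at ?VC C (inv_into U c) (c x0)" by (rule smooth_atI[OF cism]) (use U in auto)
      \<comment> \<open>\<open>\<xi>\<close> is the tangent vector at \<open>x0\<close> with
        coordinates \<open>u\<close> in the slice chart; its image under \<open>dU\<close> will be
        the required preimage of \<open>w\<close>.\<close>
      define \<xi> where "\<xi> = dmap ?VC C (inv_into U c) (c x0) u"
      have \<xi>: "\<xi> \<in> mf_model C" unfolding \<xi>_def using dmap_in_model[OF VCm C ciat] u(1) by simp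
      have icx: "inv_into U c (c x0) = x0" using cinj U(2) by simp
      have dc: "dmap C ?VC c x0 \<xi> = u"
      proof -
        have "dmap C ?VC c (inv_into U c (c x0)) (dmap ?VC C (inv_into U c) (c x0) u) = u"
          by (rule dmap_left_inverse[OF VCm C ciat, of _ "c ` U"])
             (use cat icx U u(1) f_inv_into_f[of _ c U] in auto)
        then show ?thesis by (simp add: icx \<xi>_def)
      qed
      have qat: "smooth_at ?VC ?VW q (c x0)" by (rule smooth_atI[OF qsm]) (use cm[OF U(2)] in auto)
      have "dmap C ?VW ?f x0 \<xi> = dmap ?VC ?VW q (c x0) u"
        using dmap_compose[OF C VCm VW cat qat \<xi>] dc by simp
      also have "\<dots> = w" using dmap_linear_vec[OF VC q(1) cm[OF U(2)] u(1)] u(2) by simp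
      finally have "w = dmap C ?VW ?f x0 \<xi>" by simp
      also have "\<dots> = dmap CQ ?VW (\<lambda>y. ?f (\<sigma> y)) (\<Upsilon> x0) (dU x0 \<xi>)"
      proof (rule slice_submersion[OF V x0(1) VW fsm U(1,2) _ \<xi>])
        fix x assume "x \<in> U" "x \<in> Dd"
        then show "q (c x) = 0" using cL cm q(4) by blast
      qed
      finally show "w \<in> dmap CQ ?VW (\<lambda>y. ?f (\<sigma> y)) y0 ` mf_model CQ"
        using dU_model[OF x0C \<xi>] x0(2) by blast
    qed
    have Fat: "smooth_at CQ ?VW (\<lambda>y. ?f (\<sigma> y)) y0" by (rule smooth_atI[OF Fsm No yN])
    have "dim W \<le> dim (mf_model CQ)"
    proof -
      obtain K where K: "linear K" "\<And>v. v \<in> mf_model CQ \<Longrightarrow> dmap CQ ?VW (\<lambda>y. ?f (\<sigma> y)) y0 v = K v"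
        by (rule dmap_linear[OF CQ VW Fat]) blast
      have "W \<subseteq> K ` mf_model CQ" using surj K(2) by auto
      then show ?thesis using dim_subset[of W "K ` mf_model CQ"] dim_image_le[OF K(1), of "mf_model CQ"] by linarith
    qed
    then have "dim L' + dim W = dim (mf_model CQ)" using L'(3) by simp
    from submersion_slice_chart[OF CQ No yN q(2) Fsm surj iff L'(1) L'V this] show ?thesis .
  qed
  then show ?thesis unfolding embedded_submanifold_def using sub L'(1) L'V by blast
qed

text \<open>Near a given point the value is computed from a composable lift depending smoothly on
  the data: two adapted sections for the base points, a group element that makes them composable,
  and the differential of the second section for the vector. \<open>P_red\<close> then expresses the
  map as a composition of smooth ones.\<close>

lemma P_red_smooth:
  "smooth_on {(z, (x, v)). z \<in> C2 R \<and> x = snd z \<and> v \<in> ds_D R x}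
       (prod_manifold (prod_manifold CQ CQ) (tangent_bundle CQ))
       (tangent_bundle QE) (\<lambda>(z, (x, v)). (fst (fst z), ds_P R z v))"
    (is "smooth_on ?A ?Z _ ?P'")
proof (rule smooth_on_local)
  note CC = premanifold_prod[OF CQ CQ] and TQ = premanifold_tangent_bundle[OF CQ]
  note TC = premanifold_tangent_bundle[OF C] and TE = premanifold_tangent_bundle[OF pre(1)] and TM = premanifold_tangent_bundle[OF pre(2)]
  note CCC = premanifold_prod[OF C C]
  show Z: "premanifold ?Z" by (rule premanifold_prod[OF CC TQ])
  fix p assume pA: "p \<in> ?A"
  obtain y0 y1 u where p: "p = ((y0, y1), (y1, u))" "(y0, y1) \<in> C2 R" "u \<in> ds_D R y1" using pA by auto
  obtain x0 x1 where x: "(x0, x1) \<in> C2 S" "\<Upsilon> x0 = y0" "\<Upsilon> x1 = y1" by (rule C2R_lift[OF p(2)])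
  have xC: "x0 \<in> pts C" "x1 \<in> pts C" using x(1) C2_iff by auto
  obtain V0 \<sigma>0 where V0: "adapted V0 \<sigma>0" "\<Upsilon> x0 \<in> V0" "\<sigma>0 (\<Upsilon> x0) = x0" by (rule adapted_section[OF xC(1)])
  obtain V1 \<sigma>1 where V1: "adapted V1 \<sigma>1" "\<Upsilon> x1 \<in> V1" "\<sigma>1 (\<Upsilon> x1) = x1" by (rule adapted_section[OF xC(2)])
  note A0 = adaptedD[OF V0(1)] and A1 = adaptedD[OF V1(1)]
  have ptsT: "pts (tangent_bundle CQ) = pts CQ \<times> mf_model CQ" by (rule pts_tangent_bundle[OF CQ])
  \<comment> \<open>A point of the pullback carries the base point of its vector a second time;
    restricting it to \<open>V1\<close> keeps \<open>\<sigma>1\<close> and its differential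
    available there.\<close>
  define T1 where "T1 = {t \<in> pts (tangent_bundle CQ). fst t \<in> V1}"
  have T1: "openin (mf_top (tangent_bundle CQ)) T1"
    unfolding T1_def
    by (rule smooth_on_openin_vimage[OF TQ CQ smooth_on_tangent_base[OF CQ] openin_topspace A1(1)]) (simp add: ptsT)
  let ?W = "(V0 \<times> V1) \<times> T1"
  have W: "openin (mf_top ?Z) ?W" using A0(1) A1(1) T1 by (simp add: openin_prod_Times_iff)
  have uM: "u \<in> mf_model CQ" using D_red_subspace(2) p(2,3) unfolding C2R_iff by blast
  have pW: "p \<in> ?W" using p V0(2) V1(2) x uM A1(6) by (auto simp: T1_def ptsT)
  let ?B = "?A \<inter> ?W"
  have BZ: "?B \<subseteq> pts (prod_manifold CQ CQ) \<times> pts (tangent_bundle CQ)" using openin_subset[OF W] by auto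
  have f: "smooth_on ?B ?Z (prod_manifold CQ CQ) fst" and s: "smooth_on ?B ?Z (tangent_bundle CQ) snd"
    by (rule smooth_on_fst[OF CC TQ BZ], rule smooth_on_snd[OF CC TQ BZ])
  have f0: "smooth_on ?B ?Z CQ (\<lambda>p. fst (fst p))"
    by (rule smooth_on_compose[OF Z CC f smooth_on_fst[OF CQ CQ order_refl]]) (use smooth_on_image[OF CC f] in simp)
  have f1: "smooth_on ?B ?Z CQ (\<lambda>p. snd (fst p))"
    by (rule smooth_on_compose[OF Z CC f smooth_on_snd[OF CQ CQ order_refl]]) (use smooth_on_image[OF CC f] in simp)
  define a0 where "a0 p = \<sigma>0 (fst (fst p))" for p :: "((('e \<times> 'g) set \<times> 'm set) \<times> (('e \<times> 'g) set \<times> 'm set)) \<times> ((('e \<times> 'g) set \<times> 'm set) \<times> (('ce \<times> 'cg) \<times> 'cm))"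
  define a1 where "a1 p = \<sigma>1 (snd (fst p))" for p :: "((('e \<times> 'g) set \<times> 'm set) \<times> (('e \<times> 'g) set \<times> 'm set)) \<times> ((('e \<times> 'g) set \<times> 'm set) \<times> (('ce \<times> 'cg) \<times> 'cm))"
  \<comment> \<open>The correction of \<open>C2R_lift\<close>, now as a smooth function of
    \<open>p\<close>: the division map matches the second entry of the first lift with the point of
    \<open>M\<close> below the second lift.\<close>
  define g where "g p = \<delta> (snd (a0 p)) (\<phi> (fst (a1 p)))" for p
  define b0 where "b0 p = act (g p) (a0 p)" for p
  \<comment> \<open>The vectors of \<open>D\<close> have zero \<open>M\<close>-component, so
    \<open>adapted_lift\<close> makes this the lift of the given reduced variation.\<close>
  define w where "w p = dmap CQ C \<sigma>1 (fst (snd p)) (snd (snd p))" for p :: "((('e \<times> 'g) set \<times> 'm set) \<times> (('e \<times> 'g) set \<times> 'm set)) \<times> ((('e \<times> 'g) set \<times> 'm set) \<times> (('ce \<times> 'cg) \<times> 'cm))"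
  have a0: "smooth_on ?B ?Z C a0" unfolding a0_def[abs_def] by (rule smooth_on_compose[OF Z CQ f0 A0(2)]) auto
  have a1: "smooth_on ?B ?Z C a1" unfolding a1_def[abs_def] by (rule smooth_on_compose[OF Z CQ f1 A1(2)]) auto
  have a0C: "a0 p \<in> pts C" "\<Upsilon> (a0 p) = fst (fst p)" and a1C: "a1 p \<in> pts C" "\<Upsilon> (a1 p) = snd (fst p)"
    and C2R: "fst p \<in> C2 R" and base: "fst (snd p) = snd (fst p)" and vec: "snd (snd p) \<in> ds_D R (snd (fst p))" if "p \<in> ?B" for p
    using that A0(3,5) A1(3,5) by (auto simp: a0_def a1_def)
  have pig: "\<pi> (snd (a0 p)) = \<pi> (\<phi> (fst (a1 p)))" if "p \<in> ?B" for p
  proof -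
    have "\<phi>Q (fst (snd (fst p))) = snd (fst (fst p))" using C2R[OF that] C2R_iff[of "fst (fst p)" "snd (fst p)"] by simp
    then show ?thesis
      using snd_Upsilon[of "a0 p"] phiQ_Upsilon[OF a1C(1)[OF that]] a0C(2)[OF that] a1C(2)[OF that] by simp
  qed
  have gd: "g p \<in> carrier G" "aM (g p) (snd (a0 p)) = \<phi> (fst (a1 p))" if "p \<in> ?B" for p
    using delta[OF _ _ pig[OF that]] a0C(1)[OF that] a1C(1)[OF that] phi_pts unfolding g_def by auto
  have b0C: "b0 p \<in> pts C" "\<Upsilon> (b0 p) = fst (fst p)" "snd (b0 p) = \<phi> (fst (a1 p))" "(b0 p, a1 p) \<in> C2 S" if "p \<in> ?B" for p
  proof -
    show 1: "b0 p \<in> pts C" unfolding b0_def by (rule act_pts[OF gd(1)[OF that] a0C(1)[OF that]])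
    show "\<Upsilon> (b0 p) = fst (fst p)" unfolding b0_def using Upsilon_act[OF gd(1)[OF that] a0C(1)[OF that]] a0C(2)[OF that] by simp
    show 2: "snd (b0 p) = \<phi> (fst (a1 p))" unfolding b0_def act_def using gd(2)[OF that] by simp
    show "(b0 p, a1 p) \<in> C2 S" unfolding C2_iff using 1 2 a1C(1)[OF that] by simp
  qed
  have wD: "w p \<in> D (a1 p)" "dU (a1 p) (w p) = snd (snd p)" if p: "p \<in> ?B" for p
  proof -
    obtain v where v: "v \<in> D (a1 p)" "snd (snd p) = dU (a1 p) v"
      using D_red[OF a1C(1)[OF p]] vec[OF p] a1C(2)[OF p] by auto
    have yV: "snd (fst p) \<in> V1" using p by auto
    have "w p = dmap CQ C \<sigma>1 (snd (fst p)) (dU (\<sigma>1 (snd (fst p))) v)"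
      unfolding w_def base[OF p] v(2) by (simp add: a1_def)
    also have "\<dots> = v" by (rule adapted_lift[OF V1(1) yV]) (use D_vertical[OF a1C(1)[OF p]] v(1) in blast)
    finally show "w p \<in> D (a1 p)" "dU (a1 p) (w p) = snd (snd p)" using v by auto
  qed
  have fa1: "smooth_on ?B ?Z E (\<lambda>p. fst (a1 p))"
    by (rule smooth_on_compose[OF Z C a1 smooth_proj(1)]) (use smooth_on_image[OF C a1] in simp)
  have pa1: "smooth_on ?B ?Z M (\<lambda>p. \<phi> (fst (a1 p)))"
    by (rule smooth_on_compose[OF Z pre(1) fa1 phi(1)]) (use smooth_on_image[OF pre(1) fa1] in simp)
  have fa0: "smooth_on ?B ?Z E (\<lambda>p. fst (a0 p))"
    by (rule smooth_on_compose[OF Z C a0 smooth_proj(1)]) (use smooth_on_image[OF C a0] in simp)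
  have sa0: "smooth_on ?B ?Z M (\<lambda>p. snd (a0 p))"
    by (rule smooth_on_compose[OF Z C a0 smooth_proj(2)]) (use smooth_on_image[OF C a0] in simp)
  have gs: "smooth_on ?B ?Z GM g" unfolding g_def[abs_def] by (rule smooth_on_delta[OF Z sa0 pa1 pig])
  have b0: "smooth_on ?B ?Z C b0" unfolding b0_def[abs_def] act_def
    by (intro smooth_on_Pair Z pre actE.smooth_on_act actM.smooth_on_act gs fa0 sa0)
  have tw: "smooth_on ?B ?Z (tangent_bundle C) (\<lambda>p. (\<lambda>(x, v). (\<sigma>1 x, dmap CQ C \<sigma>1 x v)) (snd p))"
    by (rule smooth_on_compose[OF Z TQ s smooth_on_tangent_map[OF CQ C A1(2,1)]]) (auto simp: T1_def ptsT)
  have tw: "smooth_on ?B ?Z (tangent_bundle C) (\<lambda>p. (a1 p, w p))"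
  proof (rule smooth_on_cong[OF Z tw])
    fix p assume p: "p \<in> ?B"
    show "(\<lambda>(x, v). (\<sigma>1 x, dmap CQ C \<sigma>1 x v)) (snd p) = (a1 p, w p)"
      unfolding w_def a1_def base[OF p, symmetric] by (simp add: case_prod_beta')
  qed
  have \<Lambda>: "smooth_on ?B ?Z (prod_manifold (prod_manifold C C) (tangent_bundle C)) (\<lambda>p. ((b0 p, a1 p), (a1 p, w p)))"
    by (intro smooth_on_Pair[OF Z CCC TC _ tw] smooth_on_Pair[OF Z C C b0 a1])
  have "smooth_on ?B ?Z (tangent_bundle E) (\<lambda>p. (\<lambda>(z, (x, v)). (fst (fst z), P z v)) ((b0 p, a1 p), (a1 p, w p)))"
  proof (rule smooth_on_compose[OF Z premanifold_prod[OF CCC TC] \<Lambda> P_smooth], rule image_subsetI)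
    fix p assume p: "p \<in> ?B"
    show "((b0 p, a1 p), (a1 p, w p)) \<in> {(z, (x, v)). z \<in> C2 S \<and> x = snd z \<and> v \<in> D x}"
      using b0C(4)[OF p] wD(1)[OF p] by simp
  qed
  then have Pw: "smooth_on ?B ?Z (tangent_bundle E) (\<lambda>p. (fst (b0 p), P (b0 p, a1 p) (w p)))" by simp
  have "smooth_on ?B ?Z (tangent_bundle M) (\<lambda>p. (\<lambda>(x, v). (\<phi> (fst x), dmap C M (\<lambda>x. \<phi> (fst x)) x v)) (a1 p, w p))"
    by (rule smooth_on_compose[OF Z TC tw smooth_on_tangent_map[OF C pre(2) smooth_proj(3) C_open]])
       (use smooth_on_image[OF TC tw] pts_tangent_bundle[OF C] in blast)
  then have phw: "smooth_on ?B ?Z (tangent_bundle M) (\<lambda>p. (\<phi> (fst (a1 p)), dmap E M \<phi> (fst (a1 p)) (fst (w p))))"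
  proof (rule smooth_on_cong[OF Z])
    fix p assume p: "p \<in> ?B"
    have "w p \<in> mf_model C" using D_model[OF a1C(1)[OF p]] wD(1)[OF p] by blast
    then show "(\<lambda>(x, v). (\<phi> (fst x), dmap C M (\<lambda>x. \<phi> (fst x)) x v)) (a1 p, w p) =
        (\<phi> (fst (a1 p)), dmap E M \<phi> (fst (a1 p)) (fst (w p)))"
      using dphi_fst[OF a1C(1)[OF p]] by simp
  qed
  let ?arg = "\<lambda>p. (P (b0 p, a1 p) (w p), dmap E M \<phi> (fst (a1 p)) (fst (w p)))"
  \<comment> \<open>The two vectors are based at \<open>fst (b0 p)\<close> and
    \<open>\<phi> (fst (a1 p))\<close>. By composability the latter is the second entry of
    \<open>b0 p\<close>, so together they form a tangent vector at \<open>b0 p\<close>.\<close>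
  have "smooth_on ?B ?Z (tangent_bundle C) (\<lambda>p. ((fst (b0 p), \<phi> (fst (a1 p))), ?arg p))"
    by (rule smooth_on_tangent_Pair[OF Z pre(1,2) Pw phw])
  then have arg: "smooth_on ?B ?Z (tangent_bundle C) (\<lambda>p. (b0 p, ?arg p))"
  proof (rule smooth_on_cong[OF Z])
    fix p assume p: "p \<in> ?B"
    show "((fst (b0 p), \<phi> (fst (a1 p))), ?arg p) = (b0 p, ?arg p)" using b0C(3)[OF p] by (simp add: prod_eq_iff)
  qed
  have "smooth_on ?B ?Z (tangent_bundle QE) (\<lambda>p. (\<lambda>(x, v). ((fst \<circ> \<Upsilon>) x, dU1 x v)) (b0 p, ?arg p))"
    by (rule smooth_on_compose[OF Z TC arg smooth_on_tangent_map[OF C QE Upsilon1(1) C_open]])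
       (use smooth_on_image[OF TC arg] pts_tangent_bundle[OF C] in blast)
  then have "smooth_on ?B ?Z (tangent_bundle QE) ?P'"
  proof (rule smooth_on_cong[OF Z])
    fix p assume p: "p \<in> ?B"
    have "ds_P R (\<Upsilon> (b0 p), \<Upsilon> (a1 p)) (dU (a1 p) (w p)) = dU1 (b0 p) (?arg p)"
      by (rule P_red[OF b0C(4)[OF p] wD(1)[OF p]])
    then have "ds_P R (fst p) (snd (snd p)) = dU1 (b0 p) (?arg p)"
      using b0C(2)[OF p] a1C(2)[OF p] wD(2)[OF p] by simp
    then show "(\<lambda>(x, v). ((fst \<circ> \<Upsilon>) x, dU1 x v)) (b0 p, ?arg p) = ?P' p"
      using b0C(2)[OF p] by (simp add: case_prod_beta')
  qed
  then show "\<exists>W. openin (mf_top ?Z) W \<and> p \<in> W \<and> smooth_on (?A \<inter> W) ?Z (tangent_bundle QE) ?P'"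
    using W pW by blast
qed

text \<open>On \<open>E \<times> M\<close> the composite of \<open>\<Upsilon>\<close>,
  \<open>fst\<close> and \<open>\<phi>Q\<close> sends \<open>(e, m)\<close> to
  \<open>\<pi> (\<phi> e)\<close>. Applied to arguments whose \<open>E\<close>-component is a value
  of \<open>P\<close>, and hence vertical, it shows that the reduced \<open>P\<close> is vertical as
  well.\<close>

lemma dphiQ_dU1:
  assumes x: "x \<in> pts C" and v: "v \<in> mf_model C"
  shows "dmap QE QM \<phi>Q (fst (\<Upsilon> x)) (dU1 x v) = dmap M QM \<pi> (\<phi> (fst x)) (dmap E M \<phi> (fst x) (fst v))"
proof -
  have q: "fst (\<Upsilon> x) \<in> pts QE" using Upsilon_pts[OF x] by (auto simp: mem_Times_iff)
  have pa: "smooth_at QE QM \<phi>Q ((fst \<circ> \<Upsilon>) x)" by (rule smooth_atI[OF smooth_phiQ openin_topspace]) (use q in simp)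
  have pm: "smooth_at C M (\<lambda>x. \<phi> (fst x)) x" by (rule smooth_atI[OF smooth_proj(3) C_open x])
  have m: "\<phi> (fst x) \<in> pts M" using x phi_pts by auto
  have "dmap QE QM \<phi>Q (fst (\<Upsilon> x)) (dU1 x v) = dmap C QM (\<lambda>x. \<phi>Q ((fst \<circ> \<Upsilon>) x)) x v"
    using dmap_compose[OF C QE QM Upsilon1(2)[OF x] pa v] by (simp add: o_def)
  also have "\<dots> = dmap C QM (\<lambda>x. \<pi> (\<phi> (fst x))) x v"
    by (rule dmap_cong[OF C C_open x _ v]) (simp only: o_apply phiQ_Upsilon)
  also have "\<dots> = dmap M QM \<pi> (\<phi> (fst x)) (dmap E M \<phi> (fst x) (fst v))"
    using dmap_compose[OF C pre(2) QM pm pi_smooth_at[OF m] v] dphi_fst[OF x v] by simp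
  finally show ?thesis .
qed

theorem dldps_reduced: "dldps R"
  unfolding dldps_def R_simps(1-5)
proof (intro conjI ballI allI)
  show "fiber_bundle QE QM (prod_manifold F GM) \<phi>Q" by (rule fiber_bundle_QE)
  show "smooth_map CQ (vec_manifold UNIV) (ds_L R)" unfolding smooth_map_def using L_red_smooth by simp
  show "embedded_submanifold CQ (ds_Dd R)" by (rule Dd_red_embedded)
  show "vector_subbundle CQ (ds_D R)" by (rule D_red_subbundle)
  show "\<And>x. x \<in> pts CQ \<Longrightarrow> ds_D R x \<subseteq> mf_model QE \<times> {0}" by (rule D_red_subspace(3))
  show "smooth_on {(z, (x, v)). z \<in> C2 R \<and> x = snd z \<and> v \<in> ds_D R x}
       (prod_manifold (prod_manifold CQ CQ) (tangent_bundle CQ))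
       (tangent_bundle QE) (\<lambda>(z, (x, v)). (fst (fst z), ds_P R z v))" by (rule P_red_smooth)
  fix z assume "z \<in> C2 R"
  then obtain y0 y1 where y: "z = (y0, y1)" "(y0, y1) \<in> C2 R" by (cases z) auto
  obtain x0 x1 where x: "(x0, x1) \<in> C2 S" "\<Upsilon> x0 = y0" "\<Upsilon> x1 = y1" by (rule C2R_lift[OF y(2)])
  have xC: "x0 \<in> pts C" "x1 \<in> pts C" using x(1) C2_iff by auto
  have lift: "\<exists>v'\<in>D x1. v = dU x1 v'" if "v \<in> ds_D R (snd z)" for v
    using that D_red[OF xC(2)] x(3) y(1) by auto
  have PR: "ds_P R z (dU x1 v) = dU1 x0 (P (x0, x1) v, dmap E M \<phi> (fst x1) (fst v))" if "v \<in> D x1" for v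
    using P_red[OF x(1) that] x y by simp
  \<comment> \<open>On the model spaces the differentials coincide with globally linear maps
    \<open>K\<close>, \<open>L\<close> and \<open>J\<close>; linearity of the reduced
    \<open>P\<close> then follows from that of \<open>P\<close>.\<close>
  obtain K where K: "linear K" "\<And>v. v \<in> mf_model C \<Longrightarrow> dU1 x0 v = K v"
    by (rule dmap_linear[OF C QE Upsilon1(2)[OF xC(1)]]) blast
  obtain L where L: "linear L" "\<And>v. v \<in> mf_model C \<Longrightarrow> dU x1 v = L v"
    by (rule dmap_linear[OF C CQ Upsilon_smooth_at[OF xC(2)]]) blast
  have e1: "fst x1 \<in> pts E" "fst x0 \<in> pts E" using xC by auto
  obtain J where J: "linear J" "\<And>v. v \<in> mf_model E \<Longrightarrow> dmap E M \<phi> (fst x1) v = J v"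
    by (rule dmap_linear[OF pre(1,2) phi_smooth_at[OF e1(1)]]) blast
  have DE: "fst v \<in> mf_model E" "v \<in> mf_model C" if "v \<in> D x1" for v using D_model[OF xC(2)] that by auto
  have PK: "ds_P R z (L v) = K (P (x0, x1) v, J (fst v))" if v: "v \<in> D x1" for v
    using PR[OF v] L(2)[OF DE(2)[OF v]] J(2)[OF DE(1)[OF v]] K(2)[OF P_arg_model[OF x(1) v]] by simp
  have liftL: "\<exists>v'\<in>D x1. v = L v'" if "v \<in> ds_D R (snd z)" for v
    using lift[OF that] L(2) DE(2) by metis
  note sub = D_subspace[OF xC(2)]
  fix v assume v: "v \<in> ds_D R (snd z)"
  obtain v' where v': "v' \<in> D x1" "v = L v'" using liftL[OF v] by blast
  have vdU: "v = dU x1 v'" using v' L(2) DE(2) by simp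
  have am: "(P (x0, x1) v', dmap E M \<phi> (fst x1) (fst v')) \<in> mf_model C" by (rule P_arg_model[OF x(1) v'(1)])
  show "ds_P R z v \<in> mf_model QE"
    unfolding vdU PR[OF v'(1)] by (rule dmap_in_model[OF C QE Upsilon1(2)[OF xC(1)] am])
  have y0: "fst (fst z) = fst (\<Upsilon> x0)" using y x by simp
  show "dmap QE QM \<phi>Q (fst (fst z)) (ds_P R z v) = 0"
    unfolding vdU PR[OF v'(1)] y0 dphiQ_dU1[OF xC(1) am]
    using P_props(2)[OF x(1), of v'] v'(1) dmap_zero[OF pre(2) QM pi_smooth_at[OF phi_pts[OF e1(2)]]] by simp
  show "ds_P R z (v + w) = ds_P R z v + ds_P R z w" if w: "w \<in> ds_D R (snd z)" for w
  proof -
    obtain w' where w': "w' \<in> D x1" "w = L w'" using liftL[OF w] by blast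
    have "v' + w' \<in> D x1" using sub v'(1) w'(1) subspace_add by blast
    moreover have "v + w = L (v' + w')" using v'(2) w'(2) linear_add[OF L(1)] by simp
    ultimately have "ds_P R z (v + w) = K (P (x0, x1) (v' + w'), J (fst (v' + w')))" using PK by simp
    also have "\<dots> = K ((P (x0, x1) v', J (fst v')) + (P (x0, x1) w', J (fst w')))"
      using P_props(3)[OF x(1)] v'(1) w'(1) linear_add[OF J(1)] by simp
    also have "\<dots> = K (P (x0, x1) v', J (fst v')) + K (P (x0, x1) w', J (fst w'))" by (rule linear_add[OF K(1)])
    finally show ?thesis using PK v' w' by simp
  qed
  show "ds_P R z (r *\<^sub>R v) = r *\<^sub>R ds_P R z v" for r
  proof -
    have "r *\<^sub>R v' \<in> D x1" using sub v'(1) subspace_mul by blast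
    moreover have "r *\<^sub>R v = L (r *\<^sub>R v')" using v'(2) linear_scale[OF L(1)] by simp
    ultimately have "ds_P R z (r *\<^sub>R v) = K (P (x0, x1) (r *\<^sub>R v'), J (fst (r *\<^sub>R v')))" using PK by simp
    also have "\<dots> = K (r *\<^sub>R (P (x0, x1) v', J (fst v')))"
      using P_props(4)[OF x(1)] v'(1) linear_scale[OF J(1)] by simp
    also have "\<dots> = r *\<^sub>R K (P (x0, x1) v', J (fst v'))" by (rule linear_scale[OF K(1)])
    finally show ?thesis using PK v' by simp
  qed
qed

end

section \<open>Comparison of two reductions\<close>

locale two_reductions = R1: reduction G GM S aE aM Hor1 + R2: reduction G GM S aE aM Hor2
  for G :: "'g monoid" (structure) and GM :: "('g, 'cg::euclidean_space) manifold"
    and S :: "('e, 'ce::euclidean_space, 'm, 'cm::euclidean_space, 'f, 'cf::euclidean_space) dldps_data"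
    and aE :: "'g \<Rightarrow> 'e \<Rightarrow> 'e" and aM :: "'g \<Rightarrow> 'm \<Rightarrow> 'm" and Hor1 Hor2 :: "('m \<times> 'm) set"
begin

text \<open>The fibers of both reduction maps are the orbits of one action, so the value does not
  depend on the choice. Source and target are the same manifold, since the quotients involve no
  connection.\<close>

definition \<Theta> :: "('e \<times> 'g) set \<times> 'm set \<Rightarrow> ('e \<times> 'g) set \<times> 'm set" where
  "\<Theta> y = R2.\<Upsilon> (SOME x. x \<in> pts R1.C \<and> R1.\<Upsilon> x = y)"

lemma Theta: assumes x: "x \<in> pts R1.C" shows "\<Theta> (R1.\<Upsilon> x) = R2.\<Upsilon> x"
proof -
  define x' where "x' = (SOME x'. x' \<in> pts R1.C \<and> R1.\<Upsilon> x' = R1.\<Upsilon> x)"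
  have "x' \<in> pts R1.C \<and> R1.\<Upsilon> x' = R1.\<Upsilon> x" unfolding x'_def by (rule someI[of _ x]) (use x in simp)
  then have x': "x' \<in> pts R1.C" "R1.\<Upsilon> x' = R1.\<Upsilon> x" by auto
  obtain g where g: "g \<in> carrier G" "x = R1.act g x'" by (rule R1.Upsilon_eqD[OF x'(1) x x'(2)])
  then have "R2.\<Upsilon> x' = R2.\<Upsilon> x" using R2.Upsilon_act[OF g(1) x'(1)] by simp
  then show ?thesis unfolding \<Theta>_def x'_def .
qed

lemma smooth_Theta: "smooth_on (pts R1.CQ) R1.CQ R1.CQ \<Theta>"
proof (rule smooth_on_descend[OF R1.C R1.CQ R1.Upsilon_sections openin_topspace])
  have eq: "{x \<in> pts R1.C. R1.\<Upsilon> x \<in> pts R1.CQ} = pts R1.C" using R1.Upsilon_pts by blast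
  show "smooth_on {x \<in> pts R1.C. R1.\<Upsilon> x \<in> pts R1.CQ} R1.C R1.CQ (\<lambda>x. \<Theta> (R1.\<Upsilon> x))"
    unfolding eq by (rule smooth_on_cong[OF R1.C R2.smooth_Upsilon]) (rule Theta[symmetric])
qed

lemma Theta_smooth_at: "y \<in> pts R1.CQ \<Longrightarrow> smooth_at R1.CQ R1.CQ \<Theta> y"
  by (rule smooth_atI[OF smooth_Theta openin_topspace])

lemma Theta_image: "\<Theta> ` pts R1.CQ = pts R1.CQ"
proof -
  have "\<Theta> ` (R1.\<Upsilon> ` pts R1.C) = R2.\<Upsilon> ` pts R1.C" unfolding image_image by (rule image_cong[OF refl Theta])
  then show ?thesis unfolding R1.Upsilon_image R2.Upsilon_image .
qed

lemma dTheta: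
  assumes x: "x \<in> pts R1.C" and v: "v \<in> mf_model R1.C"
  shows "dmap R1.CQ R1.CQ \<Theta> (R1.\<Upsilon> x) (R1.dU x v) = R2.dU x v"
proof -
  have "dmap R1.CQ R1.CQ \<Theta> (R1.\<Upsilon> x) (R1.dU x v) = dmap R1.C R1.CQ (\<lambda>x. \<Theta> (R1.\<Upsilon> x)) x v"
    by (rule dmap_compose[OF R1.C R1.CQ R1.CQ R1.Upsilon_smooth_at[OF x] Theta_smooth_at[OF R1.Upsilon_pts[OF x]] v, symmetric])
  also have "\<dots> = R2.dU x v" by (rule dmap_cong[OF R1.C R1.C_open x Theta v])
  finally show ?thesis .
qed

text \<open>The differential of a local section of the second reduction map, followed by that of the
  first reduction map, is a right inverse of the differential of \<open>\<Theta>\<close>.\<close>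

lemma dTheta_surj:
  assumes y: "y \<in> pts R1.CQ" shows "dmap R1.CQ R1.CQ \<Theta> y ` mf_model R1.CQ = mf_model R1.CQ"
proof
  show "dmap R1.CQ R1.CQ \<Theta> y ` mf_model R1.CQ \<subseteq> mf_model R1.CQ"
    by (rule image_subsetI) (rule dmap_in_model[OF R1.CQ R1.CQ Theta_smooth_at[OF y]])
  show "mf_model R1.CQ \<subseteq> dmap R1.CQ R1.CQ \<Theta> y ` mf_model R1.CQ"
  proof
    fix w assume w: "w \<in> mf_model R1.CQ"
    obtain x where x: "x \<in> pts R1.C" "R1.\<Upsilon> x = y" by (rule R1.Upsilon_preimage[OF y])
    obtain V \<sigma> where V: "R2.adapted V \<sigma>" "R2.\<Upsilon> x \<in> V" "\<sigma> (R2.\<Upsilon> x) = x" by (rule R2.adapted_section[OF x(1)])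
    note AD = R2.adaptedD[OF V(1)]
    have s: "smooth_at R1.CQ R1.C \<sigma> (R2.\<Upsilon> x)" by (rule smooth_atI[OF AD(2,1) V(2)])
    define v where "v = dmap R1.CQ R1.C \<sigma> (R2.\<Upsilon> x) w"
    have v: "v \<in> mf_model R1.C" unfolding v_def by (rule dmap_in_model[OF R1.CQ R1.C s w])
    have "R2.dU (\<sigma> (R2.\<Upsilon> x)) v = w"
      unfolding v_def
      by (rule dmap_left_inverse[OF R1.CQ R1.C s _ AD(1) V(2) AD(3) w])
         (use R2.Upsilon_smooth_at[OF x(1)] V(3) in simp)
    then have "w = dmap R1.CQ R1.CQ \<Theta> y (R1.dU x v)" using dTheta[OF x(1) v] x(2) V(3) by simp
    then show "w \<in> dmap R1.CQ R1.CQ \<Theta> y ` mf_model R1.CQ" using R1.dU_model[OF x(1) v] by blast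
  qed
qed

text \<open>Both reduction maps have second entry \<open>\<pi> m\<close>. Hence the second entry of
  \<open>\<Theta>\<close> does not vary with the first argument, as a morphism requires.\<close>

lemma snd_Theta: assumes "y \<in> pts R1.CQ" shows "snd (\<Theta> y) = snd y"
proof -
  obtain x where x: "x \<in> pts R1.C" "R1.\<Upsilon> x = y" by (rule R1.Upsilon_preimage[OF assms])
  show ?thesis using Theta[OF x(1)] R1.snd_Upsilon[of x] R2.snd_Upsilon[of x] x(2) by simp
qed

text \<open>Let \<open>?a\<close> pair the value of the original \<open>P\<close> with the image of
  the variation under \<open>d\<phi>\<close>. The pair on the right is the image of
  \<open>?a\<close> under the differential of the first reduction map, and the chain rule through
  \<open>\<Theta>\<close> turns it into the formula for the second one.\<close>

lemma P_Theta:
  assumes z: "(x0, x1) \<in> C2 S" and v: "v \<in> ds_D S x1"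
  shows "ds_P R2.R (\<Theta> (R1.\<Upsilon> x0), \<Theta> (R1.\<Upsilon> x1)) (dmap R1.CQ R1.CQ \<Theta> (R1.\<Upsilon> x1) (R1.dU x1 v)) =
    dmap R1.CQ R1.QE (fst \<circ> \<Theta>) (R1.\<Upsilon> x0)
      (ds_P R1.R (R1.\<Upsilon> x0, R1.\<Upsilon> x1) (R1.dU x1 v), dmap R1.QE R1.QM R1.\<phi>Q (fst (R1.\<Upsilon> x1)) (fst (R1.dU x1 v)))"
proof -
  have x: "x0 \<in> pts R1.C" "x1 \<in> pts R1.C" "ds_phi S (fst x1) = snd x0" using z R1.C2_iff by auto
  have vm: "v \<in> mf_model R1.C" using R1.D_model[OF x(2)] v by blast
  let ?a = "(ds_P S (x0, x1) v, dmap (ds_E S) (ds_M S) (ds_phi S) (fst x1) (fst v))"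
  have am: "?a \<in> mf_model R1.C" by (rule R1.P_arg_model[OF z v])
  have Tat: "smooth_at R1.CQ R1.QE (fst \<circ> \<Theta>) (R1.\<Upsilon> x0)"
    unfolding o_def
    by (rule smooth_at_compose[OF R1.CQ R1.CQ Theta_smooth_at[OF R1.Upsilon_pts[OF x(1)]] smooth_at_fst[OF R1.QE R1.QM]])
       (use imageI[OF R1.Upsilon_pts[OF x(1)], of \<Theta>] Theta_image in simp)
  \<comment> \<open>Both sides apply the differential of \<open>\<pi>\<close> to the image of the
    variation under \<open>d\<phi>\<close>; the base points agree because
    \<open>ds_phi S (fst x1) = snd x0\<close>.\<close>
  have "dmap R1.QE R1.QM R1.\<phi>Q (fst (R1.\<Upsilon> x1)) (fst (R1.dU x1 v)) = dmap (ds_M S) R1.QM R1.\<pi> (snd x0) (snd ?a)"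
    using R1.dphiQ_dU1[OF x(2) vm] R1.dU_pair[OF x(2) vm] x(3) by simp
  then have "(ds_P R1.R (R1.\<Upsilon> x0, R1.\<Upsilon> x1) (R1.dU x1 v), dmap R1.QE R1.QM R1.\<phi>Q (fst (R1.\<Upsilon> x1)) (fst (R1.dU x1 v))) = R1.dU x0 ?a"
    unfolding R1.P_red[OF z v] R1.dU_pair[OF x(1) am] by simp
  moreover have "dmap R1.CQ R1.QE (fst \<circ> \<Theta>) (R1.\<Upsilon> x0) (R1.dU x0 ?a) = dmap R1.C R1.QE (\<lambda>x. (fst \<circ> \<Theta>) (R1.\<Upsilon> x)) x0 ?a"
    by (rule dmap_compose[OF R1.C R1.CQ R1.QE R1.Upsilon_smooth_at[OF x(1)] Tat am, symmetric])
  moreover have "\<dots> = R2.dU1 x0 ?a"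
    by (rule dmap_cong[OF R1.C R1.C_open x(1) _ am]) (simp only: o_apply Theta)
  moreover have "ds_P R2.R (\<Theta> (R1.\<Upsilon> x0), \<Theta> (R1.\<Upsilon> x1)) (dmap R1.CQ R1.CQ \<Theta> (R1.\<Upsilon> x1) (R1.dU x1 v)) = R2.dU1 x0 ?a"
    unfolding Theta[OF x(1)] Theta[OF x(2)] dTheta[OF x(2) vm] by (rule R2.P_red[OF z v])
  ultimately show ?thesis by simp
qed

text \<open>The axioms on \<open>L\<close>, \<open>D\<close>, \<open>Dd\<close>, \<open>P\<close>
  and composable pairs are checked on values of the first reduction map, where both reduced systems
  are described by the same data of \<open>S\<close>.\<close>

theorem Theta_morphism: "dldps_morphism R1.R R2.R \<Theta>"
  unfolding dldps_morphism_def R1.R_simps(1-5) R2.R_simps(1-5)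
proof (intro conjI)
  show "dldps R1.R" "dldps R2.R" by (rule R1.dldps_reduced, rule R2.dldps_reduced)
  show "submersion R1.CQ R1.CQ \<Theta>"
    unfolding submersion_def smooth_map_def using smooth_Theta Theta_image dTheta_surj by auto
  show "\<Theta> ` pts R1.CQ = pts R1.CQ" by (rule Theta_image)
  show "\<forall>(\<epsilon>, m)\<in>pts R1.CQ. \<forall>v\<in>mf_model R1.QE. dmap R1.QE R1.QM (\<lambda>\<epsilon>'. snd (\<Theta> (\<epsilon>', m))) \<epsilon> v = 0"
  proof
    fix y assume "y \<in> pts R1.CQ"
    then obtain q m where y: "y = (q, m)" and q: "q \<in> pts R1.QE" "m \<in> pts R1.QM" by auto
    show "case y of (\<epsilon>, m) \<Rightarrow> \<forall>v\<in>mf_model R1.QE. dmap R1.QE R1.QM (\<lambda>\<epsilon>'. snd (\<Theta> (\<epsilon>', m))) \<epsilon> v = 0"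
      unfolding y prod.case
    proof
      fix v assume v: "v \<in> mf_model R1.QE"
      have "dmap R1.QE R1.QM (\<lambda>\<epsilon>'. snd (\<Theta> (\<epsilon>', m))) q v = dmap R1.QE R1.QM (\<lambda>\<epsilon>'. m) q v"
        by (rule dmap_cong[OF R1.QE openin_topspace q(1) _ v]) (use snd_Theta q(2) in simp)
      then show "dmap R1.QE R1.QM (\<lambda>\<epsilon>'. snd (\<Theta> (\<epsilon>', m))) q v = 0"
        using dmap_const[OF R1.QE q(1) v, of R1.QM m] by simp
    qed
  qed
  show "\<forall>(x0, x1)\<in>C2 R1.R. snd (\<Theta> x0) = R1.\<phi>Q (fst (\<Theta> x1))"
  proof
    fix z assume "z \<in> C2 R1.R"
    then obtain y0 y1 where z: "z = (y0, y1)" "(y0, y1) \<in> C2 R1.R" by (cases z) auto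
    obtain x0 x1 where x: "(x0, x1) \<in> C2 S" "R1.\<Upsilon> x0 = y0" "R1.\<Upsilon> x1 = y1" by (rule R1.C2R_lift[OF z(2)])
    have "x0 \<in> pts R1.C" "x1 \<in> pts R1.C" using x(1) R1.C2_iff by auto
    then show "case z of (x0, x1) \<Rightarrow> snd (\<Theta> x0) = R1.\<phi>Q (fst (\<Theta> x1))"
      using R2.C2_Upsilon[OF x(1)] Theta x(2,3) z(1) unfolding R2.C2R_iff by auto
  qed
  show "\<forall>y\<in>pts R1.CQ. ds_L R1.R y = ds_L R2.R (\<Theta> y)"
  proof
    fix y assume "y \<in> pts R1.CQ"
    then obtain x where x: "x \<in> pts R1.C" "R1.\<Upsilon> x = y" by (rule R1.Upsilon_preimage)
    show "ds_L R1.R y = ds_L R2.R (\<Theta> y)" using R1.L_red[OF x(1)] R2.L_red[OF x(1)] Theta[OF x(1)] x(2) by simp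
  qed
  show "ds_Dd R2.R = \<Theta> ` ds_Dd R1.R"
    unfolding R1.R_simps R2.R_simps image_image by (rule image_cong[OF refl]) (use Theta R1.Dd_pts in auto)
  show "\<forall>y\<in>pts R1.CQ. ds_D R2.R (\<Theta> y) = dmap R1.CQ R1.CQ \<Theta> y ` ds_D R1.R y"
  proof
    fix y assume "y \<in> pts R1.CQ"
    then obtain x where x: "x \<in> pts R1.C" "R1.\<Upsilon> x = y" by (rule R1.Upsilon_preimage)
    have "dmap R1.CQ R1.CQ \<Theta> (R1.\<Upsilon> x) ` R1.dU x ` ds_D S x = R2.dU x ` ds_D S x"
      unfolding image_image by (rule image_cong[OF refl]) (use dTheta[OF x(1)] R1.D_model[OF x(1)] in blast)
    then show "ds_D R2.R (\<Theta> y) = dmap R1.CQ R1.CQ \<Theta> y ` ds_D R1.R y"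
      unfolding x(2)[symmetric] Theta[OF x(1)] R1.D_red[OF x(1)] R2.D_red[OF x(1)] by simp
  qed
  show "\<forall>(x0, x1)\<in>C2 R1.R. \<forall>v\<in>ds_D R1.R x1.
        ds_P R2.R (\<Theta> x0, \<Theta> x1) (dmap R1.CQ R1.CQ \<Theta> x1 v) =
        dmap R1.CQ R1.QE (fst \<circ> \<Theta>) x0 (ds_P R1.R (x0, x1) v, dmap R1.QE R1.QM R1.\<phi>Q (fst x1) (fst v))"
  proof
    fix z assume "z \<in> C2 R1.R"
    then obtain y0 y1 where z: "z = (y0, y1)" "(y0, y1) \<in> C2 R1.R" by (cases z) auto
    obtain x0 x1 where x: "(x0, x1) \<in> C2 S" "R1.\<Upsilon> x0 = y0" "R1.\<Upsilon> x1 = y1" by (rule R1.C2R_lift[OF z(2)])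
    have x1: "x1 \<in> pts R1.C" using x(1) R1.C2_iff by auto
    show "case z of (x0, x1) \<Rightarrow> \<forall>v\<in>ds_D R1.R x1.
        ds_P R2.R (\<Theta> x0, \<Theta> x1) (dmap R1.CQ R1.CQ \<Theta> x1 v) =
        dmap R1.CQ R1.QE (fst \<circ> \<Theta>) x0 (ds_P R1.R (x0, x1) v, dmap R1.QE R1.QM R1.\<phi>Q (fst x1) (fst v))"
      unfolding z(1) prod.case
    proof
      fix w assume "w \<in> ds_D R1.R y1"
      then have "w \<in> R1.dU x1 ` ds_D S x1" using R1.D_red[OF x1] x(3) by simp
      then obtain v where v: "v \<in> ds_D S x1" "w = R1.dU x1 v" by blast
      show "ds_P R2.R (\<Theta> y0, \<Theta> y1) (dmap R1.CQ R1.CQ \<Theta> y1 w) =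
        dmap R1.CQ R1.QE (fst \<circ> \<Theta>) y0 (ds_P R1.R (y0, y1) w, dmap R1.QE R1.QM R1.\<phi>Q (fst y1) (fst w))"
        using P_Theta[OF x(1) v(1)] unfolding v(2) x(2,3) .
    qed
  qed
qed

end

theorem proposition5p14:
  fixes G :: "'g monoid"
    and GM :: "('g, 'cg::euclidean_space) manifold"
    and S :: "('e, 'ce::euclidean_space, 'm, 'cm::euclidean_space, 'f, 'cf::euclidean_space) dldps_data"
    and aE :: "'g \<Rightarrow> 'e \<Rightarrow> 'e"
    and aM :: "'g \<Rightarrow> 'm \<Rightarrow> 'm"
    and Hor1 Hor2 :: "('m \<times> 'm) set"
  assumes "dldps S"
    and "symmetry_group G GM aE aM S"
    and "discrete_connection G GM (ds_M S) aM Hor1"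
    and "discrete_connection G GM (ds_M S) aM Hor2"
  shows "dldps_isomorphic (reduced_system G GM aE aM S Hor1) (reduced_system G GM aE aM S Hor2)"
proof -
  have fb: "fiber_bundle (ds_E S) (ds_M S) (ds_F S) (ds_phi S)" using assms(1) by (simp add: dldps_def)
  have lie: "lie_group G GM" and acts: "acts_on_fiber_bundle G GM (ds_E S) (ds_M S) (ds_F S) (ds_phi S) aE aM"
    using assms(2) by (simp_all add: symmetry_group_def)
  interpret T12: two_reductions G GM S aE aM Hor1 Hor2 by unfold_locales (fact lie fb acts assms)+
  interpret T21: two_reductions G GM S aE aM Hor2 Hor1 by unfold_locales
  have "T21.\<Theta> (T12.\<Theta> y) = y" if "y \<in> pts (C1 T12.R1.R)" for y
  proof -
    have "y \<in> pts T12.R1.CQ" using that unfolding T12.R1.R_simps .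
    then obtain x where x: "x \<in> pts T12.R1.C" "T12.R1.\<Upsilon> x = y" by (rule T12.R1.Upsilon_preimage)
    show ?thesis using T12.Theta[OF x(1)] T21.Theta[OF x(1)] x(2) by simp
  qed
  moreover have "T12.\<Theta> (T21.\<Theta> y) = y" if "y \<in> pts (C1 T12.R2.R)" for y
  proof -
    have "y \<in> pts T12.R1.CQ" using that unfolding T12.R2.R_simps .
    then obtain x where x: "x \<in> pts T12.R1.C" "T12.R2.\<Upsilon> x = y" by (rule T12.R2.Upsilon_preimage)
    show ?thesis using T12.Theta[OF x(1)] T21.Theta[OF x(1)] x(2) by simp
  qed
  ultimately show ?thesis
    unfolding dldps_isomorphic_def using T12.Theta_morphism T21.Theta_morphism by blast
qed

end
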